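(* Let $(R,\mathfrak m)$ be an equicharacteristic Cohen-Macaulay local ring with infinite residue field and let $I$ be an $\mathfrak m$-primary ideal. If $I$ is stretched with respect to a minimal reduction $H$ of $I$, then $I$ is stretched with respect to any general minimal reduction of $I$.
   Context: $\lambda$ denotes length. A reduction of $I$ is an ideal $J\subseteq I$ with $I^{r+1}=JI^r$ for some $r\geq0$; it is minimal if it properly contains no other reduction of $I$. For $I$ $\mathfrak m$-primary and infinite residue field, every minimal reduction is generated by $d=\dim R$ elements. Stretched. An $\mathfrak m$-primary ideal $I$ is stretched with respect to a minimal reduction $J$ of $I$ if (a) $J\cap I^2=JI$ and (b) $HF_{I/J}(2)\leq1$, where $HF_{I/J}(2)=\lambda\big((I^2+J)/(I^3+J)\big)=\lambda\big(I^2/((J\cap I^2)+I^3)\big)$ is the value at 2 of the Hilbert function of the ideal $I/J$ of $R/J$. General minimal reductions. Let $k=R/\mathfrak m$ and $I=(a_1,\ldots,a_n)$. A general minimal reduction is $J=(x_1,\ldots,x_d)$ with $x_i=\sum_j\lambda_{ij}a_j$, $\lambda_{ij}\in R$, where the image of $(\lambda_{ij})$ in $k^{dn}$ lies in a suitable dense Zariski open subset; an assertion holds for a (any) general minimal reduction if there is a dense open $U\subseteq k^{dn}$ such that it holds for all $J$ coming from $U$. *)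

theory Defs
  imports
    "HOL-Library.Extended_Nat"
    "HOL-Analysis.Abstract_Topology"
    "HOL-Algebra.Indexed_Polynomials"
    "HOL-Algebra.Ideal_Product"
    "HOL-Algebra.Multiplicative_Group"
begin

definition local_ring :: "('a, 'b) ring_scheme \<Rightarrow> 'a set \<Rightarrow> bool" where
  "local_ring R \<mm> \<longleftrightarrow> cring R \<and> maximalideal \<mm> R \<and> (\<forall>M. maximalideal M R \<longrightarrow> M = \<mm>)"

definition krull_dim :: "('a, 'b) ring_scheme \<Rightarrow> enat" where
  "krull_dim R = Sup {enat n | n. \<exists>P :: nat \<Rightarrow> 'a set.
     (\<forall>i\<le>n. primeideal (P i) R) \<and> (\<forall>i<n. P i \<subset> P (Suc i))}"

text \<open>Each \<open>xs ! i\<close> is a non-zero-divisor on \<open>R / (xs ! 0, ..., xs ! (i - 1))\<close>, and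
  \<open>R / (xs) \<noteq> 0\<close>.\<close>

definition regular_sequence :: "('a, 'b) ring_scheme \<Rightarrow> 'a list \<Rightarrow> bool" where
  "regular_sequence R xs \<longleftrightarrow>
     set xs \<subseteq> carrier R \<and>
     (\<forall>i<length xs. \<forall>y\<in>carrier R.
        (xs ! i) \<otimes>\<^bsub>R\<^esub> y \<in> Idl\<^bsub>R\<^esub> (set (take i xs)) \<longrightarrow> y \<in> Idl\<^bsub>R\<^esub> (set (take i xs))) \<and>
     Idl\<^bsub>R\<^esub> (set xs) \<noteq> carrier R"

definition depth :: "('a, 'b) ring_scheme \<Rightarrow> 'a set \<Rightarrow> enat" where
  "depth R \<mm> = Sup {enat (length xs) | xs. regular_sequence R xs \<and> set xs \<subseteq> \<mm>}"

definition cohen_macaulay_local_ring :: "('a, 'b) ring_scheme \<Rightarrow> 'a set \<Rightarrow> bool" where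
  "cohen_macaulay_local_ring R \<mm> \<longleftrightarrow>
     local_ring R \<mm> \<and> noetherian_ring R \<and> depth R \<mm> = krull_dim R"

text \<open>The characteristic is the additive order of \<open>\<one>\<close>; by convention \<^const>\<open>group.ord\<close> is \<open>0\<close>
  for elements of infinite order.\<close>

definition ring_char :: "('a, 'b) ring_scheme \<Rightarrow> nat" where
  "ring_char R = group.ord (add_monoid R) \<one>\<^bsub>R\<^esub>"

definition equicharacteristic :: "('a, 'b) ring_scheme \<Rightarrow> 'a set \<Rightarrow> bool" where
  "equicharacteristic R \<mm> \<longleftrightarrow> ring_char R = ring_char (R Quot \<mm>)"

definition radical :: "('a, 'b) ring_scheme \<Rightarrow> 'a set \<Rightarrow> 'a set" where
  "radical R I = {x \<in> carrier R. \<exists>n::nat. x [^]\<^bsub>R\<^esub> n \<in> I}"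

definition primary_ideal :: "('a, 'b) ring_scheme \<Rightarrow> 'a set \<Rightarrow> bool" where
  "primary_ideal R I \<longleftrightarrow> ideal I R \<and> I \<noteq> carrier R \<and>
     (\<forall>x\<in>carrier R. \<forall>y\<in>carrier R. x \<otimes>\<^bsub>R\<^esub> y \<in> I \<longrightarrow> x \<in> I \<or> y \<in> radical R I)"

definition m_primary :: "('a, 'b) ring_scheme \<Rightarrow> 'a set \<Rightarrow> 'a set \<Rightarrow> bool" where
  "m_primary R \<mm> I \<longleftrightarrow> primary_ideal R I \<and> radical R I = \<mm>"

primrec ideal_pow :: "('a, 'b) ring_scheme \<Rightarrow> 'a set \<Rightarrow> nat \<Rightarrow> 'a set" where
  "ideal_pow R I 0 = carrier R"
| "ideal_pow R I (Suc n) = ideal_prod R I (ideal_pow R I n)"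

definition reduction :: "('a, 'b) ring_scheme \<Rightarrow> 'a set \<Rightarrow> 'a set \<Rightarrow> bool" where
  "reduction R J I \<longleftrightarrow> ideal J R \<and> J \<subseteq> I \<and>
     (\<exists>r. ideal_pow R I (Suc r) = ideal_prod R J (ideal_pow R I r))"

definition minimal_reduction :: "('a, 'b) ring_scheme \<Rightarrow> 'a set \<Rightarrow> 'a set \<Rightarrow> bool" where
  "minimal_reduction R J I \<longleftrightarrow> reduction R J I \<and> \<not> (\<exists>K. reduction R K I \<and> K \<subset> J)"

definition module_length :: "('a, 'b) ring_scheme \<Rightarrow> ('a, 'c, 'd) module_scheme \<Rightarrow> enat" where
  "module_length R M = Sup {enat n | n. \<exists>C :: nat \<Rightarrow> 'c set.
     (\<forall>i\<le>n. submodule (C i) R M) \<and> (\<forall>i<n. C i \<subset> C (Suc i))}"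

definition ideal_as_module :: "('a, 'b) ring_scheme \<Rightarrow> 'a set \<Rightarrow> ('a, 'a) module" where
  "ideal_as_module R K =
     \<lparr>carrier = K, monoid.mult = monoid.mult R, one = \<one>\<^bsub>R\<^esub>, zero = \<zero>\<^bsub>R\<^esub>, add = add R, smult = monoid.mult R\<rparr>"

text \<open>Modules in \<open>HOL-Algebra\<close> extend the ring record; their fields \<^const>\<open>monoid.mult\<close> and
  \<^const>\<open>monoid.one\<close> carry no meaning and are filled with dummies here.\<close>

definition quot_module ::
  "('a, 'b) ring_scheme \<Rightarrow> ('a, 'c, 'd) module_scheme \<Rightarrow> 'c set \<Rightarrow> ('a, 'c set) module" where
  "quot_module R M N =
     \<lparr>carrier = a_rcosets\<^bsub>M\<^esub> N, monoid.mult = (\<lambda>_ _. N), one = N, zero = N, add = set_add M,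
      smult = (\<lambda>r Y. \<Union>x\<in>Y. N +>\<^bsub>M\<^esub> (r \<odot>\<^bsub>M\<^esub> x))\<rparr>"

text \<open>The Hilbert function of the ideal \<open>I/J\<close> of \<open>R/J\<close>: the length of
  \<open>(I/J)\<^sup>n / (I/J)\<^sup>n\<^sup>+\<^sup>1 = (I\<^sup>n + J) / (I\<^sup>n\<^sup>+\<^sup>1 + J)\<close>.\<close>

definition hilbert_function ::
  "('a, 'b) ring_scheme \<Rightarrow> 'a set \<Rightarrow> 'a set \<Rightarrow> nat \<Rightarrow> enat" where
  "hilbert_function R I J n =
     module_length R
       (quot_module R (ideal_as_module R (set_add R (ideal_pow R I n) J))
                      (set_add R (ideal_pow R I (Suc n)) J))"

definition stretched :: "('a, 'b) ring_scheme \<Rightarrow> 'a set \<Rightarrow> 'a set \<Rightarrow> bool" where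
  "stretched R I J \<longleftrightarrow>
     minimal_reduction R J I \<and>
     J \<inter> ideal_pow R I 2 = ideal_prod R J I \<and>
     hilbert_function R I J 2 \<le> 1"

text \<open>Evaluation of a polynomial \<open>P \<in> K[X\<^sub>i | i \<in> N]\<close> (a finitely supported function from monomials,
  i.e. multisets of indices, to coefficients) at a point \<open>x\<close>.\<close>

definition indexed_poly_eval ::
  "('a, 'b) ring_scheme \<Rightarrow> ('c multiset \<Rightarrow> 'a) \<Rightarrow> ('c \<Rightarrow> 'a) \<Rightarrow> 'a" where
  "indexed_poly_eval K P x =
     (\<Oplus>\<^bsub>K\<^esub>M\<in>{M. P M \<noteq> \<zero>\<^bsub>K\<^esub>}. P M \<otimes>\<^bsub>K\<^esub> (\<Otimes>\<^bsub>K\<^esub>i\<in>set_mset M. x i [^]\<^bsub>K\<^esub> count M i))"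

text \<open>The Zariski topology on \<open>K\<^sup>N\<close>, generated by the distinguished open sets \<open>P \<noteq> 0\<close>.
  Points are extensional functions.\<close>

definition zariski_topology :: "('a, 'b) ring_scheme \<Rightarrow> 'c set \<Rightarrow> ('c \<Rightarrow> 'a) topology" where
  "zariski_topology K N = topology_generated_by
     {{x \<in> N \<rightarrow>\<^sub>E carrier K. indexed_poly_eval K P x \<noteq> \<zero>\<^bsub>K\<^esub>} | P.
        P \<in> ring.indexed_pset K N (carrier K)}"

definition dense_open_in :: "'a topology \<Rightarrow> 'a set \<Rightarrow> bool" where
  "dense_open_in T U \<longleftrightarrow> openin T U \<and> T closure_of U = topspace T"

text \<open>For \<open>I = (a\<^sub>0, ..., a\<^sub>n\<^sub>-\<^sub>1)\<close> and \<open>d = dim R\<close>, the ideal \<open>(x\<^sub>0, ..., x\<^sub>d\<^sub>-\<^sub>1)\<close> with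
  \<open>x\<^sub>i = \<Sum>\<^sub>j l i j \<cdot> a\<^sub>j\<close>, and the image of the coefficient matrix in \<open>(R/\<mm>)\<^sup>d\<^sup>n\<close>.\<close>

definition combination_ideal ::
  "('a, 'b) ring_scheme \<Rightarrow> nat \<Rightarrow> nat \<Rightarrow> (nat \<Rightarrow> 'a) \<Rightarrow> (nat \<Rightarrow> nat \<Rightarrow> 'a) \<Rightarrow> 'a set" where
  "combination_ideal R d n a l =
     Idl\<^bsub>R\<^esub> ((\<lambda>i. \<Oplus>\<^bsub>R\<^esub>j\<in>{..<n}. l i j \<otimes>\<^bsub>R\<^esub> a j) ` {..<d})"

definition residue_matrix ::
  "('a, 'b) ring_scheme \<Rightarrow> 'a set \<Rightarrow> nat \<Rightarrow> nat \<Rightarrow> (nat \<Rightarrow> nat \<Rightarrow> 'a) \<Rightarrow> nat \<times> nat \<Rightarrow> 'a set" where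
  "residue_matrix R \<mm> d n l = (\<lambda>(i, j)\<in>{..<d} \<times> {..<n}. \<mm> +>\<^bsub>R\<^esub> l i j)"

definition holds_for_general_minimal_reduction ::
  "('a, 'b) ring_scheme \<Rightarrow> 'a set \<Rightarrow> nat \<Rightarrow> (nat \<Rightarrow> 'a) \<Rightarrow> ('a set \<Rightarrow> bool) \<Rightarrow> bool" where
  "holds_for_general_minimal_reduction R \<mm> n a Q \<longleftrightarrow>
     (let d = the_enat (krull_dim R) in
      \<exists>U. dense_open_in (zariski_topology (R Quot \<mm>) ({..<d} \<times> {..<n})) U \<and>
          (\<forall>l. (\<forall>i<d. \<forall>j<n. l i j \<in> carrier R) \<and> residue_matrix R \<mm> d n l \<in> U \<longrightarrow>
               Q (combination_ideal R d n a l)))"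

end

theory Submission
  imports Defs
begin

text \<open>Let \<open>d = dim R\<close>. A matrix of coefficients \<open>x\<close> defines an ideal \<open>J\<^sub>x\<close> generated by \<open>d\<close> linear
  combinations of the generators of \<open>I\<close>. For a polynomial function \<open>f\<close> over \<open>R\<close> the condition
  \<open>f x \<notin> \<mm>\<close> only depends on the residues of \<open>x\<close>; these conditions form a base of the Zariski topology,
  and since \<open>R / \<mm>\<close> is infinite any two of them that are satisfiable are jointly satisfiable.

  By Northcott and Rees, every reduction of \<open>I\<close> contains one with \<open>d\<close> generators, which can be chosen
  to be a regular sequence, and none has fewer. Hence \<open>H = J\<^sub>x\<close> for some \<open>x = x\<^sub>0\<close>, and a reduction
  \<open>J\<^sub>x\<close> is automatically minimal. Three conditions remain: \<open>I\<^sup>r\<^sup>+\<^sup>1 = J\<^sub>x I\<^sup>r\<close>, \<open>J\<^sub>x \<inter> I\<^sup>2 = J\<^sub>x I\<close>, and, given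
  the second, that \<open>I\<^sup>2 / (J\<^sub>x I + I\<^sup>3)\<close> has length at most one. Each is a statement about linear relations
  which perturb the identity matrix at \<open>x\<^sub>0\<close>, so that Cramer's rule yields a polynomial function whose
  non-vanishing modulo \<open>\<mm>\<close> implies it.\<close>

section \<open>Ideals\<close>

text \<open>The obstacle is that residues fix the matrix only modulo \<mm>, while J_x depends on the
  matrix itself; each condition must therefore be certified by a unit determinant over R. For the
  reduction equation this suffices at once: the inclusion I T \<subseteq> J T with T = I^r moves
  from x0 to x. The equation J \<inter> I^2 = J I is different in kind: as H is generated by a
  regular sequence, it amounts to injectivity of (R/I)^d \<rightarrow> I/I^2, which can be tested on
  the socle of R/I and there becomes independence of finitely many classes over R/\<mm>. For the
  length condition the products at x are known only up to multiples of an extra element u, and the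
  delicate point is that \<mm> must still kill u. Either some J_x I equals I^2, which is then an
  open condition, or the relations obtained for \<mm> u never have a unit coefficient, and this
  turns them into a square system in generators of \<mm>. The bound behind Northcott and Rees is a
  count: s analytically independent elements give q^s monomials, against a colength of order
  q^d.\<close>

context cring
begin

lemma ideal_add: "ideal L R \<Longrightarrow> x \<in> L \<Longrightarrow> y \<in> L \<Longrightarrow> x \<oplus> y \<in> L"
  by (simp add: additive_subgroup.a_closed ideal.axioms(1))

lemma ideal_neg: "ideal L R \<Longrightarrow> x \<in> L \<Longrightarrow> \<ominus> x \<in> L"
  by (simp add: additive_subgroup.a_inv_closed ideal.axioms(1))

lemma ideal_diff: "ideal L R \<Longrightarrow> x \<in> L \<Longrightarrow> y \<in> L \<Longrightarrow> x \<ominus> y \<in> L"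
  by (simp add: a_minus_def ideal_add ideal_neg)

lemma ideal_zero: "ideal L R \<Longrightarrow> \<zero> \<in> L"
  by (simp add: additive_subgroup.zero_closed ideal.axioms(1))

lemma ideal_subset: "ideal L R \<Longrightarrow> L \<subseteq> carrier R"
  by (rule subsetI) (rule ideal.Icarr)

lemma ideal_finsum:
  assumes "ideal L R" and "\<And>i. i \<in> A \<Longrightarrow> f i \<in> L"
  shows "(\<Oplus>i\<in>A. f i) \<in> L"
  using assms(2)
proof (induction A rule: infinite_finite_induct)
  case (insert x F)
  then have "f \<in> F \<rightarrow> carrier R" "f x \<in> carrier R"
    using ideal.Icarr[OF assms(1)] by auto
  with insert show ?case by (simp add: finsum_insert ideal_add[OF assms(1)])
qed (simp_all add: ideal_zero[OF assms(1)] finsum_infinite)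

lemma ideal_add_cancel_left:
  assumes "ideal L R" "x \<in> L" "y \<in> carrier R" "x \<oplus> y \<in> L"
  shows "y \<in> L"
proof -
  have "y = (x \<oplus> y) \<ominus> x"
    using assms(3) ideal.Icarr[OF assms(1,2)] by algebra
  then show ?thesis using ideal_diff[OF assms(1,4,2)] by simp
qed

text \<open>This colon ideal serves as an induction principle: a property of the form "t s lies in
  L" passes from generators to a whole generated ideal once the generators lie in the colon
  ideal.\<close>

lemma ideal_colon:
  assumes "ideal L R" "S \<subseteq> carrier R"
  shows "ideal {x \<in> carrier R. \<forall>s\<in>S. x \<otimes> s \<in> L} R"
proof (rule idealI[OF ring_axioms])
  show "subgroup {x \<in> carrier R. \<forall>s\<in>S. x \<otimes> s \<in> L} (add_monoid R)"
  proof (rule add.subgroupI)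
    have "\<zero> \<in> {x \<in> carrier R. \<forall>s\<in>S. x \<otimes> s \<in> L}"
      using assms by (auto simp: ideal_zero)
    then show "{x \<in> carrier R. \<forall>s\<in>S. x \<otimes> s \<in> L} \<noteq> {}" by blast
  qed (use assms in \<open>auto simp: l_distr l_minus ideal_add ideal_neg subset_iff\<close>)
next
  fix x y assume x: "x \<in> {x \<in> carrier R. \<forall>s\<in>S. x \<otimes> s \<in> L}" and y: "y \<in> carrier R"
  have "y \<otimes> x \<otimes> s \<in> L" if "s \<in> S" for s
    using that x y assms ideal.I_l_closed[OF assms(1), of "x \<otimes> s" y] by (auto simp: m_assoc subset_iff)
  then show "y \<otimes> x \<in> {x \<in> carrier R. \<forall>s\<in>S. x \<otimes> s \<in> L}" using x y by auto
  then show "x \<otimes> y \<in> {x \<in> carrier R. \<forall>s\<in>S. x \<otimes> s \<in> L}" using x y by (simp add: m_comm)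
qed

text \<open>The ideal \<open>K + (S)\<close>. Working modulo an ideal \<open>K\<close> is expressed by carrying \<open>K\<close> along as a base
  ideal instead of passing to \<open>R / K\<close>.\<close>

definition ext :: "'a set \<Rightarrow> 'a set \<Rightarrow> 'a set" where
  "ext K S = Idl (K \<union> S)"

lemma ext_ideal: "ideal K R \<Longrightarrow> S \<subseteq> carrier R \<Longrightarrow> ideal (ext K S) R"
  unfolding ext_def by (rule genideal_ideal) (use ideal_subset in blast)

lemma ext_base: "ideal K R \<Longrightarrow> S \<subseteq> carrier R \<Longrightarrow> K \<subseteq> ext K S"
  unfolding ext_def using genideal_self[of "K \<union> S"] ideal_subset[of K] by blast

lemma ext_gens: "ideal K R \<Longrightarrow> S \<subseteq> carrier R \<Longrightarrow> S \<subseteq> ext K S"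
  unfolding ext_def using genideal_self[of "K \<union> S"] ideal_subset[of K] by blast

lemma ext_minimal: "ideal L R \<Longrightarrow> K \<subseteq> L \<Longrightarrow> S \<subseteq> L \<Longrightarrow> ext K S \<subseteq> L"
  unfolding ext_def by (rule genideal_minimal) auto

lemma ext_mono: "ideal K' R \<Longrightarrow> S' \<subseteq> carrier R \<Longrightarrow> K \<subseteq> K' \<Longrightarrow> S \<subseteq> S' \<Longrightarrow> ext K S \<subseteq> ext K' S'"
  using ext_minimal[OF ext_ideal, of K' S' K S] ext_base[of K' S'] ext_gens[of K' S'] by blast

lemma ext_empty: "ideal K R \<Longrightarrow> ext K {} = K"
  using ext_minimal[of K K "{}"] ext_base[of K "{}"] by blast

lemma ext_ext:
  assumes "ideal K R" "S \<subseteq> carrier R" "T \<subseteq> carrier R"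
  shows "ext (ext K S) T = ext K (S \<union> T)"
proof
  have U: "S \<union> T \<subseteq> carrier R" using assms by auto
  show "ext (ext K S) T \<subseteq> ext K (S \<union> T)"
    using ext_mono[OF assms(1) U, of K S] ext_gens[OF assms(1) U] ext_ideal[OF assms(1) U]
    by (intro ext_minimal[of _ "ext K S"]) auto
  have i: "ideal (ext K S) R" using ext_ideal assms by auto
  show "ext K (S \<union> T) \<subseteq> ext (ext K S) T"
    using ext_base[OF i assms(3)] ext_gens[OF i assms(3)] ext_ideal[OF i assms(3)]
      ext_base[OF assms(1,2)] ext_gens[OF assms(1,2)]
    by (intro ext_minimal) auto
qed

lemma Idl_eq_ext: "S \<subseteq> carrier R \<Longrightarrow> Idl S = ext {\<zero>} S"
  using genideal_minimal[OF ext_ideal[OF zeroideal], of S S] ext_gens[OF zeroideal, of S]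
    ext_minimal[of "Idl S" "{\<zero>}" S] genideal_ideal[of S] genideal_self[of S]
  by (auto simp: ideal_zero)

lemma set_add_eq_ext: "ideal K R \<Longrightarrow> ideal L R \<Longrightarrow> K <+> L = ext K L"
  unfolding ext_def by (rule union_genideal[symmetric])

lemma ext_idealE:
  assumes "ideal K R" "ideal L R" "y \<in> ext K L"
  obtains k l where "k \<in> K" "l \<in> L" "y = k \<oplus> l"
  using assms by (auto simp: set_add_eq_ext[symmetric] set_add_def')

lemma ext_Idl:
  assumes "ideal K R" "S \<subseteq> carrier R"
  shows "ext K (Idl S) = ext K S"
proof
  show "ext K (Idl S) \<subseteq> ext K S"
    using assms ext_ideal[OF assms] ext_base[OF assms] ext_gens[OF assms]
    by (intro ext_minimal genideal_minimal) auto
  show "ext K S \<subseteq> ext K (Idl S)"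
    using assms genideal_self[OF assms(2)] ideal_subset[OF genideal_ideal[OF assms(2)]]
    by (intro ext_mono) auto
qed

lemma ext_singleton:
  assumes "ideal K R" "x \<in> carrier R"
  shows "ext K {x} = {k \<oplus> r \<otimes> x | k r. k \<in> K \<and> r \<in> carrier R}"
proof -
  have "ext K {x} = ext K (PIdl x)"
    using ext_Idl[of K "{x}"] assms cgenideal_eq_genideal[OF assms(2)] by simp
  also have "\<dots> = K <+> PIdl x"
    by (rule set_add_eq_ext[symmetric]) (use assms cgenideal_ideal in auto)
  also have "\<dots> = {k \<oplus> r \<otimes> x | k r. k \<in> K \<and> r \<in> carrier R}"
    unfolding set_add_def' cgenideal_def by blast
  finally show ?thesis .
qed

lemma ext_singletonE:
  assumes "ideal K R" "x \<in> carrier R" "y \<in> ext K {x}"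
  obtains k r where "k \<in> K" "r \<in> carrier R" "y = k \<oplus> r \<otimes> x"
  using assms by (auto simp: ext_singleton)

lemma ext_singletonI:
  assumes "ideal K R" "x \<in> carrier R" "k \<in> K" "r \<in> carrier R"
  shows "k \<oplus> r \<otimes> x \<in> ext K {x}"
  using assms by (auto simp: ext_singleton)

lemma ext_insert:
  assumes "ideal K R" "x \<in> carrier R" "S \<subseteq> carrier R"
  shows "ext K (insert x S) = ext (ext K {x}) S"
  using ext_ext[of K "{x}" S] assms by simp

lemma ext_insert':
  assumes "ideal K R" "x \<in> carrier R" "S \<subseteq> carrier R"
  shows "ext K (insert x S) = ext (ext K S) {x}"
  using ext_ext[of K S "{x}"] assms by simp

lemma ext_imageE:
  assumes "finite Q" "ideal K R" "g ` Q \<subseteq> carrier R" "y \<in> ext K (g ` Q)"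
  obtains k r where "k \<in> K" "r \<in> Q \<rightarrow> carrier R" "y = k \<oplus> (\<Oplus>q\<in>Q. r q \<otimes> g q)"
proof -
  have "\<exists>k r. k \<in> K \<and> r \<in> Q \<rightarrow> carrier R \<and> y = k \<oplus> (\<Oplus>q\<in>Q. r q \<otimes> g q)"
    using assms
  proof (induction Q arbitrary: y rule: finite_induct)
    case empty
    then have "y \<in> K" "y \<in> carrier R" by (auto simp: ext_empty ideal.Icarr)
    then show ?case by (intro exI[of _ y]) auto
  next
    case (insert q Q)
    have g: "g q \<in> carrier R" "g ` Q \<subseteq> carrier R" using insert by auto
    have "y \<in> ext (ext K (g ` Q)) {g q}"
      using insert.prems ext_insert'[OF insert.prems(1) g] by simp
    then obtain y' s where y': "y' \<in> ext K (g ` Q)" "s \<in> carrier R" "y = y' \<oplus> s \<otimes> g q"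
      using ext_singletonE[OF ext_ideal[OF insert.prems(1) g(2)] g(1)] by metis
    obtain k r where kr: "k \<in> K" "r \<in> Q \<rightarrow> carrier R" "y' = k \<oplus> (\<Oplus>q\<in>Q. r q \<otimes> g q)"
      using insert.IH[OF insert.prems(1) g(2) y'(1)] by blast
    define r' where "r' = r(q := s)"
    have "(\<Oplus>p\<in>insert q Q. r' p \<otimes> g p) = r' q \<otimes> g q \<oplus> (\<Oplus>p\<in>Q. r' p \<otimes> g p)"
      using insert.hyps g kr(2) y'(2) by (intro finsum_insert) (auto simp: r'_def Pi_iff image_subset_iff)
    also have "(\<Oplus>p\<in>Q. r' p \<otimes> g p) = (\<Oplus>p\<in>Q. r p \<otimes> g p)"
      using insert.hyps g kr(2) by (intro finsum_cong') (auto simp: r'_def Pi_iff image_subset_iff)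
    finally have "y = k \<oplus> (\<Oplus>p\<in>insert q Q. r' p \<otimes> g p)"
    proof -
      assume a: "(\<Oplus>p\<in>insert q Q. r' p \<otimes> g p) = r' q \<otimes> g q \<oplus> (\<Oplus>p\<in>Q. r p \<otimes> g p)"
      have c: "(\<Oplus>p\<in>Q. r p \<otimes> g p) \<in> carrier R" "k \<in> carrier R"
        using kr g insert.prems ideal.Icarr by (auto intro!: finsum_closed)
      show ?thesis unfolding a using c y' g kr by (simp add: r'_def a_ac)
    qed
    moreover have "r' \<in> insert q Q \<rightarrow> carrier R" using kr y' by (auto simp: r'_def)
    ultimately show ?case using kr(1) by blast
  qed
  then show thesis using that by blast
qed

lemma ideal_prod_minimal:
  assumes "ideal L R" "\<And>i j. i \<in> I \<Longrightarrow> j \<in> J \<Longrightarrow> i \<otimes> j \<in> L"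
  shows "I \<cdot> J \<subseteq> L"
proof
  fix x assume "x \<in> I \<cdot> J"
  then show "x \<in> L" by induction (use assms in \<open>auto intro: ideal_add\<close>)
qed

lemma ideal_prod_mono: "I \<subseteq> I' \<Longrightarrow> J \<subseteq> J' \<Longrightarrow> I \<cdot> J \<subseteq> I' \<cdot> J'"
proof
  fix x assume "I \<subseteq> I'" "J \<subseteq> J'" "x \<in> I \<cdot> J"
  from this(3,1,2) show "x \<in> I' \<cdot> J'" by induction (auto intro: ideal_prod.intros)
qed

lemma ideal_prod_Idl_left:
  assumes "ideal L R" "S \<subseteq> carrier R" "J \<subseteq> carrier R" "\<And>s j. s \<in> S \<Longrightarrow> j \<in> J \<Longrightarrow> s \<otimes> j \<in> L"
  shows "(Idl S) \<cdot> J \<subseteq> L"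
proof (rule ideal_prod_minimal[OF assms(1)])
  have "Idl S \<subseteq> {x \<in> carrier R. \<forall>s\<in>J. x \<otimes> s \<in> L}"
    using assms by (intro genideal_minimal ideal_colon) auto
  then show "i \<otimes> j \<in> L" if "i \<in> Idl S" "j \<in> J" for i j using that by blast
qed

lemma ideal_prod_Idl_Idl:
  assumes "S \<subseteq> carrier R" "T \<subseteq> carrier R"
  shows "(Idl S) \<cdot> (Idl T) = Idl {s \<otimes> t | s t. s \<in> S \<and> t \<in> T}"
proof
  let ?P = "{s \<otimes> t | s t. s \<in> S \<and> t \<in> T}"
  have P: "?P \<subseteq> carrier R" using assms by auto
  note L = genideal_ideal[OF P]
  have 1: "t \<otimes> s \<in> Idl ?P" if "s \<in> S" "t \<in> Idl T" for s t
  proof -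
    have "x \<otimes> s' \<in> Idl ?P" if "x \<in> T" "s' \<in> S" for x s'
    proof -
      have "x \<otimes> s' = s' \<otimes> x" using that assms by (intro m_comm) auto
      also have "\<dots> \<in> Idl ?P" using that genideal_self[OF P] by blast
      finally show ?thesis .
    qed
    then have "Idl T \<subseteq> {x \<in> carrier R. \<forall>s\<in>S. x \<otimes> s \<in> Idl ?P}"
      using assms by (intro genideal_minimal ideal_colon[OF L]) auto
    then show ?thesis using that by auto
  qed
  have T: "Idl T \<subseteq> carrier R" using assms genideal_ideal ideal_subset by blast
  show "(Idl S) \<cdot> (Idl T) \<subseteq> Idl ?P"
    using 1 assms T by (intro ideal_prod_Idl_left[OF L]) (auto simp: subset_iff m_comm)
  show "Idl ?P \<subseteq> (Idl S) \<cdot> (Idl T)"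
    using assms genideal_self[of S] genideal_self[of T]
    by (intro genideal_minimal ideal_prod_is_ideal genideal_ideal) (auto intro!: ideal_prod.prod)
qed

lemma ideal_pow_ideal: "ideal I R \<Longrightarrow> ideal (ideal_pow R I n) R"
  by (induction n) (auto simp: oneideal ideal_prod_is_ideal)

lemma ideal_pow_1: "ideal I R \<Longrightarrow> ideal_pow R I (Suc 0) = I"
  by (simp add: ideal_prod_one)

lemma ideal_pow_add:
  "ideal I R \<Longrightarrow> ideal_pow R I (p + q) = ideal_pow R I p \<cdot> ideal_pow R I q"
proof (induction p)
  case 0
  then show ?case
    using ideal_prod_commute[OF ideal_pow_ideal[OF 0] oneideal, of q]
    by (simp add: ideal_prod_one ideal_pow_ideal)
next
  case (Suc p)
  then show ?case by (simp add: ideal_prod_assoc ideal_pow_ideal)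
qed

lemma ideal_pow_antimono: "ideal I R \<Longrightarrow> p \<le> q \<Longrightarrow> ideal_pow R I q \<subseteq> ideal_pow R I p"
proof -
  assume I: "ideal I R" and "p \<le> q"
  then obtain t where "q = p + t" using le_Suc_ex by blast
  then show ?thesis
    using ideal_pow_add[OF I, of p t] ideal_prod_inter[OF ideal_pow_ideal[OF I] ideal_pow_ideal[OF I], of p t]
    by auto
qed

lemma ideal_pow_mono: "I \<subseteq> J \<Longrightarrow> ideal_pow R I n \<subseteq> ideal_pow R J n"
  by (induction n) (auto intro: ideal_prod_mono[THEN subsetD])

lemma ideal_pow_mult:
  "ideal I R \<Longrightarrow> x \<in> ideal_pow R I p \<Longrightarrow> y \<in> ideal_pow R I q \<Longrightarrow> x \<otimes> y \<in> ideal_pow R I (p + q)"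
  by (simp add: ideal_pow_add ideal_prod.prod)

lemma ideal_pow_nat_pow: "ideal I R \<Longrightarrow> x \<in> I \<Longrightarrow> x [^] n \<in> ideal_pow R I n"
proof (induction n)
  case (Suc n)
  then have "x [^] n \<otimes> x \<in> ideal_pow R I (n + Suc 0)"
    using ideal_pow_1[of I] by (intro ideal_pow_mult) auto
  then show ?case by simp
qed simp

end

section \<open>Noetherian local rings\<close>

locale noetherian_local = cring R + noetherian_ring R for R (structure) +
  fixes \<mm>
  assumes maximal: "maximalideal \<mm> R"
    and local_unique: "maximalideal M R \<Longrightarrow> M = \<mm>"
begin

lemma m_ideal: "ideal \<mm> R"
  using maximal maximalideal.axioms(1) by blast

lemma m_prime: "primeideal \<mm> R"
  by (rule maximalideal_prime[OF maximal])

lemma m_carrier: "\<mm> \<subseteq> carrier R"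
  by (rule ideal_subset[OF m_ideal])

lemma one_notin_m: "\<one> \<notin> \<mm>"
  using maximal maximalideal.I_notcarr ideal.one_imp_carrier[OF m_ideal] by metis

text \<open>In a noetherian ring a nonempty chain of ideals contains its union, so Zorn's lemma
  applies to every nonempty family of ideals.\<close>

lemma ideals_maximal:
  assumes "I \<in> S" "\<And>I. I \<in> S \<Longrightarrow> ideal I R"
  obtains M where "M \<in> S" "\<And>I. I \<in> S \<Longrightarrow> M \<subseteq> I \<Longrightarrow> I = M"
proof -
  have "\<exists>M\<in>S. \<forall>L\<in>S. M \<subseteq> L \<longrightarrow> L = M"
  proof (rule subset_Zorn_nonempty)
    show "S \<noteq> {}" using assms by blast
    fix C assume "C \<noteq> {}" and "subset.chain S C"
    then have "C \<subseteq> {I. ideal I R}"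
      using assms(2) unfolding pred_on.chain_def by auto
    then have "subset.chain {I. ideal I R} C"
      using \<open>subset.chain S C\<close> unfolding pred_on.chain_def by auto
    then have "\<Union>C \<in> C" using \<open>C \<noteq> {}\<close> by (intro ideal_chain_is_trivial)
    then show "\<Union>C \<in> S" using \<open>subset.chain S C\<close> unfolding pred_on.chain_def by auto
  qed
  then show thesis using that by blast
qed

lemma proper_ideal_le_m:
  assumes "ideal L R" "\<one> \<notin> L"
  shows "L \<subseteq> \<mm>"
proof -
  obtain M where M: "M \<in> {L'. ideal L' R \<and> L \<subseteq> L' \<and> \<one> \<notin> L'}"
    "\<And>I. I \<in> {L'. ideal L' R \<and> L \<subseteq> L' \<and> \<one> \<notin> L'} \<Longrightarrow> M \<subseteq> I \<Longrightarrow> I = M"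
    by (rule ideals_maximal[of L "{L'. ideal L' R \<and> L \<subseteq> L' \<and> \<one> \<notin> L'}"]) (use assms in auto)
  have "maximalideal M R"
  proof (rule maximalidealI)
    show "carrier R \<noteq> M" using M(1) by auto
    show "J = M \<or> J = carrier R" if "ideal J R" "M \<subseteq> J" "J \<subseteq> carrier R" for J
    proof (cases "\<one> \<in> J")
      case True then show ?thesis using ideal.one_imp_carrier that by blast
    next
      case False then show ?thesis using M that by blast
    qed
  qed (use M in auto)
  then show ?thesis using local_unique M(1) by blast
qed

lemma unit_notin_m:
  assumes "x \<in> carrier R" "x \<notin> \<mm>"
  obtains y where "y \<in> carrier R" "y \<otimes> x = \<one>"
proof -
  have "\<one> \<in> PIdl x"
    using proper_ideal_le_m[OF cgenideal_ideal[OF assms(1)]] assms cgenideal_self by blast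
  then show thesis using that unfolding cgenideal_def by auto
qed

lemma unit_cancel:
  assumes "ideal L R" "x \<in> carrier R" "x \<notin> \<mm>" "y \<in> carrier R" "x \<otimes> y \<in> L"
  shows "y \<in> L"
proof -
  obtain z where z: "z \<in> carrier R" "z \<otimes> x = \<one>" using unit_notin_m assms by blast
  have "z \<otimes> (x \<otimes> y) \<in> L" using ideal.I_l_closed[OF assms(1,5) z(1)] .
  then show ?thesis using z assms by (simp add: m_assoc[symmetric])
qed

lemma one_minus_notin_m: "x \<in> \<mm> \<Longrightarrow> \<one> \<ominus> x \<notin> \<mm>"
proof
  assume x: "x \<in> \<mm>" "\<one> \<ominus> x \<in> \<mm>"
  have "\<one> = (\<one> \<ominus> x) \<oplus> x" using x m_carrier by (simp add: a_minus_def a_assoc l_neg subset_iff)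
  then show False using ideal_add[OF m_ideal x(2,1)] one_notin_m by simp
qed

lemma notin_m_mult: "x \<in> carrier R \<Longrightarrow> y \<in> carrier R \<Longrightarrow> x \<notin> \<mm> \<Longrightarrow> y \<notin> \<mm> \<Longrightarrow> x \<otimes> y \<notin> \<mm>"
  using primeideal.I_prime[OF m_prime] by blast

text \<open>A maximal counterexample replaces induction over generators: let L be maximal among the
  ideals above B that do not contain N. For u in N outside L, maximality puts N into L + (u), so
  \<mm> N lies in L + \<mm> u; then u is congruent to r u modulo L with r in \<mm>, and the unit 1 -
  r forces u into L.\<close>

lemma nakayama:
  assumes N: "ideal N R" and B: "ideal B R" and sub: "N \<subseteq> ext B (\<mm> \<cdot> N)"
  shows "N \<subseteq> B"
proof (rule ccontr)
  assume nsub: "\<not> N \<subseteq> B"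
  obtain L where L: "L \<in> {L. ideal L R \<and> B \<subseteq> L \<and> \<not> N \<subseteq> L}"
    "\<And>I. I \<in> {L. ideal L R \<and> B \<subseteq> L \<and> \<not> N \<subseteq> L} \<Longrightarrow> L \<subseteq> I \<Longrightarrow> I = L"
    by (rule ideals_maximal[of B "{L. ideal L R \<and> B \<subseteq> L \<and> \<not> N \<subseteq> L}"]) (use B nsub in auto)
  then have Li: "ideal L R" by simp
  obtain u where u: "u \<in> N" "u \<notin> L" using L by auto
  have uc: "u \<in> carrier R" using u(1) by (rule ideal.Icarr[OF N])
  have i: "ideal (ext L {u}) R" using Li uc ext_ideal by simp
  have "N \<subseteq> ext L {u}"
    using L(2)[of "ext L {u}"] L(1) i ext_base[of L "{u}"] ext_gens[of L "{u}"] uc u by blast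
  have mN: "x \<otimes> y \<in> {l \<oplus> r \<otimes> u | l r. l \<in> L \<and> r \<in> \<mm>}" if x: "x \<in> \<mm>" and y: "y \<in> N" for x y
  proof -
    obtain l r where lr: "l \<in> L" "r \<in> carrier R" "y = l \<oplus> r \<otimes> u"
      using ext_singletonE[OF Li uc] y \<open>N \<subseteq> ext L {u}\<close> by blast
    have "x \<otimes> y = x \<otimes> l \<oplus> (x \<otimes> r) \<otimes> u"
      using x m_carrier lr ideal.Icarr[OF Li] uc by (auto simp: r_distr m_assoc subset_iff)
    then show ?thesis using ideal.I_l_closed[OF Li lr(1)] ideal.I_r_closed[OF m_ideal x lr(2)] x m_carrier
      by blast
  qed
  have zz: "\<exists>l r. l \<in> L \<and> r \<in> \<mm> \<and> z = l \<oplus> r \<otimes> u" if "z \<in> \<mm> \<cdot> N" for z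
    using that
  proof induction
    case (prod i j)
    then show ?case using mN[of i j] by auto
  next
    case (sum s1 s2)
    then obtain l1 r1 l2 r2 where *: "l1 \<in> L" "l2 \<in> L" "r1 \<in> \<mm>" "r2 \<in> \<mm>"
      "s1 = l1 \<oplus> r1 \<otimes> u" "s2 = l2 \<oplus> r2 \<otimes> u" by blast
    have "s1 \<oplus> s2 = (l1 \<oplus> l2) \<oplus> (r1 \<oplus> r2) \<otimes> u"
    proof -
      have "l1 \<in> carrier R" "l2 \<in> carrier R" "r1 \<in> carrier R" "r2 \<in> carrier R"
        using * ideal.Icarr[OF Li] m_carrier by auto
      then show ?thesis unfolding *(5,6) using uc by algebra
    qed
    then show ?case using * ideal_add[OF Li] ideal_add[OF m_ideal] by blast
  qed
  obtain b z where b: "b \<in> B" and z: "z \<in> \<mm> \<cdot> N" and ubz: "u = b \<oplus> z"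
    by (rule ext_idealE[OF B ideal_prod_is_ideal[OF m_ideal N] subsetD[OF sub u(1)]])
  obtain l r where "l \<in> L" "r \<in> \<mm>" "z = l \<oplus> r \<otimes> u" using zz[OF z] by blast
  then have lr: "b \<in> L" "l \<in> L" "r \<in> \<mm>" "u = b \<oplus> (l \<oplus> r \<otimes> u)"
    using b ubz L(1) by auto
  have c: "b \<in> carrier R" "l \<in> carrier R" "r \<in> carrier R" using lr ideal.Icarr[OF Li] m_carrier by auto
  have "(\<one> \<ominus> r) \<otimes> u = u \<ominus> r \<otimes> u" using c uc by algebra
  also have "\<dots> = (b \<oplus> (l \<oplus> r \<otimes> u)) \<ominus> r \<otimes> u" using lr(4) by simp
  also have "\<dots> = b \<oplus> l" using c uc by algebra
  finally have "(\<one> \<ominus> r) \<otimes> u \<in> L" using lr ideal_add[OF Li] by simp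
  then have "u \<in> L" using unit_cancel[OF Li _ one_minus_notin_m[OF lr(3)] uc] c by simp
  then show False using u by blast
qed

end

section \<open>Associated primes and regular sequences\<close>

context noetherian_local
begin

section \<open>Maximal annihilators modulo an ideal\<close>

definition ann :: "'a set \<Rightarrow> 'a \<Rightarrow> 'a set" where
  "ann K u = {x \<in> carrier R. x \<otimes> u \<in> K}"

text \<open>The maximal elements among the associated primes of R/K. They are finitely many and
  their union consists of the zero divisors on R/K, so avoiding them produces regular
  elements.\<close>

definition max_anns :: "'a set \<Rightarrow> 'a set set" where
  "max_anns K = {P. \<exists>u\<in>carrier R - K. P = ann K u \<and> (\<forall>v\<in>carrier R - K. P \<subseteq> ann K v \<longrightarrow> ann K v = P)}"

lemma ann_ideal: "ideal K R \<Longrightarrow> u \<in> carrier R \<Longrightarrow> ideal (ann K u) R"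
  unfolding ann_def using ideal_colon[of K "{u}"] by simp

lemma ann_base: "ideal K R \<Longrightarrow> u \<in> carrier R \<Longrightarrow> K \<subseteq> ann K u"
  unfolding ann_def by (auto simp: ideal.I_r_closed ideal.Icarr)

lemma max_anns_above:
  assumes "ideal K R" "u \<in> carrier R - K"
  obtains P where "P \<in> max_anns K" "ann K u \<subseteq> P"
proof -
  let ?S = "{ann K v | v. v \<in> carrier R - K \<and> ann K u \<subseteq> ann K v}"
  obtain M where M: "M \<in> ?S" "\<And>L. L \<in> ?S \<Longrightarrow> M \<subseteq> L \<Longrightarrow> L = M"
    by (rule ideals_maximal[of "ann K u" ?S]) (use assms ann_ideal in auto)
  then obtain v where v: "v \<in> carrier R - K" "M = ann K v" "ann K u \<subseteq> ann K v" by auto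
  have "ann K w = M" if "w \<in> carrier R - K" "M \<subseteq> ann K w" for w
    using M(2)[of "ann K w"] that v by auto
  then have "M \<in> max_anns K" unfolding max_anns_def using v by auto
  then show thesis using that v by auto
qed

text \<open>If a b kills u and a does not, then a u is again a nonzero class whose annihilator
  contains P; by maximality it equals P, and it contains b.\<close>

lemma max_anns_prime:
  assumes "ideal K R" "P \<in> max_anns K"
  shows "primeideal P R"
proof -
  obtain u where u: "u \<in> carrier R" "u \<notin> K" "P = ann K u"
    and mx: "\<And>v. v \<in> carrier R - K \<Longrightarrow> P \<subseteq> ann K v \<Longrightarrow> ann K v = P"
    using assms(2) unfolding max_anns_def by auto
  have P: "ideal P R" using ann_ideal[OF assms(1) u(1)] u(3) by simp
  show ?thesis
  proof (rule primeidealI[OF P is_cring])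
    have "\<one> \<notin> P" using u by (simp add: ann_def)
    then show "carrier R \<noteq> P" by auto
    fix a b assume a: "a \<in> carrier R" and b: "b \<in> carrier R" and ab: "a \<otimes> b \<in> P"
    show "a \<in> P \<or> b \<in> P"
    proof (cases "a \<in> P")
      case False
      then have "a \<otimes> u \<in> carrier R - K" using a u by (simp add: ann_def)
      moreover have "P \<subseteq> ann K (a \<otimes> u)"
      proof
        fix x assume "x \<in> P"
        then have x: "x \<in> carrier R" "x \<otimes> u \<in> K" using u(3) by (auto simp: ann_def)
        have "x \<otimes> (a \<otimes> u) = a \<otimes> (x \<otimes> u)" using x a u(1) by (simp add: m_lcomm)
        then show "x \<in> ann K (a \<otimes> u)"
          using ideal.I_l_closed[OF assms(1) x(2) a] x by (simp add: ann_def)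
      qed
      ultimately have "ann K (a \<otimes> u) = P" by (rule mx)
      moreover have "b \<otimes> (a \<otimes> u) \<in> K"
        using ab a b u by (simp add: ann_def m_assoc m_lcomm)
      ultimately show ?thesis using b by (auto simp: ann_def)
    qed simp
  qed
qed

lemma prime_avoids_product:
  assumes P: "primeideal P R" and "finite F" "\<And>Q. Q \<in> F \<Longrightarrow> ideal Q R \<and> \<not> Q \<subseteq> P"
  shows "\<exists>x\<in>carrier R. x \<notin> P \<and> (\<forall>Q\<in>F. x \<in> Q)"
  using assms(2,3)
proof (induction F rule: finite_induct)
  case empty
  have "\<one> \<notin> P"
    using primeideal.I_notcarr[OF P] ideal.one_imp_carrier[OF primeideal.axioms(1)[OF P]] by auto
  then show ?case by auto
next
  case (insert Q F)
  then obtain x where x: "x \<in> carrier R" "x \<notin> P" "\<forall>Q\<in>F. x \<in> Q" by auto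
  obtain y where y: "y \<in> Q" "y \<notin> P" using insert.prems by auto
  have yc: "y \<in> carrier R" using insert.prems[of Q] y(1) ideal.Icarr[of Q R y] by auto
  have "y \<otimes> x \<notin> P" using primeideal.I_prime[OF P yc x(1)] x y by auto
  moreover have "y \<otimes> x \<in> Q'" if "Q' \<in> insert Q F" for Q'
    using insert.prems[OF that] that x y yc ideal.I_l_closed[of Q' R x y] ideal.I_r_closed[of Q' R y x]
    by auto
  ultimately show ?case using x yc by (intro bexI[of _ "y \<otimes> x"]) auto
qed

lemma increasing_ideals_stabilise:
  assumes "\<And>i. ideal (N i) R" "\<And>i. N i \<subseteq> N (Suc i)"
  obtains i where "N (Suc i) = N (i::nat)"
proof -
  obtain M where M: "M \<in> range N" "\<And>L. L \<in> range N \<Longrightarrow> M \<subseteq> L \<Longrightarrow> L = M"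
    by (rule ideals_maximal[of "N 0" "range N"]) (use assms(1) in auto)
  then obtain i where "M = N i" by auto
  then have "N (Suc i) = N i" using M(2)[of "N (Suc i)"] assms(2) by auto
  then show thesis by (rule that)
qed

text \<open>For an infinite sequence of distinct P_i = ann(u_i), the ideals generated over K by u_0,
  ..., u_{i-1} stabilise, so some u_i lies in the ideal of its predecessors. An x in all earlier P_j
  but outside P_i would kill these predecessors and hence u_i modulo K; so some P_j lies in P_i, and
  maximality makes them equal.\<close>

lemma finite_max_anns:
  assumes K: "ideal K R"
  shows "finite (max_anns K)"
proof (rule ccontr)
  assume "infinite (max_anns K)"
  then obtain P :: "nat \<Rightarrow> 'a set" where P: "inj P" "range P \<subseteq> max_anns K"
    using infinite_countable_subset by blast
  define u where "u i = (SOME u. u \<in> carrier R - K \<and> P i = ann K u \<and>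
    (\<forall>v\<in>carrier R - K. P i \<subseteq> ann K v \<longrightarrow> ann K v = P i))" for i
  have u': "u i \<in> carrier R - K \<and> P i = ann K (u i) \<and>
    (\<forall>v\<in>carrier R - K. P i \<subseteq> ann K v \<longrightarrow> ann K v = P i)" for i
  proof -
    have "P i \<in> max_anns K" using P(2) by auto
    then have "\<exists>u. u \<in> carrier R - K \<and> P i = ann K u \<and>
        (\<forall>v\<in>carrier R - K. P i \<subseteq> ann K v \<longrightarrow> ann K v = P i)"
      unfolding max_anns_def mem_Collect_eq by (elim bexE) auto
    then show ?thesis unfolding u_def by (rule someI_ex)
  qed
  have u: "u i \<in> carrier R" "u i \<notin> K" "P i = ann K (u i)" for i
    using u'[of i] by simp_all
  have mx: "ann K v = P i" if "v \<in> carrier R - K" "P i \<subseteq> ann K v" for i v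
    using u'[of i] that by blast
  have uc: "u ` A \<subseteq> carrier R" for A using u(1) by auto
  define N where "N i = ext K (u ` {..<i})" for i
  have Ni: "ideal (N i) R" for i unfolding N_def by (rule ext_ideal[OF K uc])
  have mono: "N i \<subseteq> N (Suc i)" for i
    unfolding N_def by (rule ext_mono[OF K uc]) (auto simp: lessThan_Suc)
  obtain i where "N (Suc i) = N i"
    by (rule increasing_ideals_stabilise[of N, OF Ni mono])
  moreover have "u i \<in> N (Suc i)"
    unfolding N_def using ext_gens[OF K uc[of "{..<Suc i}"]] by (auto simp: image_subset_iff)
  ultimately have ui: "u i \<in> N i" by simp
  have "\<not> (\<forall>Q\<in>P ` {..<i}. ideal Q R \<and> \<not> Q \<subseteq> P i)"
  proof
    assume "\<forall>Q\<in>P ` {..<i}. ideal Q R \<and> \<not> Q \<subseteq> P i"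
    then obtain x where x: "x \<in> carrier R" "x \<notin> P i" "\<forall>Q\<in>P ` {..<i}. x \<in> Q"
      using prime_avoids_product[OF max_anns_prime[OF K, of "P i"], of "P ` {..<i}"] P(2) by blast
    have "N i \<subseteq> ann K x" unfolding N_def
      by (rule ext_minimal[OF ann_ideal[OF K x(1)] ann_base[OF K x(1)]])
        (use x u in \<open>auto simp: ann_def m_comm\<close>)
    then have "x \<otimes> u i \<in> K" using ui x u(1) by (auto simp: ann_def m_comm)
    then show False using x u by (auto simp: ann_def)
  qed
  then obtain j where j: "j < i" "P j \<subseteq> P i"
    using u ann_ideal[OF K] by auto
  then have "P i = P j" using mx[of "u i" j] u by auto
  then show False using j P(1) by (auto dest: injD)
qed

text \<open>Regular sequences on \<open>R / K\<close>, without the requirement that the quotient be nonzero.\<close>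

definition nzd :: "'a set \<Rightarrow> 'a \<Rightarrow> bool" where
  "nzd K x \<longleftrightarrow> (\<forall>r\<in>carrier R. x \<otimes> r \<in> K \<longrightarrow> r \<in> K)"

lemma nzdD: "nzd K x \<Longrightarrow> r \<in> carrier R \<Longrightarrow> x \<otimes> r \<in> K \<Longrightarrow> r \<in> K"
  by (auto simp: nzd_def)

lemma nzd_if_avoids:
  assumes "ideal K R" "x \<in> carrier R" "\<And>P. P \<in> max_anns K \<Longrightarrow> x \<notin> P"
  shows "nzd K x"
  unfolding nzd_def
proof (intro ballI impI, rule ccontr)
  fix r assume r: "r \<in> carrier R" "x \<otimes> r \<in> K" "r \<notin> K"
  obtain P where "P \<in> max_anns K" "ann K r \<subseteq> P" using max_anns_above[of K r] assms r by auto
  moreover have "x \<in> ann K r" using r assms by (simp add: ann_def)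
  ultimately show False using assms(3) by auto
qed

lemma nzd_pow:
  assumes "ideal K R" "x \<in> carrier R" "nzd K x" "r \<in> carrier R" "x [^] (n::nat) \<otimes> r \<in> K"
  shows "r \<in> K"
  using assms(4,5)
proof (induction n arbitrary: r)
  case (Suc n)
  have "x \<otimes> (x [^] n \<otimes> r) \<in> K" using Suc.prems assms(2) by (simp add: m_assoc m_lcomm m_comm)
  then have "x [^] n \<otimes> r \<in> K" using nzdD[OF assms(3)] Suc.prems(1) assms(2) by simp
  then show ?case using Suc by simp
qed simp

primrec regseq :: "'a set \<Rightarrow> 'a list \<Rightarrow> bool" where
  "regseq K [] = True"
| "regseq K (y # ys) = (nzd K y \<and> regseq (ext K {y}) ys)"

lemma regseq_iff_nth:
  assumes "ideal K R" "set ys \<subseteq> carrier R"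
  shows "regseq K ys \<longleftrightarrow> (\<forall>i<length ys. nzd (ext K (set (take i ys))) (ys ! i))"
  using assms
proof (induction ys arbitrary: K)
  case (Cons y ys)
  have e: "ext (ext K {y}) (set (take i ys)) = ext K (set (take (Suc i) (y # ys)))" for i
    using ext_insert[of K y "set (take i ys)"] Cons.prems set_take_subset[of i ys] by auto
  have "regseq (ext K {y}) ys \<longleftrightarrow>
    (\<forall>i<length ys. nzd (ext (ext K {y}) (set (take i ys))) (ys ! i))"
    using Cons ext_ideal[of K "{y}"] by simp
  then show ?case
    using Cons.prems by (simp add: e ext_empty All_less_Suc2)
qed simp

lemma regseq_snoc:
  assumes "ideal K R" "set ys \<subseteq> carrier R"
  shows "regseq K (ys @ [z]) \<longleftrightarrow> regseq K ys \<and> nzd (ext K (set ys)) z"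
  using assms
proof (induction ys arbitrary: K)
  case (Cons y ys)
  then show ?case using ext_insert[of K y "set ys"] ext_ideal[of K "{y}"] by simp
qed (simp add: ext_empty)

text \<open>The first claim needs Nakayama: if v r lies in K then r = k + u r' with r' again killed
  by v modulo K, so the annihilator N of v satisfies N \<subseteq> K + u N. The second claim is
  formal: writing u r = k + r' v, regularity of v modulo u makes r' a multiple of u modulo K, and u
  can be cancelled.\<close>

lemma nzd_swap:
  assumes K: "ideal K R" and uv: "u \<in> \<mm>" "v \<in> \<mm>" and reg: "nzd K u" "nzd (ext K {u}) v"
  shows "nzd K v" "nzd (ext K {v}) u"
proof -
  have c: "u \<in> carrier R" "v \<in> carrier R" using uv m_carrier by auto
  let ?N = "ann K v"
  have N: "ideal ?N R" by (rule ann_ideal[OF K c(2)])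
  have *: "\<exists>k\<in>K. \<exists>r'\<in>?N. r = k \<oplus> u \<otimes> r'" if r: "r \<in> ?N" for r
  proof -
    have rc: "r \<in> carrier R" "v \<otimes> r \<in> K" using r c by (auto simp: ann_def m_comm)
    then have "r \<in> ext K {u}" using nzdD[OF reg(2) rc(1)] ext_base[OF K, of "{u}"] c by auto
    then obtain k r' where k: "k \<in> K" "r' \<in> carrier R" "r = k \<oplus> r' \<otimes> u"
      using ext_singletonE[OF K c(1)] by metis
    have kc: "k \<in> carrier R" using ideal.Icarr[OF K k(1)] .
    have "v \<otimes> r = v \<otimes> k \<oplus> u \<otimes> (r' \<otimes> v)" unfolding k(3) using c k kc by algebra
    then have "u \<otimes> (r' \<otimes> v) \<in> K"
      using ideal_add_cancel_left[OF K ideal.I_l_closed[OF K k(1) c(2)]] rc c k by auto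
    then have "r' \<in> ?N" using nzdD[OF reg(1)] c k by (simp add: ann_def)
    then show ?thesis using k c m_comm[of r' u] by auto
  qed
  have "?N \<subseteq> K"
  proof (rule nakayama[OF N K], rule subsetI)
    fix r assume "r \<in> ?N"
    then obtain k r' where k: "k \<in> K" "r' \<in> ?N" "r = k \<oplus> u \<otimes> r'" using * by blast
    have i: "\<mm> \<cdot> ?N \<subseteq> carrier R" using ideal_prod_in_carrier[OF m_ideal N] .
    have "u \<otimes> r' \<in> \<mm> \<cdot> ?N" using ideal_prod.prod[OF uv(1) k(2)] .
    then show "r \<in> ext K (\<mm> \<cdot> ?N)"
      unfolding k(3) using ext_base[OF K i] ext_gens[OF K i] k(1)
      by (intro ideal_add[OF ext_ideal[OF K i]]) auto
  qed
  then show "nzd K v" using c by (auto simp: nzd_def ann_def m_comm)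
  show "nzd (ext K {v}) u" unfolding nzd_def
  proof (intro ballI impI)
    fix r assume r: "r \<in> carrier R" "u \<otimes> r \<in> ext K {v}"
    obtain k r' where k: "k \<in> K" "r' \<in> carrier R" "u \<otimes> r = k \<oplus> r' \<otimes> v"
      using ext_singletonE[OF K c(2) r(2)] by metis
    have kc: "k \<in> carrier R" using ideal.Icarr[OF K k(1)] .
    have "v \<otimes> r' = \<ominus> k \<oplus> (k \<oplus> r' \<otimes> v)" using c k kc by algebra
    also have "\<dots> = \<ominus> k \<oplus> r \<otimes> u" using k(3) r c m_comm by metis
    also have "\<dots> \<in> ext K {u}" by (rule ext_singletonI[OF K c(1) ideal_neg[OF K k(1)] r(1)])
    finally have "r' \<in> ext K {u}" using nzdD[OF reg(2) k(2)] by simp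
    then obtain k' s where k': "k' \<in> K" "s \<in> carrier R" "r' = k' \<oplus> s \<otimes> u"
      using ext_singletonE[OF K c(1)] by metis
    have k'c: "k' \<in> carrier R" using ideal.Icarr[OF K k'(1)] .
    have "u \<otimes> (r \<ominus> s \<otimes> v) = u \<otimes> r \<ominus> u \<otimes> (s \<otimes> v)" using r c k' by algebra
    also have "\<dots> = k \<oplus> v \<otimes> k'" unfolding k(3) k'(3) using r c k' k'c kc by algebra
    finally have "u \<otimes> (r \<ominus> s \<otimes> v) \<in> K"
      using ideal_add[OF K k(1) ideal.I_l_closed[OF K k'(1) c(2)]] by simp
    then have "r \<ominus> s \<otimes> v \<in> K" using nzdD[OF reg(1)] r c k' by simp
    moreover have "r = (r \<ominus> s \<otimes> v) \<oplus> s \<otimes> v" using r c k' by algebra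
    ultimately show "r \<in> ext K {v}" using ext_singletonI[OF K c(2) _ k'(2)] by metis
  qed
qed

text \<open>Adjacent exchange, repeated: \<open>z\<close> passes each member of \<open>ys\<close> in
  turn. In the exchange theorem the new element is produced at the end but must stand first to be
  absorbed into the base ideal.\<close>

lemma regseq_move_to_front:
  assumes "ideal K R" "set ys \<subseteq> \<mm>" "z \<in> \<mm>" "regseq K (ys @ [z])"
  shows "regseq K (z # ys)"
  using assms
proof (induction ys arbitrary: K)
  case (Cons y ys)
  have c: "y \<in> carrier R" "z \<in> carrier R" using Cons.prems m_carrier by auto
  have "regseq (ext K {y}) (z # ys)"
    using Cons ext_ideal[of K "{y}"] c by simp
  then have "nzd (ext K {y}) z" "regseq (ext (ext K {y}) {z}) ys" by auto
  moreover have "ext (ext K {y}) {z} = ext (ext K {z}) {y}"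
    using ext_ext[of K "{y}" "{z}"] ext_ext[of K "{z}" "{y}"] Cons.prems(1) c by (simp add: insert_commute)
  ultimately show ?case
    using nzd_swap[of K y z] Cons.prems by simp
qed simp

section \<open>Chains of primes below a regular sequence\<close>

lemma prime_disjoint_from_multiplicative_set:
  assumes K: "ideal K R" and S: "S \<subseteq> carrier R" "\<one> \<in> S" "\<And>s t. s \<in> S \<Longrightarrow> t \<in> S \<Longrightarrow> s \<otimes> t \<in> S"
    and "K \<inter> S = {}"
  obtains P where "primeideal P R" "K \<subseteq> P" "P \<inter> S = {}"
proof -
  let ?S = "{L. ideal L R \<and> K \<subseteq> L \<and> L \<inter> S = {}}"
  obtain M where "M \<in> ?S" and mx: "\<And>L. L \<in> ?S \<Longrightarrow> M \<subseteq> L \<Longrightarrow> L = M"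
    by (rule ideals_maximal[of K ?S]) (use assms in auto)
  then have M: "ideal M R" "K \<subseteq> M" "M \<inter> S = {}" by auto
  have meets: "\<exists>m r. m \<in> M \<and> r \<in> carrier R \<and> m \<oplus> r \<otimes> a \<in> S" if a: "a \<in> carrier R" "a \<notin> M" for a
  proof -
    have a': "{a} \<subseteq> carrier R" using a by simp
    have "ext M {a} \<noteq> M" using ext_gens[OF M(1) a'] a by auto
    then have "ext M {a} \<notin> ?S" using mx[of "ext M {a}"] ext_base[OF M(1) a'] by auto
    then have "ext M {a} \<inter> S \<noteq> {}" using ext_ideal[OF M(1) a'] ext_base[OF M(1) a'] M(2) by auto
    then show ?thesis using ext_singleton[OF M(1) a(1)] by auto
  qed
  have "primeideal M R"
  proof (rule primeidealI[OF M(1) is_cring])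
    show "carrier R \<noteq> M" using M(3) S by auto
    fix a b assume ab: "a \<in> carrier R" "b \<in> carrier R" "a \<otimes> b \<in> M"
    show "a \<in> M \<or> b \<in> M"
    proof (rule ccontr)
      assume "\<not> (a \<in> M \<or> b \<in> M)"
      then obtain m r m' r' where *: "m \<in> M" "r \<in> carrier R" "m \<oplus> r \<otimes> a \<in> S"
        "m' \<in> M" "r' \<in> carrier R" "m' \<oplus> r' \<otimes> b \<in> S"
        using meets[of a] meets[of b] ab by auto
      have c: "m \<in> carrier R" "m' \<in> carrier R" using ideal.Icarr[OF M(1)] * by auto
      have "(m \<oplus> r \<otimes> a) \<otimes> (m' \<oplus> r' \<otimes> b) = m \<otimes> (m' \<oplus> r' \<otimes> b) \<oplus> ((r \<otimes> a) \<otimes> m' \<oplus> (r \<otimes> r') \<otimes> (a \<otimes> b))"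
        using c * ab by algebra
      also have "\<dots> \<in> M"
        using c * ab ideal.I_l_closed[OF M(1)] ideal.I_r_closed[OF M(1)]
        by (intro ideal_add[OF M(1)]) auto
      finally show False using S(3)[OF *(3,6)] M(3) by auto
    qed
  qed
  then show thesis using that M by auto
qed

text \<open>The last element \<open>y\<close> allows a strict descent from P: localising at P and
  inverting y keeps the ideal of the preceding elements proper, because y is regular modulo it, so
  that ideal has a prime above it inside P that misses y. Iterating gives as many strict inclusions
  as elements.\<close>

lemma regseq_prime_chain:
  assumes K: "ideal K R" and ys: "set ys \<subseteq> carrier R" and "regseq K ys"
    and "primeideal P R" "ext K (set ys) \<subseteq> P"
  shows "\<exists>Q::nat \<Rightarrow> 'a set. (\<forall>i\<le>length ys. primeideal (Q i) R) \<and> (\<forall>i<length ys. Q i \<subset> Q (Suc i)) \<and> Q (length ys) = P"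
  using assms(2-)
proof (induction ys arbitrary: P rule: rev_induct)
  case Nil
  then show ?case by (intro exI[of _ "\<lambda>_. P"]) auto
next
  case (snoc y ys)
  let ?K = "ext K (set ys)"
  have c: "set ys \<subseteq> carrier R" "y \<in> carrier R" using snoc.prems by auto
  have K': "ideal ?K R" by (rule ext_ideal[OF K c(1)])
  have nz: "nzd ?K y" "regseq K ys" using snoc.prems(2) regseq_snoc[OF K c(1)] by auto
  have sub: "?K \<subseteq> P" "y \<in> P"
    using snoc.prems(4) ext_mono[OF K, of "set (ys @ [y])" K "set ys"] ext_gens[OF K, of "set (ys @ [y])"] snoc.prems(1) by auto
  interpret P: primeideal P R by (rule snoc.prems(3))
  have 1: "\<one> \<notin> P" using P.I_notcarr P.one_imp_carrier by auto
  \<comment> \<open>Both requirements on P' are encoded here: exponent 0 gives the complement of P,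
    hence P' \<subseteq> P, and s = 1 with exponent 1 gives y itself, hence y \<notin> P'.\<close>
  let ?S = "{s \<otimes> y [^] n | s (n::nat). s \<in> carrier R - P}"
  obtain P' where P': "primeideal P' R" "?K \<subseteq> P'" "P' \<inter> ?S = {}"
  proof (rule prime_disjoint_from_multiplicative_set[OF K', of ?S])
    show "?S \<subseteq> carrier R" using c by auto
    show "\<one> \<in> ?S" using 1 by (intro CollectI exI[of _ \<one>] exI[of _ 0]) auto
    fix s t assume "s \<in> ?S" "t \<in> ?S"
    then obtain s' n t' k where *: "s = s' \<otimes> y [^] (n::nat)" "t = t' \<otimes> y [^] (k::nat)"
      "s' \<in> carrier R - P" "t' \<in> carrier R - P" by auto
    have "s \<otimes> t = (s' \<otimes> t') \<otimes> (y [^] n \<otimes> y [^] k)"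
      unfolding *(1,2) using *(3,4) c by (simp add: m_ac)
    then have "s \<otimes> t = (s' \<otimes> t') \<otimes> y [^] (n + k)" using c by (simp add: nat_pow_mult)
    moreover have "s' \<otimes> t' \<in> carrier R - P" using * P.I_prime by auto
    ultimately show "s \<otimes> t \<in> ?S" by blast
  next
    have "s \<in> ?K" if "s \<otimes> y [^] n \<in> ?K" "s \<in> carrier R" for s and n :: nat
      using nzd_pow[OF K' c(2) nz(1) that(2), of n] that c by (simp add: m_comm)
    then show "?K \<inter> ?S = {}" using sub by auto
  qed (rule that)
  have "P' \<subseteq> P"
  proof
    fix x assume x: "x \<in> P'"
    then have xc: "x \<in> carrier R" using ideal.Icarr[OF primeideal.axioms(1)[OF P'(1)]] by simp
    show "x \<in> P"
    proof (rule ccontr)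
      assume "x \<notin> P"
      then have "x \<otimes> y [^] (0::nat) \<in> ?S" using xc by blast
      then show False using x P'(3) xc by auto
    qed
  qed
  moreover have "\<one> \<otimes> y [^] (1::nat) \<in> ?S" using 1 by blast
  then have "y \<notin> P'" using P'(3) c by auto
  ultimately have ss: "P' \<subset> P" using sub by auto
  obtain Q where Q: "\<forall>i\<le>length ys. primeideal (Q i) R" "\<forall>i<length ys. Q i \<subset> Q (Suc i)" "Q (length ys) = P'"
    using snoc.IH[OF c(1) nz(2) P'(1,2)] by blast
  let ?Q = "Q(length (ys @ [y]) := P)"
  have "primeideal (?Q i) R" if "i \<le> length (ys @ [y])" for i
    using that Q(1) snoc.prems(3) by (cases "i = length (ys @ [y])") auto
  moreover have "?Q i \<subset> ?Q (Suc i)" if "i < length (ys @ [y])" for i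
    using that Q(2,3) ss by (cases "i = length ys") auto
  ultimately show ?case by (intro exI[of _ ?Q]) auto
qed

end

section \<open>Prime avoidance over an infinite residue field and exchange of regular
  sequences\<close>

locale noetherian_local_inf = noetherian_local +
  assumes infinite_residue: "infinite (carrier (R Quot \<mm>))"
begin

lemma infinite_residue_system:
  obtains T where "T \<subseteq> carrier R" "infinite T" "\<And>s t. s \<in> T \<Longrightarrow> t \<in> T \<Longrightarrow> s \<ominus> t \<in> \<mm> \<Longrightarrow> s = t"
proof -
  define f where "f C = (SOME x. x \<in> carrier R \<and> C = \<mm> +> x)" for C
  have f: "f C \<in> carrier R \<and> C = \<mm> +> f C" if "C \<in> carrier (R Quot \<mm>)" for C
  proof -
    have "\<exists>x. x \<in> carrier R \<and> C = \<mm> +> x" using that by (auto simp: FactRing_def A_RCOSETS_def')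
    then show ?thesis unfolding f_def by (rule someI_ex)
  qed
  have "inj_on f (carrier (R Quot \<mm>))" by (rule inj_onI) (metis f)
  then have "infinite (f ` carrier (R Quot \<mm>))" using infinite_residue finite_imageD by blast
  moreover have "s = t" if "s \<in> f ` carrier (R Quot \<mm>)" "t \<in> f ` carrier (R Quot \<mm>)" "s \<ominus> t \<in> \<mm>" for s t
  proof -
    obtain C D where CD: "C \<in> carrier (R Quot \<mm>)" "D \<in> carrier (R Quot \<mm>)" "s = f C" "t = f D" using \<open>s \<in> _\<close> \<open>t \<in> _\<close> by auto
    have "\<mm> +> s = \<mm> +> t" using quotient_eq_iff_same_a_r_cos[OF m_ideal, of s t] f[OF CD(1)] f[OF CD(2)] CD that(3) by auto
    then show ?thesis using f[OF CD(1)] f[OF CD(2)] CD by metis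
  qed
  ultimately show thesis using that[of "f ` carrier (R Quot \<mm>)"] f by auto
qed

text \<open>Each prime rules out at most one c from a system of pairwise incongruent elements: if c
  and c' both fail, (c' - c) v lies in P with c' - c a unit, so v and then u lie in P. Finitely many
  primes therefore leave some c over.\<close>

lemma primes_avoid_pencil:
  assumes F: "finite F" "\<And>P. P \<in> F \<Longrightarrow> primeideal P R" and uv: "u \<in> carrier R" "v \<in> carrier R"
  obtains c where "c \<in> carrier R" "\<And>P. P \<in> F \<Longrightarrow> \<not> (u \<in> P \<and> v \<in> P) \<Longrightarrow> u \<oplus> c \<otimes> v \<notin> P"
proof -
  obtain T where T: "T \<subseteq> carrier R" "infinite T" "\<And>s t. s \<in> T \<Longrightarrow> t \<in> T \<Longrightarrow> s \<ominus> t \<in> \<mm> \<Longrightarrow> s = t"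
    using infinite_residue_system by blast
  define B where "B P = {c \<in> T. \<not> (u \<in> P \<and> v \<in> P) \<and> u \<oplus> c \<otimes> v \<in> P}" for P
  have "finite (B P)" if P: "P \<in> F" for P
  proof (cases "B P = {}")
    case False
    then obtain c where c: "c \<in> B P" by auto
    interpret P: primeideal P R by (rule F(2)[OF P])
    have "c' = c" if c': "c' \<in> B P" for c'
    proof (rule ccontr)
      assume ne: "c' \<noteq> c"
      have cc: "c \<in> carrier R" "c' \<in> carrier R" using c c' T(1) by (auto simp: B_def)
      have "c' \<ominus> c \<notin> \<mm>" using T(3) c c' ne by (auto simp: B_def)
      moreover have "(c' \<ominus> c) \<otimes> v = (u \<oplus> c' \<otimes> v) \<ominus> (u \<oplus> c \<otimes> v)" using cc uv by algebra
      then have "(c' \<ominus> c) \<otimes> v \<in> P" using c c' ideal_diff[OF P.ideal_axioms] by (auto simp: B_def)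
      ultimately have v: "v \<in> P" using unit_cancel[OF P.ideal_axioms _ _ uv(2)] cc by auto
      have "u = (u \<oplus> c \<otimes> v) \<ominus> c \<otimes> v" using cc uv by algebra
      also have "\<dots> \<in> P" using c v cc ideal_diff[OF P.ideal_axioms] P.I_l_closed by (auto simp: B_def)
      finally show False using v c by (auto simp: B_def)
    qed
    then have "B P \<subseteq> {c}" by auto
    then show ?thesis using finite_subset by auto
  qed simp
  then have "finite (\<Union>P\<in>F. B P)" using F(1) by auto
  then obtain c where "c \<in> T" "c \<notin> (\<Union>P\<in>F. B P)" using T(2) by (meson finite_subset subsetI)
  then show thesis using that[of c] T(1) by (auto simp: B_def)
qed

lemma primes_avoid_combination:
  assumes F: "finite F" "\<And>P. P \<in> F \<Longrightarrow> primeideal P R" and xs: "set xs \<subseteq> carrier R"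
  shows "\<exists>w\<in>Idl (set xs). \<forall>P\<in>F. \<not> set xs \<subseteq> P \<longrightarrow> w \<notin> P"
  using xs
proof (induction xs)
  case Nil
  have "\<zero> \<in> Idl {}" using genideal_ideal[of "{}"] ideal_zero by auto
  then show ?case by auto
next
  case (Cons x xs)
  then obtain w where w: "w \<in> Idl (set xs)" "\<And>P. P \<in> F \<Longrightarrow> \<not> set xs \<subseteq> P \<Longrightarrow> w \<notin> P" by auto
  have wc: "w \<in> carrier R" using w(1) ideal.Icarr[OF genideal_ideal] Cons.prems by auto
  have xc: "x \<in> carrier R" using Cons.prems by simp
  obtain c where c: "c \<in> carrier R" "\<And>P. P \<in> F \<Longrightarrow> \<not> (x \<in> P \<and> w \<in> P) \<Longrightarrow> x \<oplus> c \<otimes> w \<notin> P"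
    using primes_avoid_pencil[OF F xc wc] by blast
  have "x \<oplus> c \<otimes> w \<notin> P" if P: "P \<in> F" "\<not> set (x # xs) \<subseteq> P" for P
  proof (cases "set xs \<subseteq> P")
    case True
    then have "x \<notin> P" using P by auto
    then show ?thesis using c(2)[OF P(1)] by auto
  next
    case False
    then show ?thesis using c(2)[OF P(1)] w(2)[OF P(1)] by auto
  qed
  moreover have "x \<oplus> c \<otimes> w \<in> Idl (set (x # xs))"
  proof -
    note L = genideal_ideal[OF Cons.prems]
    have "Idl (set xs) \<subseteq> Idl (set (x # xs))"
      using genideal_minimal[OF L] genideal_self[OF Cons.prems] by auto
    then show ?thesis using w(1) genideal_self[OF Cons.prems] c(1)
      by (intro ideal_add[OF L] ideal.I_l_closed[OF L]) auto
  qed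
  ultimately show ?case by blast
qed

text \<open>A Steinitz exchange for regular sequences. The last member of \<open>ys\<close> is
  replaced by z = x + c w with w in the ideal of the remaining \<open>xs\<close>; moved to the
  front, z is absorbed into K, and both lists become shorter by one. If the lengths agree, the
  successive z form a regular sequence with the same ideal as \<open>xs\<close>. This bounds the
  number of generators of a reduction from below and provides regular generators for reductions with
  d generators.\<close>

theorem regseq_exchange:
  assumes "ideal K R" "K \<subseteq> \<mm>" "set ys \<subseteq> \<mm>" "set xs \<subseteq> \<mm>" "regseq K ys"
    and "\<And>e. e \<in> \<mm> \<Longrightarrow> \<exists>n::nat. e [^] n \<in> ext K (set xs)"
  shows "length ys \<le> length xs \<and> (length ys = length xs \<longrightarrow>
    (\<exists>zs. length zs = length xs \<and> set zs \<subseteq> \<mm> \<and> regseq K zs \<and> ext K (set zs) = ext K (set xs)))"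
  using assms
proof (induction xs arbitrary: K ys)
  case Nil
  have "ys = []"
  proof (cases ys)
    case (Cons y ys')
    then have y: "y \<in> \<mm>" "y \<in> carrier R" "nzd K y" using Nil m_carrier by auto
    obtain n :: nat where "y [^] n \<in> K" using Nil.prems(6)[OF y(1)] ext_empty[OF Nil.prems(1)] by auto
    then have "\<one> \<in> K" using nzd_pow[OF Nil.prems(1) y(2,3), of \<one> n] y by simp
    then show ?thesis using Nil.prems(2) one_notin_m by auto
  qed simp
  then show ?case by auto
next
  case (Cons x xs)
  note K = Cons.prems(1)
  show ?case
  proof (cases ys rule: rev_cases)
    case (snoc ys' y)
    have ys': "set ys' \<subseteq> \<mm>" "set ys' \<subseteq> carrier R" "y \<in> \<mm>" "y \<in> carrier R"
      using Cons.prems(3) snoc m_carrier by auto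
    have xs: "set xs \<subseteq> \<mm>" "x \<in> \<mm>" "set (x # xs) \<subseteq> carrier R" "x \<in> carrier R" "set xs \<subseteq> carrier R"
      using Cons.prems(4) m_carrier by auto
    let ?K = "ext K (set ys')"
    have K': "ideal ?K R" by (rule ext_ideal[OF K ys'(2)])
    have reg: "regseq K ys'" "nzd ?K y" using Cons.prems(5) snoc regseq_snoc[OF K ys'(2)] by auto
    note F = finite_max_anns[OF K'] max_anns_prime[OF K']
    \<comment> \<open>A prime ann(u) containing \<open>x\<close> and \<open>xs\<close> would contain
      a power of y, and y, being regular modulo \<open>?K\<close>, could then be cancelled to put u
      into \<open>?K\<close>.\<close>
    have notsub: "\<not> set (x # xs) \<subseteq> P" if P: "P \<in> max_anns ?K" for P
    proof
      assume sub: "set (x # xs) \<subseteq> P"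
      have Pi: "ideal P R" using F(2)[OF P] by (rule primeideal.axioms)
      obtain u where u: "u \<in> carrier R" "u \<notin> ?K" "P = ann ?K u" using P unfolding max_anns_def by auto
      have extP: "ext K (set (x # xs)) \<subseteq> P"
        using sub ann_base[OF K' u(1)] ext_base[OF K ys'(2)] u(3) by (intro ext_minimal Pi) auto
      obtain n :: nat where "y [^] n \<in> ext K (set (x # xs))" using Cons.prems(6)[OF ys'(3)] by (elim exE)
      then have "y [^] n \<in> P" by (rule subsetD[OF extP])
      then have "y [^] n \<in> ann ?K u" by (simp only: u(3))
      then have "y [^] n \<otimes> u \<in> ?K" by (simp add: ann_def)
      then have "u \<in> ?K" by (rule nzd_pow[OF K' ys'(4) reg(2) u(1)])
      then show False using u(2) by (elim notE)
    qed
    obtain w where w: "w \<in> Idl (set xs)" "\<And>P. P \<in> max_anns ?K \<Longrightarrow> \<not> set xs \<subseteq> P \<Longrightarrow> w \<notin> P"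
      using primes_avoid_combination[OF F xs(5)] by auto
    have wc: "w \<in> carrier R" using ideal.Icarr[OF genideal_ideal[OF xs(5)] w(1)] .
    obtain c where c: "c \<in> carrier R"
      "\<And>P. P \<in> max_anns ?K \<Longrightarrow> \<not> (x \<in> P \<and> w \<in> P) \<Longrightarrow> x \<oplus> c \<otimes> w \<notin> P"
      using primes_avoid_pencil[OF F xs(4) wc] by blast
    define z where "z = x \<oplus> c \<otimes> w"
    have "x \<oplus> c \<otimes> w \<notin> P" if P: "P \<in> max_anns ?K" for P
      using c(2)[OF P] w(2)[OF P] notsub[OF P] by (cases "set xs \<subseteq> P") auto
    then have nz: "nzd ?K z" unfolding z_def using xs wc c(1) by (intro nzd_if_avoids[OF K']) auto
    have cw: "c \<otimes> w \<in> Idl (set xs)" using ideal.I_l_closed[OF genideal_ideal[OF xs(5)] w(1) c(1)] .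
    have "Idl (set xs) \<subseteq> \<mm>" by (rule genideal_minimal[OF m_ideal xs(1)])
    then have z: "z \<in> \<mm>" "z \<in> carrier R" "{z} \<subseteq> carrier R"
      unfolding z_def using cw xs c wc by (auto intro: ideal_add[OF m_ideal])
    have "regseq K (z # ys')"
      using regseq_move_to_front[OF K ys'(1) z(1)] regseq_snoc[OF K ys'(2)] reg(1) nz by simp
    then have reg1: "nzd K z" "regseq (ext K {z}) ys'" by auto
    let ?K1 = "ext K {z}"
    have K1: "ideal ?K1 R" by (rule ext_ideal[OF K z(3)])
    have eq: "ext ?K1 (set xs) = ext K (set (x # xs))"
    proof -
      have e: "ext ?K1 (set xs) = ext K (insert z (set xs))" using ext_insert[OF K z(2) xs(5)] by simp
      note L = ext_ideal[OF K xs(3)]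
      have i: "insert z (set xs) \<subseteq> carrier R" using z xs by auto
      note L' = ext_ideal[OF K i]
      have s: "Idl (set xs) \<subseteq> ext K (set (x # xs))"
        using ext_gens[OF K xs(3)] by (intro genideal_minimal[OF L]) auto
      have s': "Idl (set xs) \<subseteq> ext K (insert z (set xs))"
        using ext_gens[OF K i] by (intro genideal_minimal[OF L']) auto
      have "z \<in> ext K (set (x # xs))" unfolding z_def
        using ext_gens[OF K xs(3)] s cw by (intro ideal_add[OF L]) auto
      moreover have "x = z \<ominus> c \<otimes> w" unfolding z_def using xs c wc by algebra
      then have "x \<in> ext K (insert z (set xs))"
        using ext_gens[OF K i] s' cw ideal_diff[OF L', of z "c \<otimes> w"] by auto
      ultimately show ?thesis unfolding e
        using ext_base[OF K i] ext_base[OF K xs(3)] ext_gens[OF K i] ext_gens[OF K xs(3)]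
        by (intro subset_antisym ext_minimal L L') auto
    qed
    have K1m: "?K1 \<subseteq> \<mm>" using Cons.prems(2) z by (intro ext_minimal m_ideal) auto
    have IH: "length ys' \<le> length xs \<and> (length ys' = length xs \<longrightarrow>
      (\<exists>zs. length zs = length xs \<and> set zs \<subseteq> \<mm> \<and> regseq ?K1 zs \<and> ext ?K1 (set zs) = ext ?K1 (set xs)))"
      using Cons.IH[OF K1 K1m ys'(1) xs(1) reg1(2)] Cons.prems(6) unfolding eq by blast
    show ?thesis
    proof (intro conjI impI)
      show "length ys \<le> length (x # xs)" using IH snoc by simp
      assume "length ys = length (x # xs)"
      then obtain zs where zs: "length zs = length xs" "set zs \<subseteq> \<mm>" "regseq ?K1 zs" "ext ?K1 (set zs) = ext ?K1 (set xs)"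
        using IH snoc by auto
      have "ext K (set (z # zs)) = ext K (set (x # xs))"
        using ext_insert[OF K z(2), of "set zs"] zs m_carrier eq by auto
      then show "\<exists>zs. length zs = length (x # xs) \<and> set zs \<subseteq> \<mm> \<and> regseq K zs \<and> ext K (set zs) = ext K (set (x # xs))"
        using zs z reg1(1) by (intro exI[of _ "z # zs"]) auto
    qed
  qed simp
qed

text \<open>Cohen-Macaulayness supplies a regular sequence of length dim R. If it did not generate
  an \<mm>-primary ideal, some prime strictly below \<mm> would contain it; the chain of primes
  below that one, extended by \<mm>, would have dim R + 1 inclusions. The list \<open>xs\<close>
  bounds the lengths of regular sequences, so that the supremum in \<open>depth\<close> is
  attained.\<close>

lemma CM_regular_system:
  assumes CM: "depth R \<mm> = krull_dim R"
    and xs: "set xs \<subseteq> \<mm>" "\<And>e. e \<in> \<mm> \<Longrightarrow> \<exists>n::nat. e [^] n \<in> Idl (set xs)"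
  obtains ys where "krull_dim R = enat (length ys)" "set ys \<subseteq> \<mm>" "regseq {\<zero>} ys"
    "\<And>e. e \<in> \<mm> \<Longrightarrow> \<exists>n::nat. e [^] n \<in> Idl (set ys)"
proof -
  have z: "{\<zero>} \<subseteq> \<mm>" using ideal_zero[OF m_ideal] by auto
  have reg: "regseq {\<zero>} ys" if "regular_sequence R ys" "set ys \<subseteq> \<mm>" for ys
  proof -
    have c: "set ys \<subseteq> carrier R" using that m_carrier by auto
    have "ext {\<zero>} (set (take i ys)) = Idl (set (take i ys))" for i
      using Idl_eq_ext[of "set (take i ys)"] c set_take_subset[of i ys] by auto
    then show ?thesis
      using that(1) regseq_iff_nth[OF zeroideal c] unfolding regular_sequence_def nzd_def by auto
  qed
  have bound: "length ys \<le> length xs" if "regular_sequence R ys" "set ys \<subseteq> \<mm>" for ys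
    using regseq_exchange[OF zeroideal z that(2) xs(1) reg[OF that]] xs m_carrier
      Idl_eq_ext[of "set xs"] by auto
  let ?A = "{enat (length ys) | ys. regular_sequence R ys \<and> set ys \<subseteq> \<mm>}"
  have "?A \<subseteq> enat ` {..length xs}" using bound by auto
  then have fin: "finite ?A" using finite_subset by blast
  have "Idl {} = {\<zero>}" using Idl_eq_ext[of "{}"] ext_empty[OF zeroideal] by simp
  moreover have "carrier R \<noteq> {\<zero>}" using one_notin_m z one_closed by blast
  ultimately have "regular_sequence R []" using one_notin_m z one_closed by (auto simp: regular_sequence_def)
  then have "enat (length ([]::'a list)) \<in> ?A" by force
  then have ne: "?A \<noteq> {}" by (intro notI) (simp only: empty_iff)
  have "Sup ?A \<in> ?A" using Max_in[OF fin ne] unfolding Max_Sup[OF fin ne] .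
  then obtain ys where ys: "depth R \<mm> = enat (length ys)" "regular_sequence R ys" "set ys \<subseteq> \<mm>"
    unfolding depth_def by auto
  note ry = reg[OF ys(2,3)]
  have c: "set ys \<subseteq> carrier R" using ys m_carrier by auto
  have prim: "\<exists>n::nat. e [^] n \<in> Idl (set ys)" if e: "e \<in> \<mm>" for e
  proof (rule ccontr)
    assume no: "\<not> (\<exists>n::nat. e [^] n \<in> Idl (set ys))"
    have ec: "e \<in> carrier R" using e m_carrier by auto
    let ?S = "range (\<lambda>n::nat. e [^] n)"
    obtain P where P: "primeideal P R" "Idl (set ys) \<subseteq> P" "P \<inter> ?S = {}"
    proof (rule prime_disjoint_from_multiplicative_set[OF genideal_ideal[OF c], of ?S])
      show "\<one> \<in> ?S" by (intro image_eqI[of _ _ 0]) auto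
      show "s \<otimes> t \<in> ?S" if "s \<in> ?S" "t \<in> ?S" for s t using that ec by (auto simp: nat_pow_mult)
    qed (use ec no that in auto)
    have "e [^] (1::nat) \<in> ?S" by blast
    then have "e \<notin> P" using P(3) ec by auto
    moreover have "e [^] (0::nat) \<in> ?S" by blast
    then have "\<one> \<notin> P" using P(3) by auto
    then have "P \<subseteq> \<mm>" by (rule proper_ideal_le_m[OF primeideal.axioms(1)[OF P(1)]])
    ultimately have ss: "P \<subset> \<mm>" using e by auto
    obtain Q :: "nat \<Rightarrow> 'a set" where Q: "\<forall>i\<le>length ys. primeideal (Q i) R" "\<forall>i<length ys. Q i \<subset> Q (Suc i)" "Q (length ys) = P"
      using regseq_prime_chain[OF zeroideal c ry P(1)] P(2) Idl_eq_ext[OF c] by auto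
    let ?Q = "Q(Suc (length ys) := \<mm>)"
    have "primeideal (?Q i) R" if "i \<le> Suc (length ys)" for i
      using that Q(1) m_prime by (cases "i = Suc (length ys)") auto
    moreover have "?Q i \<subset> ?Q (Suc i)" if "i < Suc (length ys)" for i
      using that Q(2,3) ss by (cases "i = length ys") auto
    ultimately have "\<exists>Q::nat \<Rightarrow> 'a set. (\<forall>i\<le>Suc (length ys). primeideal (Q i) R) \<and>
        (\<forall>i<Suc (length ys). Q i \<subset> Q (Suc i))"
      by (intro exI[of _ ?Q]) blast
    then have "enat (Suc (length ys)) \<le> krull_dim R"
      unfolding krull_dim_def by (intro Sup_upper) blast
    then have "enat (Suc (length ys)) \<le> enat (length ys)" using CM ys(1) by simp
    then show False by simp
  qed
  show thesis using that[of ys] CM ys ry prim by auto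
qed

end

section \<open>Colength\<close>

context noetherian_local
begin

text \<open>A filtration above B whose factors are quotients of R/\<mm>. Factors may vanish, so the
  number of steps bounds a length from above without having to equal it.\<close>

primrec steps :: "'a set \<Rightarrow> 'a list \<Rightarrow> bool" where
  "steps B [] = True"
| "steps B (u # us) = ((\<forall>e\<in>\<mm>. e \<otimes> u \<in> B) \<and> steps (ext B {u}) us)"

text \<open>\<open>R / B\<close> has length at most \<open>L\<close>: each of \<open>L\<close> steps adjoins an element killed by \<open>\<mm>\<close>.\<close>

definition colength_le :: "'a set \<Rightarrow> nat \<Rightarrow> bool" where
  "colength_le B L \<longleftrightarrow> (\<exists>us. length us = L \<and> set us \<subseteq> carrier R \<and> steps B us \<and> ext B (set us) = carrier R)"

lemma steps_append:
  assumes "ideal B R" "set us \<subseteq> carrier R"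
  shows "steps B (us @ vs) \<longleftrightarrow> steps B us \<and> steps (ext B (set us)) vs"
  using assms
proof (induction us arbitrary: B)
  case (Cons u us)
  then show ?case using ext_insert[of B u "set us"] ext_ideal[of B "{u}"] by auto
qed (simp add: ext_empty)

lemma mult_ext_subset:
  assumes B: "ideal B R" "ideal B' R" and c: "S \<subseteq> carrier R" "t \<in> carrier R"
    and tB: "\<And>b. b \<in> B \<Longrightarrow> t \<otimes> b \<in> B'" and x: "x \<in> ext B S"
  shows "t \<otimes> x \<in> ext B' ((\<otimes>) t ` S)"
proof -
  have tS: "(\<otimes>) t ` S \<subseteq> carrier R" using c by auto
  let ?C = "{x \<in> carrier R. \<forall>s\<in>{t}. x \<otimes> s \<in> ext B' ((\<otimes>) t ` S)}"
  have m: "x \<otimes> t = t \<otimes> x" if "x \<in> B \<union> S" for x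
    using that c ideal_subset[OF B(1)] by (intro m_comm) auto
  have "ext B S \<subseteq> ?C"
  proof (rule ext_minimal[OF ideal_colon[OF ext_ideal[OF B(2) tS]]])
    show "B \<subseteq> ?C" using m tB ext_base[OF B(2) tS] ideal_subset[OF B(1)] by auto
    show "S \<subseteq> ?C" using m ext_gens[OF B(2) tS] c by auto
  qed (use c in auto)
  then have "x \<otimes> t \<in> ext B' ((\<otimes>) t ` S)" using x by auto
  moreover have "x \<in> carrier R" using x ideal.Icarr[OF ext_ideal[OF B(1) c(1)]] by auto
  ultimately show ?thesis using c(2) m_comm by metis
qed

lemma steps_mult:
  assumes "ideal B R" "ideal B' R" "set us \<subseteq> carrier R" "t \<in> carrier R"
    and "\<And>b. b \<in> B \<Longrightarrow> t \<otimes> b \<in> B'" and "steps B us"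
  shows "steps B' (map ((\<otimes>) t) us)"
  using assms
proof (induction us arbitrary: B B')
  case (Cons u us)
  have c: "u \<in> carrier R" "{u} \<subseteq> carrier R" "{t \<otimes> u} \<subseteq> carrier R" using Cons.prems by auto
  have "e \<otimes> (t \<otimes> u) \<in> B'" if "e \<in> \<mm>" for e
  proof -
    have "e \<otimes> (t \<otimes> u) = t \<otimes> (e \<otimes> u)" using that m_carrier c Cons.prems by (auto intro: m_lcomm)
    then show ?thesis using Cons.prems that by auto
  qed
  moreover have "steps (ext B' {t \<otimes> u}) (map ((\<otimes>) t) us)"
    using Cons.prems mult_ext_subset[OF Cons.prems(1,2) c(2) Cons.prems(4,5)]
    by (intro Cons.IH[of "ext B {u}"] ext_ideal c) auto
  ultimately show ?case by simp
qed simp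

lemma steps_mono:
  assumes "ideal B R" "ideal B' R" "set us \<subseteq> carrier R" "B \<subseteq> B'" "steps B us"
  shows "steps B' us"
  using assms
proof (induction us arbitrary: B B')
  case (Cons u us)
  have c: "{u} \<subseteq> carrier R" using Cons.prems by auto
  have us: "set us \<subseteq> carrier R" and st: "steps (ext B {u}) us"
    and e: "\<And>e. e \<in> \<mm> \<Longrightarrow> e \<otimes> u \<in> B" using Cons.prems(3,5) by simp_all
  have "ext B {u} \<subseteq> ext B' {u}" by (rule ext_mono[OF Cons.prems(2) c Cons.prems(4)]) simp
  then have "steps (ext B' {u}) us"
    by (rule Cons.IH[OF ext_ideal[OF Cons.prems(1) c] ext_ideal[OF Cons.prems(2) c] us _ st])
  then show ?case using e Cons.prems(4) by (simp add: subset_iff)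
qed simp

lemma colength_le_mono:
  assumes "ideal B R" "ideal B' R" "B \<subseteq> B'" "colength_le B L"
  shows "colength_le B' L"
proof -
  obtain us where us: "length us = L" "set us \<subseteq> carrier R" "steps B us" "ext B (set us) = carrier R"
    using assms(4) unfolding colength_le_def by auto
  have "ext B' (set us) = carrier R"
    using ext_mono[OF assms(2) us(2) assms(3), of "set us"] us(4) ideal_subset[OF ext_ideal[OF assms(2) us(2)]] by auto
  then show ?thesis unfolding colength_le_def
    using us steps_mono[OF assms(1,2) us(2) assms(3) us(3)] by blast
qed

text \<open>R/(K, y^N) is filtered by the powers of y, and each of the N factors is the image of
  R/(K, y) under multiplication by a power of y.\<close>

lemma colength_le_power:
  assumes K: "ideal K R" and y: "y \<in> carrier R" and L: "colength_le (ext K {y}) L"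
  shows "colength_le (ext K {y [^] (N::nat)}) (N * L)"
proof (induction N)
  case 0
  have c: "{\<one>} \<subseteq> carrier R" by simp
  have "ext K {\<one>} = carrier R"
    using ideal.one_imp_carrier[OF ext_ideal[OF K c]] ext_gens[OF K c] by auto
  moreover have "ext (carrier R) {} = carrier R" by (rule ext_empty[OF oneideal])
  ultimately show ?case unfolding colength_le_def by auto
next
  case (Suc N)
  let ?t = "y [^] N" and ?t' = "y [^] Suc N"
  have c: "{?t} \<subseteq> carrier R" "{?t'} \<subseteq> carrier R" "{y} \<subseteq> carrier R" "?t \<in> carrier R" "?t' \<in> carrier R" using y by auto
  obtain us where us: "length us = L" "set us \<subseteq> carrier R" "steps (ext K {y}) us" "ext (ext K {y}) (set us) = carrier R"
    using L unfolding colength_le_def by auto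
  obtain vs where vs: "length vs = N * L" "set vs \<subseteq> carrier R" "steps (ext K {?t}) vs" "ext (ext K {?t}) (set vs) = carrier R"
    using Suc unfolding colength_le_def by auto
  let ?B = "ext K {y}" and ?B' = "ext K {?t'}"
  have B: "ideal ?B R" "ideal ?B' R" "ideal (ext K {?t}) R" using ext_ideal[OF K] c by auto
  have tB: "?t \<otimes> b \<in> ?B'" if b: "b \<in> ?B" for b
  proof -
    obtain k r where k: "k \<in> K" "r \<in> carrier R" "b = k \<oplus> r \<otimes> y" using ext_singletonE[OF K y b] by metis
    have kc: "k \<in> carrier R" using ideal.Icarr[OF K k(1)] .
    have "?t \<otimes> b = ?t \<otimes> k \<oplus> r \<otimes> ?t'" unfolding k(3) using k(2) kc y c(4) by (simp add: r_distr m_lcomm)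
    then show ?thesis using ext_singletonI[OF K c(5) ideal.I_l_closed[OF K k(1) c(4)] k(2)] by simp
  qed
  have tus: "(\<otimes>) ?t ` set us \<subseteq> carrier R" using us c by auto
  have st: "steps ?B' (map ((\<otimes>) ?t) us)" by (rule steps_mult[OF B(1,2) us(2) c(4) tB us(3)])
  have eq: "ext ?B' ((\<otimes>) ?t ` set us) = ext K {?t}"
  proof
    have "s \<otimes> ?t \<in> ext K {?t}" if "s \<in> carrier R" for s
      using ext_gens[OF K c(1)] ideal.I_l_closed[OF B(3) _ that] by auto
    then have s: "?t \<otimes> s \<in> ext K {?t}" if "s \<in> carrier R" for s using that c(4) m_comm by metis
    have "?t' = ?t \<otimes> y" using y by simp
    then show "ext ?B' ((\<otimes>) ?t ` set us) \<subseteq> ext K {?t}"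
      using s y us(2) ext_base[OF K c(1)] by (intro ext_minimal B) auto
    have "?t \<otimes> \<one> \<in> ext ?B' ((\<otimes>) ?t ` set us)"
      by (rule mult_ext_subset[OF B(1,2) us(2) c(4)]) (use tB us(4) in auto)
    then show "ext K {?t} \<subseteq> ext ?B' ((\<otimes>) ?t ` set us)"
      using ext_base[OF B(2) tus] ext_base[OF K c(2)] c(4) by (intro ext_minimal ext_ideal B tus) auto
  qed
  let ?ws = "map ((\<otimes>) ?t) us @ vs"
  have "steps ?B' ?ws" using steps_append[OF B(2), of "map ((\<otimes>) ?t) us" vs] st tus eq vs by simp
  moreover have "ext ?B' (set ?ws) = carrier R"
    using ext_ext[OF B(2) tus vs(2)] eq vs(4) by simp
  ultimately show ?case unfolding colength_le_def
    using us vs tus by (intro exI[of _ ?ws]) auto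
qed

text \<open>The generators are raised to powers one after the other, each contributing a factor N.
  This growth is what limits the number of analytically independent elements later.\<close>

lemma colength_le_powers:
  assumes "ideal K R" "set ys \<subseteq> carrier R" "colength_le (ext K (set ys)) L"
  shows "colength_le (ext K ((\<lambda>y. y [^] (N::nat)) ` set ys)) (N ^ length ys * L)"
  using assms
proof (induction ys arbitrary: K L)
  case (Cons y ys)
  note K = Cons.prems(1)
  have c: "y \<in> carrier R" "set ys \<subseteq> carrier R" "y [^] N \<in> carrier R" "{y [^] N} \<subseteq> carrier R" using Cons.prems by auto
  have c': "(\<lambda>y. y [^] N) ` set ys \<subseteq> carrier R" using c by auto
  have "colength_le (ext (ext K (set ys)) {y}) L" using Cons.prems ext_insert'[OF K c(1,2)] by simp
  from colength_le_power[OF ext_ideal[OF K c(2)] c(1) this, of N]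
  have "colength_le (ext (ext K {y [^] N}) (set ys)) (N * L)"
    using ext_insert'[OF K c(3,2)] ext_insert[OF K c(3,2)] by simp
  from Cons.IH[OF ext_ideal[OF K c(4)] c(2) this]
  show ?case using ext_insert[OF K c(3) c'] by (simp add: ac_simps)
qed simp

text \<open>A stand-in for the length of C/B: \<phi> C is the number of steps of a fixed filtration
  F of R/B in which C meets F_{i+1} outside F_i. If C \<subset> C' had the same such steps, C'
  \<inter> F_i would lie in C for all i by induction, and so C' = C.\<close>

lemma steps_rank:
  assumes B: "ideal B R" and L: "colength_le B L"
  obtains \<phi> :: "'a set \<Rightarrow> nat" where "\<And>C. \<phi> C \<le> L"
    "\<And>C C'. ideal C R \<Longrightarrow> ideal C' R \<Longrightarrow> B \<subseteq> C \<Longrightarrow> C \<subset> C' \<Longrightarrow> \<phi> C < \<phi> C'"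
proof -
  obtain us where us: "length us = L" "set us \<subseteq> carrier R" "steps B us" "ext B (set us) = carrier R"
    using L unfolding colength_le_def by auto
  define F where "F i = ext B (set (take i us))" for i
  have tc: "set (take i us) \<subseteq> carrier R" for i using us(2) set_take_subset[of i us] by auto
  have F: "ideal (F i) R" for i unfolding F_def by (rule ext_ideal[OF B tc])
  have step: "F (Suc i) = ext (F i) {us ! i}" "us ! i \<in> carrier R" "\<And>e. e \<in> \<mm> \<Longrightarrow> e \<otimes> us ! i \<in> F i"
    if i: "i < L" for i
  proof -
    have t: "take (Suc i) us = take i us @ [us ! i]" using i us(1) by (simp add: take_Suc_conv_app_nth)
    show uc: "us ! i \<in> carrier R" using i us by auto
    show "F (Suc i) = ext (F i) {us ! i}" unfolding F_def t using ext_insert'[OF B uc tc] by simp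
    have "steps B (take (Suc i) us @ drop (Suc i) us)" using us(3) by simp
    then have "steps B (take i us @ [us ! i])" using steps_append[OF B tc] t by metis
    then show "\<And>e. e \<in> \<mm> \<Longrightarrow> e \<otimes> us ! i \<in> F i" using steps_append[OF B tc] unfolding F_def by auto
  qed
  define J where "J C = {i. i < L \<and> \<not> C \<inter> F (Suc i) \<subseteq> F i}" for C
  show thesis
  proof (rule that[of "\<lambda>C. card (J C)"])
    fix C
    have "J C \<subseteq> {..<L}" by (auto simp: J_def)
    then show "card (J C) \<le> L" using card_mono[of "{..<L}" "J C"] by simp
  next
    fix C C' assume C: "ideal C R" "ideal C' R" "B \<subseteq> C" "C \<subset> C'"
    have "J C \<subseteq> J C'" using C(4) by (auto simp: J_def)
    moreover have "J C \<noteq> J C'"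
    proof
      assume eq: "J C = J C'"
      have "C' \<inter> F i \<subseteq> C" if "i \<le> L" for i
        using that
      proof (induction i)
        case 0
        then show ?case using C(3) ext_empty[OF B] by (auto simp: F_def)
      next
        case (Suc i)
        then have iL: "i < L" and IH: "C' \<inter> F i \<subseteq> C" by auto
        note st = step[OF iL]
        show ?case
        proof
          fix x assume x: "x \<in> C' \<inter> F (Suc i)"
          show "x \<in> C"
          proof (cases "C' \<inter> F (Suc i) \<subseteq> F i")
            case True
            then show ?thesis using x IH by auto
          next
            case False
            then have "i \<in> J C" using eq iL by (simp add: J_def)
            then obtain c where c: "c \<in> C" "c \<in> F (Suc i)" "c \<notin> F i" by (auto simp: J_def)
            obtain b r where br: "b \<in> F i" "r \<in> carrier R" "c = b \<oplus> r \<otimes> us ! i"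
              using ext_singletonE[OF F st(2), of c i] c st(1) by metis
            obtain b' s where bs: "b' \<in> F i" "s \<in> carrier R" "x = b' \<oplus> s \<otimes> us ! i"
              using ext_singletonE[OF F st(2), of x i] x st(1) by (metis IntD2)
            have bc: "b \<in> carrier R" "b' \<in> carrier R" using ideal.Icarr[OF F] br bs by auto
            \<comment> \<open>Since c lies outside F_i, its coefficient at the new element is a
              unit, so a multiple of c cancels that coefficient in x and brings the difference down
              to F_i.\<close>
            have "r \<notin> \<mm>" using st(3)[of r] ideal_add[OF F br(1)] br(3) c(3) by auto
            then obtain r' where r': "r' \<in> carrier R" "r' \<otimes> r = \<one>" using unit_notin_m br(2) by blast
            have cc: "c \<in> carrier R" using ideal.Icarr[OF C(1)] c by auto
            have "x \<ominus> (s \<otimes> r') \<otimes> c = b' \<oplus> s \<otimes> us ! i \<ominus> ((s \<otimes> r') \<otimes> b \<oplus> s \<otimes> (r' \<otimes> r) \<otimes> us ! i)"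
              unfolding bs(3) br(3) using bs(2) br(2) r'(1) bc st(2) by algebra
            also have "\<dots> = b' \<ominus> (s \<otimes> r') \<otimes> b"
              unfolding r'(2) using bs(2) br(2) r'(1) bc st(2) by algebra
            finally have e: "x \<ominus> (s \<otimes> r') \<otimes> c = b' \<ominus> (s \<otimes> r') \<otimes> b" .
            have src: "s \<otimes> r' \<in> carrier R" using bs r' by simp
            have scC: "(s \<otimes> r') \<otimes> c \<in> C" using ideal.I_l_closed[OF C(1) c(1) src] .
            have "x \<ominus> (s \<otimes> r') \<otimes> c \<in> C'" using x scC C(4) by (intro ideal_diff[OF C(2)]) auto
            moreover have "x \<ominus> (s \<otimes> r') \<otimes> c \<in> F i" unfolding e
              using ideal_diff[OF F bs(1) ideal.I_l_closed[OF F br(1) src]] .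
            ultimately have "x \<ominus> (s \<otimes> r') \<otimes> c \<in> C" using IH by auto
            moreover have "x = (x \<ominus> (s \<otimes> r') \<otimes> c) \<oplus> (s \<otimes> r') \<otimes> c"
              unfolding bs(3) using bs bc st(2) cc r' by algebra
            ultimately show ?thesis using ideal_add[OF C(1) _ scC] by metis
          qed
        qed
      qed
      from this[of L] have "C' \<inter> carrier R \<subseteq> C" using us by (simp add: F_def)
      then show False using C(4) ideal_subset[OF C(2)] by auto
    qed
    ultimately have "J C \<subset> J C'" by auto
    moreover have "finite (J C')" by (simp add: J_def)
    ultimately show "card (J C) < card (J C')" by (rule psubset_card_mono[rotated])
  qed
qed

lemma ideal_power_closed:
  assumes "ideal L R" "x \<in> carrier R" "x [^] (n::nat) \<in> L" "n \<le> k"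
  shows "x [^] k \<in> L"
proof -
  have "x [^] k = x [^] (k - n) \<otimes> x [^] n" using assms by (simp add: nat_pow_mult)
  then show ?thesis using ideal.I_l_closed[OF assms(1,3), of "x [^] (k - n)"] assms(2) by simp
qed

lemma common_exponent:
  assumes "ideal L R" "finite S" "S \<subseteq> carrier R" "\<And>x. x \<in> S \<Longrightarrow> \<exists>n::nat. x [^] n \<in> L"
  obtains k :: nat where "\<And>x. x \<in> S \<Longrightarrow> x [^] k \<in> L" "k > 0"
proof -
  have "\<exists>k>0. \<forall>x\<in>S. x [^] (k::nat) \<in> L"
    using assms(2-4)
  proof (induction S rule: finite_induct)
    case empty
    then show ?case by (intro exI[of _ 1]) auto
  next
    case (insert x S)
    then obtain k where k: "k > 0" "\<forall>x\<in>S. x [^] (k::nat) \<in> L" by auto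
    obtain n :: nat where n: "x [^] n \<in> L" using insert.prems by auto
    have "\<forall>z\<in>insert x S. z [^] (k + n) \<in> L"
      using k n insert.prems(1) ideal_power_closed[OF assms(1), of _ k "k + n"]
        ideal_power_closed[OF assms(1), of x n "k + n"] by auto
    then show ?case using k by (intro exI[of _ "k + n"]) auto
  qed
  then show thesis using that by auto
qed

lemma m_finite_generators:
  obtains es where "set es \<subseteq> carrier R" "\<mm> = Idl (set es)"
proof -
  obtain E where "E \<subseteq> carrier R" "finite E" "\<mm> = Idl E" using finetely_gen[OF m_ideal] by auto
  then show thesis using that finite_list[of E] by auto
qed

text \<open>A common power of the finitely many generators of \<mm> lies in B, and R/\<mm> has
  length one; raising the generators to that power gives a finite bound.\<close>

lemma m_primary_colength_finite:
  assumes B: "ideal B R" "\<And>e. e \<in> \<mm> \<Longrightarrow> \<exists>n::nat. e [^] n \<in> B"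
  obtains L where "colength_le B L"
proof -
  obtain es where es: "set es \<subseteq> carrier R" "\<mm> = Idl (set es)" using m_finite_generators .
  have em: "set es \<subseteq> \<mm>" using es genideal_self[OF es(1)] by auto
  obtain k :: nat where k: "\<And>x. x \<in> set es \<Longrightarrow> x [^] k \<in> B"
    by (rule common_exponent[OF B(1) finite_set es(1)]) (use em B in auto)
  have "ext \<mm> {\<one>} = carrier R"
    using ideal.one_imp_carrier[OF ext_ideal[OF m_ideal]] ext_gens[OF m_ideal, of "{\<one>}"] by auto
  then have "colength_le \<mm> 1"
    unfolding colength_le_def using m_carrier by (intro exI[of _ "[\<one>]"]) (auto simp: subset_iff)
  then have "colength_le (ext {\<zero>} (set es)) 1" using es Idl_eq_ext by simp
  from colength_le_powers[OF zeroideal es(1) this, of k]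
  have cl: "colength_le (ext {\<zero>} ((\<lambda>y. y [^] k) ` set es)) (k ^ length es)" by simp
  have "(\<lambda>y. y [^] k) ` set es \<subseteq> carrier R" using es by auto
  from ext_ideal[OF zeroideal this] have "colength_le B (k ^ length es)"
    by (rule colength_le_mono[OF _ B(1) _ cl]) (rule ext_minimal[OF B(1)], use k ideal_zero[OF B(1)] in auto)
  then show thesis by (rule that)
qed

end

section \<open>Forms in the generators of an ideal\<close>

context cring
begin

lemma minus_eqI: "x \<in> carrier R \<Longrightarrow> y \<in> carrier R \<Longrightarrow> x = d \<oplus> y \<Longrightarrow> d \<in> carrier R \<Longrightarrow> x \<ominus> y = d"
  by algebra

lemma finsum_diff:
  assumes "f \<in> A \<rightarrow> carrier R" "g \<in> A \<rightarrow> carrier R"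
  shows "(\<Oplus>t\<in>A. f t) \<ominus> (\<Oplus>t\<in>A. g t) = (\<Oplus>t\<in>A. f t \<ominus> g t)"
proof -
  have fc: "f t \<in> carrier R" and gc: "g t \<in> carrier R" if "t \<in> A" for t using assms that by auto
  have "(\<Oplus>t\<in>A. f t) = (\<Oplus>t\<in>A. (f t \<ominus> g t) \<oplus> g t)"
  proof (rule finsum_cong'[OF refl])
    fix t assume "t \<in> A"
    then show "f t = (f t \<ominus> g t) \<oplus> g t" using fc[of t] gc[of t] by algebra
  qed (use fc gc in auto)
  also have "\<dots> = (\<Oplus>t\<in>A. f t \<ominus> g t) \<oplus> (\<Oplus>t\<in>A. g t)"
    by (rule finsum_addf) (use fc gc in auto)
  finally show ?thesis
    by (rule minus_eqI[rotated 2]) (use fc gc in \<open>auto intro!: finsum_closed\<close>)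
qed

section \<open>One-variable polynomials as coefficient lists, constant term first\<close>

primrec horner :: "'a list \<Rightarrow> 'a \<Rightarrow> 'a" where
  "horner [] b = \<zero>"
| "horner (c # cs) b = c \<oplus> b \<otimes> horner cs b"

lemma horner_closed [simp]: "set cs \<subseteq> carrier R \<Longrightarrow> b \<in> carrier R \<Longrightarrow> horner cs b \<in> carrier R"
  by (induction cs) auto

lemma horner_in_ideal: "ideal L R \<Longrightarrow> set cs \<subseteq> L \<Longrightarrow> b \<in> carrier R \<Longrightarrow> horner cs b \<in> L"
  by (induction cs) (auto simp: ideal_zero ideal.I_l_closed ideal_add)

lemma horner_smult:
  "set cs \<subseteq> carrier R \<Longrightarrow> b \<in> carrier R \<Longrightarrow> k \<in> carrier R \<Longrightarrow>
    horner (map ((\<otimes>) k) cs) b = k \<otimes> horner cs b"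
  by (induction cs) (auto simp: r_distr m_lcomm)

lemma horner_snoc:
  "set cs \<subseteq> carrier R \<Longrightarrow> c \<in> carrier R \<Longrightarrow> b \<in> carrier R \<Longrightarrow>
    horner (cs @ [c]) b = horner cs b \<oplus> b [^] length cs \<otimes> c"
  by (induction cs) (auto simp: r_distr m_assoc a_assoc m_comm m_lcomm)

lemma horner_finsum:
  assumes "b \<in> carrier R"
  shows "f \<in> {..<n} \<rightarrow> carrier R \<Longrightarrow> horner (map f [0..<n]) b = (\<Oplus>t\<in>{..<n}. b [^] t \<otimes> f t)"
proof (induction n)
  case (Suc n)
  have f: "f t \<in> carrier R" if "t \<le> n" for t using Suc.prems that by auto
  have "horner (map f [0..<Suc n]) b = (\<Oplus>t\<in>{..<n}. b [^] t \<otimes> f t) \<oplus> b [^] n \<otimes> f n"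
    using Suc.IH f horner_snoc[of "map f [0..<n]" "f n" b] assms
    by (auto simp: image_subset_iff)
  moreover have "(\<Oplus>t\<in>{..<Suc n}. b [^] t \<otimes> f t) = b [^] n \<otimes> f n \<oplus> (\<Oplus>t\<in>{..<n}. b [^] t \<otimes> f t)"
    unfolding lessThan_Suc using f assms by (intro finsum_insert) auto
  moreover have "(\<Oplus>t\<in>{..<n}. b [^] t \<otimes> f t) \<in> carrier R" using f assms by (auto intro!: finsum_closed)
  ultimately show ?case using f[of n] assms by (simp add: a_comm)
qed simp

lemma horner_add_smult:
  assumes "set xs \<subseteq> carrier R" "set ys \<subseteq> carrier R" "k \<in> carrier R"
  shows "\<exists>qs. set qs \<subseteq> carrier R \<and> length qs = max (length xs) (length ys) \<and>
    (\<forall>b\<in>carrier R. horner qs b = horner xs b \<oplus> k \<otimes> horner ys b)"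
  using assms(1,2)
proof (induction xs arbitrary: ys)
  case Nil
  then show ?case using assms(3)
    by (intro exI[of _ "map ((\<otimes>) k) ys"]) (auto simp: horner_smult)
next
  case (Cons x xs)
  show ?case
  proof (cases ys)
    case Nil
    then show ?thesis using Cons.prems assms(3) by (intro exI[of _ "x # xs"]) auto
  next
    case ys: (Cons y ys')
    obtain qs where qs: "set qs \<subseteq> carrier R" "length qs = max (length xs) (length ys')"
      "\<forall>b\<in>carrier R. horner qs b = horner xs b \<oplus> k \<otimes> horner ys' b"
      using Cons.IH[of ys'] Cons.prems ys by auto
    have c: "x \<in> carrier R" "y \<in> carrier R" "set xs \<subseteq> carrier R" "set ys' \<subseteq> carrier R"
      using Cons.prems ys by auto
    have "horner ((x \<oplus> k \<otimes> y) # qs) b = horner (x # xs) b \<oplus> k \<otimes> horner ys b" if b: "b \<in> carrier R" for b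
    proof -
      have h: "horner xs b \<in> carrier R" "horner ys' b \<in> carrier R" using c b by auto
      have "(x \<oplus> k \<otimes> y) \<oplus> b \<otimes> (u \<oplus> k \<otimes> v) = (x \<oplus> b \<otimes> u) \<oplus> k \<otimes> (y \<oplus> b \<otimes> v)"
        if "u \<in> carrier R" "v \<in> carrier R" for u v
        using that b c(1,2) assms(3) by algebra
      from this[OF h] show ?thesis unfolding ys horner.simps bspec[OF qs(3) b] .
    qed
    then show ?thesis using qs(1,2) ys c assms(3) by (intro exI[of _ "(x \<oplus> k \<otimes> y) # qs"]) auto
  qed
qed

lemma horner_divide_step:
  assumes "c \<in> carrier R" "b \<in> carrier R" "b0 \<in> carrier R" "h \<in> carrier R" "q \<in> carrier R"
  shows "c \<oplus> b \<otimes> (h \<oplus> (b \<ominus> b0) \<otimes> q) = c \<oplus> b0 \<otimes> h \<oplus> (b \<ominus> b0) \<otimes> (h \<oplus> (b \<ominus> b0) \<otimes> q \<oplus> b0 \<otimes> q)"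
  using assms by algebra

text \<open>Division by the linear factor b - b0. The quotient has one coefficient fewer, which is
  the measure for the induction on zeros.\<close>

lemma horner_divide:
  assumes "set cs \<subseteq> carrier R" "b0 \<in> carrier R"
  shows "\<exists>qs. set qs \<subseteq> carrier R \<and> length qs = length cs - 1 \<and>
    (\<forall>b\<in>carrier R. horner cs b = horner cs b0 \<oplus> (b \<ominus> b0) \<otimes> horner qs b)"
  using assms(1)
proof (induction cs)
  case Nil
  then show ?case using assms(2) by (intro exI[of _ "[]"]) auto
next
  case (Cons c cs)
  then obtain qs where qs: "set qs \<subseteq> carrier R" "length qs = length cs - 1"
    "\<forall>b\<in>carrier R. horner cs b = horner cs b0 \<oplus> (b \<ominus> b0) \<otimes> horner qs b" by auto
  have c: "c \<in> carrier R" "set cs \<subseteq> carrier R" using Cons.prems by auto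
  obtain qs' where qs': "set qs' \<subseteq> carrier R" "length qs' = max (length cs) (length qs)"
    "\<forall>b\<in>carrier R. horner qs' b = horner cs b \<oplus> b0 \<otimes> horner qs b"
    using horner_add_smult[OF c(2) qs(1) assms(2)] by auto
  have "horner (c # cs) b = horner (c # cs) b0 \<oplus> (b \<ominus> b0) \<otimes> horner qs' b" if b: "b \<in> carrier R" for b
  proof -
    have h: "horner cs b0 \<in> carrier R" "horner qs b \<in> carrier R" using c qs(1) b assms(2) by auto
    note e = bspec[OF qs(3) b]
    have "horner qs' b = (horner cs b0 \<oplus> (b \<ominus> b0) \<otimes> horner qs b) \<oplus> b0 \<otimes> horner qs b"
      using bspec[OF qs'(3) b] unfolding e .
    then show ?thesis
      unfolding horner.simps e using horner_divide_step[OF c(1) b assms(2) h] by simp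
  qed
  then show ?case using qs' qs(2) by (intro exI[of _ qs']) auto
qed

text \<open>A polynomial with all exponents below \<open>n\<close> is given by its coefficients, indexed by lists of exponents.\<close>

primrec mpoly_eval :: "nat \<Rightarrow> (nat list \<Rightarrow> 'a) \<Rightarrow> 'a list \<Rightarrow> 'a" where
  "mpoly_eval n c [] = c []"
| "mpoly_eval n c (x # xs) = (\<Oplus>t\<in>{..<n}. x [^] t \<otimes> mpoly_eval n (\<lambda>e. c (t # e)) xs)"

lemma mpoly_eval_closed [simp]:
  "set xs \<subseteq> carrier R \<Longrightarrow> (\<And>e. c e \<in> carrier R) \<Longrightarrow> mpoly_eval n c xs \<in> carrier R"
  by (induction xs arbitrary: c) (auto intro!: finsum_closed)

lemma mpoly_eval_add:
  "set xs \<subseteq> carrier R \<Longrightarrow> (\<And>e. c e \<in> carrier R) \<Longrightarrow> (\<And>e. c' e \<in> carrier R) \<Longrightarrow>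
    mpoly_eval n (\<lambda>e. c e \<oplus> c' e) xs = mpoly_eval n c xs \<oplus> mpoly_eval n c' xs"
proof (induction xs arbitrary: c c')
  case (Cons x xs)
  have x: "x \<in> carrier R" "set xs \<subseteq> carrier R" using Cons.prems by auto
  have "mpoly_eval n (\<lambda>e. c e \<oplus> c' e) (x # xs) =
    (\<Oplus>t\<in>{..<n}. x [^] t \<otimes> mpoly_eval n (\<lambda>e. c (t # e)) xs \<oplus> x [^] t \<otimes> mpoly_eval n (\<lambda>e. c' (t # e)) xs)"
    using Cons.IH[OF x(2)] Cons.prems x by (simp add: r_distr)
  also have "\<dots> = mpoly_eval n c (x # xs) \<oplus> mpoly_eval n c' (x # xs)"
    using Cons.prems x by (subst finsum_addf) auto
  finally show ?case .
qed simp

lemma mpoly_eval_smult: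
  "set xs \<subseteq> carrier R \<Longrightarrow> (\<And>e. c e \<in> carrier R) \<Longrightarrow> k \<in> carrier R \<Longrightarrow>
    mpoly_eval n (\<lambda>e. k \<otimes> c e) xs = k \<otimes> mpoly_eval n c xs"
proof (induction xs arbitrary: c)
  case (Cons x xs)
  have x: "x \<in> carrier R" "set xs \<subseteq> carrier R" using Cons.prems by auto
  have "mpoly_eval n (\<lambda>e. k \<otimes> c e) (x # xs) = (\<Oplus>t\<in>{..<n}. k \<otimes> (x [^] t \<otimes> mpoly_eval n (\<lambda>e. c (t # e)) xs))"
    using Cons.IH[OF x(2)] Cons.prems x by (simp add: m_lcomm)
  also have "\<dots> = k \<otimes> mpoly_eval n c (x # xs)"
    using Cons.prems x by (simp add: finsum_rdistr)
  finally show ?case .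
qed simp

lemma mpoly_eval_zero:
  "set xs \<subseteq> carrier R \<Longrightarrow> (\<And>e. c e = \<zero>) \<Longrightarrow> mpoly_eval n c xs = \<zero>"
proof -
  assume "set xs \<subseteq> carrier R" "\<And>e. c e = \<zero>"
  then have "c = (\<lambda>_. \<zero>)" "mpoly_eval n (\<lambda>_. \<zero>) xs = \<zero>"
    using mpoly_eval_smult[of xs "\<lambda>_. \<zero>" \<zero> n] by auto
  then show ?thesis by simp
qed

lemma mpoly_eval_in_pow:
  assumes I: "ideal I R"
  shows "set xs \<subseteq> I \<Longrightarrow> (\<And>e. c e \<in> carrier R) \<Longrightarrow> (\<And>e. c e \<noteq> \<zero> \<Longrightarrow> r \<le> sum_list e) \<Longrightarrow>
    mpoly_eval n c xs \<in> ideal_pow R I r"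
proof (induction xs arbitrary: c r)
  case Nil
  show ?case
  proof (cases "c [] = \<zero>")
    case True
    then show ?thesis using ideal_zero[OF ideal_pow_ideal[OF I]] by simp
  next
    case False
    then have "r = 0" using Nil.prems(3)[of "[]"] by simp
    then show ?thesis using Nil.prems by simp
  qed
next
  case (Cons x xs)
  have x: "x \<in> I" "set xs \<subseteq> I" using Cons.prems by auto
  have "x [^] t \<otimes> mpoly_eval n (\<lambda>e. c (t # e)) xs \<in> ideal_pow R I r" for t
  proof -
    \<comment> \<open>Truncated subtraction is harmless: for t > r the factor x^t alone already lies
      in the r-th power.\<close>
    have "r - t \<le> sum_list e" if "c (t # e) \<noteq> \<zero>" for e using Cons.prems(3)[OF that] by simp
    then have "mpoly_eval n (\<lambda>e. c (t # e)) xs \<in> ideal_pow R I (r - t)"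
      using Cons.IH[OF x(2), of "\<lambda>e. c (t # e)" "r - t"] Cons.prems(2) by blast
    then have "x [^] t \<otimes> mpoly_eval n (\<lambda>e. c (t # e)) xs \<in> ideal_pow R I (t + (r - t))"
      by (rule ideal_pow_mult[OF I ideal_pow_nat_pow[OF I x(1)]])
    then show ?thesis by (rule subsetD[OF ideal_pow_antimono[OF I], rotated]) simp
  qed
  then show ?case by (simp add: ideal_finsum[OF ideal_pow_ideal[OF I]])
qed

text \<open>The convention at \<open>0\<close> reflects \<open>J H\<^sup>r\<^sup>-\<^sup>1\<close> being the degree \<open>r\<close> part of the ideal generated by \<open>J\<close>.\<close>

definition graded_prod :: "'a set \<Rightarrow> 'a set \<Rightarrow> nat \<Rightarrow> 'a set" where
  "graded_prod J H r = (case r of 0 \<Rightarrow> {\<zero>} | Suc q \<Rightarrow> J \<cdot> ideal_pow R H q)"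

lemma graded_prod_ideal: "ideal J R \<Longrightarrow> ideal H R \<Longrightarrow> ideal (graded_prod J H r) R"
  by (cases r) (auto simp: graded_prod_def zeroideal ideal_prod_is_ideal ideal_pow_ideal)

lemma graded_prod_mult:
  assumes "ideal J R" "ideal H R" "u \<in> graded_prod J H r" "v \<in> ideal_pow R H t"
  shows "u \<otimes> v \<in> graded_prod J H (r + t)"
proof (cases r)
  case 0
  have "v \<in> carrier R" using assms(4) ideal.Icarr[OF ideal_pow_ideal[OF assms(2)]] by simp
  then have "u \<otimes> v = \<zero>" using assms(3) 0 by (simp add: graded_prod_def)
  then show ?thesis using ideal_zero[OF graded_prod_ideal[OF assms(1,2)]] by simp
next
  case (Suc q)
  have "u \<otimes> v \<in> (J \<cdot> ideal_pow R H q) \<cdot> ideal_pow R H t"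
    using assms(3,4) Suc by (auto simp: graded_prod_def intro: ideal_prod.prod)
  then show ?thesis
    using Suc assms(1,2) by (simp add: graded_prod_def ideal_prod_assoc ideal_pow_ideal ideal_pow_add)
qed

text \<open>Modulo J every x is a multiple b y, so a form of degree r takes the value F(b) y^r up to
  an error in the ideal generated by J. Homogeneity keeps track of the degree of the error, which
  has to land in J H^(r-1) and not merely in J.\<close>

lemma mpoly_eval_homogeneous_shift:
  assumes J: "ideal J R" and H: "ideal H R" and y: "y \<in> H"
  shows "list_all2 (\<lambda>x b. x \<in> H \<and> b \<in> carrier R \<and> x \<ominus> b \<otimes> y \<in> J) xs bs \<Longrightarrow>
    (\<And>e. c e \<in> carrier R) \<Longrightarrow> (\<And>e. c e \<noteq> \<zero> \<Longrightarrow> sum_list e = r) \<Longrightarrow>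
    mpoly_eval n c xs \<ominus> mpoly_eval n c bs \<otimes> y [^] r \<in> graded_prod J H r"
proof (induction xs bs arbitrary: c r rule: list_all2_induct)
  case Nil
  note L = graded_prod_ideal[OF J H, of r]
  show ?case
  proof (cases "c [] = \<zero>")
    case True
    then show ?thesis using ideal_zero[OF L] ideal.Icarr[OF H y] by (simp add: a_minus_def)
  next
    case False
    then have "r = 0" using Nil(2)[of "[]"] by simp
    then show ?thesis using Nil(1)[of "[]"] ideal_zero[OF L] by (simp add: a_minus_def r_neg)
  qed
next
  case (Cons x xs b bs)
  note L = graded_prod_ideal[OF J H, of r]
  have yc: "y \<in> carrier R" using ideal.Icarr[OF H y] .
  have x: "x \<in> H" "b \<in> carrier R" "x \<ominus> b \<otimes> y \<in> J" "x \<in> carrier R"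
    using Cons(1) ideal.Icarr[OF H] by auto
  have "set xs \<subseteq> H" "set bs \<subseteq> carrier R"
    using Cons(2) by (auto simp: list_all2_conv_all_nth in_set_conv_nth)
  then have xs: "set xs \<subseteq> H" "set xs \<subseteq> carrier R" "set bs \<subseteq> carrier R" using ideal_subset[OF H] by auto
  have pow: "x [^] t \<ominus> b [^] t \<otimes> y [^] t \<in> graded_prod J H t" for t :: nat
  proof (induction t)
    case 0
    show ?case by (simp add: graded_prod_def a_minus_def r_neg)
  next
    case (Suc t)
    note L' = graded_prod_ideal[OF J H, of "Suc t"]
    have c: "x [^] t \<in> carrier R" "b [^] t \<in> carrier R" "y [^] t \<in> carrier R" using x yc by auto
    have "p \<otimes> x \<ominus> (q \<otimes> b) \<otimes> (s \<otimes> y) = (x \<ominus> b \<otimes> y) \<otimes> p \<oplus> (p \<ominus> q \<otimes> s) \<otimes> (b \<otimes> y)"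
      if "p \<in> carrier R" "q \<in> carrier R" "s \<in> carrier R" for p q s
      using that x(2,4) yc by algebra
    from this[OF c] have "x [^] Suc t \<ominus> b [^] Suc t \<otimes> y [^] Suc t =
      (x \<ominus> b \<otimes> y) \<otimes> x [^] t \<oplus> (x [^] t \<ominus> b [^] t \<otimes> y [^] t) \<otimes> (b \<otimes> y)"
      by simp
    moreover have "(x \<ominus> b \<otimes> y) \<otimes> x [^] t \<in> graded_prod J H (Suc t)"
      using ideal_prod.prod[OF x(3) ideal_pow_nat_pow[OF H x(1)]] by (simp add: graded_prod_def)
    moreover have "b \<otimes> y \<in> ideal_pow R H 1"
      using ideal.I_l_closed[OF H y x(2)] ideal_pow_1[OF H] by simp
    then have "(x [^] t \<ominus> b [^] t \<otimes> y [^] t) \<otimes> (b \<otimes> y) \<in> graded_prod J H (Suc t)"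
      using graded_prod_mult[OF J H Suc.IH, of "b \<otimes> y" 1] by simp
    ultimately show ?case using ideal_add[OF L'] by simp
  qed
  let ?E = "\<lambda>t. mpoly_eval n (\<lambda>e. c (t # e)) xs" and ?F = "\<lambda>t. mpoly_eval n (\<lambda>e. c (t # e)) bs"
  have c: "?E t \<in> carrier R" "?F t \<in> carrier R" for t using xs Cons.prems by auto
  have summand: "x [^] t \<otimes> ?E t \<ominus> b [^] t \<otimes> ?F t \<otimes> y [^] r \<in> graded_prod J H r" for t
  proof (cases "t \<le> r")
    case True
    have cc: "x [^] t \<in> carrier R" "b [^] t \<in> carrier R" "y [^] t \<in> carrier R" "y [^] (r - t) \<in> carrier R" using x yc by auto
    have yr: "y [^] r = y [^] t \<otimes> y [^] (r - t)" using True yc by (simp add: nat_pow_mult)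
    have "sum_list e = r - t" if "c (t # e) \<noteq> \<zero>" for e using Cons.prems(2)[OF that] by simp
    then have IH: "?E t \<ominus> ?F t \<otimes> y [^] (r - t) \<in> graded_prod J H (r - t)"
      using Cons.IH[of "\<lambda>e. c (t # e)" "r - t"] Cons.prems(1) by blast
    have "p \<otimes> u \<ominus> q \<otimes> v \<otimes> (s \<otimes> s') = (u \<ominus> v \<otimes> s') \<otimes> p \<oplus> (p \<ominus> q \<otimes> s) \<otimes> (v \<otimes> s')"
      if "p \<in> carrier R" "q \<in> carrier R" "s \<in> carrier R" "s' \<in> carrier R" "u \<in> carrier R" "v \<in> carrier R"
      for p q s s' u v
      using that by algebra
    from this[OF cc c] have "x [^] t \<otimes> ?E t \<ominus> b [^] t \<otimes> ?F t \<otimes> y [^] r =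
      (?E t \<ominus> ?F t \<otimes> y [^] (r - t)) \<otimes> x [^] t \<oplus> (x [^] t \<ominus> b [^] t \<otimes> y [^] t) \<otimes> (?F t \<otimes> y [^] (r - t))"
      unfolding yr .
    moreover have "(?E t \<ominus> ?F t \<otimes> y [^] (r - t)) \<otimes> x [^] t \<in> graded_prod J H (r - t + t)"
      by (rule graded_prod_mult[OF J H IH ideal_pow_nat_pow[OF H x(1)]])
    moreover have "(x [^] t \<ominus> b [^] t \<otimes> y [^] t) \<otimes> (?F t \<otimes> y [^] (r - t)) \<in> graded_prod J H (t + (r - t))"
      by (rule graded_prod_mult[OF J H pow ideal.I_l_closed[OF ideal_pow_ideal[OF H] ideal_pow_nat_pow[OF H y] c(2)]])
    ultimately show ?thesis using True ideal_add[OF L] by simp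
  next
    case False
    then have z: "c (t # e) = \<zero>" for e using Cons.prems(2)[of "t # e"] by auto
    have "?E t = \<zero>" "?F t = \<zero>" using mpoly_eval_zero[OF xs(2) z] mpoly_eval_zero[OF xs(3) z] by auto
    then show ?thesis using x yc ideal_zero[OF L] by (simp add: a_minus_def)
  qed
  have "mpoly_eval n c (x # xs) \<ominus> mpoly_eval n c (b # bs) \<otimes> y [^] r =
    (\<Oplus>t\<in>{..<n}. x [^] t \<otimes> ?E t) \<ominus> (\<Oplus>t\<in>{..<n}. b [^] t \<otimes> ?F t \<otimes> y [^] r)"
    using x c yc by (simp add: finsum_ldistr)
  also have "\<dots> = (\<Oplus>t\<in>{..<n}. x [^] t \<otimes> ?E t \<ominus> b [^] t \<otimes> ?F t \<otimes> y [^] r)"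
    using x c yc by (intro finsum_diff) auto
  also have "\<dots> \<in> graded_prod J H r" by (rule ideal_finsum[OF L summand])
  finally show ?case .
qed

lemma reduction_pow:
  assumes "ideal I R" "ideal H R" "ideal_pow R I (Suc q) = H \<cdot> ideal_pow R I q"
  shows "ideal_pow R I (j + q) = ideal_pow R H j \<cdot> ideal_pow R I q"
proof (induction j)
  case 0
  show ?case using ideal_prod_commute[OF oneideal ideal_pow_ideal[OF assms(1)]]
    by (simp add: ideal_prod_one ideal_pow_ideal assms(1))
next
  case (Suc j)
  note i = ideal_pow_ideal[OF assms(1)] ideal_pow_ideal[OF assms(2)]
  have "ideal_pow R I (Suc j + q) = I \<cdot> (ideal_pow R H j \<cdot> ideal_pow R I q)" using Suc by simp
  also have "\<dots> = ideal_pow R H j \<cdot> (I \<cdot> ideal_pow R I q)"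
    using ideal_prod_assoc[OF assms(1) i(2) i(1)] ideal_prod_commute[OF assms(1) i(2)]
      ideal_prod_assoc[OF i(2) assms(1) i(1)] by metis
  also have "\<dots> = ideal_pow R H j \<cdot> (H \<cdot> ideal_pow R I q)" using assms(3) by simp
  also have "\<dots> = ideal_pow R H (Suc j) \<cdot> ideal_pow R I q"
    using ideal_prod_assoc[OF i(2) assms(2) i(1)] ideal_prod_commute[OF assms(2) i(2)] by simp
  finally show ?case .
qed

end

section \<open>Zeros of polynomials modulo \<mm>\<close>

context noetherian_local
begin

definition incongruent :: "'a set \<Rightarrow> bool" where
  "incongruent T \<longleftrightarrow> T \<subseteq> carrier R \<and> (\<forall>s\<in>T. \<forall>t\<in>T. s \<ominus> t \<in> \<mm> \<longrightarrow> s = t)"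

text \<open>A polynomial over a field with infinitely many zeros vanishes, here stated for
  representatives. Dividing by b - b0 gives a quotient with values in \<mm> on T without b0, so its
  coefficients lie in \<mm> by induction and the polynomial has all its values in \<mm>. The value
  at 0 gives the constant term, and outside \<mm> the factor b can be cancelled.\<close>

lemma horner_coeffs_in_m:
  assumes "incongruent T" "infinite T" "set cs \<subseteq> carrier R" "\<And>b. b \<in> T \<Longrightarrow> horner cs b \<in> \<mm>"
  shows "set cs \<subseteq> \<mm>"
  using assms
proof (induction "length cs" arbitrary: cs T)
  case (Suc len)
  then obtain c cs' where cs: "cs = c # cs'" "length cs' = len" by (cases cs) auto
  have c: "c \<in> carrier R" "set cs' \<subseteq> carrier R" using Suc.prems cs by auto
  have T: "T \<subseteq> carrier R" "\<And>s t. s \<in> T \<Longrightarrow> t \<in> T \<Longrightarrow> s \<ominus> t \<in> \<mm> \<Longrightarrow> s = t"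
    using Suc.prems(1) by (auto simp: incongruent_def)
  obtain b0 where b0: "b0 \<in> T" using infinite_imp_nonempty[OF Suc.prems(2)] by auto
  have b0c: "b0 \<in> carrier R" using b0 T by auto
  obtain qs where qs: "set qs \<subseteq> carrier R" "length qs = length cs - 1"
    "\<forall>b\<in>carrier R. horner cs b = horner cs b0 \<oplus> (b \<ominus> b0) \<otimes> horner qs b"
    using horner_divide[OF Suc.prems(3) b0c] by auto
  have "horner qs b \<in> \<mm>" if b: "b \<in> T - {b0}" for b
  proof -
    have bc: "b \<in> carrier R" using b T by auto
    have q: "horner qs b \<in> carrier R" using qs(1) bc by auto
    have "horner cs b0 \<oplus> (b \<ominus> b0) \<otimes> horner qs b \<in> \<mm>"
      using Suc.prems(4)[of b] b unfolding bspec[OF qs(3) bc] by simp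
    then have "(b \<ominus> b0) \<otimes> horner qs b \<in> \<mm>"
      using ideal_add_cancel_left[OF m_ideal Suc.prems(4)[OF b0]] bc q b0c by simp
    moreover have "b \<ominus> b0 \<notin> \<mm>" using T(2)[of b b0] b b0 by auto
    ultimately show ?thesis using unit_cancel[OF m_ideal _ _ q] bc b0c by auto
  qed
  moreover have "incongruent (T - {b0})" "infinite (T - {b0})"
    using Suc.prems(1,2) by (auto simp: incongruent_def)
  ultimately have qm: "set qs \<subseteq> \<mm>" using Suc.hyps(1)[of qs "T - {b0}"] qs(1,2) cs by auto
  have all: "horner cs b \<in> \<mm>" if b: "b \<in> carrier R" for b
  proof -
    have "(b \<ominus> b0) \<otimes> horner qs b \<in> \<mm>"
      using ideal.I_l_closed[OF m_ideal horner_in_ideal[OF m_ideal qm b]] b b0c by auto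
    then show ?thesis unfolding bspec[OF qs(3) b] by (rule ideal_add[OF m_ideal Suc.prems(4)[OF b0]])
  qed
  have cm: "c \<in> \<mm>" using all[of \<zero>] c by (simp add: cs(1))
  \<comment> \<open>At most one element of T lies in \<mm>, so infinitely many points remain at
    which b is a unit.\<close>
  let ?T = "T - \<mm>"
  have "T \<inter> \<mm> \<subseteq> {x}" if "x \<in> T \<inter> \<mm>" for x using that T(2) ideal_diff[OF m_ideal] by auto
  then have "finite (T \<inter> \<mm>)"
    by (cases "T \<inter> \<mm> = {}") (use finite_subset[of "T \<inter> \<mm>" "{_}"] in blast)+
  then have "infinite ?T" using Suc.prems(2) Diff_infinite_finite[of "T \<inter> \<mm>" T] by (simp add: Diff_Int)
  moreover have "incongruent ?T" using Suc.prems(1) by (auto simp: incongruent_def)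
  moreover have "horner cs' b \<in> \<mm>" if b: "b \<in> ?T" for b
  proof -
    have bc: "b \<in> carrier R" using b T by auto
    have "b \<otimes> horner cs' b \<in> \<mm>"
      using ideal_add_cancel_left[OF m_ideal cm, of "b \<otimes> horner cs' b"] all[OF bc] c bc by (simp add: cs(1))
    then show ?thesis using unit_cancel[OF m_ideal bc _ horner_closed[OF c(2) bc]] b by auto
  qed
  ultimately have "set cs' \<subseteq> \<mm>" using Suc.hyps(1)[of cs' ?T] cs c by auto
  then show ?case using cm cs by auto
qed simp

end

context noetherian_local_inf
begin

lemma ex_incongruent:
  obtains T where "incongruent T" "infinite T"
  using infinite_residue_system unfolding incongruent_def by metis

lemma mpoly_coeffs_in_m:
  assumes "\<And>e. c e \<in> carrier R"
    and "\<And>bs. set bs \<subseteq> carrier R \<Longrightarrow> length bs = s \<Longrightarrow> mpoly_eval n c bs \<in> \<mm>"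
    and "length e = s" "set e \<subseteq> {..<n}"
  shows "c e \<in> \<mm>"
  using assms
proof (induction s arbitrary: c e)
  case 0
  then show ?case using "0.prems"(2)[of "[]"] by auto
next
  case (Suc s)
  obtain t e' where e: "e = t # e'" "length e' = s" "t < n" "set e' \<subseteq> {..<n}"
    using Suc.prems(3,4) by (cases e) auto
  obtain T where T: "incongruent T" "infinite T" using ex_incongruent .
  have "mpoly_eval n (\<lambda>e. c (t # e)) bs \<in> \<mm>" if bs: "set bs \<subseteq> carrier R" "length bs = s" for bs
  proof -
    let ?f = "\<lambda>t. mpoly_eval n (\<lambda>e. c (t # e)) bs"
    have f: "?f \<in> {..<n} \<rightarrow> carrier R" using bs Suc.prems(1) by auto
    have "horner (map ?f [0..<n]) b \<in> \<mm>" if "b \<in> T" for b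
    proof -
      have b: "b \<in> carrier R" using \<open>b \<in> T\<close> T(1) by (auto simp: incongruent_def)
      show ?thesis using Suc.prems(2)[of "b # bs"] bs b horner_finsum[OF b f] by simp
    qed
    then have "set (map ?f [0..<n]) \<subseteq> \<mm>"
      using f by (intro horner_coeffs_in_m[OF T]) auto
    then show ?thesis using e(3) by auto
  qed
  then show ?case using Suc.IH[of "\<lambda>e. c (t # e)" e'] Suc.prems(1) e by auto
qed

end

section \<open>Reductions generated by \<open>dim R\<close> elements\<close>

context noetherian_local
begin

lemma ext_pow_step:
  assumes J: "ideal J R" and H: "ideal H R" and y: "y \<in> H" and HJ: "H \<subseteq> ext J {y}"
  shows "ideal_pow R H (Suc j) \<subseteq> ext (J \<cdot> ideal_pow R H j) {y [^] Suc j}"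
proof (induction j)
  case 0
  have "y \<in> carrier R" using ideal.Icarr[OF H y] .
  then show ?case using HJ J H by (simp add: ideal_prod_one)
next
  case (Suc j)
  have yc: "y \<in> carrier R" using ideal.Icarr[OF H y] .
  note Hp = ideal_pow_ideal[OF H]
  have B: "ideal (J \<cdot> ideal_pow R H j) R" "ideal (J \<cdot> ideal_pow R H (Suc j)) R"
    by (rule ideal_prod_is_ideal[OF J Hp])+
  have c: "y [^] Suc j \<in> carrier R" "y [^] Suc (Suc j) \<in> carrier R" "{y [^] Suc (Suc j)} \<subseteq> carrier R"
    using yc by (auto simp del: nat_pow_Suc)
  let ?L = "ext (J \<cdot> ideal_pow R H (Suc j)) {y [^] Suc (Suc j)}"
  have L: "ideal ?L R" using ext_ideal[OF B(2) c(3)] .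
  note base = ext_base[OF B(2) c(3)]
  have "h \<otimes> z \<in> ?L" if h: "h \<in> H" and z: "z \<in> ideal_pow R H (Suc j)" for h z
  proof -
    obtain k r where k: "k \<in> J" "r \<in> carrier R" "h = k \<oplus> r \<otimes> y"
      using ext_singletonE[OF J yc subsetD[OF HJ h]] by metis
    obtain k' r' where k': "k' \<in> J \<cdot> ideal_pow R H j" "r' \<in> carrier R" "z = k' \<oplus> r' \<otimes> y [^] Suc j"
      using ext_singletonE[OF B(1) c(1) subsetD[OF Suc.IH z]] by metis
    have kc: "k \<in> carrier R" "k' \<in> carrier R" "z \<in> carrier R"
      using ideal.Icarr[OF J k(1)] ideal.Icarr[OF B(1) k'(1)] ideal.Icarr[OF Hp z] by auto
    have "h \<otimes> z = k \<otimes> z \<oplus> (r \<otimes> (y \<otimes> k') \<oplus> (r \<otimes> r') \<otimes> (y \<otimes> y [^] Suc j))"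
    proof -
      have "(k \<oplus> r \<otimes> y) \<otimes> (k' \<oplus> r' \<otimes> p) = k \<otimes> (k' \<oplus> r' \<otimes> p) \<oplus> (r \<otimes> (y \<otimes> k') \<oplus> (r \<otimes> r') \<otimes> (y \<otimes> p))"
        if "p \<in> carrier R" for p using that kc k(2) k'(2) yc by algebra
      from this[OF c(1)] show ?thesis unfolding k(3) k'(3) .
    qed
    moreover have "k \<otimes> z \<in> ?L" using base ideal_prod.prod[OF k(1) z] by auto
    moreover have "y \<otimes> k' \<in> H \<cdot> (J \<cdot> ideal_pow R H j)" by (rule ideal_prod.prod[OF y k'(1)])
    then have "y \<otimes> k' \<in> J \<cdot> ideal_pow R H (Suc j)"
      using ideal_prod_assoc[OF H J Hp] ideal_prod_assoc[OF J H Hp] ideal_prod_commute[OF H J] by simp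
    then have "r \<otimes> (y \<otimes> k') \<in> ?L" using base ideal.I_l_closed[OF L _ k(2)] by auto
    moreover have "y \<otimes> y [^] Suc j = y [^] Suc (Suc j)" using yc by (simp add: m_comm)
    then have "(r \<otimes> r') \<otimes> (y \<otimes> y [^] Suc j) \<in> ?L"
      using ext_gens[OF B(2) c(3)] ideal.I_l_closed[OF L _ m_closed[OF k(2) k'(2)]] by auto
    ultimately show ?thesis using ideal_add[OF L] by simp
  qed
  then show ?case using ideal_prod_minimal[OF L, of H "ideal_pow R H (Suc j)"] by simp
qed

text \<open>Modulo J H^r every element of H^(r+1) is a multiple of y^(r+1), so the relation carries
  over to H^(r+1) itself. Multiplying with I^q, where q is a reduction exponent of H, turns it into
  I^(r+q+1) \<subseteq> J I^(r+q) + \<mm> I^(r+q+1), and Nakayama removes the last term.\<close>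

lemma reduction_drop_generator:
  assumes I: "ideal I R" and red: "reduction R H I" and J: "ideal J R" "J \<subseteq> H"
    and y: "y \<in> H" "H \<subseteq> ext J {y}"
    and rel: "y [^] Suc r \<in> ext (\<mm> \<cdot> ideal_pow R I (Suc r)) (J \<cdot> ideal_pow R H r)"
  shows "reduction R J I"
proof -
  obtain q where H: "ideal H R" "H \<subseteq> I" and q: "ideal_pow R I (Suc q) = H \<cdot> ideal_pow R I q"
    using red unfolding reduction_def by auto
  note Hp = ideal_pow_ideal[OF H(1)] and Ip = ideal_pow_ideal[OF I]
  let ?n = "r + q"
  let ?N = "ideal_pow R I (Suc ?n)" and ?B = "J \<cdot> ideal_pow R I ?n"
  have i: "ideal (\<mm> \<cdot> ideal_pow R I (Suc r)) R" "ideal (J \<cdot> ideal_pow R H r) R" "ideal ?B R" "ideal (\<mm> \<cdot> ?N) R"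
    by (intro ideal_prod_is_ideal m_ideal J(1) Hp Ip)+
  let ?E = "ext (\<mm> \<cdot> ideal_pow R I (Suc r)) (J \<cdot> ideal_pow R H r)"
  have E: "ideal ?E R" using ext_ideal[OF i(1) ideal_subset[OF i(2)]] .
  have "ideal_pow R H (Suc r) \<subseteq> ext (J \<cdot> ideal_pow R H r) {y [^] Suc r}"
    by (rule ext_pow_step[OF J(1) H(1) y])
  also have "\<dots> \<subseteq> ?E"
    using ext_gens[OF i(1) ideal_subset[OF i(2)]] rel by (intro ext_minimal[OF E]) auto
  finally have HE: "ideal_pow R H (Suc r) \<subseteq> ?E" .
  let ?F = "ext ?B (\<mm> \<cdot> ?N)"
  have F: "ideal ?F R" using ext_ideal[OF i(3) ideal_subset[OF i(4)]] .
  have mult: "z \<otimes> w \<in> ?F" if z: "z \<in> ?E" and w: "w \<in> ideal_pow R I q" for z w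
  proof -
    obtain u v where uv: "u \<in> \<mm> \<cdot> ideal_pow R I (Suc r)" "v \<in> J \<cdot> ideal_pow R H r" "z = u \<oplus> v"
      using ext_idealE[OF i(1,2) z] by metis
    have c: "u \<in> carrier R" "v \<in> carrier R" "w \<in> carrier R"
      using ideal.Icarr[OF i(1) uv(1)] ideal.Icarr[OF i(2) uv(2)] ideal.Icarr[OF Ip w] by auto
    have "u \<otimes> w \<in> (\<mm> \<cdot> ideal_pow R I (Suc r)) \<cdot> ideal_pow R I q" by (rule ideal_prod.prod[OF uv(1) w])
    also have "\<dots> = \<mm> \<cdot> ?N"
      using ideal_prod_assoc[OF m_ideal Ip Ip] ideal_pow_add[OF I, of "Suc r" q] by (simp del: ideal_pow.simps)
    finally have 1: "u \<otimes> w \<in> ?F" using ext_gens[OF i(3) ideal_subset[OF i(4)]] by auto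
    have "v \<otimes> w \<in> (J \<cdot> ideal_pow R H r) \<cdot> ideal_pow R I q" by (rule ideal_prod.prod[OF uv(2) w])
    also have "\<dots> = J \<cdot> (ideal_pow R H r \<cdot> ideal_pow R I q)" by (rule ideal_prod_assoc[OF J(1) Hp Ip])
    also have "\<dots> \<subseteq> ?B"
      using ideal_prod_mono[OF subset_refl[of J], of "ideal_pow R H r \<cdot> ideal_pow R I q" "ideal_pow R I r \<cdot> ideal_pow R I q"]
        ideal_prod_mono[OF ideal_pow_mono[OF H(2)] subset_refl] ideal_pow_add[OF I, of r q] by auto
    finally have 2: "v \<otimes> w \<in> ?F" using ext_base[OF i(3) ideal_subset[OF i(4)]] by auto
    show ?thesis unfolding uv(3) using l_distr[OF c] ideal_add[OF F 1 2] by simp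
  qed
  have "?N = ideal_pow R H (Suc r) \<cdot> ideal_pow R I q"
    using reduction_pow[OF I H(1) q, of "Suc r"] by simp
  also have "\<dots> \<subseteq> ?F"
    using HE mult by (intro ideal_prod_minimal[OF F]) auto
  finally have "?N \<subseteq> ?B" by (rule nakayama[OF Ip i(3)])
  moreover have "?B \<subseteq> ?N" using J(2) H(2) ideal_prod_mono[of J I "ideal_pow R I ?n" "ideal_pow R I ?n"] by auto
  ultimately have "ideal_pow R I (Suc ?n) = J \<cdot> ideal_pow R I ?n" by auto
  then show ?thesis unfolding reduction_def using J H(2) by blast
qed

text \<open>These are the ideals compared in the counting argument below: monomials with exponent
  lists in S and arbitrary coefficients from R, over a base ideal.\<close>

lemma mpoly_span_ideal:
  assumes I: "ideal I R" and xs: "set xs \<subseteq> carrier R"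
  shows "ideal {i \<oplus> mpoly_eval n c xs | i c. i \<in> I \<and> (\<forall>e. c e \<in> carrier R) \<and> (\<forall>e. e \<notin> S \<longrightarrow> c e = \<zero>)} R"
    (is "ideal ?C R")
proof -
  have C: "i \<oplus> mpoly_eval n c xs \<in> ?C" if "i \<in> I" "\<And>e. c e \<in> carrier R" "\<And>e. e \<notin> S \<Longrightarrow> c e = \<zero>" for i c
    using that by blast
  have sub: "?C \<subseteq> carrier R" using xs ideal.Icarr[OF I] by auto
  have lm: "k \<otimes> z \<in> ?C" if k: "k \<in> carrier R" and z: "z \<in> ?C" for k z
  proof -
    obtain i c where ic: "i \<in> I" "\<And>e. c e \<in> carrier R" "\<And>e. e \<notin> S \<Longrightarrow> c e = \<zero>" "z = i \<oplus> mpoly_eval n c xs"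
      using z by auto
    have "k \<otimes> z = k \<otimes> i \<oplus> mpoly_eval n (\<lambda>e. k \<otimes> c e) xs"
      unfolding ic(4) using mpoly_eval_smult[OF xs ic(2) k] k ic(2) xs ideal.Icarr[OF I ic(1)] by (simp add: r_distr)
    also have "\<dots> \<in> ?C" using ic k by (intro C ideal.I_l_closed[OF I]) auto
    finally show ?thesis .
  qed
  have ad: "z \<oplus> z' \<in> ?C" if "z \<in> ?C" "z' \<in> ?C" for z z'
  proof -
    obtain i c where ic: "i \<in> I" "\<And>e. c e \<in> carrier R" "\<And>e. e \<notin> S \<Longrightarrow> c e = \<zero>" "z = i \<oplus> mpoly_eval n c xs"
      using \<open>z \<in> ?C\<close> by auto
    obtain i' c' where ic': "i' \<in> I" "\<And>e. c' e \<in> carrier R" "\<And>e. e \<notin> S \<Longrightarrow> c' e = \<zero>" "z' = i' \<oplus> mpoly_eval n c' xs"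
      using \<open>z' \<in> ?C\<close> by auto
    have car: "i \<in> carrier R" "i' \<in> carrier R" "mpoly_eval n c xs \<in> carrier R" "mpoly_eval n c' xs \<in> carrier R"
      using ideal.Icarr[OF I] ic ic' xs by auto
    have "z \<oplus> z' = (i \<oplus> i') \<oplus> mpoly_eval n (\<lambda>e. c e \<oplus> c' e) xs"
      unfolding ic(4) ic'(4) mpoly_eval_add[OF xs ic(2) ic'(2)] using car by (simp add: a_ac)
    also have "\<dots> \<in> ?C" using ic ic' by (intro C ideal_add[OF I]) auto
    finally show ?thesis .
  qed
  show ?thesis
  proof (rule idealI[OF ring_axioms])
    show "subgroup ?C (add_monoid R)"
    proof (rule add.subgroupI[OF sub])
      have "\<zero> \<oplus> mpoly_eval n (\<lambda>_. \<zero>) xs \<in> ?C" by (rule C) (auto simp: ideal_zero[OF I])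
      then show "?C \<noteq> {}" by blast
      show "\<ominus> z \<in> ?C" if "z \<in> ?C" for z
      proof -
        have "\<ominus> z = (\<ominus> \<one>) \<otimes> z" using subsetD[OF sub that] by (simp add: l_minus)
        then show ?thesis using lm[OF _ that, of "\<ominus> \<one>"] by simp
      qed
    qed (rule ad)
    show "x \<otimes> z \<in> ?C" if "z \<in> ?C" "x \<in> carrier R" for z x using lm that by blast
    show "z \<otimes> x \<in> ?C" if "z \<in> ?C" "x \<in> carrier R" for z x
      using lm[OF that(2,1)] m_comm[OF subsetD[OF sub that(1)] that(2)] by simp
  qed
qed

end

context noetherian_local_inf
begin

text \<open>If the generators \<open>xs\<close> of a reduction are analytically dependent, a linear change of
  coordinates turns the relation into an integral equation for one of them over the others.\<close>

lemma reduction_fewer_generators: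
  assumes I: "ideal I R" "I \<subseteq> \<mm>" and xs: "set xs \<subseteq> carrier R" and red: "reduction R (Idl (set xs)) I"
    and c: "\<And>e. c e \<in> carrier R" "\<And>e. c e \<noteq> \<zero> \<Longrightarrow> sum_list e = r"
    and rel: "mpoly_eval n c xs \<in> \<mm> \<cdot> ideal_pow R I r"
    and e: "length e = length xs" "set e \<subseteq> {..<n}" "c e \<notin> \<mm>"
  obtains A where "finite A" "A \<subseteq> carrier R" "card A < length xs" "Idl A \<subseteq> Idl (set xs)" "reduction R (Idl A) I"
proof -
  let ?H = "Idl (set xs)" and ?s = "length xs"
  note H = genideal_ideal[OF xs]
  have xH: "set xs \<subseteq> ?H" by (rule genideal_self[OF xs])
  \<comment> \<open>Over the infinite residue field the nonzero form given by \<open>c\<close> has a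
    nonzero value; \<open>bs\<close> lifts such a point.\<close>
  have "\<exists>bs. set bs \<subseteq> carrier R \<and> length bs = ?s \<and> mpoly_eval n c bs \<notin> \<mm>"
  proof (rule ccontr)
    assume "\<not> ?thesis"
    then have "mpoly_eval n c bs \<in> \<mm>" if "set bs \<subseteq> carrier R" "length bs = ?s" for bs
      using that by simp
    then have "c e \<in> \<mm>" by (rule mpoly_coeffs_in_m[OF c(1) _ e(1,2)])
    then show False using e(3) by simp
  qed
  then obtain bs where bs: "set bs \<subseteq> carrier R" "length bs = ?s" "mpoly_eval n c bs \<notin> \<mm>"
    by (elim exE conjE)
  show thesis
  proof (cases r)
    case 0
    \<comment> \<open>Degree zero means a constant: with y = 0 the error ideal of the shift is zero,
      so the values at \<open>xs\<close> and \<open>bs\<close> agree, although one lies in \<mm> and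
      the other does not.\<close>
    have "list_all2 (\<lambda>x b. x \<in> ?H \<and> b \<in> carrier R \<and> x \<ominus> b \<otimes> \<zero> \<in> ?H) xs bs"
      using bs xH xs by (auto simp: list_all2_conv_all_nth subset_iff a_minus_def)
    from mpoly_eval_homogeneous_shift[OF H H ideal_zero[OF H] this c(1), where r = r]
    have "mpoly_eval n c xs \<ominus> mpoly_eval n c bs = \<zero>"
      using c bs 0 by (simp add: graded_prod_def)
    then have "mpoly_eval n c xs = mpoly_eval n c bs" using c bs xs by (simp add: r_right_minus_eq)
    moreover have "mpoly_eval n c xs \<in> \<mm>" using rel 0 by (simp add: ideal_prod_one m_ideal)
    ultimately show ?thesis using bs by simp
  next
    case (Suc r')
    \<comment> \<open>A form of positive degree has no constant term, so a unit value requires a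
      unit among the arguments.\<close>
    have "\<not> set bs \<subseteq> \<mm>"
    proof
      assume "set bs \<subseteq> \<mm>"
      have le: "r \<le> sum_list e" if "c e \<noteq> \<zero>" for e using c(2)[OF that] by simp
      have "mpoly_eval n c bs \<in> ideal_pow R \<mm> r"
        by (rule mpoly_eval_in_pow[OF m_ideal \<open>set bs \<subseteq> \<mm>\<close> c(1) le])
      moreover have "ideal_pow R \<mm> r \<subseteq> \<mm>"
        using ideal_pow_antimono[OF m_ideal, of "Suc 0" r] Suc unfolding ideal_pow_1[OF m_ideal] by simp
      ultimately show False using bs(3) by (simp add: subset_iff)
    qed
    then obtain p where p: "p < ?s" "bs ! p \<notin> \<mm>" using bs(2) by (auto simp: subset_iff in_set_conv_nth)
    have bp: "bs ! p \<in> carrier R" using bs p by auto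
    obtain u where u: "u \<in> carrier R" "u \<otimes> bs ! p = \<one>" using unit_notin_m[OF bp p(2)] by blast
    have xp: "xs ! p \<in> ?H" "xs ! p \<in> carrier R" using p xH xs by auto
    \<comment> \<open>This is x_p / b_p. Subtracting b_i y from each x_i makes the p-th difference
      vanish, so H is generated by y and the other differences; modulo these the form becomes a unit
      times y^r.\<close>
    define y where "y = u \<otimes> xs ! p"
    have y: "y \<in> ?H" "y \<in> carrier R" using ideal.I_l_closed[OF H xp(1) u(1)] u xp by (auto simp: y_def)
    define g where "g i = xs ! i \<ominus> bs ! i \<otimes> y" for i
    have nthc: "xs ! i \<in> carrier R" "bs ! i \<in> carrier R" "xs ! i \<in> ?H" if "i < ?s" for i
      using that xs bs(1,2) xH by auto
    have gc: "g i \<in> carrier R" "g i \<in> ?H" if "i < ?s" for i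
      using nthc[OF that] y ideal_diff[OF H nthc(3)[OF that] ideal.I_l_closed[OF H y(1) nthc(2)[OF that]]]
      by (auto simp: g_def)
    define A where "A = g ` ({..<?s} - {p})"
    have A: "A \<subseteq> carrier R" "A \<subseteq> ?H" using gc by (auto simp: A_def)
    note J = genideal_ideal[OF A(1)]
    have JH: "Idl A \<subseteq> ?H" by (rule genideal_minimal[OF H A(2)])
    have "g p = \<zero>"
    proof -
      have "bs ! p \<otimes> y = (u \<otimes> bs ! p) \<otimes> xs ! p" unfolding y_def using u(1) xp bp by (simp add: m_ac)
      then show ?thesis unfolding g_def using u(2) xp by (simp add: a_minus_def r_neg)
    qed
    then have gJ: "g i \<in> Idl A" if "i < ?s" for i
      using that genideal_self[OF A(1)] ideal_zero[OF J] by (cases "i = p") (auto simp: A_def)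
    have yc: "{y} \<subseteq> carrier R" using y by simp
    have HJy: "?H \<subseteq> ext (Idl A) {y}"
    proof (rule genideal_minimal[OF ext_ideal[OF J yc]], rule subsetI)
      fix x assume "x \<in> set xs"
      then obtain i where i: "i < ?s" "x = xs ! i" by (auto simp: in_set_conv_nth)
      have "x = g i \<oplus> bs ! i \<otimes> y" unfolding g_def i(2) using nthc[OF i(1)] y(2) by algebra
      then show "x \<in> ext (Idl A) {y}"
        using ext_singletonI[OF J y(2) gJ[OF i(1)] nthc(2)[OF i(1)]] by simp
    qed
    have "list_all2 (\<lambda>x b. x \<in> ?H \<and> b \<in> carrier R \<and> x \<ominus> b \<otimes> y \<in> Idl A) xs bs"
      using bs(2) nthc gJ by (auto simp: list_all2_conv_all_nth g_def)
    from mpoly_eval_homogeneous_shift[OF J H y(1) this c(1), where r = r] c(2)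
    have sh: "mpoly_eval n c xs \<ominus> mpoly_eval n c bs \<otimes> y [^] r \<in> (Idl A) \<cdot> ideal_pow R ?H r'"
      using Suc by (auto simp: graded_prod_def)
    have i: "ideal (\<mm> \<cdot> ideal_pow R I r) R" "ideal ((Idl A) \<cdot> ideal_pow R ?H r') R"
      by (intro ideal_prod_is_ideal m_ideal J ideal_pow_ideal I(1) H)+
    let ?E = "ext (\<mm> \<cdot> ideal_pow R I r) ((Idl A) \<cdot> ideal_pow R ?H r')"
    have E: "ideal ?E R" using ext_ideal[OF i(1) ideal_subset[OF i(2)]] .
    have cc: "mpoly_eval n c xs \<in> carrier R" "mpoly_eval n c bs \<in> carrier R" "y [^] r \<in> carrier R"
      using xs bs c y by auto
    have "mpoly_eval n c bs \<otimes> y [^] r = mpoly_eval n c xs \<ominus> (mpoly_eval n c xs \<ominus> mpoly_eval n c bs \<otimes> y [^] r)"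
    proof -
      have "q \<otimes> v = p \<ominus> (p \<ominus> q \<otimes> v)" if "p \<in> carrier R" "q \<in> carrier R" "v \<in> carrier R" for p q v
        using that by algebra
      from this[OF cc] show ?thesis .
    qed
    also have "\<dots> \<in> ?E"
      by (rule ideal_diff[OF E subsetD[OF ext_base[OF i(1) ideal_subset[OF i(2)]] rel]
        subsetD[OF ext_gens[OF i(1) ideal_subset[OF i(2)]] sh]])
    finally have "y [^] r \<in> ?E" using unit_cancel[OF E cc(2) bs(3) cc(3)] by simp
    then have "reduction R (Idl A) I"
      using Suc by (intro reduction_drop_generator[OF I(1) red J JH y(1) HJy, of r']) (simp del: nat_pow_Suc ideal_pow.simps)
    moreover have "card A < ?s"
    proof -
      have "card A \<le> card ({..<?s} - {p})" unfolding A_def by (rule card_image_le) simp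
      also have "\<dots> < ?s" using p by simp
      finally show ?thesis .
    qed
    ultimately show ?thesis using that[of A] A JH by (simp add: A_def)
  qed
qed

text \<open>Take a reduction inside H with the least number s of generators; a relation with a unit
  coefficient would allow fewer, so these generators are analytically independent. The q^s monomials
  with exponents below q are then counted by the rank function over the ideal of (k s q)-th powers
  of \<open>ys\<close>, whose colength is at most (k s q)^d L with d = length \<open>ys\<close>. For
  large q this is impossible unless s \<le> d.\<close>

lemma reduction_dim_generators:
  assumes I: "ideal I R" "I \<subseteq> \<mm>" and Iprim: "\<And>e. e \<in> \<mm> \<Longrightarrow> \<exists>n::nat. e [^] n \<in> I"
    and red: "reduction R H I"
    and ys: "set ys \<subseteq> \<mm>" "\<And>e. e \<in> \<mm> \<Longrightarrow> \<exists>n::nat. e [^] n \<in> Idl (set ys)"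
  obtains A where "finite A" "A \<subseteq> carrier R" "card A \<le> length ys" "Idl A \<subseteq> H" "reduction R (Idl A) I"
proof -
  let ?P = "\<lambda>s. \<exists>A. finite A \<and> A \<subseteq> carrier R \<and> card A = s \<and> Idl A \<subseteq> H \<and> reduction R (Idl A) I"
  have "ideal H R" using red by (simp add: reduction_def)
  then obtain A0 where "A0 \<subseteq> carrier R" "finite A0" "H = Idl A0" using finetely_gen by blast
  then have ex: "\<exists>s. ?P s" using red by auto
  define s where "s = (LEAST s. ?P s)"
  have Ps: "?P s" unfolding s_def by (rule LeastI_ex[OF ex])
  have least: "s \<le> card A" if "finite A" "A \<subseteq> carrier R" "Idl A \<subseteq> H" "reduction R (Idl A) I" for A
    unfolding s_def by (rule Least_le) (use that in auto)
  obtain A where A: "finite A" "A \<subseteq> carrier R" "card A = s" "Idl A \<subseteq> H" "reduction R (Idl A) I"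
    using Ps by auto
  obtain xs where xs: "set xs = A" "length xs = s"
    using finite_distinct_list[OF A(1)] A(3) distinct_card by metis
  have xc: "set xs \<subseteq> carrier R" using xs A by simp
  have redx: "reduction R (Idl (set xs)) I" using xs A by simp
  have xI: "set xs \<subseteq> I" using genideal_self[OF xc] redx by (auto simp: reduction_def)
  have indep: "h e \<in> \<mm>"
    if h: "\<And>e. h e \<in> carrier R" "\<And>e. h e \<noteq> \<zero> \<Longrightarrow> sum_list e = r"
      and rel: "mpoly_eval n h xs \<in> \<mm> \<cdot> ideal_pow R I r" and e: "length e = s" "set e \<subseteq> {..<n}" for h r n e
  proof (rule ccontr)
    assume nm: "h e \<notin> \<mm>"
    have le: "length e = length xs" using e xs by simp
    obtain A' where "finite A'" "A' \<subseteq> carrier R" "card A' < length xs" "Idl A' \<subseteq> Idl (set xs)" "reduction R (Idl A') I"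
      using reduction_fewer_generators[OF I xc redx h rel le e(2) nm] by blast
    then show False using least[of A'] A(4) xs by auto
  qed
  have "s \<le> length ys"
  proof (rule ccontr)
    assume "\<not> s \<le> length ys"
    then have sd: "Suc (length ys) \<le> s" by simp
    have yc: "set ys \<subseteq> carrier R" using ys m_carrier by auto
    obtain L where "colength_le (Idl (set ys)) L"
      using m_primary_colength_finite[OF genideal_ideal[OF yc] ys(2)] by blast
    then have L: "colength_le (ext {\<zero>} (set ys)) L" using Idl_eq_ext[OF yc] by simp
    obtain k :: nat where k: "\<And>x. x \<in> set ys \<Longrightarrow> x [^] k \<in> I" "k > 0"
      by (rule common_exponent[OF I(1) finite_set yc]) (use Iprim ys(1) in auto)
    have main: "q ^ s \<le> (k * (s * q)) ^ length ys * L" if q: "q > 0" for q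
    proof -
      \<comment> \<open>The cutoff s q exceeds the degree of all monomials with exponents below q,
        so I^(s q) does not disturb their lowest-degree parts; the factor k makes the powers of
        \<open>ys\<close> lie in I^(s q).\<close>
      let ?n = "s * q" and ?S = "{e. set e \<subseteq> {..<q} \<and> length e = s}"
      let ?B = "ext {\<zero>} ((\<lambda>y. y [^] (k * ?n)) ` set ys)"
      have yp: "(\<lambda>y. y [^] (k * ?n)) ` set ys \<subseteq> carrier R" using yc by auto
      have B: "ideal ?B R" by (rule ext_ideal[OF zeroideal yp])
      have col: "colength_le ?B ((k * ?n) ^ length ys * L)"
        by (rule colength_le_powers[OF zeroideal yc L])
      note In = ideal_pow_ideal[OF I(1), of ?n]
      have "y [^] (k * ?n) \<in> ideal_pow R I ?n" if "y \<in> set ys" for y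
        using ideal_pow_nat_pow[OF I(1) k(1)[OF that], of ?n] yc that by (auto simp: nat_pow_pow)
      then have BI: "?B \<subseteq> ideal_pow R I ?n" using ideal_zero[OF In] by (intro ext_minimal[OF In]) auto
      obtain \<phi> :: "'a set \<Rightarrow> nat" where ph: "\<And>C. \<phi> C \<le> (k * ?n) ^ length ys * L"
        "\<And>C C'. ideal C R \<Longrightarrow> ideal C' R \<Longrightarrow> ?B \<subseteq> C \<Longrightarrow> C \<subset> C' \<Longrightarrow> \<phi> C < \<phi> C'"
        using steps_rank[OF B col] by blast
      define W where "W S = {i \<oplus> mpoly_eval q c xs | i c. i \<in> ideal_pow R I ?n \<and> (\<forall>e. c e \<in> carrier R) \<and> (\<forall>e. e \<notin> S \<longrightarrow> c e = \<zero>)}" for S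
      have Wi: "ideal (W S) R" for S unfolding W_def by (rule mpoly_span_ideal[OF In xc])
      have Wmono: "W S \<subseteq> W S'" if "S \<subseteq> S'" for S S' unfolding W_def using that by blast
      have "i \<oplus> mpoly_eval q (\<lambda>_. \<zero>) xs \<in> W S" if "i \<in> ideal_pow R I ?n" for i S
        unfolding W_def using that by auto
      then have IW: "ideal_pow R I ?n \<subseteq> W S" for S
        using mpoly_eval_zero[OF xc, of "\<lambda>_. \<zero>" q] ideal.Icarr[OF In] by auto
      have finS: "finite ?S" by (rule finite_lists_length_eq) simp
      \<comment> \<open>Exponent lists are added in order of decreasing degree. If the new monomial,
        of degree r, already lay in \<open>W S\<close>, the degree r part of the relation would be a
        form with value in I^(r+1) \<subseteq> \<mm> I^r and with coefficient 1 at the new monomial,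
        against independence. So each insertion enlarges \<open>W\<close> strictly.\<close>
      have rank: "S \<subseteq> ?S \<Longrightarrow> card S \<le> \<phi> (W S)" if "finite S" for S
        using that
      proof (induction S rule: finite_ranking_induct[where f = "\<lambda>e. - int (sum_list e)"])
        case (insert e S)
        then have e: "set e \<subseteq> {..<q}" "length e = s" and S: "S \<subseteq> ?S" by auto
        have ge: "sum_list e \<le> sum_list e'" if "e' \<in> S" for e' using insert(2)[OF that] by simp
        show ?case
        proof (cases "e \<in> S")
          case True
          then show ?thesis using insert S by (simp add: insert_absorb)
        next
          case False
          let ?r = "sum_list e"
          have "?r < ?n"
          proof -
            have "sum_list e \<le> length e * (q - 1)"
              using e(1) q by (induction e) auto
            also have "\<dots> < ?n" using e(2) q sd by auto
            finally show ?thesis .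
          qed
          let ?\<delta> = "\<lambda>e'. if e' = e then \<one> else \<zero>"
          have xe: "mpoly_eval q ?\<delta> xs \<in> carrier R" using xc by (intro mpoly_eval_closed) auto
          have "\<zero> \<oplus> mpoly_eval q ?\<delta> xs \<in> W (insert e S)"
            unfolding W_def using ideal_zero[OF In] by fastforce
          moreover have "\<zero> \<oplus> mpoly_eval q ?\<delta> xs \<notin> W S"
          proof
            assume "\<zero> \<oplus> mpoly_eval q ?\<delta> xs \<in> W S"
            then obtain i c where ic: "i \<in> ideal_pow R I ?n" "\<And>e. c e \<in> carrier R" "\<And>e. e \<notin> S \<Longrightarrow> c e = \<zero>"
              "mpoly_eval q ?\<delta> xs = i \<oplus> mpoly_eval q c xs"
              using xe unfolding W_def by auto
            define c1 where "c1 e' = (if sum_list e' = ?r then ?\<delta> e' \<ominus> c e' else \<zero>)" for e'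
            define c2 where "c2 e' = (if sum_list e' = ?r then \<zero> else c e')" for e'
            have cc: "c1 e' \<in> carrier R" "c2 e' \<in> carrier R" for e' using ic(2) by (auto simp: c1_def c2_def)
            have ev: "mpoly_eval q c1 xs \<in> carrier R" "mpoly_eval q c2 xs \<in> carrier R" "mpoly_eval q c xs \<in> carrier R" "i \<in> carrier R"
              using mpoly_eval_closed[OF xc] cc ic(2) ideal.Icarr[OF In ic(1)] by auto
            have "(\<lambda>e'. c1 e' \<oplus> c e') = (\<lambda>e'. ?\<delta> e' \<oplus> c2 e')"
            proof
              fix e'
              have "(u \<ominus> v) \<oplus> v = u \<oplus> \<zero>" if "u \<in> carrier R" "v \<in> carrier R" for u v using that by algebra
              then show "c1 e' \<oplus> c e' = ?\<delta> e' \<oplus> c2 e'" using ic(2)[of e'] by (auto simp: c1_def c2_def)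
            qed
            then have "mpoly_eval q c1 xs \<oplus> mpoly_eval q c xs = mpoly_eval q ?\<delta> xs \<oplus> mpoly_eval q c2 xs"
              using mpoly_eval_add[OF xc, of c1 c] mpoly_eval_add[OF xc, of ?\<delta> c2] cc ic(2) by simp
            then have "mpoly_eval q c1 xs \<oplus> mpoly_eval q c xs = (i \<oplus> mpoly_eval q c2 xs) \<oplus> mpoly_eval q c xs"
              unfolding ic(4) using ev by (simp add: a_ac)
            then have eq: "mpoly_eval q c1 xs = i \<oplus> mpoly_eval q c2 xs" using ev by simp
            have c2ge: "Suc ?r \<le> sum_list e'" if "c2 e' \<noteq> \<zero>" for e'
            proof -
              have "c e' \<noteq> \<zero>" "sum_list e' \<noteq> ?r" using that by (auto simp: c2_def split: if_splits)
              then show ?thesis using ic(3)[of e'] ge[of e'] by force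
            qed
            have "mpoly_eval q c2 xs \<in> ideal_pow R I (Suc ?r)"
              by (rule mpoly_eval_in_pow[OF I(1) xI cc(2) c2ge])
            moreover have "i \<in> ideal_pow R I (Suc ?r)"
              using ic(1) ideal_pow_antimono[OF I(1), of "Suc ?r" ?n] \<open>?r < ?n\<close> by (auto simp del: ideal_pow.simps)
            ultimately have "mpoly_eval q c1 xs \<in> ideal_pow R I (Suc ?r)"
              unfolding eq by (intro ideal_add[OF ideal_pow_ideal[OF I(1)]])
            then have "mpoly_eval q c1 xs \<in> \<mm> \<cdot> ideal_pow R I ?r"
              using ideal_prod_mono[OF I(2) subset_refl, of "ideal_pow R I ?r"] by auto
            moreover have "sum_list e' = ?r" if "c1 e' \<noteq> \<zero>" for e'
              using that by (simp add: c1_def split: if_splits)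
            ultimately have "c1 e \<in> \<mm>" by (intro indep[of c1 ?r q e] cc(1) e)
            moreover have "c1 e = \<one>" using ic(3)[OF False] by (simp add: c1_def a_minus_def)
            ultimately show False using one_notin_m by simp
          qed
          ultimately have "W S \<subset> W (insert e S)" using Wmono[of S "insert e S"] by auto
          then have "\<phi> (W S) < \<phi> (W (insert e S))"
            using BI IW by (intro ph(2) Wi) auto
          then show ?thesis using insert S False by simp
        qed
      qed simp
      have "q ^ s = card ?S" using card_lists_length_eq[of "{..<q}" s] by simp
      also have "\<dots> \<le> \<phi> (W ?S)" by (rule rank[OF finS subset_refl])
      also have "\<dots> \<le> (k * ?n) ^ length ys * L" by (rule ph(1))
      finally show ?thesis .
    qed
    \<comment> \<open>If s exceeds d = length \<open>ys\<close>, then for q = D + 1 the bound reads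
      q^(d+1) \<le> q^s \<le> D q^d, which gives q \<le> D.\<close>
    define D where "D = (k * s) ^ length ys * L"
    let ?q = "Suc D"
    have "?q ^ Suc (length ys) \<le> ?q ^ s" using sd by (intro power_increasing) auto
    also have "\<dots> \<le> (k * (s * ?q)) ^ length ys * L" by (rule main) simp
    also have "(k * (s * Q)) ^ l * L = (k * s) ^ l * L * Q ^ l" for Q l :: nat
      by (simp add: power_mult_distrib mult_ac)
    finally have "?q * ?q ^ length ys \<le> D * ?q ^ length ys"
      unfolding D_def[symmetric] by (simp only: power_Suc)
    then show False by (subst (asm) mult_le_cancel2) simp
  qed
  then show thesis using that[of A] A by simp
qed

end

section \<open>Polynomial functions\<close>

context cring
begin

definition points :: "'i set \<Rightarrow> ('i \<Rightarrow> 'a) set" where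
  "points N = {x. \<forall>i\<in>N. x i \<in> carrier R}"

text \<open>Polynomials are only needed through their values on \<open>R\<^sup>N\<close>, so they are represented by functions.\<close>

inductive_set polyfun :: "'i set \<Rightarrow> (('i \<Rightarrow> 'a) \<Rightarrow> 'a) set" for N where
  const: "c \<in> carrier R \<Longrightarrow> (\<lambda>x. c) \<in> polyfun N"
| add: "f \<in> polyfun N \<Longrightarrow> g \<in> polyfun N \<Longrightarrow> (\<lambda>x. f x \<oplus> g x) \<in> polyfun N"
| mult_var: "f \<in> polyfun N \<Longrightarrow> i \<in> N \<Longrightarrow> (\<lambda>x. f x \<otimes> x i) \<in> polyfun N"
| eq_on: "f \<in> polyfun N \<Longrightarrow> (\<And>x. x \<in> points N \<Longrightarrow> g x = f x) \<Longrightarrow> g \<in> polyfun N"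

lemma polyfun_closed: "f \<in> polyfun N \<Longrightarrow> x \<in> points N \<Longrightarrow> f x \<in> carrier R"
  by (induction rule: polyfun.induct) (auto simp: points_def)

lemma polyfun_depends:
  "f \<in> polyfun N \<Longrightarrow> x \<in> points N \<Longrightarrow> (\<And>i. i \<in> N \<Longrightarrow> y i = x i) \<Longrightarrow> f y = f x"
proof (induction rule: polyfun.induct)
  case (eq_on f g)
  have "y \<in> points N" using eq_on.prems by (auto simp: points_def)
  then show ?case using eq_on by auto
qed auto

lemma polyfun_mono: "f \<in> polyfun N \<Longrightarrow> N \<subseteq> N' \<Longrightarrow> f \<in> polyfun N'"
proof (induction rule: polyfun.induct)
  case (eq_on f g)
  then show ?case by - (rule polyfun.eq_on[of f N' g], auto simp: points_def)
qed (auto intro: polyfun.intros)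

lemma polyfun_var: "i \<in> N \<Longrightarrow> (\<lambda>x. x i) \<in> polyfun N"
  by - (rule polyfun.eq_on[OF polyfun.mult_var[OF polyfun.const[OF one_closed]]], auto simp: points_def)

lemma polyfun_smult: "f \<in> polyfun N \<Longrightarrow> c \<in> carrier R \<Longrightarrow> (\<lambda>x. c \<otimes> f x) \<in> polyfun N"
proof (induction rule: polyfun.induct)
  case (const k)
  then show ?case by (intro polyfun.const) auto
next
  case (add f g)
  then show ?case
    by - (rule polyfun.eq_on[OF polyfun.add[of "\<lambda>x. c \<otimes> f x" N "\<lambda>x. c \<otimes> g x"]], auto simp: r_distr polyfun_closed)
next
  case (mult_var f i)
  then show ?case
    by - (rule polyfun.eq_on[OF polyfun.mult_var[of "\<lambda>x. c \<otimes> f x" N i]], auto simp: m_assoc polyfun_closed points_def)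
next
  case (eq_on f g)
  then show ?case by - (rule polyfun.eq_on[of "\<lambda>x. c \<otimes> f x" N], auto)
qed

lemma polyfun_mult:
  assumes f: "f \<in> polyfun N" and g: "g \<in> polyfun N"
  shows "(\<lambda>x. f x \<otimes> g x) \<in> polyfun N"
  using g
proof (induction rule: polyfun.induct)
  case (const c)
  show ?case
    by (rule polyfun.eq_on[OF polyfun_smult[OF f const]]) (use f const in \<open>auto simp: m_comm polyfun_closed\<close>)
next
  case (add g h)
  then show ?case using f
    by - (rule polyfun.eq_on[OF polyfun.add[of "\<lambda>x. f x \<otimes> g x" N "\<lambda>x. f x \<otimes> h x"]], auto simp: r_distr polyfun_closed)
next
  case (mult_var g i)
  then show ?case using f
    by - (rule polyfun.eq_on[OF polyfun.mult_var[of "\<lambda>x. f x \<otimes> g x" N i]], auto simp: m_assoc polyfun_closed points_def)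
next
  case (eq_on g h)
  then show ?case by - (rule polyfun.eq_on[of "\<lambda>x. f x \<otimes> g x" N], auto)
qed

lemma polyfun_diff:
  assumes "f \<in> polyfun N" "g \<in> polyfun N"
  shows "(\<lambda>x. f x \<ominus> g x) \<in> polyfun N"
  by (rule polyfun.eq_on[OF polyfun.add[OF assms(1) polyfun_smult[OF assms(2), of "\<ominus> \<one>"]]])
    (use assms in \<open>auto simp: a_minus_def l_minus polyfun_closed\<close>)

lemma polyfun_finsum:
  "(\<And>q. q \<in> Q \<Longrightarrow> f q \<in> polyfun N) \<Longrightarrow> (\<lambda>x. \<Oplus>q\<in>Q. f q x) \<in> polyfun N"
proof (induction Q rule: infinite_finite_induct)
  case (insert q Q)
  have "(\<lambda>x. f q x \<oplus> (\<Oplus>q\<in>Q. f q x)) \<in> polyfun N"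
    using insert by (intro polyfun.add) auto
  then show ?case
  proof (rule polyfun.eq_on)
    fix x assume x: "x \<in> points N"
    have "f p x \<in> carrier R" if "p \<in> insert q Q" for p by (rule polyfun_closed[OF insert.prems[OF that] x])
    then show "(\<Oplus>p\<in>insert q Q. f p x) = f q x \<oplus> (\<Oplus>p\<in>Q. f p x)"
      using insert.hyps by (intro finsum_insert) auto
  qed
qed (auto intro: polyfun.const simp: finsum_infinite)

lemma horner_map_add:
  assumes "set gs \<subseteq> polyfun N" "set hs \<subseteq> polyfun N"
  shows "\<exists>ks. set ks \<subseteq> polyfun N \<and> (\<forall>x\<in>points N. \<forall>b\<in>carrier R.
    horner (map (\<lambda>g. g x) ks) b = horner (map (\<lambda>g. g x) gs) b \<oplus> horner (map (\<lambda>g. g x) hs) b)"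
  using assms
proof (induction gs arbitrary: hs)
  case Nil
  then have "set (map (\<lambda>g. g x) hs) \<subseteq> carrier R" if "x \<in> points N" for x
    using that polyfun_closed by auto
  then show ?case using Nil by (intro exI[of _ hs]) auto
next
  case (Cons g gs)
  have car: "set (map (\<lambda>g. g x) gs') \<subseteq> carrier R" if "x \<in> points N" "set gs' \<subseteq> polyfun N" for x gs'
    using that polyfun_closed by auto
  show ?case
  proof (cases hs)
    case Nil
    then show ?thesis using Cons.prems car[of _ "g # gs"] by (intro exI[of _ "g # gs"]) auto
  next
    case hs: (Cons h hs')
    obtain ks where ks: "set ks \<subseteq> polyfun N" "\<And>x b. x \<in> points N \<Longrightarrow> b \<in> carrier R \<Longrightarrow>
      horner (map (\<lambda>g. g x) ks) b = horner (map (\<lambda>g. g x) gs) b \<oplus> horner (map (\<lambda>g. g x) hs') b"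
      using Cons.IH[of hs'] Cons.prems hs by auto
    have "horner (map (\<lambda>g. g x) ((\<lambda>x. g x \<oplus> h x) # ks)) b =
      horner (map (\<lambda>g. g x) (g # gs)) b \<oplus> horner (map (\<lambda>g. g x) hs) b"
      if x: "x \<in> points N" and b: "b \<in> carrier R" for x b
    proof -
      have c: "g x \<in> carrier R" "h x \<in> carrier R" "horner (map (\<lambda>g. g x) gs) b \<in> carrier R"
        "horner (map (\<lambda>g. g x) hs') b \<in> carrier R"
        using Cons.prems hs car[OF x, of gs] car[OF x, of hs'] polyfun_closed[OF _ x] b by auto
      have "(p \<oplus> q) \<oplus> b \<otimes> (u \<oplus> v) = (p \<oplus> b \<otimes> u) \<oplus> (q \<oplus> b \<otimes> v)"
        if "p \<in> carrier R" "q \<in> carrier R" "u \<in> carrier R" "v \<in> carrier R" for p q u v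
        using that b by algebra
      from this[OF c] show ?thesis using ks(2)[OF x b] hs by simp
    qed
    then show ?thesis using ks(1) Cons.prems hs
      by (intro exI[of _ "(\<lambda>x. g x \<oplus> h x) # ks"]) (auto intro: polyfun.add)
  qed
qed

lemma polyfun_split_var:
  assumes "f \<in> polyfun (insert i N)"
  shows "\<exists>gs. set gs \<subseteq> polyfun N \<and>
    (\<forall>x\<in>points (insert i N). f x = horner (map (\<lambda>g. g x) gs) (x i))"
  using assms
proof (induction rule: polyfun.induct)
  case (const c)
  then show ?case by (intro exI[of _ "[\<lambda>x. c]"]) (auto intro: polyfun.const simp: points_def)
next
  case (add f g)
  then obtain fs gs where fg: "set fs \<subseteq> polyfun N" "set gs \<subseteq> polyfun N"
    "\<forall>x\<in>points (insert i N). f x = horner (map (\<lambda>g. g x) fs) (x i)"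
    "\<forall>x\<in>points (insert i N). g x = horner (map (\<lambda>g. g x) gs) (x i)" by blast
  obtain ks where "set ks \<subseteq> polyfun N" "\<forall>x\<in>points N. \<forall>b\<in>carrier R.
    horner (map (\<lambda>g. g x) ks) b = horner (map (\<lambda>g. g x) fs) b \<oplus> horner (map (\<lambda>g. g x) gs) b"
    using horner_map_add[OF fg(1,2)] by blast
  then show ?case using fg by (intro exI[of _ ks]) (auto simp: points_def)
next
  case (mult_var f j)
  then obtain fs where fs: "set fs \<subseteq> polyfun N"
    "\<forall>x\<in>points (insert i N). f x = horner (map (\<lambda>g. g x) fs) (x i)" by blast
  have car: "set (map (\<lambda>g. g x) fs) \<subseteq> carrier R" "x i \<in> carrier R" "x j \<in> carrier R"
    if "x \<in> points (insert i N)" for x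
    using that fs(1) mult_var(2) polyfun_closed[of _ N x] by (auto simp: points_def)
  show ?case
  proof (cases "j = i")
    case True
    have "f x \<otimes> x j = horner (map (\<lambda>g. g x) ((\<lambda>x. \<zero>) # fs)) (x i)" if x: "x \<in> points (insert i N)" for x
      using bspec[OF fs(2) x] horner_closed[OF car(1,2)[OF x]] car(2)[OF x] True by (simp add: m_comm)
    then show ?thesis using fs(1) by (intro exI[of _ "(\<lambda>x. \<zero>) # fs"]) (auto intro: polyfun.const)
  next
    case False
    have "f x \<otimes> x j = horner (map (\<lambda>g. g x) (map (\<lambda>g x. x j \<otimes> g x) fs)) (x i)" if x: "x \<in> points (insert i N)" for x
      using bspec[OF fs(2) x] horner_smult[OF car(1,2,3)[OF x]] horner_closed[OF car(1,2)[OF x]] car(3)[OF x]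
      by (simp add: m_comm comp_def)
    moreover have "j \<in> N" using mult_var(2) False by auto
    then have "(\<lambda>x. x j \<otimes> g x) \<in> polyfun N" if "g \<in> set fs" for g
      using fs(1) that by (intro polyfun_mult polyfun_var) auto
    ultimately show ?thesis by (intro exI[of _ "map (\<lambda>g x. x j \<otimes> g x) fs"]) auto
  qed
next
  case (eq_on f g)
  then show ?case by auto
qed

lemma polyfun_on_line:
  assumes "f \<in> polyfun N" "\<And>i. i \<in> N \<Longrightarrow> a i \<in> carrier R" "\<And>i. i \<in> N \<Longrightarrow> d i \<in> carrier R"
  shows "\<exists>cs. set cs \<subseteq> carrier R \<and> (\<forall>t\<in>carrier R. f (\<lambda>i. a i \<oplus> t \<otimes> d i) = horner cs t)"
  using assms(1)
proof (induction rule: polyfun.induct)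
  case (const c)
  then show ?case by (intro exI[of _ "[c]"]) auto
next
  case (add f g)
  then obtain cs ds where cd: "set cs \<subseteq> carrier R" "\<forall>t\<in>carrier R. f (\<lambda>i. a i \<oplus> t \<otimes> d i) = horner cs t"
    "set ds \<subseteq> carrier R" "\<forall>t\<in>carrier R. g (\<lambda>i. a i \<oplus> t \<otimes> d i) = horner ds t" by blast
  obtain qs where "set qs \<subseteq> carrier R" "\<forall>t\<in>carrier R. horner qs t = horner cs t \<oplus> \<one> \<otimes> horner ds t"
    using horner_add_smult[OF cd(1,3) one_closed] by blast
  then show ?case using cd by (intro exI[of _ qs]) auto
next
  case (mult_var f i)
  then obtain cs where cs: "set cs \<subseteq> carrier R" "\<forall>t\<in>carrier R. f (\<lambda>i. a i \<oplus> t \<otimes> d i) = horner cs t" by blast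
  have c: "a i \<in> carrier R" "d i \<in> carrier R" using assms mult_var by auto
  have c': "set (map ((\<otimes>) (a i)) cs) \<subseteq> carrier R" "set (\<zero> # cs) \<subseteq> carrier R" using cs(1) c by auto
  obtain qs where qs: "set qs \<subseteq> carrier R"
    "\<forall>t\<in>carrier R. horner qs t = horner (map ((\<otimes>) (a i)) cs) t \<oplus> d i \<otimes> horner (\<zero> # cs) t"
    using horner_add_smult[OF c' c(2)] by blast
  have "f (\<lambda>i. a i \<oplus> t \<otimes> d i) \<otimes> (a i \<oplus> t \<otimes> d i) = horner qs t" if t: "t \<in> carrier R" for t
  proof -
    have h: "horner cs t \<in> carrier R" using cs(1) t by simp
    have "u \<otimes> (a i \<oplus> t \<otimes> d i) = a i \<otimes> u \<oplus> d i \<otimes> (\<zero> \<oplus> t \<otimes> u)" if "u \<in> carrier R" for u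
      using that t c by algebra
    from this[OF h] show ?thesis using cs t c qs(2) horner_smult[OF cs(1) t c(1)] by simp
  qed
  then show ?case using qs(1) by blast
next
  case (eq_on f g)
  have "(\<lambda>i. a i \<oplus> t \<otimes> d i) \<in> points N" if "t \<in> carrier R" for t
    using that assms by (auto simp: points_def)
  then show ?case using eq_on by auto
qed

text \<open>For generators \<open>e\<close> of \<mm> these are the polynomial functions with
  coefficients in \<mm>. The witnesses \<open>fs\<close> are kept polynomial because they reappear
  as entries of a matrix to which elimination is applied.\<close>

definition combos :: "(nat \<Rightarrow> 'a) \<Rightarrow> nat \<Rightarrow> 'i set \<Rightarrow> (('i \<Rightarrow> 'a) \<Rightarrow> 'a) set" where
  "combos e G N = {f. \<exists>fs. (\<forall>j<G. fs j \<in> polyfun N) \<and> (\<forall>x\<in>points N. f x = (\<Oplus>j\<in>{..<G}. e j \<otimes> fs j x))}"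

lemma combos_add:
  assumes e: "\<And>j. j < G \<Longrightarrow> e j \<in> carrier R" and "f \<in> combos e G N" "g \<in> combos e G N"
  shows "(\<lambda>x. f x \<oplus> g x) \<in> combos e G N"
proof -
  obtain fs gs where fg: "\<forall>j<G. fs j \<in> polyfun N" "\<forall>x\<in>points N. f x = (\<Oplus>j\<in>{..<G}. e j \<otimes> fs j x)"
    "\<forall>j<G. gs j \<in> polyfun N" "\<forall>x\<in>points N. g x = (\<Oplus>j\<in>{..<G}. e j \<otimes> gs j x)"
    using assms unfolding combos_def by blast
  have "f x \<oplus> g x = (\<Oplus>j\<in>{..<G}. e j \<otimes> (fs j x \<oplus> gs j x))" if x: "x \<in> points N" for x
  proof -
    have c: "fs j x \<in> carrier R" "gs j x \<in> carrier R" if "j < G" for j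
      using polyfun_closed[OF _ x] fg(1,3) that by auto
    have "f x \<oplus> g x = (\<Oplus>j\<in>{..<G}. e j \<otimes> fs j x) \<oplus> (\<Oplus>j\<in>{..<G}. e j \<otimes> gs j x)" using fg x by simp
    also have "\<dots> = (\<Oplus>j\<in>{..<G}. e j \<otimes> fs j x \<oplus> e j \<otimes> gs j x)"
      using c e by (intro finsum_addf[symmetric]) auto
    also have "\<dots> = (\<Oplus>j\<in>{..<G}. e j \<otimes> (fs j x \<oplus> gs j x))"
      using c e by (intro finsum_cong') (auto simp: r_distr)
    finally show ?thesis .
  qed
  then show ?thesis unfolding combos_def using fg
    by (intro CollectI exI[of _ "\<lambda>j x. fs j x \<oplus> gs j x"]) (auto intro: polyfun.add)
qed

lemma combos_mult:
  assumes e: "\<And>j. j < G \<Longrightarrow> e j \<in> carrier R" and "f \<in> combos e G N" and g: "g \<in> polyfun N"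
  shows "(\<lambda>x. g x \<otimes> f x) \<in> combos e G N"
proof -
  obtain fs where fs: "\<forall>j<G. fs j \<in> polyfun N" "\<forall>x\<in>points N. f x = (\<Oplus>j\<in>{..<G}. e j \<otimes> fs j x)"
    using assms unfolding combos_def by blast
  have "g x \<otimes> f x = (\<Oplus>j\<in>{..<G}. e j \<otimes> (g x \<otimes> fs j x))" if x: "x \<in> points N" for x
  proof -
    have c: "fs j x \<in> carrier R" if "j < G" for j using polyfun_closed[OF _ x] fs(1) that by auto
    have gc: "g x \<in> carrier R" by (rule polyfun_closed[OF g x])
    have "g x \<otimes> f x = (\<Oplus>j\<in>{..<G}. g x \<otimes> (e j \<otimes> fs j x))"
      using fs(2) x c e gc by (simp add: finsum_rdistr Pi_def)
    also have "\<dots> = (\<Oplus>j\<in>{..<G}. e j \<otimes> (g x \<otimes> fs j x))"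
      using c e gc by (intro finsum_cong') (auto simp: m_lcomm)
    finally show ?thesis .
  qed
  then show ?thesis unfolding combos_def using fs(1) g
    by (intro CollectI exI[of _ "\<lambda>j x. g x \<otimes> fs j x"]) (auto intro: polyfun_mult)
qed

lemma combos_mono:
  assumes "f \<in> combos e G N" "N \<subseteq> N'"
  shows "f \<in> combos e G N'"
proof -
  obtain fs where fs: "\<forall>j<G. fs j \<in> polyfun N" "\<forall>x\<in>points N. f x = (\<Oplus>j\<in>{..<G}. e j \<otimes> fs j x)"
    using assms(1) unfolding combos_def by blast
  have "points N' \<subseteq> points N" using assms(2) by (auto simp: points_def)
  then show ?thesis unfolding combos_def
    using fs polyfun_mono[OF _ assms(2)] by (intro CollectI exI[of _ fs]) auto
qed

lemma combos_horner:
  assumes e: "\<And>j. j < G \<Longrightarrow> e j \<in> carrier R"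
  shows "set gs \<subseteq> combos e G N \<Longrightarrow> i \<in> N \<Longrightarrow> (\<lambda>x. horner (map (\<lambda>g. g x) gs) (x i)) \<in> combos e G N"
proof (induction gs)
  case Nil
  have "(\<Oplus>j\<in>{..<G}. e j \<otimes> \<zero>) = (\<Oplus>j\<in>{..<G}. \<zero>)" by (rule finsum_cong') (use e in auto)
  then show ?case unfolding combos_def
    by (intro CollectI exI[of _ "\<lambda>j x. \<zero>"]) (auto intro: polyfun.const)
next
  case (Cons g gs)
  then show ?case using e by (auto intro!: combos_add combos_mult polyfun_var)
qed

lemma polyfun_no_vars:
  "f \<in> polyfun {} \<Longrightarrow> \<exists>c\<in>carrier R. \<forall>x. f x = c"
  by (induction rule: polyfun.induct) (auto simp: points_def)

text \<open>The pivot e times one row minus k times the pivot row: the terms in the eliminated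
  unknown v cancel without division.\<close>

lemma elimination_step:
  assumes Q: "finite Q" and A: "A \<in> Q \<rightarrow> carrier R" and B: "B \<in> Q \<rightarrow> carrier R" and w: "w \<in> Q \<rightarrow> carrier R"
    and c: "e \<in> carrier R" "k \<in> carrier R" "v \<in> carrier R" "a \<in> carrier R" "b \<in> carrier R" "u \<in> carrier R"
  shows "e \<otimes> ((k \<otimes> v \<oplus> (\<Oplus>q\<in>Q. A q \<otimes> w q)) \<oplus> a \<otimes> u) \<ominus> k \<otimes> ((e \<otimes> v \<oplus> (\<Oplus>q\<in>Q. B q \<otimes> w q)) \<oplus> b \<otimes> u) =
    (\<Oplus>q\<in>Q. (e \<otimes> A q \<ominus> k \<otimes> B q) \<otimes> w q) \<oplus> (e \<otimes> a \<ominus> k \<otimes> b) \<otimes> u"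
proof -
  have ABw: "A q \<in> carrier R" "B q \<in> carrier R" "w q \<in> carrier R" if "q \<in> Q" for q using A B w that by auto
  have s: "(\<Oplus>q\<in>Q. A q \<otimes> w q) \<in> carrier R" "(\<Oplus>q\<in>Q. B q \<otimes> w q) \<in> carrier R"
    using ABw by (auto intro!: finsum_closed)
  have "(\<Oplus>q\<in>Q. (e \<otimes> A q \<ominus> k \<otimes> B q) \<otimes> w q) = (\<Oplus>q\<in>Q. e \<otimes> (A q \<otimes> w q) \<ominus> k \<otimes> (B q \<otimes> w q))"
  proof (rule finsum_cong'[OF refl])
    have "(e \<otimes> x \<ominus> k \<otimes> y) \<otimes> z = e \<otimes> (x \<otimes> z) \<ominus> k \<otimes> (y \<otimes> z)"
      if "x \<in> carrier R" "y \<in> carrier R" "z \<in> carrier R" for x y z using that c by algebra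
    then show "(e \<otimes> A q \<ominus> k \<otimes> B q) \<otimes> w q = e \<otimes> (A q \<otimes> w q) \<ominus> k \<otimes> (B q \<otimes> w q)" if "q \<in> Q" for q
      using ABw[OF that] by blast
  qed (use ABw c in auto)
  also have "\<dots> = (\<Oplus>q\<in>Q. e \<otimes> (A q \<otimes> w q)) \<ominus> (\<Oplus>q\<in>Q. k \<otimes> (B q \<otimes> w q))"
    using ABw c by (intro finsum_diff[symmetric]) auto
  also have "\<dots> = e \<otimes> (\<Oplus>q\<in>Q. A q \<otimes> w q) \<ominus> k \<otimes> (\<Oplus>q\<in>Q. B q \<otimes> w q)"
    using ABw c Q by (simp add: finsum_rdistr Pi_def)
  finally have eq: "(\<Oplus>q\<in>Q. (e \<otimes> A q \<ominus> k \<otimes> B q) \<otimes> w q) = e \<otimes> (\<Oplus>q\<in>Q. A q \<otimes> w q) \<ominus> k \<otimes> (\<Oplus>q\<in>Q. B q \<otimes> w q)" .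
  have "e \<otimes> ((k \<otimes> v \<oplus> x) \<oplus> a \<otimes> u) \<ominus> k \<otimes> ((e \<otimes> v \<oplus> y) \<oplus> b \<otimes> u) = (e \<otimes> x \<ominus> k \<otimes> y) \<oplus> (e \<otimes> a \<ominus> k \<otimes> b) \<otimes> u"
    if "x \<in> carrier R" "y \<in> carrier R" for x y using that c by algebra
  from this[OF s] show ?thesis unfolding eq .
qed

text \<open>Subtracting B_q times the solved relation for each w_q from f times the pivot row leaves
  a relation in v and u only.\<close>

lemma elimination_back_substitution:
  assumes Q: "finite Q" and B: "B \<in> Q \<rightarrow> carrier R" and D: "D \<in> Q \<rightarrow> carrier R" and w: "w \<in> Q \<rightarrow> carrier R"
    and c: "e \<in> carrier R" "f \<in> carrier R" "v \<in> carrier R" "b \<in> carrier R" "u \<in> carrier R"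
  shows "f \<otimes> ((e \<otimes> v \<oplus> (\<Oplus>q\<in>Q. B q \<otimes> w q)) \<oplus> b \<otimes> u) \<ominus> (\<Oplus>q\<in>Q. B q \<otimes> (f \<otimes> w q \<oplus> D q \<otimes> u)) =
    (f \<otimes> e) \<otimes> v \<oplus> (f \<otimes> b \<ominus> (\<Oplus>q\<in>Q. B q \<otimes> D q)) \<otimes> u"
proof -
  have BDw: "D q \<in> carrier R" "B q \<in> carrier R" "w q \<in> carrier R" if "q \<in> Q" for q using D B w that by auto
  have s: "(\<Oplus>q\<in>Q. B q \<otimes> w q) \<in> carrier R" "(\<Oplus>q\<in>Q. B q \<otimes> D q) \<in> carrier R"
    using BDw by (auto intro!: finsum_closed)
  have "(\<Oplus>q\<in>Q. B q \<otimes> (f \<otimes> w q \<oplus> D q \<otimes> u)) = (\<Oplus>q\<in>Q. f \<otimes> (B q \<otimes> w q) \<oplus> (B q \<otimes> D q) \<otimes> u)"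
  proof (rule finsum_cong'[OF refl])
    have "x \<otimes> (f \<otimes> z \<oplus> y \<otimes> u) = f \<otimes> (x \<otimes> z) \<oplus> (x \<otimes> y) \<otimes> u"
      if "x \<in> carrier R" "y \<in> carrier R" "z \<in> carrier R" for x y z using that c by algebra
    then show "B q \<otimes> (f \<otimes> w q \<oplus> D q \<otimes> u) = f \<otimes> (B q \<otimes> w q) \<oplus> (B q \<otimes> D q) \<otimes> u" if "q \<in> Q" for q
      using BDw[OF that] by blast
  qed (use BDw c in auto)
  also have "\<dots> = (\<Oplus>q\<in>Q. f \<otimes> (B q \<otimes> w q)) \<oplus> (\<Oplus>q\<in>Q. (B q \<otimes> D q) \<otimes> u)"
    using BDw c by (intro finsum_addf) auto
  also have "\<dots> = f \<otimes> (\<Oplus>q\<in>Q. B q \<otimes> w q) \<oplus> (\<Oplus>q\<in>Q. B q \<otimes> D q) \<otimes> u"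
    using BDw c Q by (simp add: finsum_rdistr finsum_ldistr Pi_def)
  finally have eq: "(\<Oplus>q\<in>Q. B q \<otimes> (f \<otimes> w q \<oplus> D q \<otimes> u)) = f \<otimes> (\<Oplus>q\<in>Q. B q \<otimes> w q) \<oplus> (\<Oplus>q\<in>Q. B q \<otimes> D q) \<otimes> u" .
  have "f \<otimes> ((e \<otimes> v \<oplus> x) \<oplus> b \<otimes> u) \<ominus> (f \<otimes> x \<oplus> y \<otimes> u) = (f \<otimes> e) \<otimes> v \<oplus> (f \<otimes> b \<ominus> y) \<otimes> u"
    if "x \<in> carrier R" "y \<in> carrier R" for x y using that c by algebra
  from this[OF s] show ?thesis unfolding eq .
qed

text \<open>Fraction-free elimination for a square polynomial family that is the identity at \<open>x0\<close>:
  \<open>f\<close> plays the role of the determinant, \<open>D\<close> that of Cramer's numerators.\<close>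

lemma polyfun_cramer:
  assumes "finite Q" and "x0 \<in> points N"
  shows "(\<And>p q. p \<in> Q \<Longrightarrow> q \<in> Q \<Longrightarrow> C p q \<in> polyfun N) \<Longrightarrow> (\<And>p. p \<in> Q \<Longrightarrow> c p \<in> polyfun N) \<Longrightarrow>
    (\<And>p q. p \<in> Q \<Longrightarrow> q \<in> Q \<Longrightarrow> C p q x0 = (if p = q then \<one> else \<zero>)) \<Longrightarrow>
    (\<And>p. p \<in> Q \<Longrightarrow> c p x0 = \<zero>) \<Longrightarrow>
    \<exists>f D. f \<in> polyfun N \<and> (\<forall>p\<in>Q. D p \<in> polyfun N) \<and> f x0 = \<one> \<and> (\<forall>p\<in>Q. D p x0 = \<zero>) \<and>
      (\<forall>x\<in>points N. \<forall>L w u. ideal L R \<and> w \<in> Q \<rightarrow> carrier R \<and> u \<in> carrier R \<and>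
        (\<forall>p\<in>Q. (\<Oplus>q\<in>Q. C p q x \<otimes> w q) \<oplus> c p x \<otimes> u \<in> L) \<longrightarrow>
        (\<forall>p\<in>Q. f x \<otimes> w p \<oplus> D p x \<otimes> u \<in> L))"
  using assms(1)
proof (induction Q arbitrary: C c rule: finite_induct)
  case empty
  then show ?case by (intro exI[of _ "\<lambda>x. \<one>"] exI[of _ "\<lambda>p x. \<one>"]) (auto intro: polyfun.const)
next
  case (insert r Q)
  have C: "C p q \<in> polyfun N" if "p \<in> insert r Q" "q \<in> insert r Q" for p q using insert.prems(1) that by blast
  have c: "c p \<in> polyfun N" if "p \<in> insert r Q" for p using insert.prems(2) that by blast
  \<comment> \<open>The reduced system is again the identity at x0: there the pivot is 1 and the
    other entries of its column are 0.\<close>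
  define C' where "C' p q x = C r r x \<otimes> C p q x \<ominus> C p r x \<otimes> C r q x" for p q x
  define c' where "c' p x = C r r x \<otimes> c p x \<ominus> C p r x \<otimes> c r x" for p x
  have C'1: "C' p q \<in> polyfun N" if "p \<in> Q" "q \<in> Q" for p q
    unfolding C'_def using that C by (auto intro!: polyfun_diff polyfun_mult)
  have C'2: "c' p \<in> polyfun N" if "p \<in> Q" for p
    unfolding c'_def using that C c by (auto intro!: polyfun_diff polyfun_mult)
  have C'3: "C' p q x0 = (if p = q then \<one> else \<zero>)" if "p \<in> Q" "q \<in> Q" for p q
    using that insert.prems(3)[of r r] insert.prems(3)[of p q] insert.prems(3)[of p r] insert.prems(3)[of r q] insert.hyps(2)
    by (auto simp: C'_def a_minus_def)
  have C'4: "c' p x0 = \<zero>" if "p \<in> Q" for p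
    using that insert.prems(3)[of r r] insert.prems(3)[of p r] insert.prems(4)[of r] insert.prems(4)[of p] insert.hyps(2)
    by (auto simp: c'_def a_minus_def)
  have "\<exists>f' D'. f' \<in> polyfun N \<and> (\<forall>p\<in>Q. D' p \<in> polyfun N) \<and> f' x0 = \<one> \<and> (\<forall>p\<in>Q. D' p x0 = \<zero>) \<and>
      (\<forall>x\<in>points N. \<forall>L w u. ideal L R \<and> w \<in> Q \<rightarrow> carrier R \<and> u \<in> carrier R \<and>
        (\<forall>p\<in>Q. (\<Oplus>q\<in>Q. C' p q x \<otimes> w q) \<oplus> c' p x \<otimes> u \<in> L) \<longrightarrow>
        (\<forall>p\<in>Q. f' x \<otimes> w p \<oplus> D' p x \<otimes> u \<in> L))"
    by (intro insert.IH C'1 C'2 C'3 C'4)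
  then obtain f' D' where IH: "f' \<in> polyfun N \<and> (\<forall>p\<in>Q. D' p \<in> polyfun N) \<and> f' x0 = \<one> \<and> (\<forall>p\<in>Q. D' p x0 = \<zero>) \<and>
      (\<forall>x\<in>points N. \<forall>L w u. ideal L R \<and> w \<in> Q \<rightarrow> carrier R \<and> u \<in> carrier R \<and>
        (\<forall>p\<in>Q. (\<Oplus>q\<in>Q. C' p q x \<otimes> w q) \<oplus> c' p x \<otimes> u \<in> L) \<longrightarrow>
        (\<forall>p\<in>Q. f' x \<otimes> w p \<oplus> D' p x \<otimes> u \<in> L))"
    by (elim exE)
  have f': "f' \<in> polyfun N" "\<forall>p\<in>Q. D' p \<in> polyfun N" "f' x0 = \<one>"
    "\<forall>p\<in>Q. D' p x0 = \<zero>" using IH by simp_all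
  have cr: "\<forall>p\<in>Q. f' x \<otimes> w p \<oplus> D' p x \<otimes> u \<in> L"
    if "x \<in> points N" "ideal L R" "w \<in> Q \<rightarrow> carrier R" "u \<in> carrier R"
      "\<forall>p\<in>Q. (\<Oplus>q\<in>Q. C' p q x \<otimes> w q) \<oplus> c' p x \<otimes> u \<in> L" for x L w u
    using IH that by simp
  define f where "f x = f' x \<otimes> C r r x" for x
  define D where "D p x = (if p = r then f' x \<otimes> c r x \<ominus> (\<Oplus>q\<in>Q. C r q x \<otimes> D' q x) else C r r x \<otimes> D' p x)" for p x
  have F1: "f \<in> polyfun N" unfolding f_def using f' C by (auto intro: polyfun_mult)
  have F2: "D p \<in> polyfun N" if "p \<in> insert r Q" for p
  proof (cases "p = r")
    case True
    then have "D p = (\<lambda>x. f' x \<otimes> c r x \<ominus> (\<Oplus>q\<in>Q. C r q x \<otimes> D' q x))" by (auto simp: D_def)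
    also have "\<dots> \<in> polyfun N"
      using f' c C by (auto intro!: polyfun_diff polyfun_mult polyfun_finsum)
    finally show ?thesis .
  next
    case False
    then have "D p = (\<lambda>x. C r r x \<otimes> D' p x)" by (auto simp: D_def)
    also have "\<dots> \<in> polyfun N" using f' C that False by (auto intro!: polyfun_mult)
    finally show ?thesis .
  qed
  have F3: "f x0 = \<one>" using f'(3) insert.prems(3)[of r r] by (simp add: f_def)
  have F5: "D p x0 = \<zero>" if p: "p \<in> insert r Q" for p
  proof (cases "p = r")
    case True
    have "(\<Oplus>q\<in>Q. C r q x0 \<otimes> D' q x0) = (\<Oplus>q\<in>Q. \<zero>)"
      using f'(4) polyfun_closed[OF C assms(2)] by (intro finsum_cong') auto
    then show ?thesis using True f'(3) insert.prems(4)[of r] by (simp add: D_def a_minus_def)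
  next
    case False
    then show ?thesis using p f'(4) polyfun_closed[OF C assms(2)] by (simp add: D_def)
  qed
  have F4: "\<forall>p\<in>insert r Q. f x \<otimes> w p \<oplus> D p x \<otimes> u \<in> L"
    if x: "x \<in> points N" and L: "ideal L R" and w: "w \<in> insert r Q \<rightarrow> carrier R" and u: "u \<in> carrier R"
      and rows: "\<forall>p\<in>insert r Q. (\<Oplus>q\<in>insert r Q. C p q x \<otimes> w q) \<oplus> c p x \<otimes> u \<in> L" for x L w u
  proof -
    have Cc: "C p q x \<in> carrier R" if "p \<in> insert r Q" "q \<in> insert r Q" for p q
      using polyfun_closed[OF C[OF that] x] .
    have cc: "c p x \<in> carrier R" if "p \<in> insert r Q" for p using polyfun_closed[OF c[OF that] x] .
    have wc: "w p \<in> carrier R" if "p \<in> insert r Q" for p using w that by auto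
    have f'c: "f' x \<in> carrier R" using polyfun_closed[OF f'(1) x] .
    have D'c: "D' p x \<in> carrier R" if "p \<in> Q" for p using polyfun_closed[OF _ x] f'(2) that by auto
    have wQ: "w \<in> Q \<rightarrow> carrier R" using w by auto
    have row: "(C p r x \<otimes> w r \<oplus> (\<Oplus>q\<in>Q. C p q x \<otimes> w q)) \<oplus> c p x \<otimes> u \<in> L" if p: "p \<in> insert r Q" for p
    proof -
      have "(\<Oplus>q\<in>insert r Q. C p q x \<otimes> w q) = C p r x \<otimes> w r \<oplus> (\<Oplus>q\<in>Q. C p q x \<otimes> w q)"
        using insert.hyps Cc[OF p] wc by (intro finsum_insert) auto
      then show ?thesis using rows p by auto
    qed
    have "(\<Oplus>q\<in>Q. C' p q x \<otimes> w q) \<oplus> c' p x \<otimes> u \<in> L" if p: "p \<in> Q" for p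
    proof -
      have "C r r x \<otimes> ((C p r x \<otimes> w r \<oplus> (\<Oplus>q\<in>Q. C p q x \<otimes> w q)) \<oplus> c p x \<otimes> u) \<ominus>
        C p r x \<otimes> ((C r r x \<otimes> w r \<oplus> (\<Oplus>q\<in>Q. C r q x \<otimes> w q)) \<oplus> c r x \<otimes> u) \<in> L"
        using row[of p] row[of r] p Cc by (intro ideal_diff[OF L] ideal.I_l_closed[OF L]) auto
      then show ?thesis unfolding C'_def c'_def
        using elimination_step[OF insert.hyps(1), of "\<lambda>q. C p q x" "\<lambda>q. C r q x" w "C r r x" "C p r x" "w r" "c p x" "c r x" u]
          Cc cc wc wQ u p by (simp add: Pi_def)
    qed
    then have sol: "f' x \<otimes> w p \<oplus> D' p x \<otimes> u \<in> L" if "p \<in> Q" for p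
      using cr[OF x L wQ u] that by auto
    have "f x \<otimes> w p \<oplus> D p x \<otimes> u \<in> L" if p: "p \<in> Q" for p
    proof -
      have "p \<noteq> r" using p insert.hyps by auto
      have "(a \<otimes> b) \<otimes> v \<oplus> (b \<otimes> d) \<otimes> u = b \<otimes> (a \<otimes> v \<oplus> d \<otimes> u)"
        if "a \<in> carrier R" "b \<in> carrier R" "v \<in> carrier R" "d \<in> carrier R" for a b v d using that u by algebra
      then have "f x \<otimes> w p \<oplus> D p x \<otimes> u = C r r x \<otimes> (f' x \<otimes> w p \<oplus> D' p x \<otimes> u)"
        using f'c Cc[of r r] wc[of p] D'c[OF p] p \<open>p \<noteq> r\<close> by (simp add: f_def D_def)
      then show ?thesis using ideal.I_l_closed[OF L sol[OF p]] Cc by auto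
    qed
    moreover have "f x \<otimes> w r \<oplus> D r x \<otimes> u \<in> L"
    proof -
      have "f x \<otimes> w r \<oplus> D r x \<otimes> u = f' x \<otimes> ((C r r x \<otimes> w r \<oplus> (\<Oplus>q\<in>Q. C r q x \<otimes> w q)) \<oplus> c r x \<otimes> u) \<ominus>
        (\<Oplus>q\<in>Q. C r q x \<otimes> (f' x \<otimes> w q \<oplus> D' q x \<otimes> u))"
        using elimination_back_substitution[OF insert.hyps(1), of "\<lambda>q. C r q x" "\<lambda>q. D' q x" w "C r r x" "f' x" "w r" "c r x" u]
          Cc cc wc wQ u D'c f'c by (simp add: f_def D_def Pi_def)
      also have "\<dots> \<in> L"
        using row[of r] sol f'c Cc by (intro ideal_diff[OF L] ideal.I_l_closed[OF L] ideal_finsum[OF L]) auto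
      finally show ?thesis .
    qed
    ultimately show ?thesis by auto
  qed
  show ?case
  proof (intro exI[of _ f] exI[of _ D] conjI ballI allI impI)
    fix x L w u p
    assume "x \<in> points N" "ideal L R \<and> w \<in> insert r Q \<rightarrow> carrier R \<and> u \<in> carrier R \<and>
      (\<forall>p\<in>insert r Q. (\<Oplus>q\<in>insert r Q. C p q x \<otimes> w q) \<oplus> c p x \<otimes> u \<in> L)" "p \<in> insert r Q"
    then show "f x \<otimes> w p \<oplus> D p x \<otimes> u \<in> L" using F4[of x L w u] by blast
  qed (fact F1, erule F2, fact F3, erule F5)
qed

end

context noetherian_local_inf
begin

text \<open>A polynomial function with values in \<open>\<mm>\<close> has its coefficients in \<open>\<mm>\<close>, since the residue field is infinite.\<close>

lemma polyfun_into_m: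
  assumes e: "\<And>j. j < G \<Longrightarrow> e j \<in> carrier R" and me: "\<mm> = Idl (e ` {..<G})" and "finite N"
  shows "f \<in> polyfun N \<Longrightarrow> (\<And>x. x \<in> points N \<Longrightarrow> f x \<in> \<mm>) \<Longrightarrow> f \<in> combos e G N"
  using assms(3)
proof (induction N arbitrary: f rule: finite_induct)
  case empty
  obtain c where c: "c \<in> carrier R" "\<And>x. f x = c" using polyfun_no_vars[OF empty(1)] by blast
  have ec: "e ` {..<G} \<subseteq> carrier R" using e by auto
  have "c \<in> ext {\<zero>} (e ` {..<G})" using empty(2) c me Idl_eq_ext[OF ec] by (simp add: points_def)
  then obtain k r where kr: "k \<in> {\<zero>}" "r \<in> {..<G} \<rightarrow> carrier R" "c = k \<oplus> (\<Oplus>j\<in>{..<G}. r j \<otimes> e j)"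
    using ext_imageE[OF _ zeroideal ec] by (metis finite_lessThan)
  have rc: "r j \<in> carrier R" if "j < G" for j using kr(2) that by auto
  have "(\<Oplus>j\<in>{..<G}. r j \<otimes> e j) \<in> carrier R" using rc e by (auto intro!: finsum_closed)
  then have "c = (\<Oplus>j\<in>{..<G}. r j \<otimes> e j)" using kr by simp
  also have "\<dots> = (\<Oplus>j\<in>{..<G}. e j \<otimes> r j)" using rc e by (intro finsum_cong') (auto simp: m_comm)
  finally show ?case unfolding combos_def using c rc
    by (intro CollectI exI[of _ "\<lambda>j x. r j"]) (auto intro: polyfun.const)
next
  case (insert i N)
  obtain gs where gs: "set gs \<subseteq> polyfun N" "\<forall>x\<in>points (insert i N). f x = horner (map (\<lambda>g. g x) gs) (x i)"
    using polyfun_split_var[OF insert.prems(1)] by blast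
  obtain T where T: "incongruent T" "infinite T" using ex_incongruent .
  \<comment> \<open>For fixed values of the other variables, f is a polynomial in x_i with values in
    \<mm> at infinitely many incongruent arguments; so each coefficient function maps into \<mm>,
    and the induction hypothesis applies to it.\<close>
  have "g x \<in> \<mm>" if g: "g \<in> set gs" and x: "x \<in> points N" for g x
  proof -
    have "horner (map (\<lambda>g. g x) gs) b \<in> \<mm>" if "b \<in> T" for b
    proof -
      have b: "b \<in> carrier R" using that T(1) by (auto simp: incongruent_def)
      have xb: "x(i := b) \<in> points (insert i N)" using x b by (auto simp: points_def)
      have "h (x(i := b)) = h x" if "h \<in> set gs" for h
      proof (rule polyfun_depends[OF _ x])
        show "h \<in> polyfun N" using that gs(1) by auto
        show "(x(i := b)) j = x j" if "j \<in> N" for j using that insert.hyps(2) by auto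
      qed
      then have eq: "map (\<lambda>g. g (x(i := b))) gs = map (\<lambda>g. g x) gs" by simp
      have "f (x(i := b)) = horner (map (\<lambda>g. g x) gs) b"
        using bspec[OF gs(2) xb] unfolding eq fun_upd_same .
      then show ?thesis using insert.prems(2)[OF xb] by (simp only:)
    qed
    moreover have "set (map (\<lambda>g. g x) gs) \<subseteq> carrier R" using gs(1) x polyfun_closed by auto
    ultimately have "set (map (\<lambda>g. g x) gs) \<subseteq> \<mm>" by (intro horner_coeffs_in_m[OF T]) auto
    then show ?thesis using g by auto
  qed
  then have "set gs \<subseteq> combos e G N" using insert.IH gs(1) by auto
  then have "set gs \<subseteq> combos e G (insert i N)" using combos_mono[of _ e G N "insert i N"] by auto
  then have "(\<lambda>x. horner (map (\<lambda>g. g x) gs) (x i)) \<in> combos e G (insert i N)"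
    by (intro combos_horner e) auto
  then obtain fs where fs: "\<forall>j<G. fs j \<in> polyfun (insert i N)"
    "\<forall>x\<in>points (insert i N). horner (map (\<lambda>g. g x) gs) (x i) = (\<Oplus>j\<in>{..<G}. e j \<otimes> fs j x)"
    unfolding combos_def by blast
  have "\<forall>x\<in>points (insert i N). f x = (\<Oplus>j\<in>{..<G}. e j \<otimes> fs j x)"
  proof
    fix x assume x: "x \<in> points (insert i N)"
    show "f x = (\<Oplus>j\<in>{..<G}. e j \<otimes> fs j x)" by (rule trans[OF bspec[OF gs(2) x] bspec[OF fs(2) x]])
  qed
  with fs(1) show ?case unfolding combos_def by blast
qed

text \<open>On the line from a to b both functions become one-variable polynomials, one nonzero
  modulo \<mm> at parameter 0, the other at 1. Each has only finitely many zeros in an infinite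
  incongruent set, so some parameter avoids both. This is the irreducibility of affine space over an
  infinite field.\<close>

lemma polyfun_common_nonzero:
  assumes f: "f \<in> polyfun N" "a \<in> points N" "f a \<notin> \<mm>" and g: "g \<in> polyfun N" "b \<in> points N" "g b \<notin> \<mm>"
  obtains x where "x \<in> points N" "f x \<notin> \<mm>" "g x \<notin> \<mm>"
proof -
  have c: "a i \<in> carrier R" "b i \<ominus> a i \<in> carrier R" if "i \<in> N" for i
    using that f(2) g(2) by (auto simp: points_def)
  let ?l = "\<lambda>t i. a i \<oplus> t \<otimes> (b i \<ominus> a i)"
  have l: "?l t \<in> points N" if "t \<in> carrier R" for t using c that by (auto simp: points_def)
  obtain cs where cs: "set cs \<subseteq> carrier R" "\<forall>t\<in>carrier R. f (?l t) = horner cs t"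
    using polyfun_on_line[of f N a "\<lambda>i. b i \<ominus> a i"] f(1) c by blast
  obtain ds where ds: "set ds \<subseteq> carrier R" "\<forall>t\<in>carrier R. g (?l t) = horner ds t"
    using polyfun_on_line[of g N a "\<lambda>i. b i \<ominus> a i"] g(1) c by blast
  obtain T where T: "incongruent T" "infinite T" using ex_incongruent .
  have fin: "finite {t \<in> T. horner us t \<in> \<mm>}" if "set us \<subseteq> carrier R" "t0 \<in> carrier R" "horner us t0 \<notin> \<mm>" for us t0
  proof (rule ccontr)
    assume inf: "infinite {t \<in> T. horner us t \<in> \<mm>}"
    have "set us \<subseteq> \<mm>"
      by (rule horner_coeffs_in_m[OF _ inf that(1)]) (use T(1) in \<open>auto simp: incongruent_def\<close>)
    then show False using horner_in_ideal[OF m_ideal _ that(2)] that(3) by auto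
  qed
  have "f (?l \<zero>) = f a" using c f(2) by (intro polyfun_depends[OF f(1)]) auto
  then have f0: "finite {t \<in> T. horner cs t \<in> \<mm>}" using fin[OF cs(1), of \<zero>] cs(2) f(3) by auto
  have "?l \<one> i = b i" if "i \<in> N" for i
  proof -
    have "a i \<in> carrier R" "b i \<in> carrier R" using that f(2) g(2) by (auto simp: points_def)
    moreover have "p \<oplus> \<one> \<otimes> (q \<ominus> p) = q" if "p \<in> carrier R" "q \<in> carrier R" for p q using that by algebra
    ultimately show ?thesis by blast
  qed
  then have "g (?l \<one>) = g b" by (intro polyfun_depends[OF g(1,2)])
  then have g0: "finite {t \<in> T. horner ds t \<in> \<mm>}" using fin[OF ds(1), of \<one>] ds(2) g(3) by auto
  have "infinite (T - ({t \<in> T. horner cs t \<in> \<mm>} \<union> {t \<in> T. horner ds t \<in> \<mm>}))"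
    using T(2) f0 g0 by (intro Diff_infinite_finite) auto
  then obtain t where t: "t \<in> T" "horner cs t \<notin> \<mm>" "horner ds t \<notin> \<mm>"
    using infinite_imp_nonempty by blast
  then have "t \<in> carrier R" using T(1) by (auto simp: incongruent_def)
  then show thesis using that[of "?l t"] l t cs ds by auto
qed

end

section \<open>Ideals of linear combinations\<close>

context cring
begin

lemma finsum_matrix:
  assumes "finite A" "finite B" and w: "w \<in> B \<rightarrow> carrier R"
  shows "c \<in> A \<rightarrow> carrier R \<Longrightarrow> (\<And>j p. j \<in> A \<Longrightarrow> p \<in> B \<Longrightarrow> M j p \<in> carrier R) \<Longrightarrow>
    (\<Oplus>j\<in>A. c j \<otimes> (\<Oplus>p\<in>B. M j p \<otimes> w p)) = (\<Oplus>p\<in>B. (\<Oplus>j\<in>A. c j \<otimes> M j p) \<otimes> w p)"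
  using assms(1)
proof (induction A rule: finite_induct)
  case empty
  have "w p \<in> carrier R" if "p \<in> B" for p using w that by auto
  then have "(\<Oplus>p\<in>B. \<zero> \<otimes> w p) = (\<Oplus>p\<in>B. \<zero>)" by (intro finsum_cong') auto
  then show ?case by simp
next
  case (insert j A)
  have wc: "w p \<in> carrier R" if "p \<in> B" for p using w that by auto
  have cj: "c j \<in> carrier R" and cA: "c \<in> A \<rightarrow> carrier R" using insert.prems(1) by auto
  have Mj: "M j p \<in> carrier R" if "p \<in> B" for p using insert.prems(2) that by auto
  have MA: "M j' p \<in> carrier R" if "j' \<in> A" "p \<in> B" for j' p using insert.prems(2) that by auto
  have S: "(\<Oplus>j\<in>A. c j \<otimes> M j p) \<in> carrier R" if "p \<in> B" for p using cA MA that by (auto intro!: finsum_closed)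
  have "(\<Oplus>j\<in>insert j A. c j \<otimes> (\<Oplus>p\<in>B. M j p \<otimes> w p)) =
    c j \<otimes> (\<Oplus>p\<in>B. M j p \<otimes> w p) \<oplus> (\<Oplus>j\<in>A. c j \<otimes> (\<Oplus>p\<in>B. M j p \<otimes> w p))"
    using insert.hyps cj cA Mj MA wc by (intro finsum_insert) (auto intro!: m_closed finsum_closed)
  also have "(\<Oplus>j\<in>A. c j \<otimes> (\<Oplus>p\<in>B. M j p \<otimes> w p)) = (\<Oplus>p\<in>B. (\<Oplus>j\<in>A. c j \<otimes> M j p) \<otimes> w p)"
    by (rule insert.IH[OF cA MA])
  also have "c j \<otimes> (\<Oplus>p\<in>B. M j p \<otimes> w p) = (\<Oplus>p\<in>B. c j \<otimes> M j p \<otimes> w p)"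
  proof -
    have "c j \<otimes> (\<Oplus>p\<in>B. M j p \<otimes> w p) = (\<Oplus>p\<in>B. c j \<otimes> (M j p \<otimes> w p))"
      using cj Mj wc assms(2) by (intro finsum_rdistr) auto
    also have "\<dots> = (\<Oplus>p\<in>B. c j \<otimes> M j p \<otimes> w p)"
      using cj Mj wc by (intro finsum_cong') (auto simp: m_assoc)
    finally show ?thesis .
  qed
  also have "(\<Oplus>p\<in>B. c j \<otimes> M j p \<otimes> w p) \<oplus> (\<Oplus>p\<in>B. (\<Oplus>j\<in>A. c j \<otimes> M j p) \<otimes> w p) =
    (\<Oplus>p\<in>B. c j \<otimes> M j p \<otimes> w p \<oplus> (\<Oplus>j\<in>A. c j \<otimes> M j p) \<otimes> w p)"
    using cj Mj wc S by (intro finsum_addf[symmetric]) auto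
  also have "\<dots> = (\<Oplus>p\<in>B. (\<Oplus>j\<in>insert j A. c j \<otimes> M j p) \<otimes> w p)"
  proof (rule finsum_cong'[OF refl])
    show "c j \<otimes> M j p \<otimes> w p \<oplus> (\<Oplus>j\<in>A. c j \<otimes> M j p) \<otimes> w p = (\<Oplus>j\<in>insert j A. c j \<otimes> M j p) \<otimes> w p" if "p \<in> B" for p
    proof -
      have "(\<Oplus>j\<in>insert j A. c j \<otimes> M j p) = c j \<otimes> M j p \<oplus> (\<Oplus>j\<in>A. c j \<otimes> M j p)"
        using insert.hyps cj cA Mj[OF that] MA that by (intro finsum_insert) auto
      then show ?thesis using cj Mj[OF that] S[OF that] wc[OF that] by (simp add: l_distr)
    qed
  qed (use insert.prems wc in \<open>auto intro!: finsum_closed m_closed\<close>)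
  finally show ?case .
qed

lemma finsum_delta:
  assumes "finite B" "p \<in> B" "w \<in> B \<rightarrow> carrier R"
  shows "(\<Oplus>q\<in>B. (if p = q then \<one> else \<zero>) \<otimes> w q) = w p"
proof -
  have "w q \<in> carrier R" if "q \<in> B" for q using assms(3) that by auto
  then have "(\<Oplus>q\<in>B. (if p = q then \<one> else \<zero>) \<otimes> w q) = (\<Oplus>q\<in>B. if p = q then w q else \<zero>)"
    by (intro finsum_cong') auto
  also have "\<dots> = w p" by (rule finsum_singleton[OF assms(2,1,3)])
  finally show ?thesis .
qed

text \<open>In the applications c is one row of x - x0. The z_j are known modulo L in terms of w and
  u, so the perturbed element w_p plus the sum of the c_j z_j becomes row p of a linear system whose
  matrix is the identity plus a term linear in c.\<close>

lemma perturbed_row: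
  assumes L: "ideal L R" and fin: "finite A" "finite P" and p: "p \<in> P"
    and w: "w \<in> P \<rightarrow> carrier R" and u: "u \<in> carrier R"
    and c: "\<And>j. j \<in> A \<Longrightarrow> c j \<in> carrier R" and b: "\<And>j. j \<in> A \<Longrightarrow> b j \<in> L"
    and M: "\<And>j q. j \<in> A \<Longrightarrow> q \<in> P \<Longrightarrow> M j q \<in> carrier R" and M': "\<And>j. j \<in> A \<Longrightarrow> M' j \<in> carrier R"
    and z: "\<And>j. j \<in> A \<Longrightarrow> z j = (b j \<oplus> M' j \<otimes> u) \<oplus> (\<Oplus>q\<in>P. M j q \<otimes> w q)"
  shows "((\<Oplus>q\<in>P. ((if p = q then \<one> else \<zero>) \<oplus> (\<Oplus>j\<in>A. c j \<otimes> M j q)) \<otimes> w q) \<oplus> (\<Oplus>j\<in>A. c j \<otimes> M' j) \<otimes> u)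
    \<ominus> (w p \<oplus> (\<Oplus>j\<in>A. c j \<otimes> z j)) \<in> L"
proof -
  have wc: "w q \<in> carrier R" if "q \<in> P" for q using w that by auto
  have bc: "b j \<in> carrier R" if "j \<in> A" for j using ideal.Icarr[OF L b[OF that]] .
  let ?S = "\<lambda>j. \<Oplus>q\<in>P. M j q \<otimes> w q"
  have S: "?S j \<in> carrier R" if "j \<in> A" for j using M[OF that] wc by (auto intro!: finsum_closed)
  have cM: "(\<Oplus>j\<in>A. c j \<otimes> M j q) \<in> carrier R" if "q \<in> P" for q using c M that by (auto intro!: finsum_closed)
  have s: "(\<Oplus>j\<in>A. c j \<otimes> b j) \<in> carrier R" "(\<Oplus>j\<in>A. c j \<otimes> M' j) \<in> carrier R" "(\<Oplus>j\<in>A. c j \<otimes> ?S j) \<in> carrier R"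
    using c bc M' S by (auto intro!: finsum_closed)
  have "(\<Oplus>q\<in>P. ((if p = q then \<one> else \<zero>) \<oplus> (\<Oplus>j\<in>A. c j \<otimes> M j q)) \<otimes> w q) =
    (\<Oplus>q\<in>P. (if p = q then \<one> else \<zero>) \<otimes> w q \<oplus> (\<Oplus>j\<in>A. c j \<otimes> M j q) \<otimes> w q)"
    using wc cM by (intro finsum_cong') (auto simp: l_distr)
  also have "\<dots> = (\<Oplus>q\<in>P. (if p = q then \<one> else \<zero>) \<otimes> w q) \<oplus> (\<Oplus>q\<in>P. (\<Oplus>j\<in>A. c j \<otimes> M j q) \<otimes> w q)"
    using wc cM by (intro finsum_addf) auto
  also have "\<dots> = w p \<oplus> (\<Oplus>j\<in>A. c j \<otimes> ?S j)"
    using finsum_delta[OF fin(2) p w] finsum_matrix[OF fin w, of c M] c M by (simp add: Pi_def)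
  finally have e1: "(\<Oplus>q\<in>P. ((if p = q then \<one> else \<zero>) \<oplus> (\<Oplus>j\<in>A. c j \<otimes> M j q)) \<otimes> w q) = w p \<oplus> (\<Oplus>j\<in>A. c j \<otimes> ?S j)" .
  have "(\<Oplus>j\<in>A. c j \<otimes> z j) = (\<Oplus>j\<in>A. (c j \<otimes> b j \<oplus> (c j \<otimes> M' j) \<otimes> u) \<oplus> c j \<otimes> ?S j)"
  proof (rule finsum_cong'[OF refl])
    have "x \<otimes> ((y \<oplus> v \<otimes> u) \<oplus> t) = (x \<otimes> y \<oplus> (x \<otimes> v) \<otimes> u) \<oplus> x \<otimes> t"
      if "x \<in> carrier R" "y \<in> carrier R" "v \<in> carrier R" "t \<in> carrier R" for x y v t using that u by algebra
    then show "c j \<otimes> z j = (c j \<otimes> b j \<oplus> (c j \<otimes> M' j) \<otimes> u) \<oplus> c j \<otimes> ?S j" if "j \<in> A" for j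
      using c[OF that] bc[OF that] M'[OF that] S[OF that] z[OF that] by simp
  qed (use c bc M' S u in auto)
  also have "\<dots> = (\<Oplus>j\<in>A. c j \<otimes> b j \<oplus> (c j \<otimes> M' j) \<otimes> u) \<oplus> (\<Oplus>j\<in>A. c j \<otimes> ?S j)"
    using c bc M' S u by (intro finsum_addf) auto
  also have "(\<Oplus>j\<in>A. c j \<otimes> b j \<oplus> (c j \<otimes> M' j) \<otimes> u) = (\<Oplus>j\<in>A. c j \<otimes> b j) \<oplus> (\<Oplus>j\<in>A. (c j \<otimes> M' j) \<otimes> u)"
    using c bc M' u by (intro finsum_addf) auto
  also have "(\<Oplus>j\<in>A. (c j \<otimes> M' j) \<otimes> u) = (\<Oplus>j\<in>A. c j \<otimes> M' j) \<otimes> u"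
    using c M' u fin by (intro finsum_ldistr[symmetric]) auto
  finally have e2: "(\<Oplus>j\<in>A. c j \<otimes> z j) = ((\<Oplus>j\<in>A. c j \<otimes> b j) \<oplus> (\<Oplus>j\<in>A. c j \<otimes> M' j) \<otimes> u) \<oplus> (\<Oplus>j\<in>A. c j \<otimes> ?S j)" .
  have "((v \<oplus> t) \<oplus> m \<otimes> u) \<ominus> (v \<oplus> ((x \<oplus> m \<otimes> u) \<oplus> t)) = \<ominus> x"
    if "v \<in> carrier R" "t \<in> carrier R" "m \<in> carrier R" "x \<in> carrier R" for v t m x using that u by algebra
  from this[OF wc[OF p] s(3,2,1)]
  have "((\<Oplus>q\<in>P. ((if p = q then \<one> else \<zero>) \<oplus> (\<Oplus>j\<in>A. c j \<otimes> M j q)) \<otimes> w q) \<oplus> (\<Oplus>j\<in>A. c j \<otimes> M' j) \<otimes> u)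
    \<ominus> (w p \<oplus> (\<Oplus>j\<in>A. c j \<otimes> z j)) = \<ominus> (\<Oplus>j\<in>A. c j \<otimes> b j)"
    unfolding e1 e2 .
  also have "\<dots> \<in> L" using b c by (intro ideal_neg[OF L] ideal_finsum[OF L] ideal.I_l_closed[OF L])
  finally show ?thesis .
qed

definition lin_comb :: "nat \<Rightarrow> (nat \<Rightarrow> 'a) \<Rightarrow> (nat \<times> nat \<Rightarrow> 'a) \<Rightarrow> nat \<Rightarrow> 'a" where
  "lin_comb n a x i = (\<Oplus>j\<in>{..<n}. x (i, j) \<otimes> a j)"

definition comb_ideal :: "nat \<Rightarrow> nat \<Rightarrow> (nat \<Rightarrow> 'a) \<Rightarrow> (nat \<times> nat \<Rightarrow> 'a) \<Rightarrow> 'a set" where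
  "comb_ideal d n a x = Idl (lin_comb n a x ` {..<d})"

lemma lin_comb_perturb:
  assumes a: "\<And>j. j < n \<Longrightarrow> a j \<in> carrier R" and x: "x \<in> points ({..<d} \<times> {..<n})" "x0 \<in> points ({..<d} \<times> {..<n})"
    and i: "i < d" and y: "y \<in> carrier R"
  shows "lin_comb n a x i \<otimes> y = lin_comb n a x0 i \<otimes> y \<oplus> (\<Oplus>j\<in>{..<n}. (x (i, j) \<ominus> x0 (i, j)) \<otimes> (a j \<otimes> y))"
proof -
  have c: "x (i, j) \<in> carrier R" "x0 (i, j) \<in> carrier R" "a j \<in> carrier R" if "j \<in> {..<n}" for j
    using x i a that by (auto simp: points_def)
  have 1: "lin_comb n a x' i \<otimes> y = (\<Oplus>j\<in>{..<n}. x' (i, j) \<otimes> (a j \<otimes> y))"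
    if "\<And>j. j \<in> {..<n} \<Longrightarrow> x' (i, j) \<in> carrier R" for x'
  proof -
    have "lin_comb n a x' i \<otimes> y = (\<Oplus>j\<in>{..<n}. x' (i, j) \<otimes> a j \<otimes> y)"
      unfolding lin_comb_def using that a y by (intro finsum_ldistr) auto
    also have "\<dots> = (\<Oplus>j\<in>{..<n}. x' (i, j) \<otimes> (a j \<otimes> y))"
      using that a y by (intro finsum_cong') (auto simp: m_assoc)
    finally show ?thesis .
  qed
  have "(\<Oplus>j\<in>{..<n}. x (i, j) \<otimes> (a j \<otimes> y)) =
    (\<Oplus>j\<in>{..<n}. x0 (i, j) \<otimes> (a j \<otimes> y) \<oplus> (x (i, j) \<ominus> x0 (i, j)) \<otimes> (a j \<otimes> y))"
  proof (rule finsum_cong'[OF refl])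
    have split: "u \<otimes> t = v \<otimes> t \<oplus> (u \<ominus> v) \<otimes> t" if "u \<in> carrier R" "v \<in> carrier R" "t \<in> carrier R" for u v t
      using that by algebra
    show "x (i, j) \<otimes> (a j \<otimes> y) = x0 (i, j) \<otimes> (a j \<otimes> y) \<oplus> (x (i, j) \<ominus> x0 (i, j)) \<otimes> (a j \<otimes> y)"
      if "j \<in> {..<n}" for j by (rule split[OF c(1,2)[OF that] m_closed[OF c(3)[OF that] y]])
  qed (use c y in auto)
  also have "\<dots> = (\<Oplus>j\<in>{..<n}. x0 (i, j) \<otimes> (a j \<otimes> y)) \<oplus> (\<Oplus>j\<in>{..<n}. (x (i, j) \<ominus> x0 (i, j)) \<otimes> (a j \<otimes> y))"
    using c y by (intro finsum_addf) auto
  finally show ?thesis using 1[of x] 1[of x0] c by simp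
qed

lemma lin_comb_closed:
  assumes "\<And>j. j < n \<Longrightarrow> a j \<in> carrier R" "x \<in> points ({..<d} \<times> {..<n})" "i < d"
  shows "lin_comb n a x i \<in> carrier R"
  unfolding lin_comb_def using assms by (auto intro!: finsum_closed simp: points_def)

lemma comb_ideal_ideal:
  assumes "\<And>j. j < n \<Longrightarrow> a j \<in> carrier R" "x \<in> points ({..<d} \<times> {..<n})"
  shows "ideal (comb_ideal d n a x) R" and "\<And>i. i < d \<Longrightarrow> lin_comb n a x i \<in> comb_ideal d n a x"
    and "comb_ideal d n a x \<subseteq> Idl (a ` {..<n})"
proof -
  have c: "lin_comb n a x ` {..<d} \<subseteq> carrier R" using lin_comb_closed[OF assms] by auto
  have a: "a ` {..<n} \<subseteq> carrier R" using assms by auto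
  show "ideal (comb_ideal d n a x) R" unfolding comb_ideal_def by (rule genideal_ideal[OF c])
  show "\<And>i. i < d \<Longrightarrow> lin_comb n a x i \<in> comb_ideal d n a x"
    unfolding comb_ideal_def using genideal_self[OF c] by auto
  note L = genideal_ideal[OF a]
  show "comb_ideal d n a x \<subseteq> Idl (a ` {..<n})" unfolding comb_ideal_def
  proof (rule genideal_minimal[OF L], rule image_subsetI)
    fix i assume i: "i \<in> {..<d}"
    have "a j \<in> Idl (a ` {..<n})" if "j \<in> {..<n}" for j using genideal_self[OF a] that by auto
    then show "lin_comb n a x i \<in> Idl (a ` {..<n})" unfolding lin_comb_def
      using assms(2) i by (intro ideal_finsum[OF L] ideal.I_l_closed[OF L]) (auto simp: points_def)
  qed
qed

lemma polyfun_coord_diff: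
  assumes "p \<in> N" "x0 \<in> points N"
  shows "(\<lambda>x. x p \<ominus> x0 p) \<in> polyfun N"
  by (rule polyfun_diff[OF polyfun_var[OF assms(1)] polyfun.const]) (use assms in \<open>auto simp: points_def\<close>)

text \<open>Near \<open>x0\<close> the products of the generators of \<open>comb_ideal d n a x0\<close> with the generators \<open>b\<close>
  can be solved for in terms of the corresponding products at \<open>x\<close>, up to multiples of \<open>u\<close>.\<close>

lemma comb_products_cramer:
  fixes d n k :: nat
  defines "N \<equiv> {..<d} \<times> {..<n}"
  assumes a: "\<And>j. j < n \<Longrightarrow> a j \<in> carrier R" and b: "\<And>q. q < k \<Longrightarrow> b q \<in> carrier R"
    and x0: "x0 \<in> points N" and B: "ideal B R" and u: "u \<in> carrier R"
    and span: "\<And>j q. j < n \<Longrightarrow> q < k \<Longrightarrow>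
      a j \<otimes> b q \<in> ext (ext B {u}) ((\<lambda>(i, q). lin_comb n a x0 i \<otimes> b q) ` ({..<d} \<times> {..<k}))"
  obtains f D where "f \<in> polyfun N" "\<And>p. p \<in> {..<d} \<times> {..<k} \<Longrightarrow> D p \<in> polyfun N"
    "f x0 = \<one>" "\<And>p. p \<in> {..<d} \<times> {..<k} \<Longrightarrow> D p x0 = \<zero>"
    "\<And>x L i q. x \<in> points N \<Longrightarrow> ideal L R \<Longrightarrow> B \<subseteq> L \<Longrightarrow>
      (\<And>i q. i < d \<Longrightarrow> q < k \<Longrightarrow> lin_comb n a x i \<otimes> b q \<in> L) \<Longrightarrow> i < d \<Longrightarrow> q < k \<Longrightarrow>
      f x \<otimes> (lin_comb n a x0 i \<otimes> b q) \<oplus> D (i, q) x \<otimes> u \<in> L"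
proof -
  let ?P = "{..<d} \<times> {..<k}"
  define w where "w = (\<lambda>(i, q). lin_comb n a x0 i \<otimes> b q)"
  have fin: "finite ?P" by simp
  have w: "w \<in> ?P \<rightarrow> carrier R"
    using lin_comb_closed[OF a x0[unfolded N_def]] b by (auto simp: w_def)
  have wP: "w ` ?P \<subseteq> carrier R" using w by auto
  have uc: "{u} \<subseteq> carrier R" using u by simp
  have ex: "\<exists>\<beta> \<gamma> M. \<beta> \<in> B \<and> \<gamma> \<in> carrier R \<and> M \<in> ?P \<rightarrow> carrier R \<and> a j \<otimes> b q = (\<beta> \<oplus> \<gamma> \<otimes> u) \<oplus> (\<Oplus>p\<in>?P. M p \<otimes> w p)"
    if jq: "j < n" "q < k" for j q
  proof -
    have mem: "a j \<otimes> b q \<in> ext (ext B {u}) (w ` ?P)" using span[OF jq] by (simp add: w_def)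
    obtain y M where y: "y \<in> ext B {u}" "M \<in> ?P \<rightarrow> carrier R" "a j \<otimes> b q = y \<oplus> (\<Oplus>p\<in>?P. M p \<otimes> w p)"
      by (rule ext_imageE[OF fin ext_ideal[OF B uc] wP mem])
    obtain \<beta> \<gamma> where "\<beta> \<in> B" "\<gamma> \<in> carrier R" "y = \<beta> \<oplus> \<gamma> \<otimes> u" by (rule ext_singletonE[OF B u y(1)])
    then show ?thesis using y by blast
  qed
  \<comment> \<open>Each product a_j b_q gets fixed coefficients over the products at x0, u and B.
    They do not depend on x, which makes the matrix below polynomial in x.\<close>
  define pick where "pick j q = (SOME t. fst t \<in> B \<and> fst (snd t) \<in> carrier R \<and> snd (snd t) \<in> ?P \<rightarrow> carrier R \<and>
    a j \<otimes> b q = (fst t \<oplus> fst (snd t) \<otimes> u) \<oplus> (\<Oplus>p\<in>?P. snd (snd t) p \<otimes> w p))" for j q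
  define \<beta> where "\<beta> j q = fst (pick j q)" for j q
  define \<gamma> where "\<gamma> j q = fst (snd (pick j q))" for j q
  define M where "M j q = snd (snd (pick j q))" for j q
  have pick: "\<beta> j q \<in> B \<and> \<gamma> j q \<in> carrier R \<and> M j q \<in> ?P \<rightarrow> carrier R \<and>
    a j \<otimes> b q = (\<beta> j q \<oplus> \<gamma> j q \<otimes> u) \<oplus> (\<Oplus>p\<in>?P. M j q p \<otimes> w p)" if jq: "j < n" "q < k" for j q
  proof -
    have "\<exists>t. fst t \<in> B \<and> fst (snd t) \<in> carrier R \<and> snd (snd t) \<in> ?P \<rightarrow> carrier R \<and>
      a j \<otimes> b q = (fst t \<oplus> fst (snd t) \<otimes> u) \<oplus> (\<Oplus>p\<in>?P. snd (snd t) p \<otimes> w p)"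
      using ex[OF jq] by (elim exE) (rule_tac x = "(\<beta>, \<gamma>, M)" in exI, simp)
    then show ?thesis unfolding \<beta>_def \<gamma>_def M_def pick_def by (rule someI_ex)
  qed
  define C where "C p p' x = (if p = p' then \<one> else \<zero>) \<oplus>
    (\<Oplus>j\<in>{..<n}. (x (fst p, j) \<ominus> x0 (fst p, j)) \<otimes> M j (snd p) p')" for p p' x
  define c where "c p x = (\<Oplus>j\<in>{..<n}. (x (fst p, j) \<ominus> x0 (fst p, j)) \<otimes> \<gamma> j (snd p))" for p x
  have coord: "(\<lambda>x. x (fst p, j) \<ominus> x0 (fst p, j)) \<in> polyfun N" if "p \<in> ?P" "j \<in> {..<n}" for p j
    using that by (intro polyfun_coord_diff[OF _ x0]) (auto simp: N_def)
  have Mc: "M j (snd p) p' \<in> carrier R" "\<gamma> j (snd p) \<in> carrier R" "\<beta> j (snd p) \<in> B"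
    if "p \<in> ?P" "p' \<in> ?P" "j \<in> {..<n}" for p p' j using pick[of j "snd p"] that by auto
  have C1: "C p p' \<in> polyfun N" if "p \<in> ?P" "p' \<in> ?P" for p p'
  proof -
    have "(\<lambda>x. (if p = p' then \<one> else \<zero>) \<oplus> (\<Oplus>j\<in>{..<n}. (x (fst p, j) \<ominus> x0 (fst p, j)) \<otimes> M j (snd p) p')) \<in> polyfun N"
      using Mc(1)[OF that] coord[OF that(1)]
      by (intro polyfun.add polyfun.const polyfun_finsum polyfun_mult) auto
    then show ?thesis by (simp add: C_def[abs_def])
  qed
  have C2: "c p \<in> polyfun N" if "p \<in> ?P" for p
  proof -
    have "(\<lambda>x. \<Oplus>j\<in>{..<n}. (x (fst p, j) \<ominus> x0 (fst p, j)) \<otimes> \<gamma> j (snd p)) \<in> polyfun N"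
      using Mc(2)[OF that that] coord[OF that] by (intro polyfun_finsum polyfun_mult polyfun.const) auto
    then show ?thesis by (simp add: c_def[abs_def])
  qed
  have zero: "x0 (fst p, j) \<ominus> x0 (fst p, j) = \<zero>" if "p \<in> ?P" "j \<in> {..<n}" for p j
    using x0 that by (auto simp: N_def points_def r_neg a_minus_def)
  have C3: "C p p' x0 = (if p = p' then \<one> else \<zero>)" if "p \<in> ?P" "p' \<in> ?P" for p p'
  proof -
    have "(\<Oplus>j\<in>{..<n}. (x0 (fst p, j) \<ominus> x0 (fst p, j)) \<otimes> M j (snd p) p') = (\<Oplus>j\<in>{..<n}. \<zero>)"
      using zero[OF that(1)] Mc(1)[OF that] by (intro finsum_cong') auto
    then show ?thesis by (simp add: C_def)
  qed
  have C4: "c p x0 = \<zero>" if "p \<in> ?P" for p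
  proof -
    have "(\<Oplus>j\<in>{..<n}. (x0 (fst p, j) \<ominus> x0 (fst p, j)) \<otimes> \<gamma> j (snd p)) = (\<Oplus>j\<in>{..<n}. \<zero>)"
      using zero[OF that] Mc(2)[OF that that] by (intro finsum_cong') auto
    then show ?thesis by (simp add: c_def)
  qed
  have "\<exists>f D. f \<in> polyfun N \<and> (\<forall>p\<in>?P. D p \<in> polyfun N) \<and> f x0 = \<one> \<and> (\<forall>p\<in>?P. D p x0 = \<zero>) \<and>
      (\<forall>x\<in>points N. \<forall>L w u. ideal L R \<and> w \<in> ?P \<rightarrow> carrier R \<and> u \<in> carrier R \<and>
        (\<forall>p\<in>?P. (\<Oplus>q\<in>?P. C p q x \<otimes> w q) \<oplus> c p x \<otimes> u \<in> L) \<longrightarrow>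
        (\<forall>p\<in>?P. f x \<otimes> w p \<oplus> D p x \<otimes> u \<in> L))"
    by (intro polyfun_cramer[OF fin x0] C1 C2 C3 C4)
  then obtain f D where fD: "f \<in> polyfun N \<and> (\<forall>p\<in>?P. D p \<in> polyfun N) \<and> f x0 = \<one> \<and> (\<forall>p\<in>?P. D p x0 = \<zero>) \<and>
      (\<forall>x\<in>points N. \<forall>L w u. ideal L R \<and> w \<in> ?P \<rightarrow> carrier R \<and> u \<in> carrier R \<and>
        (\<forall>p\<in>?P. (\<Oplus>q\<in>?P. C p q x \<otimes> w q) \<oplus> c p x \<otimes> u \<in> L) \<longrightarrow>
        (\<forall>p\<in>?P. f x \<otimes> w p \<oplus> D p x \<otimes> u \<in> L))"
    by (elim exE)
  show thesis
  proof (rule that[of f D])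
    fix x L i q
    assume x: "x \<in> points N" and L: "ideal L R" "B \<subseteq> L"
      and mem: "\<And>i q. i < d \<Longrightarrow> q < k \<Longrightarrow> lin_comb n a x i \<otimes> b q \<in> L" and iq: "i < d" "q < k"
    have row: "(\<Oplus>q\<in>?P. C p q x \<otimes> w q) \<oplus> c p x \<otimes> u \<in> L" if p: "p \<in> ?P" for p
    proof -
      have pp: "fst p < d" "snd p < k" "b (snd p) \<in> carrier R" using p b by auto
      let ?c = "\<lambda>j. x (fst p, j) \<ominus> x0 (fst p, j)"
      have cc: "?c j \<in> carrier R" if "j \<in> {..<n}" for j
        using x x0 that p by (auto simp: N_def points_def)
      \<comment> \<open>Row p applied to the products at x0, together with its u-term, agrees modulo
        L with the corresponding product at x, which lies in L by assumption.\<close>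
      have "((\<Oplus>q\<in>?P. C p q x \<otimes> w q) \<oplus> c p x \<otimes> u) \<ominus> (w p \<oplus> (\<Oplus>j\<in>{..<n}. ?c j \<otimes> (a j \<otimes> b (snd p)))) \<in> L"
        unfolding C_def c_def
      proof (rule perturbed_row[OF L(1) _ fin p w u cc, where b = "\<lambda>j. \<beta> j (snd p)"])
        fix j assume j: "j \<in> {..<n}"
        show "\<beta> j (snd p) \<in> L" using Mc(3)[OF p p j] L(2) by auto
        show "\<gamma> j (snd p) \<in> carrier R" by (rule Mc(2)[OF p p j])
        show "a j \<otimes> b (snd p) = \<beta> j (snd p) \<oplus> \<gamma> j (snd p) \<otimes> u \<oplus> (\<Oplus>q\<in>?P. M j (snd p) q \<otimes> w q)"
          using pick[of j "snd p"] j pp by auto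
        show "M j (snd p) q \<in> carrier R" if "q \<in> ?P" for q by (rule Mc(1)[OF p that j])
      qed auto
      also have "w p \<oplus> (\<Oplus>j\<in>{..<n}. ?c j \<otimes> (a j \<otimes> b (snd p))) = lin_comb n a x (fst p) \<otimes> b (snd p)"
        using lin_comb_perturb[OF a x[unfolded N_def] x0[unfolded N_def] pp(1,3)] by (simp add: w_def case_prod_beta)
      finally have d: "((\<Oplus>q\<in>?P. C p q x \<otimes> w q) \<oplus> c p x \<otimes> u) \<ominus> lin_comb n a x (fst p) \<otimes> b (snd p) \<in> L" .
      have car: "(\<Oplus>q\<in>?P. C p q x \<otimes> w q) \<oplus> c p x \<otimes> u \<in> carrier R"
        using polyfun_closed[OF C1[OF p] x] polyfun_closed[OF C2[OF p] x] u
        by (intro a_closed finsum_closed funcsetI m_closed funcset_mem[OF w])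
      have m: "lin_comb n a x (fst p) \<otimes> b (snd p) \<in> L" by (rule mem[OF pp(1,2)])
      have "s = (s \<ominus> t) \<oplus> t" if "s \<in> carrier R" "t \<in> carrier R" for s t using that by algebra
      from this[OF car ideal.Icarr[OF L(1) m]] ideal_add[OF L(1) d m] show ?thesis by simp
    qed
    have "\<forall>p\<in>?P. f x \<otimes> w p \<oplus> D p x \<otimes> u \<in> L" using fD x L(1) w u row by simp
    then show "f x \<otimes> (lin_comb n a x0 i \<otimes> b q) \<oplus> D (i, q) x \<otimes> u \<in> L" using iq by (auto simp: w_def)
  qed (use fD in auto)
qed

end

section \<open>Open conditions: reductions and the length of \<open>I\<^sup>2 / (J I + I\<^sup>3)\<close>\<close>

context noetherian_local_inf
begin

lemma comb_ideal_prod_Idl: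
  assumes "\<And>j. j < n \<Longrightarrow> a j \<in> carrier R" "x \<in> points ({..<d} \<times> {..<n})" "\<And>q. q < k \<Longrightarrow> b q \<in> carrier R"
  shows "comb_ideal d n a x \<cdot> (Idl (b ` {..<k})) = Idl ((\<lambda>(i, q). lin_comb n a x i \<otimes> b q) ` ({..<d} \<times> {..<k}))"
proof -
  have "lin_comb n a x ` {..<d} \<subseteq> carrier R" "b ` {..<k} \<subseteq> carrier R"
    using lin_comb_closed[OF assms(1,2)] assms(3) by auto
  then have "comb_ideal d n a x \<cdot> (Idl (b ` {..<k})) =
    Idl {s \<otimes> t | s t. s \<in> lin_comb n a x ` {..<d} \<and> t \<in> b ` {..<k}}"
    unfolding comb_ideal_def by (rule ideal_prod_Idl_Idl)
  also have "{s \<otimes> t | s t. s \<in> lin_comb n a x ` {..<d} \<and> t \<in> b ` {..<k}} =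
    (\<lambda>(i, q). lin_comb n a x i \<otimes> b q) ` ({..<d} \<times> {..<k})"
    by (auto simp: image_iff)
  finally show ?thesis .
qed

lemma ideal_finite_family:
  assumes "ideal T R"
  obtains k b where "\<And>q. q < (k::nat) \<Longrightarrow> b q \<in> carrier R" "T = Idl (b ` {..<k})"
proof -
  obtain B where B: "B \<subseteq> carrier R" "finite B" "T = Idl B" using finetely_gen[OF assms] by auto
  obtain bs where bs: "set bs = B" using finite_list[OF B(2)] by auto
  have "(\<lambda>q. bs ! q) ` {..<length bs} = B" using bs by (auto simp: set_conv_nth)
  moreover have "bs ! q \<in> carrier R" if "q < length bs" for q using that bs B(1) by auto
  ultimately show thesis using that[of "length bs" "\<lambda>q. bs ! q"] B(3) by simp
qed

text \<open>The case u = 0 of the preceding relations: where the determinant is a unit, the products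
  at x0 lie in J_x T. It is used with T = I^r for the reduction equation and with T = I for the
  equality J I = I^2.\<close>

lemma comb_ideal_prod_open:
  fixes d n :: nat
  defines "N \<equiv> {..<d} \<times> {..<n}"
  assumes a: "\<And>j. j < n \<Longrightarrow> a j \<in> carrier R" and I: "I = Idl (a ` {..<n})" and T: "ideal T R"
    and x0: "x0 \<in> points N" and sub: "I \<cdot> T \<subseteq> comb_ideal d n a x0 \<cdot> T"
  obtains f where "f \<in> polyfun N" "f x0 = \<one>"
    "\<And>x. x \<in> points N \<Longrightarrow> f x \<notin> \<mm> \<Longrightarrow> I \<cdot> T \<subseteq> comb_ideal d n a x \<cdot> T"
proof -
  obtain k b where b: "\<And>q. q < (k::nat) \<Longrightarrow> b q \<in> carrier R" "T = Idl (b ` {..<k})"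
    by (rule ideal_finite_family[OF T]) blast
  have ac: "a ` {..<n} \<subseteq> carrier R" using a by auto
  have bc: "b ` {..<k} \<subseteq> carrier R" using b by auto
  let ?P = "{..<d} \<times> {..<k}"
  let ?w = "\<lambda>x (i, q). lin_comb n a x i \<otimes> b q"
  have wP: "?w x ` ?P \<subseteq> carrier R" if "x \<in> points N" for x
    using lin_comb_closed[OF a that[unfolded N_def]] b by auto
  have prod: "comb_ideal d n a x \<cdot> T = Idl (?w x ` ?P)" if "x \<in> points N" for x
    unfolding b(2) by (rule comb_ideal_prod_Idl[OF a that[unfolded N_def] b(1)])
  have z: "ideal (ext {\<zero>} {\<zero>}) R" by (rule ext_ideal[OF zeroideal]) simp
  have span: "a j \<otimes> b q \<in> ext (ext {\<zero>} {\<zero>}) (?w x0 ` ?P)" if "j < n" "q < k" for j q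
  proof -
    have "a j \<in> I" "b q \<in> T" using that genideal_self[OF ac] genideal_self[OF bc] I b(2) by auto
    then have "a j \<otimes> b q \<in> Idl (?w x0 ` ?P)" using sub ideal_prod.prod[of "a j" I "b q" T R] prod[OF x0] by auto
    also have "\<dots> \<subseteq> ext (ext {\<zero>} {\<zero>}) (?w x0 ` ?P)"
      by (rule genideal_minimal[OF ext_ideal[OF z wP[OF x0]] ext_gens[OF z wP[OF x0]]])
    finally show ?thesis .
  qed
  obtain f D where f: "f \<in> polyfun N" "f x0 = \<one>"
    and D: "\<And>p. p \<in> ?P \<Longrightarrow> D p \<in> polyfun N"
    and cr: "\<And>x L i q. x \<in> points N \<Longrightarrow> ideal L R \<Longrightarrow> {\<zero>} \<subseteq> L \<Longrightarrow>
      (\<And>i q. i < d \<Longrightarrow> q < k \<Longrightarrow> lin_comb n a x i \<otimes> b q \<in> L) \<Longrightarrow> i < d \<Longrightarrow> q < k \<Longrightarrow>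
      f x \<otimes> (lin_comb n a x0 i \<otimes> b q) \<oplus> D (i, q) x \<otimes> \<zero> \<in> L"
    by (rule comb_products_cramer[OF a b(1) x0[unfolded N_def] zeroideal zero_closed span, folded N_def]) blast+
  show thesis
  proof (rule that[of f])
    fix x assume x: "x \<in> points N" and nm: "f x \<notin> \<mm>"
    let ?L = "comb_ideal d n a x \<cdot> T"
    have L: "ideal ?L R" by (rule ideal_prod_is_ideal[OF comb_ideal_ideal(1)[OF a x[unfolded N_def]] T])
    have fx: "f x \<in> carrier R" by (rule polyfun_closed[OF f(1) x])
    have mem: "lin_comb n a x i \<otimes> b q \<in> ?L" if "i < d" "q < k" for i q
      using genideal_self[OF wP[OF x]] that unfolding prod[OF x] by auto
    have zL: "{\<zero>} \<subseteq> ?L" using ideal_zero[OF L] by simp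
    have "lin_comb n a x0 i \<otimes> b q \<in> ?L" if iq: "i < d" "q < k" for i q
    proof -
      have c: "lin_comb n a x0 i \<otimes> b q \<in> carrier R"
        using lin_comb_closed[OF a x0[unfolded N_def] iq(1)] b(1)[OF iq(2)] by simp
      have "D (i, q) x \<in> carrier R" using polyfun_closed[OF D x] iq by simp
      then have "f x \<otimes> (lin_comb n a x0 i \<otimes> b q) \<in> ?L"
        using cr[OF x L zL mem iq] c fx by simp
      then show ?thesis by (rule unit_cancel[OF L fx nm c])
    qed
    then have "Idl (?w x0 ` ?P) \<subseteq> ?L" by (intro genideal_minimal[OF L]) auto
    then show "I \<cdot> T \<subseteq> ?L" using sub prod[OF x0] by auto
  qed (fact f)+
qed

text \<open>\<open>I\<^sup>2 / (J I + I\<^sup>3)\<close> has length at most one.\<close>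

definition small_quotient :: "'a set \<Rightarrow> 'a set \<Rightarrow> bool" where
  "small_quotient J I \<longleftrightarrow> (\<exists>w\<in>I \<cdot> I. I \<cdot> I \<subseteq> ext (ext (J \<cdot> I) (I \<cdot> (I \<cdot> I))) {w} \<and>
    (\<forall>e\<in>\<mm>. e \<otimes> w \<in> ext (J \<cdot> I) (I \<cdot> (I \<cdot> I))))"

lemma small_quotientI_eq:
  assumes I: "ideal I R" and J: "ideal J R" and sub: "I \<cdot> I \<subseteq> J \<cdot> I"
  shows "small_quotient J I"
proof -
  have i: "ideal (I \<cdot> I) R" "ideal (J \<cdot> I) R" "ideal (I \<cdot> (I \<cdot> I)) R"
    by (intro ideal_prod_is_ideal I J)+
  note L = ext_ideal[OF i(2) ideal_subset[OF i(3)]]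
  have z: "{\<zero>} \<subseteq> carrier R" by simp
  have "I \<cdot> I \<subseteq> ext (ext (J \<cdot> I) (I \<cdot> (I \<cdot> I))) {\<zero>}"
    using sub ext_base[OF i(2) ideal_subset[OF i(3)]] ext_base[OF L z] by blast
  then show ?thesis unfolding small_quotient_def
    using ideal_zero[OF i(1)] ideal_zero[OF L] m_carrier by (intro bexI[of _ \<zero>]) auto
qed

text \<open>Since I \<subseteq> \<mm>, the cube of I lies in \<mm> I^2 and is absorbed by
  Nakayama.\<close>

lemma nakayama_cube:
  assumes I: "ideal I R" "I \<subseteq> \<mm>" and J: "ideal J R" and sub: "I \<cdot> I \<subseteq> ext (J \<cdot> I) (I \<cdot> (I \<cdot> I))"
  shows "I \<cdot> I \<subseteq> J \<cdot> I"
proof (rule nakayama)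
  have i: "ideal (I \<cdot> I) R" "ideal (J \<cdot> I) R" by (intro ideal_prod_is_ideal I J)+
  show "ideal (I \<cdot> I) R" "ideal (J \<cdot> I) R" by fact+
  have m: "\<mm> \<cdot> (I \<cdot> I) \<subseteq> carrier R" using ideal_subset[OF ideal_prod_is_ideal[OF m_ideal i(1)]] .
  show "I \<cdot> I \<subseteq> ext (J \<cdot> I) (\<mm> \<cdot> (I \<cdot> I))"
    using sub ext_mono[OF i(2) m subset_refl ideal_prod_mono[OF I(2) subset_refl]] by blast
qed

text \<open>If no \<open>comb_ideal d n a x\<close> satisfies \<open>J I = I\<^sup>2\<close>, the Cramer relations for the generators of
  \<open>\<mm> w\<close> have all their values, hence their coefficients, in \<open>\<mm>\<close>; modulo \<open>\<mm>\<^sup>2\<close> they depend only on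
  residues, and at \<open>x0\<close> they express the generators of \<open>\<mm>\<close> themselves.\<close>

lemma small_quotient_open:
  fixes d n :: nat
  defines "N \<equiv> {..<d} \<times> {..<n}"
  assumes a: "\<And>j. j < n \<Longrightarrow> a j \<in> carrier R" and I: "I = Idl (a ` {..<n})" "I \<subseteq> \<mm>"
    and x0: "x0 \<in> points N" and sq: "small_quotient (comb_ideal d n a x0) I"
  obtains f x1 where "f \<in> polyfun N" "x1 \<in> points N" "f x1 \<notin> \<mm>"
    "\<And>x. x \<in> points N \<Longrightarrow> f x \<notin> \<mm> \<Longrightarrow> small_quotient (comb_ideal d n a x) I"
proof -
  have ac: "a ` {..<n} \<subseteq> carrier R" using a by auto
  have Ii: "ideal I R" unfolding I by (rule genideal_ideal[OF ac])
  have aI: "a j \<in> I" if "j < n" for j using that genideal_self[OF ac] I by auto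
  have Ji: "ideal (comb_ideal d n a x) R" if "x \<in> points N" for x
    by (rule comb_ideal_ideal(1)[OF a that[unfolded N_def]])
  show thesis
  \<comment> \<open>If some matrix makes the quotient vanish, this stronger property is already open
    and satisfiable, though its witness need not be x0. Otherwise the quotient is nonzero for every
    x, which becomes a statement about all values of the relations below.\<close>
  proof (cases "\<exists>x1\<in>points N. I \<cdot> I \<subseteq> comb_ideal d n a x1 \<cdot> I")
    case True
    then obtain x1 where x1: "x1 \<in> points N" "I \<cdot> I \<subseteq> comb_ideal d n a x1 \<cdot> I" by blast
    obtain f where f: "f \<in> polyfun N" "f x1 = \<one>"
      "\<And>x. x \<in> points N \<Longrightarrow> f x \<notin> \<mm> \<Longrightarrow> I \<cdot> I \<subseteq> comb_ideal d n a x \<cdot> I"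
      using comb_ideal_prod_open[OF a I(1) Ii x1(1)[unfolded N_def] x1(2), folded N_def] by blast
    show ?thesis
    proof (rule that[OF f(1) x1(1)])
      show "f x1 \<notin> \<mm>" using f(2) one_notin_m by simp
      show "small_quotient (comb_ideal d n a x) I" if "x \<in> points N" "f x \<notin> \<mm>" for x
        by (rule small_quotientI_eq[OF Ii Ji[OF that(1)] f(3)[OF that]])
    qed
  next
    case False
    let ?J = "comb_ideal d n a" and ?I3 = "I \<cdot> (I \<cdot> I)"
    let ?w = "\<lambda>x (i, q). lin_comb n a x i \<otimes> a q"
    have I3: "ideal ?I3 R" and I2: "ideal (I \<cdot> I) R" by (intro ideal_prod_is_ideal Ii)+
    define L where "L x = ext (?J x \<cdot> I) ?I3" for x
    have JI: "ideal (?J x \<cdot> I) R" if "x \<in> points N" for x by (rule ideal_prod_is_ideal[OF Ji[OF that] Ii])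
    have L: "ideal (L x) R" "?J x \<cdot> I \<subseteq> L x" "?I3 \<subseteq> L x" if "x \<in> points N" for x
      unfolding L_def using ext_ideal[OF JI[OF that] ideal_subset[OF I3]] ext_base[OF JI[OF that] ideal_subset[OF I3]]
        ext_gens[OF JI[OF that] ideal_subset[OF I3]] by auto
    obtain u where u: "u \<in> I \<cdot> I" "I \<cdot> I \<subseteq> ext (L x0) {u}" "\<And>e. e \<in> \<mm> \<Longrightarrow> e \<otimes> u \<in> L x0"
      using sq unfolding small_quotient_def L_def by blast
    have uc: "u \<in> carrier R" "{u} \<subseteq> carrier R" using ideal.Icarr[OF I2 u(1)] by auto
    have wP: "?w x ` N \<subseteq> carrier R" if "x \<in> points N" for x
      using lin_comb_closed[OF a that[unfolded N_def]] a by (auto simp: N_def)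
    have prod: "?J x \<cdot> I = Idl (?w x ` N)" if "x \<in> points N" for x
      unfolding I(1) N_def by (rule comb_ideal_prod_Idl[OF a that[unfolded N_def] a])
    have mem: "lin_comb n a x i \<otimes> a q \<in> L x" if "x \<in> points N" "i < d" "q < n" for x i q
      using genideal_self[OF wP[OF that(1)]] that L(2)[OF that(1)] unfolding prod[OF that(1)] by (auto simp: N_def)
    have L0: "L x0 = ext ?I3 (?w x0 ` N)"
    proof -
      have "L x0 = Idl ((?J x0 \<cdot> I) \<union> ?I3)" by (simp add: L_def ext_def)
      also have "\<dots> = ext ?I3 (?J x0 \<cdot> I)" by (simp add: ext_def Un_commute)
      also have "\<dots> = ext ?I3 (?w x0 ` N)" unfolding prod[OF x0] by (rule ext_Idl[OF I3 wP[OF x0]])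
      finally show ?thesis .
    qed
    have L0u: "ext (L x0) {u} = ext (ext ?I3 {u}) (?w x0 ` N)"
      unfolding L0 using ext_ext[OF I3 wP[OF x0] uc(2)] ext_ext[OF I3 uc(2) wP[OF x0]] by (simp add: Un_commute)
    have span: "a j \<otimes> a q \<in> ext (ext ?I3 {u}) (?w x0 ` N)" if "j < n" "q < n" for j q
      using u(2) ideal_prod.prod[OF aI[OF that(1)] aI[OF that(2)], of R] unfolding L0u by auto
    obtain f D where f: "f \<in> polyfun N" and D: "\<And>p. p \<in> N \<Longrightarrow> D p \<in> polyfun N"
      and f0: "f x0 = \<one>" and D0: "\<And>p. p \<in> N \<Longrightarrow> D p x0 = \<zero>"
      and cr: "\<And>x L i q. x \<in> points N \<Longrightarrow> ideal L R \<Longrightarrow> ?I3 \<subseteq> L \<Longrightarrow>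
        (\<And>i q. i < d \<Longrightarrow> q < n \<Longrightarrow> lin_comb n a x i \<otimes> a q \<in> L) \<Longrightarrow> i < d \<Longrightarrow> q < n \<Longrightarrow>
        f x \<otimes> (lin_comb n a x0 i \<otimes> a q) \<oplus> D (i, q) x \<otimes> u \<in> L"
      by (rule comb_products_cramer[OF a a x0[unfolded N_def] I3 uc(1) span[unfolded N_def], folded N_def]) blast+
    have fc: "f x \<in> carrier R" if "x \<in> points N" for x by (rule polyfun_closed[OF f that])
    have Dc: "D p x \<in> carrier R" if "p \<in> N" "x \<in> points N" for p x by (rule polyfun_closed[OF D[OF that(1)] that(2)])
    have wc: "?w x0 p \<in> carrier R" if "p \<in> N" for p using wP[OF x0] that by blast
    have crP: "f x \<otimes> ?w x0 p \<oplus> D p x \<otimes> u \<in> L x" if "p \<in> N" "x \<in> points N" for p x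
      using cr[OF that(2) L(1,3)[OF that(2)] mem[OF that(2)], of "fst p" "snd p"] that(1) by (auto simp: case_prod_beta N_def)
    obtain G e where e: "\<And>i. i < (G::nat) \<Longrightarrow> e i \<in> carrier R" "\<mm> = Idl (e ` {..<G})"
      by (rule ideal_finite_family[OF m_ideal]) blast
    have ec: "e ` {..<G} \<subseteq> carrier R" using e by auto
    have em: "e i \<in> \<mm>" if "i < G" for i using genideal_self[OF ec] e(2) that by auto
    have Nfin: "finite N" by (simp add: N_def)
    have "\<exists>r. \<forall>i<G. r i \<in> N \<rightarrow> carrier R \<and> (\<exists>k\<in>?I3. e i \<otimes> u = k \<oplus> (\<Oplus>p\<in>N. r i p \<otimes> ?w x0 p))"
    proof -
      have ex: "\<exists>r. r \<in> N \<rightarrow> carrier R \<and> (\<exists>k\<in>?I3. e i \<otimes> u = k \<oplus> (\<Oplus>p\<in>N. r p \<otimes> ?w x0 p))" if "i < G" for i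
      proof -
        have mem: "e i \<otimes> u \<in> ext ?I3 (?w x0 ` N)" using u(3)[OF em[OF that]] unfolding L0 .
        obtain k r where "k \<in> ?I3" "r \<in> N \<rightarrow> carrier R" "e i \<otimes> u = k \<oplus> (\<Oplus>p\<in>N. r p \<otimes> ?w x0 p)"
          by (rule ext_imageE[OF Nfin I3 wP[OF x0] mem])
        then show ?thesis by (intro exI[of _ r] conjI bexI[of _ k])
      qed
      show ?thesis
      proof (intro choice allI)
        fix i
        show "\<exists>r. i < G \<longrightarrow> r \<in> N \<rightarrow> carrier R \<and> (\<exists>k\<in>?I3. e i \<otimes> u = k \<oplus> (\<Oplus>p\<in>N. r p \<otimes> ?w x0 p))"
        proof (cases "i < G")
          case True
          from ex[OF this] show ?thesis by (elim exE) (rule exI, rule impI)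
        qed simp
      qed
    qed
    then obtain r where r: "\<And>i. i < G \<Longrightarrow> r i \<in> N \<rightarrow> carrier R"
      "\<And>i. i < G \<Longrightarrow> \<exists>k\<in>?I3. e i \<otimes> u = k \<oplus> (\<Oplus>p\<in>N. r i p \<otimes> ?w x0 p)" by blast
    have rc: "r i p \<in> carrier R" if "i < G" "p \<in> N" for i p using r(1)[OF that(1)] that(2) by auto
    \<comment> \<open>Multiply the relation for e_i u at x0 by f x and replace each product at x0 by
      its Cramer expression in u: what remains is \<psi> i x times u, in L x. At x0 this coefficient
      is e_i.\<close>
    define \<psi> where "\<psi> i x = f x \<otimes> e i \<oplus> (\<Oplus>p\<in>N. r i p \<otimes> D p x)" for i x
    have \<psi>: "\<psi> i \<in> polyfun N" if "i < G" for i
    proof -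
      have "(\<lambda>x. f x \<otimes> e i \<oplus> (\<Oplus>p\<in>N. r i p \<otimes> D p x)) \<in> polyfun N"
        using that rc by (intro polyfun.add polyfun_mult f D polyfun.const e polyfun_finsum) auto
      then show ?thesis by (simp add: \<psi>_def[abs_def])
    qed
    have \<psi>0: "\<psi> i x0 = e i" if "i < G" for i
    proof -
      have "(\<Oplus>p\<in>N. r i p \<otimes> D p x0) = (\<Oplus>p\<in>N. \<zero>)" using rc[OF that] D0 by (intro finsum_cong') auto
      then show ?thesis using f0 e(1)[OF that] by (simp add: \<psi>_def)
    qed
    have \<psi>u: "\<psi> i x \<otimes> u \<in> L x" if i: "i < G" and x: "x \<in> points N" for i x
    proof -
      obtain k where k: "k \<in> ?I3" "e i \<otimes> u = k \<oplus> (\<Oplus>p\<in>N. r i p \<otimes> ?w x0 p)" using r(2)[OF i] by blast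
      have kc: "k \<in> carrier R" by (rule ideal.Icarr[OF I3 k(1)])
      have "(\<Oplus>p\<in>N. r i p \<otimes> (f x \<otimes> ?w x0 p \<oplus> D p x \<otimes> u)) =
        (\<Oplus>p\<in>N. f x \<otimes> (r i p \<otimes> ?w x0 p) \<oplus> (r i p \<otimes> D p x) \<otimes> u)"
      proof (rule finsum_cong'[OF refl])
        have dist: "s \<otimes> (g \<otimes> v \<oplus> t \<otimes> u) = g \<otimes> (s \<otimes> v) \<oplus> (s \<otimes> t) \<otimes> u"
          if "s \<in> carrier R" "g \<in> carrier R" "v \<in> carrier R" "t \<in> carrier R" for s g v t using that uc(1) by algebra
        show "r i p \<otimes> (f x \<otimes> ?w x0 p \<oplus> D p x \<otimes> u) = f x \<otimes> (r i p \<otimes> ?w x0 p) \<oplus> (r i p \<otimes> D p x) \<otimes> u" if "p \<in> N" for p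
          by (rule dist[OF rc[OF i that] fc[OF x] wc[OF that] Dc[OF that x]])
        show "(\<lambda>p. f x \<otimes> (r i p \<otimes> ?w x0 p) \<oplus> (r i p \<otimes> D p x) \<otimes> u) \<in> N \<rightarrow> carrier R"
          using rc[OF i] fc[OF x] wc Dc[OF _ x] uc(1) by (intro funcsetI a_closed m_closed)
      qed
      also have "\<dots> = (\<Oplus>p\<in>N. f x \<otimes> (r i p \<otimes> ?w x0 p)) \<oplus> (\<Oplus>p\<in>N. (r i p \<otimes> D p x) \<otimes> u)"
        using rc[OF i] fc[OF x] wc Dc[OF _ x] uc(1) by (intro finsum_addf funcsetI m_closed)
      also have "\<dots> = f x \<otimes> (\<Oplus>p\<in>N. r i p \<otimes> ?w x0 p) \<oplus> (\<Oplus>p\<in>N. r i p \<otimes> D p x) \<otimes> u"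
        using finsum_rdistr[OF Nfin, of "f x" "\<lambda>p. r i p \<otimes> ?w x0 p"] finsum_ldistr[OF Nfin, of u "\<lambda>p. r i p \<otimes> D p x"]
          rc[OF i] fc[OF x] wc Dc[OF _ x] uc(1) by (simp add: Pi_iff)
      finally have s: "(\<Oplus>p\<in>N. r i p \<otimes> (f x \<otimes> ?w x0 p \<oplus> D p x \<otimes> u)) =
        f x \<otimes> (\<Oplus>p\<in>N. r i p \<otimes> ?w x0 p) \<oplus> (\<Oplus>p\<in>N. r i p \<otimes> D p x) \<otimes> u" .
      have sL: "(\<Oplus>p\<in>N. r i p \<otimes> (f x \<otimes> ?w x0 p \<oplus> D p x \<otimes> u)) \<in> L x"
        using crP[OF _ x] rc[OF i] by (intro ideal_finsum[OF L(1)[OF x]] ideal.I_l_closed[OF L(1)[OF x]])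
      have fk: "f x \<otimes> k \<in> L x" using k(1) L(3)[OF x] ideal.I_l_closed[OF L(1)[OF x] _ fc[OF x]] by auto
      have S1: "(\<Oplus>p\<in>N. r i p \<otimes> ?w x0 p) \<in> carrier R"
        by (intro finsum_closed funcsetI m_closed rc[OF i] wc)
      have S2: "(\<Oplus>p\<in>N. r i p \<otimes> D p x) \<in> carrier R"
        by (intro finsum_closed funcsetI m_closed rc[OF i] Dc[OF _ x])
      have id: "(g \<otimes> v \<oplus> t) \<otimes> u = g \<otimes> k \<oplus> (g \<otimes> s \<oplus> t \<otimes> u)"
        if "v \<otimes> u = k \<oplus> s" "g \<in> carrier R" "v \<in> carrier R" "t \<in> carrier R" "s \<in> carrier R" for g v t s
      proof -
        have "(g \<otimes> v \<oplus> t) \<otimes> u = g \<otimes> (v \<otimes> u) \<oplus> t \<otimes> u" using that(2-) uc(1) by algebra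
        also have "\<dots> = g \<otimes> (k \<oplus> s) \<oplus> t \<otimes> u" using that(1) by simp
        also have "\<dots> = g \<otimes> k \<oplus> (g \<otimes> s \<oplus> t \<otimes> u)" using that(2-) uc(1) kc by algebra
        finally show ?thesis .
      qed
      have "\<psi> i x \<otimes> u = f x \<otimes> k \<oplus> (f x \<otimes> (\<Oplus>p\<in>N. r i p \<otimes> ?w x0 p) \<oplus> (\<Oplus>p\<in>N. r i p \<otimes> D p x) \<otimes> u)"
        unfolding \<psi>_def by (rule id[OF k(2) fc[OF x] e(1)[OF i] S2 S1])
      also have "\<dots> \<in> L x" using ideal_add[OF L(1)[OF x] fk sL] unfolding s .
      finally show ?thesis .
    qed
    have \<psi>c: "\<psi> i x \<in> carrier R" if "i < G" "x \<in> points N" for i x by (rule polyfun_closed[OF \<psi>[OF that(1)] that(2)])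
    have solve: "?w x0 p \<in> M" if M: "ideal M R" "L x \<subseteq> M" "u \<in> M" and x: "x \<in> points N" "f x \<notin> \<mm>" and p: "p \<in> N" for M x p
    proof -
      have "D p x \<otimes> u \<oplus> f x \<otimes> ?w x0 p \<in> M"
        using crP[OF p x(1)] M(2) fc[OF x(1)] wc[OF p] Dc[OF p x(1)] uc(1) by (auto simp: a_comm)
      then have "f x \<otimes> ?w x0 p \<in> M"
        using ideal_add_cancel_left[OF M(1) ideal.I_l_closed[OF M(1,3) Dc[OF p x(1)]]] fc[OF x(1)] wc[OF p] by simp
      then show ?thesis by (rule unit_cancel[OF M(1) fc[OF x(1)] x(2) wc[OF p]])
    qed
    \<comment> \<open>Once u is adjoined to L x, the Cramer relations can be solved for the products
      at x0, and these together with u and I^3 generate an ideal containing I^2.\<close>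
    have cover: "I \<cdot> I \<subseteq> M" if M: "ideal M R" "L x \<subseteq> M" "u \<in> M" and x: "x \<in> points N" "f x \<notin> \<mm>" for M x
    proof -
      have "ext (ext ?I3 {u}) (?w x0 ` N) \<subseteq> M"
        using solve[OF M x] L(3)[OF x(1)] M(2,3) by (intro ext_minimal[OF M(1)] image_subsetI) auto
      then show ?thesis using u(2) unfolding L0u by blast
    qed
    \<comment> \<open>A unit value would put u into L x, hence I^2 into J_x I + I^3 and by Nakayama
      into J_x I, which is excluded in this case.\<close>
    have f\<psi>m: "f x \<otimes> \<psi> i x \<in> \<mm>" if i: "i < G" and x: "x \<in> points N" for i x
    proof (rule ccontr)
      assume nm: "f x \<otimes> \<psi> i x \<notin> \<mm>"
      have fm: "f x \<notin> \<mm>" using nm ideal.I_r_closed[OF m_ideal _ \<psi>c[OF i x]] by blast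
      have pm: "\<psi> i x \<notin> \<mm>" using nm ideal.I_l_closed[OF m_ideal _ fc[OF x]] by blast
      have uL: "u \<in> L x" by (rule unit_cancel[OF L(1)[OF x] \<psi>c[OF i x] pm uc(1) \<psi>u[OF i x]])
      have "I \<cdot> I \<subseteq> L x" by (rule cover[OF L(1)[OF x] subset_refl uL x fm])
      then have "I \<cdot> I \<subseteq> ?J x \<cdot> I" unfolding L_def by (rule nakayama_cube[OF Ii I(2) Ji[OF x]])
      then show False using False x by blast
    qed
    have "\<exists>\<Psi>. \<forall>i<G. (\<forall>j<G. \<Psi> i j \<in> polyfun N) \<and>
      (\<forall>x\<in>points N. f x \<otimes> \<psi> i x = (\<Oplus>j\<in>{..<G}. e j \<otimes> \<Psi> i j x))"
    proof (intro choice allI)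
      fix i
      show "\<exists>fs. i < G \<longrightarrow> (\<forall>j<G. fs j \<in> polyfun N) \<and>
        (\<forall>x\<in>points N. f x \<otimes> \<psi> i x = (\<Oplus>j\<in>{..<G}. e j \<otimes> fs j x))"
      proof (cases "i < G")
        case True
        have "(\<lambda>x. f x \<otimes> \<psi> i x) \<in> combos e G N"
          by (rule polyfun_into_m[OF e Nfin polyfun_mult[OF f \<psi>[OF True]] f\<psi>m[OF True]])
        then show ?thesis unfolding combos_def by blast
      qed simp
    qed
    then obtain \<Psi> where \<Psi>: "\<And>i j. i < G \<Longrightarrow> j < G \<Longrightarrow> \<Psi> i j \<in> polyfun N"
      and f\<psi>: "\<And>i x. i < G \<Longrightarrow> x \<in> points N \<Longrightarrow> f x \<otimes> \<psi> i x = (\<Oplus>j\<in>{..<G}. e j \<otimes> \<Psi> i j x)" by blast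
    have \<Psi>c: "\<Psi> i j x \<in> carrier R" if "i < G" "j < G" "x \<in> points N" for i j x
      by (rule polyfun_closed[OF \<Psi>[OF that(1,2)] that(3)])
    \<comment> \<open>The matrix \<Psi> at x0 need not be the identity; it only maps the vector e of
      generators to itself. Subtracting its value at x0 and adding the identity therefore leaves the
      product with e unchanged while making the matrix the identity at x0, as elimination
      requires.\<close>
    let ?C = "\<lambda>i j x. (\<Psi> i j x \<ominus> \<Psi> i j x0) \<oplus> (if i = j then \<one> else \<zero>)"
    have "\<exists>g D. g \<in> polyfun N \<and> (\<forall>p\<in>{..<G}. D p \<in> polyfun N) \<and> g x0 = \<one> \<and> (\<forall>p\<in>{..<G}. D p x0 = \<zero>) \<and>
      (\<forall>x\<in>points N. \<forall>L w u. ideal L R \<and> w \<in> {..<G} \<rightarrow> carrier R \<and> u \<in> carrier R \<and>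
        (\<forall>p\<in>{..<G}. (\<Oplus>q\<in>{..<G}. ?C p q x \<otimes> w q) \<oplus> \<zero> \<otimes> u \<in> L) \<longrightarrow>
        (\<forall>p\<in>{..<G}. g x \<otimes> w p \<oplus> D p x \<otimes> u \<in> L))"
    proof (rule polyfun_cramer[OF finite_lessThan x0])
      fix i j assume ij: "i \<in> {..<G}" "j \<in> {..<G}"
      show "?C i j \<in> polyfun N"
        using ij x0 by (intro polyfun.add polyfun_diff polyfun.const \<Psi>) (auto simp: \<Psi>c)
      show "?C i j x0 = (if i = j then \<one> else \<zero>)"
        using \<Psi>c[of i j x0] ij x0 by (auto simp: a_minus_def r_neg)
    qed (auto intro: polyfun.const)
    then obtain g D' where g: "g \<in> polyfun N" "g x0 = \<one>" and D': "\<forall>p\<in>{..<G}. D' p \<in> polyfun N"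
      and gcr: "\<forall>x\<in>points N. \<forall>L w u. ideal L R \<and> w \<in> {..<G} \<rightarrow> carrier R \<and> u \<in> carrier R \<and>
        (\<forall>p\<in>{..<G}. (\<Oplus>q\<in>{..<G}. ?C p q x \<otimes> w q) \<oplus> \<zero> \<otimes> u \<in> L) \<longrightarrow>
        (\<forall>p\<in>{..<G}. g x \<otimes> w p \<oplus> D' p x \<otimes> u \<in> L)"
      by (elim exE conjE)
    \<comment> \<open>The rows of \<open>?C\<close> applied to the vector e u give f x times \<psi>
      i x times u, which lies in L x; where the determinant g is a unit, each e_j u follows.\<close>
    have eu: "e j \<otimes> u \<in> L x" if x: "x \<in> points N" and gm: "g x \<notin> \<mm>" and j: "j < G" for x j
    proof -
      have gc: "g x \<in> carrier R" by (rule polyfun_closed[OF g(1) x])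
      have row: "(\<Oplus>q\<in>{..<G}. ?C i q x \<otimes> (e q \<otimes> u)) \<oplus> \<zero> \<otimes> \<zero> \<in> L x" if i: "i < G" for i
      proof -
        have ec': "e q \<in> carrier R" "\<Psi> i q x \<in> carrier R" "\<Psi> i q x0 \<in> carrier R" if "q \<in> {..<G}" for q
          using e(1) \<Psi>c[OF i] that x x0 by auto
        have dc: "(if i = q then \<one> else \<zero>) \<in> carrier R" for q by simp
        have "(\<Oplus>q\<in>{..<G}. ?C i q x \<otimes> (e q \<otimes> u)) =
          (\<Oplus>q\<in>{..<G}. ((e q \<otimes> \<Psi> i q x \<ominus> e q \<otimes> \<Psi> i q x0) \<oplus> (if i = q then \<one> else \<zero>) \<otimes> e q) \<otimes> u)"
        proof (rule finsum_cong'[OF refl])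
          have dist: "((s \<ominus> t) \<oplus> \<delta>) \<otimes> (v \<otimes> u) = ((v \<otimes> s \<ominus> v \<otimes> t) \<oplus> \<delta> \<otimes> v) \<otimes> u"
            if "s \<in> carrier R" "t \<in> carrier R" "\<delta> \<in> carrier R" "v \<in> carrier R" for s t \<delta> v using that uc(1) by algebra
          show "?C i q x \<otimes> (e q \<otimes> u) = ((e q \<otimes> \<Psi> i q x \<ominus> e q \<otimes> \<Psi> i q x0) \<oplus> (if i = q then \<one> else \<zero>) \<otimes> e q) \<otimes> u"
            if "q \<in> {..<G}" for q by (rule dist[OF ec'(2,3)[OF that] dc ec'(1)[OF that]])
        qed (use ec' uc(1) in auto)
        also have "\<dots> = (\<Oplus>q\<in>{..<G}. (e q \<otimes> \<Psi> i q x \<ominus> e q \<otimes> \<Psi> i q x0) \<oplus> (if i = q then \<one> else \<zero>) \<otimes> e q) \<otimes> u"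
          using ec' uc(1) by (intro finsum_ldistr[symmetric]) auto
        also have "(\<Oplus>q\<in>{..<G}. (e q \<otimes> \<Psi> i q x \<ominus> e q \<otimes> \<Psi> i q x0) \<oplus> (if i = q then \<one> else \<zero>) \<otimes> e q) =
          (\<Oplus>q\<in>{..<G}. e q \<otimes> \<Psi> i q x \<ominus> e q \<otimes> \<Psi> i q x0) \<oplus> (\<Oplus>q\<in>{..<G}. (if i = q then \<one> else \<zero>) \<otimes> e q)"
          using ec' by (intro finsum_addf) auto
        also have "(\<Oplus>q\<in>{..<G}. e q \<otimes> \<Psi> i q x \<ominus> e q \<otimes> \<Psi> i q x0) = f x \<otimes> \<psi> i x \<ominus> f x0 \<otimes> \<psi> i x0"
          unfolding f\<psi>[OF i x] f\<psi>[OF i x0] using ec' by (intro finsum_diff[symmetric]) auto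
        also have "(\<Oplus>q\<in>{..<G}. (if i = q then \<one> else \<zero>) \<otimes> e q) = e i"
          using i e(1) by (intro finsum_delta) auto
        also have "f x \<otimes> \<psi> i x \<ominus> f x0 \<otimes> \<psi> i x0 \<oplus> e i = f x \<otimes> \<psi> i x"
        proof -
          have "(v \<ominus> \<one> \<otimes> t) \<oplus> t = v" if "v \<in> carrier R" "t \<in> carrier R" for v t using that by algebra
          from this[OF m_closed[OF fc[OF x] \<psi>c[OF i x]] e(1)[OF i]] show ?thesis unfolding f0 \<psi>0[OF i] .
        qed
        finally have eq: "(\<Oplus>q\<in>{..<G}. ?C i q x \<otimes> (e q \<otimes> u)) = f x \<otimes> \<psi> i x \<otimes> u" .
        have "f x \<otimes> \<psi> i x \<otimes> u \<in> L x"
          using ideal.I_l_closed[OF L(1)[OF x] \<psi>u[OF i x] fc[OF x]] fc[OF x] \<psi>c[OF i x] uc(1) by (simp add: m_assoc)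
        then show ?thesis unfolding eq using ideal.Icarr[OF L(1)[OF x]] by simp
      qed
      have "g x \<otimes> (e j \<otimes> u) \<oplus> D' j x \<otimes> \<zero> \<in> L x"
      proof -
        have "(\<lambda>q. e q \<otimes> u) \<in> {..<G} \<rightarrow> carrier R" using e(1) uc(1) by auto
        then have "\<forall>p\<in>{..<G}. g x \<otimes> (e p \<otimes> u) \<oplus> D' p x \<otimes> \<zero> \<in> L x"
          using bspec[OF gcr x, THEN spec[of _ "L x"], THEN spec[of _ "\<lambda>q. e q \<otimes> u"], THEN spec[of _ \<zero>]] L(1)[OF x] row
          by blast
        then show ?thesis using j by blast
      qed
      moreover have "D' j x \<in> carrier R" using polyfun_closed[OF _ x] D' j by blast
      ultimately have "g x \<otimes> (e j \<otimes> u) \<in> L x" using gc e(1)[OF j] uc(1) by simp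
      then show ?thesis by (rule unit_cancel[OF L(1)[OF x] gc gm m_closed[OF e(1)[OF j] uc(1)]])
    qed
    show ?thesis
    proof (rule that[of "\<lambda>x. f x \<otimes> g x" x0])
      show "(\<lambda>x. f x \<otimes> g x) \<in> polyfun N" by (rule polyfun_mult[OF f g(1)])
      show "x0 \<in> points N" by (rule x0)
      show "f x0 \<otimes> g x0 \<notin> \<mm>" using f0 g(2) one_notin_m by simp
      fix x assume x: "x \<in> points N" and nm: "f x \<otimes> g x \<notin> \<mm>"
      have gc: "g x \<in> carrier R" by (rule polyfun_closed[OF g(1) x])
      have fm: "f x \<notin> \<mm>" using nm ideal.I_r_closed[OF m_ideal _ gc] by blast
      have gm: "g x \<notin> \<mm>" using nm ideal.I_l_closed[OF m_ideal _ fc[OF x]] by blast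
      note Lx = L(1)[OF x]
      have "\<mm> \<subseteq> {t \<in> carrier R. \<forall>s\<in>{u}. t \<otimes> s \<in> L x}"
        unfolding e(2) by (rule genideal_minimal[OF ideal_colon[OF Lx uc(2)]]) (use eu[OF x gm] e(1) in auto)
      then have mu: "\<forall>t\<in>\<mm>. t \<otimes> u \<in> L x" by blast
      have "I \<cdot> I \<subseteq> ext (L x) {u}"
        using ext_gens[OF Lx uc(2)]
        by (intro cover[OF ext_ideal[OF Lx uc(2)] ext_base[OF Lx uc(2)] _ x fm]) auto
      then show "small_quotient (?J x) I" unfolding small_quotient_def using u(1) mu unfolding L_def by blast
    qed
  qed
qed

end

section \<open>Open conditions: \<open>J \<inter> I\<^sup>2 = J I\<close>\<close>

context cring
begin

lemma finsum_Times:
  assumes "finite A" "finite B"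
  shows "h \<in> A \<times> B \<rightarrow> carrier R \<Longrightarrow> (\<Oplus>p\<in>A \<times> B. h p) = (\<Oplus>i\<in>A. \<Oplus>j\<in>B. h (i, j))"
  using assms(1)
proof (induction A rule: finite_induct)
  case (insert i A)
  have h: "h (i', j) \<in> carrier R" if "i' \<in> insert i A" "j \<in> B" for i' j using insert.prems that by auto
  have "insert i A \<times> B = Pair i ` B \<union> A \<times> B" by auto
  moreover have "(\<Oplus>p\<in>Pair i ` B \<union> A \<times> B. h p) = (\<Oplus>p\<in>Pair i ` B. h p) \<oplus> (\<Oplus>p\<in>A \<times> B. h p)"
    using insert.hyps assms(2) h by (intro finsum_Un_disjoint) auto
  moreover have "(\<Oplus>p\<in>Pair i ` B. h p) = (\<Oplus>j\<in>B. h (i, j))"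
    using h by (intro finsum_reindex) (auto simp: inj_on_def)
  moreover have "(\<Oplus>p\<in>A \<times> B. h p) = (\<Oplus>i\<in>A. \<Oplus>j\<in>B. h (i, j))" by (rule insert.IH) (use h in auto)
  moreover have "(\<Oplus>i\<in>insert i A. \<Oplus>j\<in>B. h (i, j)) = (\<Oplus>j\<in>B. h (i, j)) \<oplus> (\<Oplus>i\<in>A. \<Oplus>j\<in>B. h (i, j))"
    using insert.hyps h by (intro finsum_insert) (auto intro!: finsum_closed)
  ultimately show ?case by simp
qed simp

lemma finsum_bilinear:
  assumes fin: "finite A" "finite B" and t: "\<And>i j. i \<in> A \<Longrightarrow> j \<in> B \<Longrightarrow> t (i, j) \<in> carrier R"
    and y: "\<And>i. i \<in> A \<Longrightarrow> y i \<in> carrier R" and s: "\<And>j. j \<in> B \<Longrightarrow> s j \<in> carrier R"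
  shows "(\<Oplus>p\<in>A \<times> B. t p \<otimes> (y (fst p) \<otimes> s (snd p))) = (\<Oplus>i\<in>A. (\<Oplus>j\<in>B. t (i, j) \<otimes> s j) \<otimes> y i)"
proof -
  have "(\<Oplus>p\<in>A \<times> B. t p \<otimes> (y (fst p) \<otimes> s (snd p))) =
    (\<Oplus>i\<in>A. \<Oplus>j\<in>B. t (i, j) \<otimes> (y (fst (i, j)) \<otimes> s (snd (i, j))))"
    using t y s by (intro finsum_Times fin) auto
  also have "\<dots> = (\<Oplus>i\<in>A. (\<Oplus>j\<in>B. t (i, j) \<otimes> s j) \<otimes> y i)"
  proof (rule finsum_cong'[OF refl])
    fix i assume i: "i \<in> A"
    have "(\<Oplus>j\<in>B. t (i, j) \<otimes> s j) \<otimes> y i = (\<Oplus>j\<in>B. t (i, j) \<otimes> s j \<otimes> y i)"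
      using t[OF i] y[OF i] s by (intro finsum_ldistr fin) auto
    also have "\<dots> = (\<Oplus>j\<in>B. t (i, j) \<otimes> (y (fst (i, j)) \<otimes> s (snd (i, j))))"
      using t[OF i] y[OF i] s by (intro finsum_cong') (auto simp: m_assoc m_comm m_lcomm)
    finally show "(\<Oplus>j\<in>B. t (i, j) \<otimes> (y (fst (i, j)) \<otimes> s (snd (i, j)))) = (\<Oplus>j\<in>B. t (i, j) \<otimes> s j) \<otimes> y i" ..
  next
    show "(\<lambda>i. (\<Oplus>j\<in>B. t (i, j) \<otimes> s j) \<otimes> y i) \<in> A \<rightarrow> carrier R"
      using t y s by (intro funcsetI m_closed finsum_closed)
  qed
  finally show ?thesis .
qed

end

section \<open>Relations on regular sequences and linear algebra over R/\<mm>\<close>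

context noetherian_local
begin

text \<open>First syzygies of a regular sequence are Koszul, so their coefficients lie in its ideal.
  The last coefficient lies in the ideal of the earlier elements because the last element z is
  regular modulo it; substituting its expression turns the relation into one on the shorter
  sequence, with coefficients t_i + z s_i.\<close>

lemma regseq_relations:
  assumes K: "ideal K R"
  shows "set zs \<subseteq> carrier R \<Longrightarrow> regseq K zs \<Longrightarrow> (\<And>i. i < length zs \<Longrightarrow> t i \<in> carrier R) \<Longrightarrow>
    (\<Oplus>i\<in>{..<length zs}. t i \<otimes> zs ! i) \<in> K \<Longrightarrow> i < length zs \<Longrightarrow> t i \<in> ext K (set zs)"
proof (induction zs arbitrary: t i rule: rev_induct)
  case (snoc z ys)
  let ?l = "length ys" and ?K = "ext K (set ys)" and ?K' = "ext K (set (ys @ [z]))"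
  have ys: "set ys \<subseteq> carrier R" and z: "z \<in> carrier R" using snoc.prems(1) by auto
  have K': "ideal ?K R" "ideal ?K' R" using ext_ideal[OF K] ys snoc.prems(1) by auto
  have sub: "?K \<subseteq> ?K'" by (rule ext_mono[OF K snoc.prems(1)]) auto
  have reg: "regseq K ys" "nzd ?K z" using snoc.prems(2) regseq_snoc[OF K ys] by auto
  have tc: "t i \<in> carrier R" if "i \<le> ?l" for i using snoc.prems(3)[of i] that by simp
  have yc: "ys ! i \<in> carrier R" if "i < ?l" for i using ys that by auto
  have ty: "(\<Oplus>i\<in>{..<?l}. t i \<otimes> ys ! i) \<in> carrier R" using tc yc by (auto intro!: finsum_closed)
  have "(\<Oplus>i\<in>{..<Suc ?l}. t i \<otimes> (ys @ [z]) ! i) = t ?l \<otimes> z \<oplus> (\<Oplus>i\<in>{..<?l}. t i \<otimes> (ys @ [z]) ! i)"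
    unfolding lessThan_Suc using tc yc z by (subst finsum_insert) (auto simp: nth_append)
  also have "(\<Oplus>i\<in>{..<?l}. t i \<otimes> (ys @ [z]) ! i) = (\<Oplus>i\<in>{..<?l}. t i \<otimes> ys ! i)"
    using tc yc by (intro finsum_cong') (auto simp: nth_append)
  finally have tot: "t ?l \<otimes> z \<oplus> (\<Oplus>i\<in>{..<?l}. t i \<otimes> ys ! i) \<in> K" using snoc.prems(4) by simp
  have "ys ! i \<in> ?K" if "i < ?l" for i using ext_gens[OF K ys] that by auto
  then have "(\<Oplus>i\<in>{..<?l}. t i \<otimes> ys ! i) \<in> ?K"
    using tc by (intro ideal_finsum[OF K'(1)] ideal.I_l_closed[OF K'(1)]) auto
  moreover have "(\<Oplus>i\<in>{..<?l}. t i \<otimes> ys ! i) \<oplus> t ?l \<otimes> z \<in> ?K"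
    using tot ext_base[OF K ys] ty tc[of ?l] z by (auto simp: a_comm)
  ultimately have "t ?l \<otimes> z \<in> ?K" by (rule ideal_add_cancel_left[OF K'(1) _ m_closed[OF tc[OF le_refl] z]])
  then have tl: "t ?l \<in> ?K" using nzdD[OF reg(2) tc[of ?l]] z tc[of ?l] by (simp add: m_comm)
  have img: "(\<lambda>i. ys ! i) ` {..<?l} = set ys" by (auto simp: set_conv_nth)
  obtain k s where ks: "k \<in> K" "s \<in> {..<?l} \<rightarrow> carrier R" "t ?l = k \<oplus> (\<Oplus>i\<in>{..<?l}. s i \<otimes> ys ! i)"
    by (rule ext_imageE[OF finite_lessThan K, of "\<lambda>i. ys ! i" ?l "t ?l"]) (use img ys tl in auto)
  have kc: "k \<in> carrier R" by (rule ideal.Icarr[OF K ks(1)])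
  have sc: "s i \<in> carrier R" if "i < ?l" for i using ks(2) that by auto
  have sy: "(\<Oplus>i\<in>{..<?l}. s i \<otimes> ys ! i) \<in> carrier R" using sc yc by (auto intro!: finsum_closed)
  have "(\<Oplus>i\<in>{..<?l}. (t i \<oplus> z \<otimes> s i) \<otimes> ys ! i) = (\<Oplus>i\<in>{..<?l}. t i \<otimes> ys ! i \<oplus> z \<otimes> (s i \<otimes> ys ! i))"
    using tc sc yc z by (intro finsum_cong') (auto simp: l_distr m_assoc)
  also have "\<dots> = (\<Oplus>i\<in>{..<?l}. t i \<otimes> ys ! i) \<oplus> (\<Oplus>i\<in>{..<?l}. z \<otimes> (s i \<otimes> ys ! i))"
    using tc sc yc z by (intro finsum_addf) auto
  also have "(\<Oplus>i\<in>{..<?l}. z \<otimes> (s i \<otimes> ys ! i)) = z \<otimes> (\<Oplus>i\<in>{..<?l}. s i \<otimes> ys ! i)"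
    using sc yc z by (intro finsum_rdistr[symmetric]) auto
  also have "(\<Oplus>i\<in>{..<?l}. t i \<otimes> ys ! i) \<oplus> z \<otimes> (\<Oplus>i\<in>{..<?l}. s i \<otimes> ys ! i) =
    (t ?l \<otimes> z \<oplus> (\<Oplus>i\<in>{..<?l}. t i \<otimes> ys ! i)) \<ominus> z \<otimes> k"
  proof -
    have "v \<oplus> z \<otimes> w = ((k \<oplus> w) \<otimes> z \<oplus> v) \<ominus> z \<otimes> k" if "v \<in> carrier R" "w \<in> carrier R" for v w
      using that kc z by algebra
    from this[OF ty sy] show ?thesis unfolding ks(3) .
  qed
  finally have "(\<Oplus>i\<in>{..<?l}. (t i \<oplus> z \<otimes> s i) \<otimes> ys ! i) \<in> K"
    using ideal_diff[OF K tot ideal.I_l_closed[OF K ks(1) z]] by simp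
  then have IH: "t i \<oplus> z \<otimes> s i \<in> ?K" if "i < ?l" for i
    using snoc.IH[OF ys reg(1), of "\<lambda>i. t i \<oplus> z \<otimes> s i" i] tc sc z that by auto
  show ?case
  proof (cases "i = ?l")
    case True
    then show ?thesis using tl sub by auto
  next
    case False
    then have i: "i < ?l" using snoc.prems(5) by simp
    have "z \<in> ?K'" using ext_gens[OF K snoc.prems(1)] by auto
    then have "z \<otimes> s i \<in> ?K'" using ideal.I_r_closed[OF K'(2) _ sc[OF i]] by auto
    moreover have "z \<otimes> s i \<oplus> t i \<in> ?K'" using IH[OF i] sub tc[of i] sc[OF i] z i by (auto simp: a_comm)
    ultimately show ?thesis by (rule ideal_add_cancel_left[OF K'(2) _ tc[OF less_imp_le[OF i]]])
  qed
qed simp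

text \<open>Linear independence over \<open>R / \<mm>\<close> of the classes of \<open>v\<close> modulo \<open>B\<close>, when \<open>\<mm>\<close> kills these classes.\<close>

definition kindep :: "'a set \<Rightarrow> 'p set \<Rightarrow> ('p \<Rightarrow> 'a) \<Rightarrow> bool" where
  "kindep B P v \<longleftrightarrow> (\<forall>t\<in>P \<rightarrow> carrier R. (\<Oplus>p\<in>P. t p \<otimes> v p) \<in> B \<longrightarrow> (\<forall>p\<in>P. t p \<in> \<mm>))"

lemma kindepD:
  assumes "kindep B P v" "\<And>p. p \<in> P \<Longrightarrow> t p \<in> carrier R" "(\<Oplus>p\<in>P. t p \<otimes> v p) \<in> B" "p \<in> P"
  shows "t p \<in> \<mm>"
proof -
  have "t \<in> P \<rightarrow> carrier R" using assms(2) by auto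
  then show ?thesis using assms(1,3,4) unfolding kindep_def by blast
qed

text \<open>E/B is a vector space over R/\<mm>. Among the ideals generated over B by independent
  families in E a maximal one exists, and it is all of E, since an element outside could be appended
  to its family.\<close>

lemma k_basis:
  assumes B: "ideal B R" and E: "ideal E R" "B \<subseteq> E" and mE: "\<And>e y. e \<in> \<mm> \<Longrightarrow> y \<in> E \<Longrightarrow> e \<otimes> y \<in> B"
  obtains v g where "v \<in> {..<g::nat} \<rightarrow> E" "kindep B {..<g} v" "E \<subseteq> ext B (v ` {..<g})"
proof -
  let ?S = "{ext B (v ` {..<g}) | v g. v \<in> {..<g::nat} \<rightarrow> E \<and> kindep B {..<g} v}"
  have Ec: "v ` {..<g} \<subseteq> carrier R" if "v \<in> {..<g::nat} \<rightarrow> E" for v g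
    using that ideal_subset[OF E(1)] by auto
  have S0: "ext B ((\<lambda>_. \<zero>) ` {..<0::nat}) \<in> ?S"
    by (intro CollectI exI[of _ "\<lambda>_. \<zero>"] exI[of _ 0]) (auto simp: kindep_def)
  have Si: "ideal L R" if L: "L \<in> ?S" for L
  proof -
    obtain v g where "L = ext B (v ` {..<g::nat})" "v \<in> {..<g} \<rightarrow> E" using L by auto
    then show ?thesis using ext_ideal[OF B Ec] by simp
  qed
  obtain M where M: "M \<in> ?S" "\<And>L. L \<in> ?S \<Longrightarrow> M \<subseteq> L \<Longrightarrow> L = M"
  proof (rule ideals_maximal[of _ ?S, OF S0])
    show "ideal L R" if "L \<in> ?S" for L using that by (rule Si)
  qed (rule that)
  then obtain v g where v: "v \<in> {..<g::nat} \<rightarrow> E" "kindep B {..<g} v" "M = ext B (v ` {..<g})" by blast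
  have vc: "v q \<in> carrier R" "v q \<in> E" if "q < g" for q using v(1) that ideal.Icarr[OF E(1)] by auto
  have Mi: "ideal M R" unfolding v(3) by (rule ext_ideal[OF B Ec[OF v(1)]])
  have "E \<subseteq> M"
  proof (rule subsetI, rule ccontr)
    fix y assume y: "y \<in> E" "y \<notin> M"
    have ycar: "y \<in> carrier R" by (rule ideal.Icarr[OF E(1) y(1)])
    define v' where "v' = v(g := y)"
    have v'E: "v' \<in> {..<Suc g} \<rightarrow> E" using vc y by (auto simp: v'_def less_Suc_eq)
    have img: "v' ` {..<Suc g} = insert y (v ` {..<g})" by (auto simp: v'_def lessThan_Suc)
    have "kindep B {..<Suc g} v'" unfolding kindep_def
    proof (intro ballI impI)
      fix t p assume t: "t \<in> {..<Suc g} \<rightarrow> carrier R" and rel: "(\<Oplus>p\<in>{..<Suc g}. t p \<otimes> v' p) \<in> B" and p: "p \<in> {..<Suc g}"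
      have tc: "t q \<in> carrier R" if "q \<le> g" for q using t that by auto
      have S: "(\<Oplus>p\<in>{..<g}. t p \<otimes> v p) \<in> carrier R" using tc vc by (auto intro!: finsum_closed)
      have "(\<Oplus>p\<in>{..<Suc g}. t p \<otimes> v' p) = t g \<otimes> v' g \<oplus> (\<Oplus>p\<in>{..<g}. t p \<otimes> v' p)"
        unfolding lessThan_Suc using tc vc ycar by (intro finsum_insert) (auto simp: v'_def)
      also have "(\<Oplus>p\<in>{..<g}. t p \<otimes> v' p) = (\<Oplus>p\<in>{..<g}. t p \<otimes> v p)"
        using tc vc by (intro finsum_cong') (auto simp: v'_def)
      finally have rel': "t g \<otimes> y \<oplus> (\<Oplus>p\<in>{..<g}. t p \<otimes> v p) \<in> B" using rel by (simp add: v'_def)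
      have "v q \<in> M" if "q < g" for q unfolding v(3) using ext_gens[OF B Ec[OF v(1)]] that by auto
      then have SM: "(\<Oplus>p\<in>{..<g}. t p \<otimes> v p) \<in> M"
        using tc by (intro ideal_finsum[OF Mi] ideal.I_l_closed[OF Mi]) auto
      have "(\<Oplus>p\<in>{..<g}. t p \<otimes> v p) \<oplus> t g \<otimes> y \<in> M"
        using rel' S tc[of g] ycar ext_base[OF B Ec[OF v(1)]] unfolding v(3) by (auto simp: a_comm)
      then have "t g \<otimes> y \<in> M" using ideal_add_cancel_left[OF Mi SM] tc[of g] ycar by simp
      then have tg: "t g \<in> \<mm>" using unit_cancel[OF Mi tc[of g] _ ycar] y(2) by auto
      have "(\<Oplus>p\<in>{..<g}. t p \<otimes> v p) \<in> B"
        by (rule ideal_add_cancel_left[OF B mE[OF tg y(1)] S rel'])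
      then have "t q \<in> \<mm>" if "q < g" for q using kindepD[OF v(2), of t q] tc that by auto
      then show "t p \<in> \<mm>" using tg p by (cases "p = g") auto
    qed
    then have "ext B (v' ` {..<Suc g}) \<in> ?S" using v'E by blast
    moreover have "M \<subseteq> ext B (v' ` {..<Suc g})"
      unfolding v(3) using Ec[OF v'E] img by (intro ext_mono[OF B]) auto
    ultimately have "ext B (v' ` {..<Suc g}) = M" by (rule M(2))
    then show False using ext_gens[OF B Ec[OF v'E]] img y(2) by auto
  qed
  then show thesis using that[OF v(1,2)] v(3) by simp
qed

text \<open>U is maximal among the ideals above B over which v stays independent; it plays the part
  of a complement to the span of v in E/B, without having to lie inside E. Adjoining an uncovered y
  in E would keep independence: in a relation involving r y, a unit r would cover y, and r in \<mm>
  sends y into B.\<close>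

lemma k_complement:
  assumes B: "ideal B R" and E: "ideal E R" and mE: "\<And>e y. e \<in> \<mm> \<Longrightarrow> y \<in> E \<Longrightarrow> e \<otimes> y \<in> B"
    and P: "finite P" and v: "v ` P \<subseteq> E" "kindep B P v"
  obtains U where "ideal U R" "B \<subseteq> U" "kindep U P v" "E \<subseteq> ext U (v ` P)"
proof -
  let ?S = "{U. ideal U R \<and> B \<subseteq> U \<and> kindep U P v}"
  obtain U where U: "U \<in> ?S" and mx: "\<And>L. L \<in> ?S \<Longrightarrow> U \<subseteq> L \<Longrightarrow> L = U"
    by (rule ideals_maximal[of B ?S]) (use B v in auto)
  have Ui: "ideal U R" "B \<subseteq> U" and ind: "kindep U P v" using U by auto
  have vc: "v ` P \<subseteq> carrier R" using v ideal_subset[OF E] by auto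
  have "E \<subseteq> ext U (v ` P)"
  proof (rule subsetI, rule ccontr)
    fix y assume y: "y \<in> E" "y \<notin> ext U (v ` P)"
    note F = ext_ideal[OF Ui(1) vc]
    have ycar: "y \<in> carrier R" "{y} \<subseteq> carrier R" using ideal.Icarr[OF E y(1)] by auto
    have "kindep (ext U {y}) P v" unfolding kindep_def
    proof (intro ballI impI)
      fix t p assume t: "t \<in> P \<rightarrow> carrier R" and rel: "(\<Oplus>p\<in>P. t p \<otimes> v p) \<in> ext U {y}" and p: "p \<in> P"
      have tc: "t p \<in> carrier R" if "p \<in> P" for p using t that by auto
      obtain k r where kr: "k \<in> U" "r \<in> carrier R" "(\<Oplus>p\<in>P. t p \<otimes> v p) = k \<oplus> r \<otimes> y"
        by (rule ext_singletonE[OF Ui(1) ycar(1) rel])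
      have SF: "k \<oplus> r \<otimes> y \<in> ext U (v ` P)" unfolding kr(3)[symmetric]
        using ext_gens[OF Ui(1) vc] tc by (intro ideal_finsum[OF F] ideal.I_l_closed[OF F]) auto
      have "k \<in> ext U (v ` P)" using ext_base[OF Ui(1) vc] kr(1) by auto
      then have "r \<otimes> y \<in> ext U (v ` P)" using ideal_add_cancel_left[OF F _ _ SF] kr(2) ycar by simp
      then have "r \<in> \<mm>" using unit_cancel[OF F kr(2) _ ycar(1)] y(2) by auto
      then have "r \<otimes> y \<in> U" using mE[OF _ y(1)] Ui(2) by auto
      then have "(\<Oplus>p\<in>P. t p \<otimes> v p) \<in> U" unfolding kr(3) by (rule ideal_add[OF Ui(1) kr(1)])
      then show "t p \<in> \<mm>" by (intro kindepD[where t = t, OF ind tc _ p])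
    qed
    then have "ext U {y} = U"
      using mx[of "ext U {y}"] ext_ideal[OF Ui(1) ycar(2)] ext_base[OF Ui(1) ycar(2)] Ui(2) by auto
    then have "y \<in> U" using ext_gens[OF Ui(1) ycar(2)] by auto
    then show False using y(2) ext_base[OF Ui(1) vc] by auto
  qed
  then show thesis using that Ui ind by blast
qed

text \<open>The vector (r_i) is moved into the socle of R/I one generator e of \<mm> at a time, by
  multiplying with the last power of e that does not push all entries into I. Generators treated
  before continue to kill the result.\<close>

lemma socle_multiplier:
  assumes I: "ideal I R" and r: "\<And>i. i < (d::nat) \<Longrightarrow> r i \<in> carrier R" "i0 < d" "r i0 \<notin> I"
  shows "set es \<subseteq> carrier R \<Longrightarrow> (\<And>e. e \<in> set es \<Longrightarrow> \<exists>n::nat. e [^] n \<in> I) \<Longrightarrow>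
    \<exists>\<mu>\<in>carrier R. (\<exists>i<d. \<mu> \<otimes> r i \<notin> I) \<and> (\<forall>e\<in>set es. \<forall>i<d. e \<otimes> (\<mu> \<otimes> r i) \<in> I)"
proof (induction es)
  case Nil
  show ?case using r by (intro bexI[of _ \<one>]) auto
next
  case (Cons e es)
  then obtain \<mu> i1 where \<mu>: "\<mu> \<in> carrier R" "i1 < d" "\<mu> \<otimes> r i1 \<notin> I"
    "\<forall>e\<in>set es. \<forall>i<d. e \<otimes> (\<mu> \<otimes> r i) \<in> I" by auto
  have e: "e \<in> carrier R" using Cons.prems(1) by simp
  let ?Q = "\<lambda>n::nat. \<forall>i<d. e [^] n \<otimes> (\<mu> \<otimes> r i) \<in> I"
  obtain n :: nat where "e [^] n \<in> I" using Cons.prems(2)[of e] by auto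
  then have "?Q n" using ideal.I_r_closed[OF I] \<mu>(1) r(1) by auto
  then have Qk: "?Q (LEAST n. ?Q n)" by (rule LeastI)
  define k where "k = (LEAST n. ?Q n)"
  have "k \<noteq> 0"
  proof
    assume "k = 0"
    then have "e [^] (0::nat) \<otimes> (\<mu> \<otimes> r i1) \<in> I" using Qk \<mu>(2) unfolding k_def[symmetric] by blast
    then show False using \<mu> r(1) by simp
  qed
  then obtain k' where k': "k = Suc k'" using not0_implies_Suc by blast
  have "\<not> ?Q k'" using not_less_Least[of k' ?Q] k' unfolding k_def[symmetric] by simp
  then obtain i2 where i2: "i2 < d" "e [^] k' \<otimes> (\<mu> \<otimes> r i2) \<notin> I" by blast
  let ?\<mu> = "e [^] k' \<otimes> \<mu>"
  have assoc: "?\<mu> \<otimes> r i = e [^] k' \<otimes> (\<mu> \<otimes> r i)" if "i < d" for i using e \<mu>(1) r(1)[OF that] by (simp add: m_assoc)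
  have "e' \<otimes> (?\<mu> \<otimes> r i) \<in> I" if e': "e' \<in> set (e # es)" and i: "i < d" for e' i
  proof (cases "e' = e")
    case True
    have "e \<otimes> (e [^] k' \<otimes> (\<mu> \<otimes> r i)) = e [^] Suc k' \<otimes> (\<mu> \<otimes> r i)"
    proof -
      have id: "e \<otimes> (u \<otimes> w) = (u \<otimes> e) \<otimes> w" if "u \<in> carrier R" "w \<in> carrier R" for u w
        using that e by algebra
      show ?thesis using id[OF nat_pow_closed[OF e] m_closed[OF \<mu>(1) r(1)[OF i]]] by simp
    qed
    moreover have "e [^] Suc k' \<otimes> (\<mu> \<otimes> r i) \<in> I" using Qk i k' unfolding k_def[symmetric] by blast
    ultimately show ?thesis using True assoc[OF i] by simp
  next
    case False
    then have e'': "e' \<in> set es" "e' \<in> carrier R" using e' Cons.prems(1) by auto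
    have "e' \<otimes> (e [^] k' \<otimes> (\<mu> \<otimes> r i)) = e [^] k' \<otimes> (e' \<otimes> (\<mu> \<otimes> r i))"
      using e e'' \<mu>(1) r(1)[OF i] by (simp add: m_lcomm)
    then show ?thesis using \<mu>(4) e''(1) i ideal.I_l_closed[OF I] e assoc[OF i] by simp
  qed
  then show ?case using i2 assoc e \<mu>(1) by (intro bexI[of _ ?\<mu>]) auto
qed

text \<open>Write y as the sum of r_i X_i. If some r_i were outside I, a multiple \<mu> y would have
  coefficients in the socle of R/I, not all zero, and these expand in the \<sigma> q modulo I.
  Independence of the products X_i times \<sigma> q modulo I^2 puts the scalars of the expansion
  into \<mm>, which kills each \<sigma> q modulo I, a contradiction. So all r_i lie in I.\<close>

lemma comb_ideal_inter_square:
  assumes a: "\<And>j. j < n \<Longrightarrow> a j \<in> carrier R" and I: "I = Idl (a ` {..<n})"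
    and prim: "\<And>e. e \<in> \<mm> \<Longrightarrow> \<exists>n::nat. e [^] n \<in> I"
    and x: "x \<in> points ({..<d} \<times> {..<n})"
    and \<sigma>: "\<And>q. q < g \<Longrightarrow> \<sigma> q \<in> carrier R" "\<And>q e. q < g \<Longrightarrow> e \<in> \<mm> \<Longrightarrow> e \<otimes> \<sigma> q \<in> I"
      "{s \<in> carrier R. \<forall>e\<in>\<mm>. s \<otimes> e \<in> I} \<subseteq> ext I (\<sigma> ` {..<g::nat})"
    and ind: "kindep (I \<cdot> I) ({..<d} \<times> {..<g}) (\<lambda>p. lin_comb n a x (fst p) \<otimes> \<sigma> (snd p))"
  shows "comb_ideal d n a x \<inter> (I \<cdot> I) \<subseteq> comb_ideal d n a x \<cdot> I"
proof
  fix y assume y: "y \<in> comb_ideal d n a x \<inter> (I \<cdot> I)"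
  let ?X = "lin_comb n a x"
  note J = comb_ideal_ideal[where n = n and a = a, OF a x]
  have Xc: "?X i \<in> carrier R" if "i < d" for i by (rule lin_comb_closed[OF a x that])
  have XP: "?X ` {..<d} \<subseteq> carrier R" using Xc by auto
  have ac: "a ` {..<n} \<subseteq> carrier R" using a by auto
  have Ii: "ideal I R" unfolding I by (rule genideal_ideal[OF ac])
  have I2: "ideal (I \<cdot> I) R" by (rule ideal_prod_is_ideal[OF Ii Ii])
  have XI: "?X i \<in> I" if "i < d" for i
  proof -
    have "?X i \<in> comb_ideal d n a x" by (rule comb_ideal_ideal(2)[OF a x that])
    moreover have "comb_ideal d n a x \<subseteq> Idl (a ` {..<n})" by (rule comb_ideal_ideal(3)[OF a x])
    ultimately show ?thesis using I by auto
  qed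
  have \<sigma>c: "\<sigma> ` {..<g} \<subseteq> carrier R" using \<sigma>(1) by auto
  have "y \<in> ext {\<zero>} (?X ` {..<d})" using y Idl_eq_ext[OF XP] by (simp add: comb_ideal_def)
  then obtain k r where kr: "k \<in> {\<zero>}" "r \<in> {..<d} \<rightarrow> carrier R" "y = k \<oplus> (\<Oplus>i\<in>{..<d}. r i \<otimes> ?X i)"
    by (rule ext_imageE[OF finite_lessThan zeroideal XP])
  have rc: "r i \<in> carrier R" if "i < d" for i using kr(2) that by auto
  have yr: "y = (\<Oplus>i\<in>{..<d}. r i \<otimes> ?X i)" using kr(1,3) rc Xc by (auto intro!: l_zero finsum_closed)
  have "r i \<in> I" if i0: "i < d" for i
  proof (rule ccontr)
    assume ri: "r i \<notin> I"
    obtain es where es: "set es \<subseteq> carrier R" "\<mm> = Idl (set es)" using m_finite_generators .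
    have esm: "set es \<subseteq> \<mm>" using es genideal_self[OF es(1)] by auto
    obtain \<mu> i1 where \<mu>: "\<mu> \<in> carrier R" "i1 < d" "\<mu> \<otimes> r i1 \<notin> I"
      "\<forall>e\<in>set es. \<forall>i<d. e \<otimes> (\<mu> \<otimes> r i) \<in> I"
    proof -
      have "\<exists>n::nat. e [^] n \<in> I" if "e \<in> set es" for e by (rule prim[OF subsetD[OF esm that]])
      from socle_multiplier[of I d r, OF Ii rc i0 ri es(1) this] show ?thesis using that by blast
    qed
    have \<mu>r: "\<mu> \<otimes> r i \<in> carrier R" if "i < d" for i using \<mu>(1) rc[OF that] by simp
    have mem: "\<mu> \<otimes> r i \<in> ext I (\<sigma> ` {..<g})" if i: "i < d" for i
    proof -
      have "\<mm> \<subseteq> {t \<in> carrier R. \<forall>s\<in>{\<mu> \<otimes> r i}. t \<otimes> s \<in> I}" unfolding es(2)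
        by (rule genideal_minimal[OF ideal_colon[OF Ii]]) (use \<mu>(4) \<mu>r[OF i] es(1) i in auto)
      then have "\<forall>e\<in>\<mm>. (\<mu> \<otimes> r i) \<otimes> e \<in> I" using \<mu>r[OF i] m_carrier by (auto simp: m_comm subset_iff)
      then show ?thesis using \<sigma>(3) \<mu>r[OF i] by blast
    qed
    define bt where "bt i = (SOME bt. fst bt \<in> I \<and> snd bt \<in> {..<g} \<rightarrow> carrier R \<and>
        \<mu> \<otimes> r i = fst bt \<oplus> (\<Oplus>q\<in>{..<g}. snd bt q \<otimes> \<sigma> q))" for i
    have bt: "fst (bt i) \<in> I \<and> snd (bt i) \<in> {..<g} \<rightarrow> carrier R \<and>
        \<mu> \<otimes> r i = fst (bt i) \<oplus> (\<Oplus>q\<in>{..<g}. snd (bt i) q \<otimes> \<sigma> q)" if i: "i < d" for i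
    proof -
      obtain b0 t0 where "b0 \<in> I" "t0 \<in> {..<g} \<rightarrow> carrier R" "\<mu> \<otimes> r i = b0 \<oplus> (\<Oplus>q\<in>{..<g}. t0 q \<otimes> \<sigma> q)"
        by (rule ext_imageE[OF finite_lessThan[of g] Ii \<sigma>c mem[OF i]])
      then have "\<exists>bt. fst bt \<in> I \<and> snd bt \<in> {..<g} \<rightarrow> carrier R \<and>
          \<mu> \<otimes> r i = fst bt \<oplus> (\<Oplus>q\<in>{..<g}. snd bt q \<otimes> \<sigma> q)"
        by (intro exI[of _ "(b0, t0)"]) simp
      then show ?thesis unfolding bt_def by (rule someI_ex)
    qed
    define b where "b i = fst (bt i)" for i
    define t where "t p = snd (bt (fst p)) (snd p)" for p
    have tc: "t (i, q) \<in> carrier R" if "i < d" "q < g" for i q using bt[OF that(1)] that(2) by (auto simp: t_def)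
    have bI: "b i \<in> I" if "i < d" for i using bt[OF that] by (simp add: b_def)
    have bc: "b i \<in> carrier R" if "i < d" for i by (rule ideal.Icarr[OF Ii bI[OF that]])
    let ?S = "\<lambda>i. \<Oplus>q\<in>{..<g}. t (i, q) \<otimes> \<sigma> q"
    have Sc: "?S i \<in> carrier R" if "i < d" for i using tc[OF that] \<sigma>(1) by (auto intro!: finsum_closed)
    have dec: "\<mu> \<otimes> r i = b i \<oplus> ?S i" if "i < d" for i using bt[OF that] by (simp add: b_def t_def)
    have "\<mu> \<otimes> y = (\<Oplus>i\<in>{..<d}. \<mu> \<otimes> (r i \<otimes> ?X i))"
      unfolding yr using \<mu>(1) rc Xc by (intro finsum_rdistr) auto
    also have "\<dots> = (\<Oplus>i\<in>{..<d}. b i \<otimes> ?X i \<oplus> ?S i \<otimes> ?X i)"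
    proof (rule finsum_cong'[OF refl])
      fix i assume "i \<in> {..<d}"
      then have i: "i < d" by simp
      have "\<mu> \<otimes> (r i \<otimes> ?X i) = (b i \<oplus> ?S i) \<otimes> ?X i"
        unfolding dec[OF i, symmetric] using \<mu>(1) rc[OF i] Xc[OF i] by (simp add: m_assoc)
      then show "\<mu> \<otimes> (r i \<otimes> ?X i) = b i \<otimes> ?X i \<oplus> ?S i \<otimes> ?X i" using bc[OF i] Sc[OF i] Xc[OF i] by (simp add: l_distr)
    qed (use bc Sc Xc in auto)
    also have "\<dots> = (\<Oplus>i\<in>{..<d}. b i \<otimes> ?X i) \<oplus> (\<Oplus>i\<in>{..<d}. ?S i \<otimes> ?X i)"
      using bc Sc Xc by (intro finsum_addf) auto
    finally have e1: "\<mu> \<otimes> y = (\<Oplus>i\<in>{..<d}. b i \<otimes> ?X i) \<oplus> (\<Oplus>i\<in>{..<d}. ?S i \<otimes> ?X i)" .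
    have m1: "\<mu> \<otimes> y \<in> I \<cdot> I" using y ideal.I_l_closed[OF I2 _ \<mu>(1)] by auto
    have m2: "(\<Oplus>i\<in>{..<d}. b i \<otimes> ?X i) \<in> I \<cdot> I"
      using bI XI by (intro ideal_finsum[OF I2] ideal_prod.prod) auto
    have "(\<Oplus>i\<in>{..<d}. ?S i \<otimes> ?X i) \<in> carrier R" using Sc Xc by (auto intro!: finsum_closed)
    then have "(\<Oplus>i\<in>{..<d}. ?S i \<otimes> ?X i) \<in> I \<cdot> I" using ideal_add_cancel_left[OF I2 m2] m1 unfolding e1 by simp
    then have "(\<Oplus>p\<in>{..<d} \<times> {..<g}. t p \<otimes> (?X (fst p) \<otimes> \<sigma> (snd p))) \<in> I \<cdot> I"
      using finsum_bilinear[of "{..<d}" "{..<g}" t ?X \<sigma>] tc Xc \<sigma>(1) by simp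
    then have tm: "t p \<in> \<mm>" if "p \<in> {..<d} \<times> {..<g}" for p
      using kindepD[OF ind, of t p] tc that by auto
    have "?S i1 \<in> I"
      using tm \<mu>(2) \<sigma>(2) by (intro ideal_finsum[OF Ii]) auto
    then show False using \<mu>(3) unfolding dec[OF \<mu>(2)] using ideal_add[OF Ii bI[OF \<mu>(2)]] by blast
  qed
  then show "y \<in> comb_ideal d n a x \<cdot> I"
  proof -
    assume rI: "\<And>i. i < d \<Longrightarrow> r i \<in> I"
    have JI: "ideal (comb_ideal d n a x \<cdot> I) R" by (rule ideal_prod_is_ideal[OF J(1) Ii])
    have "r i \<otimes> ?X i \<in> comb_ideal d n a x \<cdot> I" if "i < d" for i
    proof -
      have "?X i \<in> comb_ideal d n a x" by (rule comb_ideal_ideal(2)[OF a x that])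
      from ideal_prod.prod[OF this rI[OF that], of R] show ?thesis using rc[OF that] Xc[OF that] by (simp add: m_comm)
    qed
    then show ?thesis unfolding yr by (intro ideal_finsum[OF JI]) auto
  qed
qed

end

context noetherian_local_inf
begin

text \<open>Injectivity of \<open>(R/I)\<^sup>d \<rightarrow> I/I\<^sup>2\<close> is tested on the socle of \<open>R/I\<close>, where multiplication by an
  element of \<open>I\<close> only depends on its class modulo \<open>\<mm> I\<close>.\<close>

lemma inter_square_open:
  fixes d n :: nat
  defines "N \<equiv> {..<d} \<times> {..<n}"
  assumes a: "\<And>j. j < n \<Longrightarrow> a j \<in> carrier R" and I: "I = Idl (a ` {..<n})"
    and prim: "\<And>e. e \<in> \<mm> \<Longrightarrow> \<exists>n::nat. e [^] n \<in> I" and x0: "x0 \<in> points N"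
    and inj: "\<And>r i. (\<And>i. i < d \<Longrightarrow> r i \<in> carrier R) \<Longrightarrow> (\<Oplus>i\<in>{..<d}. r i \<otimes> lin_comb n a x0 i) \<in> I \<cdot> I \<Longrightarrow>
      i < d \<Longrightarrow> r i \<in> I"
  obtains f where "f \<in> polyfun N" "f x0 = \<one>"
    "\<And>x. x \<in> points N \<Longrightarrow> f x \<notin> \<mm> \<Longrightarrow> comb_ideal d n a x \<inter> (I \<cdot> I) \<subseteq> comb_ideal d n a x \<cdot> I"
proof -
  have ac: "a ` {..<n} \<subseteq> carrier R" using a by auto
  have Ii: "ideal I R" unfolding I by (rule genideal_ideal[OF ac])
  have aI: "a j \<in> I" if "j < n" for j using that genideal_self[OF ac] I by auto
  \<comment> \<open>S/I is the socle of R/I; below, \<open>\<sigma>\<close> lifts a basis of it over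
    R/\<mm>.\<close>
  define S where "S = {s \<in> carrier R. \<forall>e\<in>\<mm>. s \<otimes> e \<in> I}"
  have S: "ideal S R" unfolding S_def by (rule ideal_colon[OF Ii m_carrier])
  have IS: "I \<subseteq> S" unfolding S_def using ideal.Icarr[OF Ii] ideal.I_r_closed[OF Ii] m_carrier by auto
  have mS: "e \<otimes> s \<in> I" if "e \<in> \<mm>" "s \<in> S" for e s
    using that m_carrier m_comm[of e s] by (auto simp: S_def)
  obtain \<sigma> g where \<sigma>: "\<sigma> \<in> {..<g::nat} \<rightarrow> S" "kindep I {..<g} \<sigma>" "S \<subseteq> ext I (\<sigma> ` {..<g})"
    by (rule k_basis[OF Ii S IS mS])
  have \<sigma>S: "\<sigma> q \<in> S" if "q < g" for q using \<sigma>(1) that by auto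
  have \<sigma>c: "\<sigma> q \<in> carrier R" if "q < g" for q by (rule ideal.Icarr[OF S \<sigma>S[OF that]])
  let ?P = "{..<d} \<times> {..<g}"
  have fin: "finite ?P" by simp
  let ?X = "\<lambda>x. lin_comb n a x"
  let ?v = "\<lambda>x p. ?X x (fst p) \<otimes> \<sigma> (snd p)"
  have Xc: "?X x i \<in> carrier R" if "x \<in> points N" "i < d" for x i
    by (rule lin_comb_closed[OF a that(1)[unfolded N_def] that(2)])
  have XI: "?X x i \<in> I" if "x \<in> points N" "i < d" for x i
  proof -
    have "?X x i \<in> comb_ideal d n a x" by (rule comb_ideal_ideal(2)[OF a that(1)[unfolded N_def] that(2)])
    moreover have "comb_ideal d n a x \<subseteq> Idl (a ` {..<n})" by (rule comb_ideal_ideal(3)[OF a that(1)[unfolded N_def]])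
    ultimately show ?thesis using I by auto
  qed
  have vc: "?v x p \<in> carrier R" if "x \<in> points N" "p \<in> ?P" for x p using Xc[OF that(1)] \<sigma>c that(2) by auto
  have I2: "ideal (I \<cdot> I) R" by (rule ideal_prod_is_ideal[OF Ii Ii])
  have E: "ideal (I \<cdot> S) R" by (rule ideal_prod_is_ideal[OF Ii S])
  have mE: "e \<otimes> y \<in> I \<cdot> I" if e: "e \<in> \<mm>" and y: "y \<in> I \<cdot> S" for e y
    using y
  proof induction
    case (prod i j)
    have "e \<otimes> (i \<otimes> j) = i \<otimes> (e \<otimes> j)"
      using e m_carrier ideal.Icarr[OF Ii prod(1)] ideal.Icarr[OF S prod(2)] by (intro m_lcomm) auto
    then show ?case using ideal_prod.prod[OF prod(1) mS[OF e prod(2)], of R] by simp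
  next
    case (sum s1 s2)
    have "s1 \<in> carrier R" "s2 \<in> carrier R" using sum.hyps ideal.Icarr[OF E] by auto
    then have "e \<otimes> (s1 \<oplus> s2) = e \<otimes> s1 \<oplus> e \<otimes> s2" using e m_carrier by (intro r_distr) auto
    then show ?case using ideal_prod.sum[OF sum.IH] by simp
  qed
  have vE: "?v x0 ` ?P \<subseteq> I \<cdot> S" using XI[OF x0] \<sigma>S by (auto intro: ideal_prod.prod)
  \<comment> \<open>A relation among the products is a relation among the X_i with socle
    coefficients; injectivity puts these into I, and independence of \<open>\<sigma>\<close> then
    puts the scalars into \<mm>.\<close>
  have ind0: "kindep (I \<cdot> I) ?P (?v x0)" unfolding kindep_def
  proof (intro ballI impI)
    fix t p assume t: "t \<in> ?P \<rightarrow> carrier R" and rel: "(\<Oplus>p\<in>?P. t p \<otimes> ?v x0 p) \<in> I \<cdot> I" and p: "p \<in> ?P"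
    have tc: "t (i, q) \<in> carrier R" if "i < d" "q < g" for i q using t that by auto
    let ?S = "\<lambda>i. \<Oplus>q\<in>{..<g}. t (i, q) \<otimes> \<sigma> q"
    have Sc: "?S i \<in> carrier R" if "i < d" for i using tc[OF that] \<sigma>c by (auto intro!: finsum_closed)
    have "(\<Oplus>i\<in>{..<d}. ?S i \<otimes> ?X x0 i) \<in> I \<cdot> I"
      using rel finsum_bilinear[of "{..<d}" "{..<g}" t "?X x0" \<sigma>] tc Xc[OF x0] \<sigma>c by simp
    then have SI: "?S (fst p) \<in> I" using inj[of ?S "fst p", OF Sc] p by auto
    have "t (fst p, snd p) \<in> \<mm>"
      by (rule kindepD[OF \<sigma>(2), of "\<lambda>q. t (fst p, q)"]) (use SI tc p in auto)
    then show "t p \<in> \<mm>" by simp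
  qed
  \<comment> \<open>Modulo U the products at x0 are a basis of the image of I S, so the products of
    each a_j with each \<sigma> q, and with them the products at every x, acquire
    coordinates.\<close>
  obtain U where U: "ideal U R" "I \<cdot> I \<subseteq> U" "kindep U ?P (?v x0)" "I \<cdot> S \<subseteq> ext U (?v x0 ` ?P)"
    by (rule k_complement[where v = "?v x0", OF I2 E mE fin vE ind0])
  have vP: "?v x0 ` ?P \<subseteq> carrier R" using vc[OF x0] by auto
  have w: "?v x0 \<in> ?P \<rightarrow> carrier R" using vc[OF x0] by auto
  define pick where "pick j q = (SOME bM. fst bM \<in> U \<and> snd bM \<in> ?P \<rightarrow> carrier R \<and>
    a j \<otimes> \<sigma> q = fst bM \<oplus> (\<Oplus>p\<in>?P. snd bM p \<otimes> ?v x0 p))" for j q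
  define \<beta> where "\<beta> j q = fst (pick j q)" for j q
  define M where "M j q = snd (pick j q)" for j q
  have pick: "\<beta> j q \<in> U \<and> M j q \<in> ?P \<rightarrow> carrier R \<and> a j \<otimes> \<sigma> q = \<beta> j q \<oplus> (\<Oplus>p\<in>?P. M j q p \<otimes> ?v x0 p)"
    if jq: "j < n" "q < g" for j q
  proof -
    have mem: "a j \<otimes> \<sigma> q \<in> ext U (?v x0 ` ?P)" using U(4) ideal_prod.prod[OF aI[OF jq(1)] \<sigma>S[OF jq(2)], of R] by auto
    obtain b0 M0 where "b0 \<in> U" "M0 \<in> ?P \<rightarrow> carrier R" "a j \<otimes> \<sigma> q = b0 \<oplus> (\<Oplus>p\<in>?P. M0 p \<otimes> ?v x0 p)"
      by (rule ext_imageE[OF fin U(1) vP mem])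
    then have "\<exists>bM. fst bM \<in> U \<and> snd bM \<in> ?P \<rightarrow> carrier R \<and> a j \<otimes> \<sigma> q = fst bM \<oplus> (\<Oplus>p\<in>?P. snd bM p \<otimes> ?v x0 p)"
      by (intro exI[of _ "(b0, M0)"]) simp
    then show ?thesis unfolding \<beta>_def M_def pick_def by (rule someI_ex)
  qed
  define C where "C p p' x = (if p = p' then \<one> else \<zero>) \<oplus>
    (\<Oplus>j\<in>{..<n}. (x (fst p, j) \<ominus> x0 (fst p, j)) \<otimes> M j (snd p) p')" for p p' x
  have coord: "(\<lambda>x. x (fst p, j) \<ominus> x0 (fst p, j)) \<in> polyfun N" if "p \<in> ?P" "j \<in> {..<n}" for p j
    using that by (intro polyfun_coord_diff[OF _ x0]) (auto simp: N_def)
  have Mc: "M j (snd p) p' \<in> carrier R" "\<beta> j (snd p) \<in> U"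
    if "p \<in> ?P" "p' \<in> ?P" "j \<in> {..<n}" for p p' j using pick[of j "snd p"] that by auto
  have C1: "C p p' \<in> polyfun N" if "p \<in> ?P" "p' \<in> ?P" for p p'
  proof -
    have "(\<lambda>x. (if p = p' then \<one> else \<zero>) \<oplus> (\<Oplus>j\<in>{..<n}. (x (fst p, j) \<ominus> x0 (fst p, j)) \<otimes> M j (snd p) p')) \<in> polyfun N"
      using Mc(1)[OF that] coord[OF that(1)]
      by (intro polyfun.add polyfun.const polyfun_finsum polyfun_mult) auto
    then show ?thesis by (simp add: C_def[abs_def])
  qed
  have C3: "C p p' x0 = (if p = p' then \<one> else \<zero>)" if "p \<in> ?P" "p' \<in> ?P" for p p'
  proof -
    have "x0 (fst p, j) \<ominus> x0 (fst p, j) = \<zero>" if "j \<in> {..<n}" for j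
      using x0 that \<open>p \<in> ?P\<close> by (auto simp: N_def points_def r_neg a_minus_def)
    then have "(\<Oplus>j\<in>{..<n}. (x0 (fst p, j) \<ominus> x0 (fst p, j)) \<otimes> M j (snd p) p') = (\<Oplus>j\<in>{..<n}. \<zero>)"
      using Mc(1)[OF that] by (intro finsum_cong') auto
    then show ?thesis by (simp add: C_def)
  qed
  \<comment> \<open>The matrix is transposed: the unknowns are the coefficients t of a relation at
    x, and the relation at x0 obtained from it has coefficients t C.\<close>
  have "\<exists>f D. f \<in> polyfun N \<and> (\<forall>p\<in>?P. D p \<in> polyfun N) \<and> f x0 = \<one> \<and> (\<forall>p\<in>?P. D p x0 = \<zero>) \<and>
      (\<forall>x\<in>points N. \<forall>L w u. ideal L R \<and> w \<in> ?P \<rightarrow> carrier R \<and> u \<in> carrier R \<and>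
        (\<forall>p\<in>?P. (\<Oplus>q\<in>?P. C q p x \<otimes> w q) \<oplus> \<zero> \<otimes> u \<in> L) \<longrightarrow>
        (\<forall>p\<in>?P. f x \<otimes> w p \<oplus> D p x \<otimes> u \<in> L))"
  proof (rule polyfun_cramer[OF fin x0])
    show "C q p \<in> polyfun N" if "p \<in> ?P" "q \<in> ?P" for p q by (rule C1[OF that(2,1)])
    show "C q p x0 = (if p = q then \<one> else \<zero>)" if "p \<in> ?P" "q \<in> ?P" for p q using C3[OF that(2,1)] by auto
  qed (auto intro: polyfun.const)
  then obtain f D where f: "f \<in> polyfun N" "f x0 = \<one>" and D: "\<forall>p\<in>?P. D p \<in> polyfun N"
    and cr: "\<forall>x\<in>points N. \<forall>L w u. ideal L R \<and> w \<in> ?P \<rightarrow> carrier R \<and> u \<in> carrier R \<and>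
        (\<forall>p\<in>?P. (\<Oplus>q\<in>?P. C q p x \<otimes> w q) \<oplus> \<zero> \<otimes> u \<in> L) \<longrightarrow>
        (\<forall>p\<in>?P. f x \<otimes> w p \<oplus> D p x \<otimes> u \<in> L)"
    by (elim exE conjE)
  show thesis
  proof (rule that[OF f])
    fix x assume x: "x \<in> points N" and fm: "f x \<notin> \<mm>"
    have fc: "f x \<in> carrier R" by (rule polyfun_closed[OF f(1) x])
    have Cc: "C p p' x \<in> carrier R" if "p \<in> ?P" "p' \<in> ?P" for p p' by (rule polyfun_closed[OF C1[OF that] x])
    have row: "(\<Oplus>q\<in>?P. C p q x \<otimes> ?v x0 q) \<ominus> ?v x p \<in> U" if p: "p \<in> ?P" for p
    proof -
      have pp: "fst p < d" "snd p < g" "\<sigma> (snd p) \<in> carrier R" using p \<sigma>c by auto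
      let ?c = "\<lambda>j. x (fst p, j) \<ominus> x0 (fst p, j)"
      have cc: "?c j \<in> carrier R" if "j \<in> {..<n}" for j
        using x x0 that p by (auto simp: N_def points_def)
      have "((\<Oplus>q\<in>?P. C p q x \<otimes> ?v x0 q) \<oplus> (\<Oplus>j\<in>{..<n}. ?c j \<otimes> \<zero>) \<otimes> \<zero>) \<ominus>
        (?v x0 p \<oplus> (\<Oplus>j\<in>{..<n}. ?c j \<otimes> (a j \<otimes> \<sigma> (snd p)))) \<in> U"
        unfolding C_def
      proof (rule perturbed_row[OF U(1) _ fin p w zero_closed cc, where b = "\<lambda>j. \<beta> j (snd p)"])
        fix j assume j: "j \<in> {..<n}"
        show "\<beta> j (snd p) \<in> U" by (rule Mc(2)[OF p p j])
        show "a j \<otimes> \<sigma> (snd p) = \<beta> j (snd p) \<oplus> \<zero> \<otimes> \<zero> \<oplus> (\<Oplus>q\<in>?P. M j (snd p) q \<otimes> ?v x0 q)"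
          using pick[of j "snd p"] j pp ideal.Icarr[OF U(1)] by auto
        show "M j (snd p) q \<in> carrier R" if "q \<in> ?P" for q by (rule Mc(1)[OF p that j])
      qed auto
      also have "?v x0 p \<oplus> (\<Oplus>j\<in>{..<n}. ?c j \<otimes> (a j \<otimes> \<sigma> (snd p))) = ?v x p"
        using lin_comb_perturb[OF a x[unfolded N_def] x0[unfolded N_def] pp(1,3)] by simp
      also have "(\<Oplus>j\<in>{..<n}. ?c j \<otimes> \<zero>) \<otimes> \<zero> = \<zero>" using cc by (intro r_null finsum_closed) auto
      also have "(\<Oplus>q\<in>?P. C p q x \<otimes> ?v x0 q) \<oplus> \<zero> = (\<Oplus>q\<in>?P. C p q x \<otimes> ?v x0 q)"
        by (intro r_zero finsum_closed funcsetI m_closed Cc[OF p] vc[OF x0])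
      finally show ?thesis .
    qed
    have "kindep (I \<cdot> I) ?P (?v x)" unfolding kindep_def
    proof (intro ballI impI)
      fix t p assume t: "t \<in> ?P \<rightarrow> carrier R" and rel: "(\<Oplus>p\<in>?P. t p \<otimes> ?v x p) \<in> I \<cdot> I" and p: "p \<in> ?P"
      have tc: "t p \<in> carrier R" if "p \<in> ?P" for p by (rule funcset_mem[OF t that])
      let ?R = "\<lambda>p. \<Oplus>q\<in>?P. C p q x \<otimes> ?v x0 q"
      have Rc: "?R p \<in> carrier R" if "p \<in> ?P" for p
        by (intro finsum_closed funcsetI m_closed Cc[OF that] vc[OF x0])
      have "(\<Oplus>p\<in>?P. t p \<otimes> ?R p) = (\<Oplus>p\<in>?P. t p \<otimes> (?R p \<ominus> ?v x p) \<oplus> t p \<otimes> ?v x p)"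
      proof (rule finsum_cong'[OF refl])
        have dist: "s \<otimes> y = s \<otimes> (y \<ominus> z) \<oplus> s \<otimes> z" if "s \<in> carrier R" "y \<in> carrier R" "z \<in> carrier R" for s y z
          using that by algebra
        show "t p \<otimes> ?R p = t p \<otimes> (?R p \<ominus> ?v x p) \<oplus> t p \<otimes> ?v x p" if "p \<in> ?P" for p
          by (rule dist[OF tc[OF that] Rc[OF that] vc[OF x that]])
        show "(\<lambda>p. t p \<otimes> (?R p \<ominus> ?v x p) \<oplus> t p \<otimes> ?v x p) \<in> ?P \<rightarrow> carrier R"
          by (intro funcsetI a_closed m_closed minus_closed tc Rc vc[OF x])
      qed
      also have "\<dots> = (\<Oplus>p\<in>?P. t p \<otimes> (?R p \<ominus> ?v x p)) \<oplus> (\<Oplus>p\<in>?P. t p \<otimes> ?v x p)"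
        by (intro finsum_addf funcsetI m_closed minus_closed tc Rc vc[OF x])
      also have "\<dots> \<in> U"
      proof (intro ideal_add[OF U(1)])
        show "(\<Oplus>p\<in>?P. t p \<otimes> (?R p \<ominus> ?v x p)) \<in> U"
          by (intro ideal_finsum[OF U(1)] ideal.I_l_closed[OF U(1)] row tc)
        show "(\<Oplus>p\<in>?P. t p \<otimes> ?v x p) \<in> U" using rel U(2) by (rule subsetD[rotated])
      qed
      also have "(\<Oplus>p\<in>?P. t p \<otimes> ?R p) = (\<Oplus>q\<in>?P. (\<Oplus>p\<in>?P. t p \<otimes> C p q x) \<otimes> ?v x0 q)"
        by (rule finsum_matrix[OF fin fin w t Cc])
      finally have relU: "(\<Oplus>q\<in>?P. (\<Oplus>p\<in>?P. t p \<otimes> C p q x) \<otimes> ?v x0 q) \<in> U" .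
      \<comment> \<open>Independence at x0 modulo U turns the transferred relation into linear
        conditions on t modulo \<mm>, and a unit determinant then forces t itself into
        \<mm>.\<close>
      have "(\<Oplus>p\<in>?P. t p \<otimes> C p q x) \<in> \<mm>" if q: "q \<in> ?P" for q
        by (rule kindepD[OF U(3) _ relU q]) (intro finsum_closed funcsetI m_closed tc Cc)
      moreover have "(\<Oplus>p\<in>?P. C p q x \<otimes> t p) = (\<Oplus>p\<in>?P. t p \<otimes> C p q x)" if q: "q \<in> ?P" for q
      proof (rule finsum_cong'[OF refl])
        show "(\<lambda>p. t p \<otimes> C p q x) \<in> ?P \<rightarrow> carrier R" by (intro funcsetI m_closed tc Cc q)
        show "C p q x \<otimes> t p = t p \<otimes> C p q x" if "p \<in> ?P" for p by (rule m_comm[OF Cc[OF that q] tc[OF that]])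
      qed
      ultimately have "\<forall>q\<in>?P. (\<Oplus>p\<in>?P. C p q x \<otimes> t p) \<oplus> \<zero> \<otimes> \<zero> \<in> \<mm>"
        using m_carrier by (auto simp: subset_iff)
      then have "\<forall>p\<in>?P. f x \<otimes> t p \<oplus> D p x \<otimes> \<zero> \<in> \<mm>"
        using bspec[OF cr x, THEN spec[of _ \<mm>], THEN spec[of _ t], THEN spec[of _ \<zero>]] m_ideal t by blast
      then have "f x \<otimes> t p \<oplus> D p x \<otimes> \<zero> \<in> \<mm>" using p by blast
      moreover have "D p x \<in> carrier R" using polyfun_closed[OF bspec[OF D p] x] .
      ultimately have "f x \<otimes> t p \<in> \<mm>" using fc tc[OF p] by simp
      then show "t p \<in> \<mm>" by (rule unit_cancel[OF m_ideal fc fm tc[OF p]])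
    qed
    then show "comb_ideal d n a x \<inter> (I \<cdot> I) \<subseteq> comb_ideal d n a x \<cdot> I"
      by (intro comb_ideal_inter_square[OF a I prim x[unfolded N_def] \<sigma>c])
        (auto intro: mS \<sigma>S subsetD[OF \<sigma>(3)] simp: S_def[symmetric])
  qed
qed

end

section \<open>The Zariski topology on residue points\<close>

context cring
begin

definition monomial_eval :: "('c \<Rightarrow> 'a) \<Rightarrow> 'c multiset \<Rightarrow> 'a" where
  "monomial_eval x M = (\<Otimes>i\<in>set_mset M. x i [^] count M i)"

lemma monomial_eval_closed: "(\<And>i. i \<in># M \<Longrightarrow> x i \<in> carrier R) \<Longrightarrow> monomial_eval x M \<in> carrier R"
  unfolding monomial_eval_def by (intro finprod_closed) auto

lemma monomial_eval_add_mset: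
  assumes i: "x i \<in> carrier R" and M: "\<And>j. j \<in># M \<Longrightarrow> x j \<in> carrier R"
  shows "monomial_eval x (add_mset i M) = monomial_eval x M \<otimes> x i"
proof -
  let ?A = "insert i (set_mset M)" and ?B = "set_mset M - {i}"
  have split: "(\<Otimes>j\<in>?A. x j [^] count L j) = x i [^] count L i \<otimes> (\<Otimes>j\<in>?B. x j [^] count L j)" for L
  proof -
    have "insert i (set_mset M) = insert i ?B" by auto
    then show ?thesis using i M by (subst finprod_insert[symmetric]) auto
  qed
  have P: "(\<Otimes>j\<in>?B. x j [^] count M j) \<in> carrier R" using M by (intro finprod_closed) auto
  have "monomial_eval x M = (\<Otimes>j\<in>?A. x j [^] count M j)" unfolding monomial_eval_def
    by (intro finprod_mono_neutral_cong_left) (use i M in \<open>auto simp: not_in_iff\<close>)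
  then have e1: "monomial_eval x M = x i [^] count M i \<otimes> (\<Otimes>j\<in>?B. x j [^] count M j)" by (simp only: split)
  have "monomial_eval x (add_mset i M) = (\<Otimes>j\<in>?A. x j [^] count (add_mset i M) j)" unfolding monomial_eval_def by simp
  also have "\<dots> = x i [^] count (add_mset i M) i \<otimes> (\<Otimes>j\<in>?B. x j [^] count (add_mset i M) j)" by (rule split)
  also have "(\<Otimes>j\<in>?B. x j [^] count (add_mset i M) j) = (\<Otimes>j\<in>?B. x j [^] count M j)"
    by (intro finprod_cong') (use M in auto)
  also have "x i [^] count (add_mset i M) i = x i [^] count M i \<otimes> x i" by simp
  finally show ?thesis
  proof -
    assume e2: "monomial_eval x (add_mset i M) = x i [^] count M i \<otimes> x i \<otimes> (\<Otimes>j\<in>?B. x j [^] count M j)"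
    have "u \<otimes> x i \<otimes> w = u \<otimes> w \<otimes> x i" if "u \<in> carrier R" "w \<in> carrier R" for u w using that i by algebra
    from this[OF nat_pow_closed[OF i] P] show ?thesis unfolding e1 e2 .
  qed
qed

lemma indexed_pset_support:
  assumes "P \<in> indexed_pset N (carrier R)"
  shows "finite {M. P M \<noteq> \<zero>}" "\<And>M. P M \<noteq> \<zero> \<Longrightarrow> set_mset M \<subseteq> N" "\<And>M. P M \<in> carrier R"
proof -
  have "finite {M. P M \<noteq> \<zero>} \<and> (\<forall>M. P M \<noteq> \<zero> \<longrightarrow> set_mset M \<subseteq> N)"
    using assms
  proof induction
    case (indexed_const k)
    have "{M. ring.indexed_const R k M \<noteq> \<zero>} \<subseteq> {{#}}" by (auto simp: indexed_const_def)
    then show ?case by (auto simp: finite_subset indexed_const_def)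
  next
    case (indexed_padd P Q)
    have "{M. indexed_padd P Q M \<noteq> \<zero>} \<subseteq> {M. P M \<noteq> \<zero>} \<union> {M. Q M \<noteq> \<zero>}"
      by (auto simp: indexed_padd_def)
    then show ?case using indexed_padd.IH finite_subset by (fastforce simp: finite_subset)
  next
    case (indexed_pmult P i)
    have sub: "{M. indexed_pmult P i M \<noteq> \<zero>} \<subseteq> add_mset i ` {M. P M \<noteq> \<zero>}"
    proof
      fix M assume "M \<in> {M. indexed_pmult P i M \<noteq> \<zero>}"
      then have "i \<in># M" "P (M - {#i#}) \<noteq> \<zero>" by (auto simp: indexed_pmult_def split: if_splits)
      then show "M \<in> add_mset i ` {M. P M \<noteq> \<zero>}" by (intro image_eqI[of _ _ "M - {#i#}"]) auto
    qed
    have "set_mset M \<subseteq> N" if nz: "indexed_pmult P i M \<noteq> \<zero>" for M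
    proof -
      obtain M' where "M = add_mset i M'" "P M' \<noteq> \<zero>" using sub nz by blast
      then show ?thesis using indexed_pmult.IH indexed_pmult.hyps by auto
    qed
    then show ?case using indexed_pmult.IH finite_subset[OF sub] by blast
  qed
  then show "finite {M. P M \<noteq> \<zero>}" "\<And>M. P M \<noteq> \<zero> \<Longrightarrow> set_mset M \<subseteq> N" by blast+
  show "P M \<in> carrier R" for M
    using indexed_pset_in_carrier[OF subset_refl assms] by (simp add: carrier_coeff_def)
qed

lemma indexed_poly_eval_superset:
  assumes "finite S" "{M. P M \<noteq> \<zero>} \<subseteq> S" "\<And>M. M \<in> S \<Longrightarrow> set_mset M \<subseteq> N" "\<And>M. P M \<in> carrier R"
    and "x \<in> N \<rightarrow> carrier R"
  shows "indexed_poly_eval R P x = (\<Oplus>M\<in>S. P M \<otimes> monomial_eval x M)"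
proof -
  have c: "monomial_eval x M \<in> carrier R" if "M \<in> S" for M
    using assms(3)[OF that] assms(5) by (intro monomial_eval_closed) auto
  show ?thesis unfolding indexed_poly_eval_def monomial_eval_def[symmetric]
    using assms(1,2,4) c by (intro add.finprod_mono_neutral_cong_left) auto
qed

lemma indexed_poly_eval_const:
  assumes "k \<in> carrier R"
  shows "indexed_poly_eval R (indexed_const k) x = k"
proof -
  have "indexed_poly_eval R (indexed_const k) x = (\<Oplus>M\<in>{{#}}. indexed_const k M \<otimes> monomial_eval x M)"
    by (rule indexed_poly_eval_superset[where N = "{}"]) (use assms in \<open>auto simp: indexed_const_def\<close>)
  also have "\<dots> = k" using assms by (simp add: indexed_const_def monomial_eval_def)
  finally show ?thesis .
qed

lemma indexed_poly_eval_padd: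
  assumes P: "P \<in> indexed_pset N (carrier R)" and Q: "Q \<in> indexed_pset N (carrier R)"
    and x: "x \<in> N \<rightarrow> carrier R"
  shows "indexed_poly_eval R (indexed_padd P Q) x = indexed_poly_eval R P x \<oplus> indexed_poly_eval R Q x"
proof -
  note p = indexed_pset_support[OF P] and q = indexed_pset_support[OF Q]
  let ?S = "{M. P M \<noteq> \<zero>} \<union> {M. Q M \<noteq> \<zero>}"
  have fin: "finite ?S" using p(1) q(1) by simp
  have N: "set_mset M \<subseteq> N" if "M \<in> ?S" for M using p(2)[of M] q(2)[of M] that by blast
  have c: "monomial_eval x M \<in> carrier R" if "M \<in> ?S" for M
    using N[OF that] x by (intro monomial_eval_closed) auto
  have "indexed_poly_eval R (indexed_padd P Q) x = (\<Oplus>M\<in>?S. indexed_padd P Q M \<otimes> monomial_eval x M)"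
    by (rule indexed_poly_eval_superset[OF fin _ N _ x]) (use p(3) q(3) in \<open>auto simp: indexed_padd_def\<close>)
  also have "\<dots> = (\<Oplus>M\<in>?S. P M \<otimes> monomial_eval x M \<oplus> Q M \<otimes> monomial_eval x M)"
    by (intro finsum_cong') (use p(3) q(3) c in \<open>auto simp: indexed_padd_def l_distr\<close>)
  also have "\<dots> = (\<Oplus>M\<in>?S. P M \<otimes> monomial_eval x M) \<oplus> (\<Oplus>M\<in>?S. Q M \<otimes> monomial_eval x M)"
    by (intro finsum_addf) (use p(3) q(3) c in auto)
  also have "(\<Oplus>M\<in>?S. P M \<otimes> monomial_eval x M) = indexed_poly_eval R P x"
    by (rule indexed_poly_eval_superset[OF fin _ N p(3) x, symmetric]) auto
  also have "(\<Oplus>M\<in>?S. Q M \<otimes> monomial_eval x M) = indexed_poly_eval R Q x"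
    by (rule indexed_poly_eval_superset[OF fin _ N q(3) x, symmetric]) auto
  finally show ?thesis .
qed

lemma indexed_poly_eval_pmult:
  assumes P: "P \<in> indexed_pset N (carrier R)" and i: "i \<in> N" and x: "x \<in> N \<rightarrow> carrier R"
  shows "indexed_poly_eval R (indexed_pmult P i) x = indexed_poly_eval R P x \<otimes> x i"
proof -
  note p = indexed_pset_support[OF P]
  let ?S = "{M. P M \<noteq> \<zero>}"
  have xi: "x i \<in> carrier R" using x i by auto
  have sub: "{M. indexed_pmult P i M \<noteq> \<zero>} \<subseteq> add_mset i ` ?S"
  proof
    fix M assume "M \<in> {M. indexed_pmult P i M \<noteq> \<zero>}"
    then have "i \<in># M" "P (M - {#i#}) \<noteq> \<zero>" by (auto simp: indexed_pmult_def split: if_splits)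
    then show "M \<in> add_mset i ` ?S" by (intro image_eqI[of _ _ "M - {#i#}"]) auto
  qed
  have c: "monomial_eval x M \<in> carrier R" if "M \<in> ?S" for M
    using p(2)[of M] that x by (intro monomial_eval_closed) auto
  have xM: "x j \<in> carrier R" if "M \<in> ?S" "j \<in># M" for M j using p(2)[of M] that x by auto
  have ev: "monomial_eval x (add_mset i M) = monomial_eval x M \<otimes> x i" if "M \<in> ?S" for M
    by (rule monomial_eval_add_mset[of x i M, OF xi xM[OF that]])
  have "indexed_poly_eval R (indexed_pmult P i) x = (\<Oplus>M\<in>add_mset i ` ?S. indexed_pmult P i M \<otimes> monomial_eval x M)"
  proof (rule indexed_poly_eval_superset[OF _ sub _ _ x])
    show "set_mset M \<subseteq> N" if "M \<in> add_mset i ` ?S" for M using that p(2) i by force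
  qed (use p in \<open>auto simp: indexed_pmult_def\<close>)
  also have "\<dots> = (\<Oplus>M\<in>?S. indexed_pmult P i (add_mset i M) \<otimes> monomial_eval x (add_mset i M))"
    by (intro finsum_reindex) (use p(3) c xi ev in \<open>auto simp: indexed_pmult_def inj_on_def\<close>)
  also have "\<dots> = (\<Oplus>M\<in>?S. P M \<otimes> monomial_eval x M \<otimes> x i)"
    by (intro finsum_cong') (use p(3) c xi ev in \<open>auto simp: indexed_pmult_def m_assoc\<close>)
  also have "\<dots> = (\<Oplus>M\<in>?S. P M \<otimes> monomial_eval x M) \<otimes> x i"
    by (intro finsum_ldistr[symmetric]) (use p c xi in auto)
  also have "(\<Oplus>M\<in>?S. P M \<otimes> monomial_eval x M) = indexed_poly_eval R P x"
    by (rule indexed_poly_eval_superset[OF p(1) _ _ p(3) x, symmetric]) (use p(2) in auto)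
  finally show ?thesis .
qed

end

section \<open>Polynomial functions and open sets over the residue field\<close>

context noetherian_local
begin

definition residue_point :: "'i set \<Rightarrow> ('i \<Rightarrow> 'a) \<Rightarrow> 'i \<Rightarrow> 'a set" where
  "residue_point N x = (\<lambda>i\<in>N. \<mm> +> x i)"

lemma residue_cring: "cring (R Quot \<mm>)"
  by (rule ideal.quotient_is_cring[OF m_ideal is_cring])

lemma residue_hom: "(+>) \<mm> \<in> ring_hom R (R Quot \<mm>)"
  by (rule ideal.rcos_ring_hom[OF m_ideal])

lemma residue_eq_zero: "y \<in> carrier R \<Longrightarrow> \<mm> +> y = \<zero>\<^bsub>R Quot \<mm>\<^esub> \<longleftrightarrow> y \<in> \<mm>"
  using quotient_eq_iff_same_a_r_cos[OF m_ideal, of y \<zero>] ideal_zero[OF m_ideal]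
    a_rcos_zero[OF m_ideal ideal_zero[OF m_ideal]]
  by (simp add: FactRing_def a_minus_def)

lemma residue_point_closed: "x \<in> points N \<Longrightarrow> residue_point N x \<in> N \<rightarrow>\<^sub>E carrier (R Quot \<mm>)"
  using ring_hom_closed[OF residue_hom] by (auto simp: residue_point_def points_def)

lemma residue_pointE:
  assumes y: "y \<in> N \<rightarrow>\<^sub>E carrier (R Quot \<mm>)"
  obtains x where "x \<in> points N" "residue_point N x = y"
proof -
  define x where "x i = (SOME r. r \<in> carrier R \<and> \<mm> +> r = y i)" for i
  have x: "x i \<in> carrier R \<and> \<mm> +> x i = y i" if "i \<in> N" for i
  proof -
    have "y i \<in> carrier (R Quot \<mm>)" using y that by auto
    then have "\<exists>r. r \<in> carrier R \<and> \<mm> +> r = y i" by (auto simp: FactRing_def A_RCOSETS_def')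
    then show ?thesis unfolding x_def by (rule someI_ex)
  qed
  have "residue_point N x = y"
  proof
    fix i show "residue_point N x i = y i"
      using x PiE_arb[OF y, of i] by (cases "i \<in> N") (auto simp: residue_point_def)
  qed
  moreover have "x \<in> points N" using x by (simp add: points_def)
  ultimately show thesis by (rule that[rotated])
qed

interpretation Q: cring "R Quot \<mm>" by (rule residue_cring)

abbreviation residue_poly :: "'i set \<Rightarrow> ('i multiset \<Rightarrow> 'a set) set" where
  "residue_poly N \<equiv> ring.indexed_pset (R Quot \<mm>) N (carrier (R Quot \<mm>))"

lemma residue_point_Pi: "x \<in> points N \<Longrightarrow> residue_point N x \<in> N \<rightarrow> carrier (R Quot \<mm>)"
  using residue_point_closed by (auto simp: PiE_def)

lemma polyfun_residue:
  "f \<in> polyfun N \<Longrightarrow> \<exists>P\<in>residue_poly N. \<forall>x\<in>points N. indexed_poly_eval (R Quot \<mm>) P (residue_point N x) = \<mm> +> f x"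
proof (induction rule: polyfun.induct)
  case (const c)
  have "\<mm> +> c \<in> carrier (R Quot \<mm>)" using ring_hom_closed[OF residue_hom const] .
  then show ?case
    using Q.indexed_poly_eval_const Q.indexed_pset.indexed_const[of _ "carrier (R Quot \<mm>)" N]
    by (intro bexI[of _ "Q.indexed_const (\<mm> +> c)"]) auto
next
  case (add f g)
  obtain P where P: "P \<in> residue_poly N"
    "\<And>x. x \<in> points N \<Longrightarrow> indexed_poly_eval (R Quot \<mm>) P (residue_point N x) = \<mm> +> f x" using add.IH by blast
  obtain P' where P': "P' \<in> residue_poly N"
    "\<And>x. x \<in> points N \<Longrightarrow> indexed_poly_eval (R Quot \<mm>) P' (residue_point N x) = \<mm> +> g x" using add.IH by blast
  show ?case
  proof (intro bexI ballI)
    show "Q.indexed_padd P P' \<in> residue_poly N" by (rule Q.indexed_pset.indexed_padd[OF P(1) P'(1)])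
    fix x assume x: "x \<in> points N"
    show "indexed_poly_eval (R Quot \<mm>) (Q.indexed_padd P P') (residue_point N x) = \<mm> +> (f x \<oplus> g x)"
      unfolding Q.indexed_poly_eval_padd[OF P(1) P'(1) residue_point_Pi[OF x]] P(2)[OF x] P'(2)[OF x]
      by (rule ring_hom_add[OF residue_hom polyfun_closed[OF add.hyps(1) x] polyfun_closed[OF add.hyps(2) x], symmetric])
  qed
next
  case (mult_var f i)
  obtain P where P: "P \<in> residue_poly N"
    "\<And>x. x \<in> points N \<Longrightarrow> indexed_poly_eval (R Quot \<mm>) P (residue_point N x) = \<mm> +> f x" using mult_var.IH by blast
  show ?case
  proof (intro bexI ballI)
    show "Q.indexed_pmult P i \<in> residue_poly N" by (rule Q.indexed_pset.indexed_pmult[OF P(1) mult_var.hyps(2)])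
    fix x assume x: "x \<in> points N"
    have "x i \<in> carrier R" using x mult_var.hyps(2) by (simp add: points_def)
    then show "indexed_poly_eval (R Quot \<mm>) (Q.indexed_pmult P i) (residue_point N x) = \<mm> +> (f x \<otimes> x i)"
      using Q.indexed_poly_eval_pmult[OF P(1) mult_var.hyps(2) residue_point_Pi[OF x]] P(2)[OF x] mult_var.hyps(2)
        ring_hom_mult[OF residue_hom polyfun_closed[OF mult_var.hyps(1) x], of "x i"] by (simp add: residue_point_def)
  qed
next
  case (eq_on f g)
  then show ?case by auto
qed

text \<open>Coefficients are lifted along R \<rightarrow> R/\<mm>, following the construction of the
  polynomial. Together with the reduction above this identifies subbasic open sets with
  non-vanishing sets of polynomial functions over R.\<close>

lemma residue_poly_lift:
  assumes "P \<in> residue_poly N"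
  shows "\<exists>f\<in>polyfun N. \<forall>x\<in>points N. indexed_poly_eval (R Quot \<mm>) P (residue_point N x) = \<mm> +> f x"
  using assms
proof (induction rule: Q.indexed_pset.induct)
  case (indexed_const k)
  then obtain c where c: "c \<in> carrier R" "k = \<mm> +> c" by (auto simp: FactRing_def A_RCOSETS_def')
  show ?case
    using indexed_const c by (intro bexI[of _ "\<lambda>_. c"] polyfun.const[OF c(1)]) (simp add: Q.indexed_poly_eval_const)
next
  case (indexed_padd P P')
  obtain f where f: "f \<in> polyfun N"
    "\<And>x. x \<in> points N \<Longrightarrow> indexed_poly_eval (R Quot \<mm>) P (residue_point N x) = \<mm> +> f x" using indexed_padd.IH by blast
  obtain g where g: "g \<in> polyfun N"
    "\<And>x. x \<in> points N \<Longrightarrow> indexed_poly_eval (R Quot \<mm>) P' (residue_point N x) = \<mm> +> g x" using indexed_padd.IH by blast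
  show ?case
  proof (intro bexI ballI)
    show "(\<lambda>x. f x \<oplus> g x) \<in> polyfun N" by (rule polyfun.add[OF f(1) g(1)])
    fix x assume x: "x \<in> points N"
    show "indexed_poly_eval (R Quot \<mm>) (Q.indexed_padd P P') (residue_point N x) = \<mm> +> (f x \<oplus> g x)"
      unfolding Q.indexed_poly_eval_padd[OF indexed_padd.hyps residue_point_Pi[OF x]] f(2)[OF x] g(2)[OF x]
      by (rule ring_hom_add[OF residue_hom polyfun_closed[OF f(1) x] polyfun_closed[OF g(1) x], symmetric])
  qed
next
  case (indexed_pmult P i)
  obtain f where f: "f \<in> polyfun N"
    "\<And>x. x \<in> points N \<Longrightarrow> indexed_poly_eval (R Quot \<mm>) P (residue_point N x) = \<mm> +> f x" using indexed_pmult.IH by blast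
  show ?case
  proof (intro bexI ballI)
    show "(\<lambda>x. f x \<otimes> x i) \<in> polyfun N" by (rule polyfun.mult_var[OF f(1) indexed_pmult.hyps(2)])
    fix x assume x: "x \<in> points N"
    have "x i \<in> carrier R" using x indexed_pmult.hyps(2) by (simp add: points_def)
    then show "indexed_poly_eval (R Quot \<mm>) (Q.indexed_pmult P i) (residue_point N x) = \<mm> +> (f x \<otimes> x i)"
      using Q.indexed_poly_eval_pmult[OF indexed_pmult.hyps residue_point_Pi[OF x]] f(2)[OF x] indexed_pmult.hyps(2)
        ring_hom_mult[OF residue_hom polyfun_closed[OF f(1) x], of "x i"] by (simp add: residue_point_def)
  qed
qed

definition distinguished :: "'i set \<Rightarrow> (('i \<Rightarrow> 'a) \<Rightarrow> 'a) \<Rightarrow> ('i \<Rightarrow> 'a set) set" where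
  "distinguished N f = residue_point N ` {x \<in> points N. f x \<notin> \<mm>}"

text \<open>The class of f x modulo \<mm> is the value of a polynomial at the residues of x, so it
  does not depend on the chosen lift.\<close>

lemma distinguished_iff:
  assumes f: "f \<in> polyfun N" and x: "x \<in> points N"
  shows "residue_point N x \<in> distinguished N f \<longleftrightarrow> f x \<notin> \<mm>"
proof
  assume "residue_point N x \<in> distinguished N f"
  then obtain x' where x': "x' \<in> points N" "f x' \<notin> \<mm>" "residue_point N x' = residue_point N x"
    by (auto simp: distinguished_def)
  obtain P where P: "\<And>x. x \<in> points N \<Longrightarrow> indexed_poly_eval (R Quot \<mm>) P (residue_point N x) = \<mm> +> f x"
    using polyfun_residue[OF f] by blast
  have "\<mm> +> f x' = \<mm> +> f x" using P[OF x] P[OF x'(1)] x'(3) by simp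
  then show "f x \<notin> \<mm>" using residue_eq_zero polyfun_closed[OF f x] polyfun_closed[OF f x'(1)] x'(2) by metis
qed (use x in \<open>auto simp: distinguished_def\<close>)

lemma distinguished_eq:
  assumes f: "f \<in> polyfun N"
    and P: "\<And>x. x \<in> points N \<Longrightarrow> indexed_poly_eval (R Quot \<mm>) P (residue_point N x) = \<mm> +> f x"
  shows "distinguished N f =
    {y \<in> N \<rightarrow>\<^sub>E carrier (R Quot \<mm>). indexed_poly_eval (R Quot \<mm>) P y \<noteq> \<zero>\<^bsub>R Quot \<mm>\<^esub>}" (is "_ = ?D")
proof
  show "distinguished N f \<subseteq> ?D"
  proof
    fix y assume "y \<in> distinguished N f"
    then obtain x where x: "x \<in> points N" "f x \<notin> \<mm>" "y = residue_point N x" by (auto simp: distinguished_def)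
    then show "y \<in> ?D" using P[OF x(1)] residue_eq_zero[OF polyfun_closed[OF f x(1)]] residue_point_closed[OF x(1)] by simp
  qed
  show "?D \<subseteq> distinguished N f"
  proof
    fix y assume y: "y \<in> ?D"
    then obtain x where x: "x \<in> points N" "residue_point N x = y" using residue_pointE by blast
    then have "f x \<notin> \<mm>" using y P[OF x(1)] residue_eq_zero[OF polyfun_closed[OF f x(1)]] by auto
    then show "y \<in> distinguished N f" using x by (auto simp: distinguished_def)
  qed
qed

lemma openin_distinguished:
  assumes f: "f \<in> polyfun N"
  shows "openin (zariski_topology (R Quot \<mm>) N) (distinguished N f)"
proof -
  obtain P where P: "P \<in> residue_poly N"
    "\<And>x. x \<in> points N \<Longrightarrow> indexed_poly_eval (R Quot \<mm>) P (residue_point N x) = \<mm> +> f x"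
    using polyfun_residue[OF f] by blast
  have "distinguished N f = {y \<in> N \<rightarrow>\<^sub>E carrier (R Quot \<mm>). indexed_poly_eval (R Quot \<mm>) P y \<noteq> \<zero>\<^bsub>R Quot \<mm>\<^esub>}"
    by (rule distinguished_eq[OF f P(2)])
  then show ?thesis unfolding zariski_topology_def using P(1)
    by (intro topology_generated_by_Basis) blast
qed

text \<open>The topology is given by a subbasis. Since \<mm> is prime, f g avoids \<mm> exactly
  where both f and g do, so the non-vanishing sets are closed under intersection and already form a
  base.\<close>

lemma distinguished_base:
  assumes "openin (zariski_topology (R Quot \<mm>) N) W" "y \<in> W"
  shows "\<exists>f\<in>polyfun N. y \<in> distinguished N f \<and> distinguished N f \<subseteq> W"
proof -
  have "generate_topology_on {{x \<in> N \<rightarrow>\<^sub>E carrier (R Quot \<mm>). indexed_poly_eval (R Quot \<mm>) P x \<noteq> \<zero>\<^bsub>R Quot \<mm>\<^esub>} | P.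
      P \<in> residue_poly N} W"
    using assms(1) unfolding zariski_topology_def by (rule openin_topology_generated_by)
  then show ?thesis using assms(2)
  proof (induction arbitrary: y)
    case (Int A B)
    obtain f where f: "f \<in> polyfun N" "y \<in> distinguished N f" "distinguished N f \<subseteq> A" using Int by blast
    obtain g where g: "g \<in> polyfun N" "y \<in> distinguished N g" "distinguished N g \<subseteq> B" using Int by blast
    obtain x where x: "x \<in> points N" "y = residue_point N x" using f(2) by (auto simp: distinguished_def)
    have fg: "(\<lambda>x. f x \<otimes> g x) \<in> polyfun N" by (rule polyfun_mult[OF f(1) g(1)])
    have nz: "f x \<otimes> g x \<notin> \<mm> \<longleftrightarrow> f x \<notin> \<mm> \<and> g x \<notin> \<mm>" if "x \<in> points N" for x
      using notin_m_mult[OF polyfun_closed[OF f(1) that] polyfun_closed[OF g(1) that]]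
        ideal.I_l_closed[OF m_ideal _ polyfun_closed[OF f(1) that], of "g x"]
        ideal.I_r_closed[OF m_ideal _ polyfun_closed[OF g(1) that], of "f x"] by blast
    have "distinguished N (\<lambda>x. f x \<otimes> g x) \<subseteq> distinguished N f \<inter> distinguished N g"
      using nz by (auto simp: distinguished_def)
    moreover have "y \<in> distinguished N (\<lambda>x. f x \<otimes> g x)"
      using f(2) g(2) nz[OF x(1)] unfolding x(2) distinguished_iff[OF fg x(1)] distinguished_iff[OF f(1) x(1)]
        distinguished_iff[OF g(1) x(1)] by simp
    ultimately show ?case using fg f(3) g(3) by (intro bexI[of _ "\<lambda>x. f x \<otimes> g x"]) auto
  next
    case (UN K)
    then obtain k where k: "k \<in> K" "y \<in> k" by blast
    from UN.IH[OF this] show ?case using k(1) by blast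
  next
    case (Basis s)
    then obtain P where P: "P \<in> residue_poly N"
      "s = {x \<in> N \<rightarrow>\<^sub>E carrier (R Quot \<mm>). indexed_poly_eval (R Quot \<mm>) P x \<noteq> \<zero>\<^bsub>R Quot \<mm>\<^esub>}" by blast
    obtain f where f: "f \<in> polyfun N"
      "\<And>x. x \<in> points N \<Longrightarrow> indexed_poly_eval (R Quot \<mm>) P (residue_point N x) = \<mm> +> f x"
      using residue_poly_lift[OF P(1)] by blast
    show ?case using distinguished_eq[OF f] P(2) Basis(2) f(1) by (intro bexI[of _ f]) auto
  qed simp
qed

end

context noetherian_local_inf
begin

lemma dense_open_distinguished:
  assumes f: "f \<in> polyfun N" "x \<in> points N" "f x \<notin> \<mm>"
  shows "dense_open_in (zariski_topology (R Quot \<mm>) N) (distinguished N f)"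
  unfolding dense_open_in_def
proof (intro conjI openin_distinguished[OF f(1)] subset_antisym closure_of_subset_topspace subsetI)
  fix y assume y: "y \<in> topspace (zariski_topology (R Quot \<mm>) N)"
  show "y \<in> zariski_topology (R Quot \<mm>) N closure_of distinguished N f"
    unfolding in_closure_of
  proof (intro conjI y allI impI)
    fix T assume "y \<in> T \<and> openin (zariski_topology (R Quot \<mm>) N) T"
    then obtain g where g: "g \<in> polyfun N" "y \<in> distinguished N g" "distinguished N g \<subseteq> T"
      using distinguished_base by blast
    then obtain b where b: "b \<in> points N" "g b \<notin> \<mm>" by (auto simp: distinguished_def)
    obtain z where z: "z \<in> points N" "f z \<notin> \<mm>" "g z \<notin> \<mm>"
      by (rule polyfun_common_nonzero[OF f g(1) b])
    then show "\<exists>z. z \<in> distinguished N f \<and> z \<in> T" using g(3) by (auto simp: distinguished_def)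
  qed
qed

end

section \<open>Length of quotients of ideals\<close>

context cring
begin

lemma coset_mem_iff:
  assumes B: "ideal B R" and t: "t \<in> carrier R"
  shows "y \<in> B +> t \<longleftrightarrow> y \<in> carrier R \<and> y \<ominus> t \<in> B"
proof
  assume "y \<in> B +> t"
  then obtain b where b: "b \<in> B" "y = b \<oplus> t" by (auto simp: a_r_coset_def')
  have bc: "b \<in> carrier R" by (rule ideal.Icarr[OF B b(1)])
  have "(b \<oplus> t) \<ominus> t = b" using bc t by algebra
  then show "y \<in> carrier R \<and> y \<ominus> t \<in> B" using b bc t by simp
next
  assume y: "y \<in> carrier R \<and> y \<ominus> t \<in> B"
  have "y = (y \<ominus> t) \<oplus> t" if "y \<in> carrier R" using that t by algebra
  then show "y \<in> B +> t" using y by (auto simp: a_r_coset_def')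
qed

lemma coset_eq_iff:
  assumes "ideal B R" "s \<in> carrier R" "t \<in> carrier R"
  shows "B +> s = B +> t \<longleftrightarrow> s \<ominus> t \<in> B"
  using quotient_eq_iff_same_a_r_cos[OF assms] by blast

lemma coset_eq_base_iff: "ideal B R \<Longrightarrow> t \<in> carrier R \<Longrightarrow> B +> t = B \<longleftrightarrow> t \<in> B"
  using coset_eq_iff[of B t \<zero>] a_rcos_zero[of B \<zero>] ideal_zero[of B] by (simp add: a_minus_def)

section \<open>The module T/B and its submodules\<close>

context
  fixes B T Q
  assumes B: "ideal B R" and T: "ideal T R" and BT: "B \<subseteq> T"
  defines "Q \<equiv> quot_module R (ideal_as_module R T) B"
begin

private lemma Tc: "t \<in> T \<Longrightarrow> t \<in> carrier R"
  by (rule ideal.Icarr[OF T])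

private lemma coset_ideal_as_module: "a_r_coset (ideal_as_module R T) B t = B +> t"
  by (simp add: a_r_coset_def r_coset_def ideal_as_module_def)

lemma quot_carrier: "carrier Q = (+>) B ` T"
  by (auto simp: Q_def quot_module_def A_RCOSETS_def RCOSETS_def a_r_coset_def r_coset_def ideal_as_module_def)

lemma quot_zero: "\<zero>\<^bsub>Q\<^esub> = B"
  by (simp add: Q_def quot_module_def)

lemma quot_add:
  assumes "s \<in> carrier R" "t \<in> carrier R"
  shows "(B +> s) \<oplus>\<^bsub>Q\<^esub> (B +> t) = B +> (s \<oplus> t)"
proof -
  have "(B +> s) \<oplus>\<^bsub>Q\<^esub> (B +> t) = (B +> s) <+> (B +> t)"
    by (simp add: Q_def quot_module_def set_add_def set_mult_def ideal_as_module_def)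
  then show ?thesis using ideal.a_rcos_sum[OF B assms] by simp
qed

lemma quot_smult:
  assumes "r \<in> carrier R" "t \<in> carrier R"
  shows "r \<odot>\<^bsub>Q\<^esub> (B +> t) = B +> (r \<otimes> t)"
proof -
  have "r \<odot>\<^bsub>Q\<^esub> (B +> t) = (\<Union>x\<in>B +> t. B +> (r \<otimes> x))"
    by (simp add: Q_def quot_module_def coset_ideal_as_module) (simp add: ideal_as_module_def)
  also have "\<dots> = (\<Union>x\<in>B +> t. B +> (r \<otimes> t))"
  proof (rule SUP_cong[OF refl])
    fix x assume "x \<in> B +> t"
    then have x: "x \<in> carrier R" "x \<ominus> t \<in> B" using coset_mem_iff[OF B assms(2)] by auto
    have "r \<otimes> x \<ominus> r \<otimes> t = r \<otimes> (x \<ominus> t)" using assms x(1) by algebra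
    then have "r \<otimes> x \<ominus> r \<otimes> t \<in> B" using ideal.I_l_closed[OF B x(2) assms(1)] by simp
    then show "B +> (r \<otimes> x) = B +> (r \<otimes> t)" using coset_eq_iff[OF B] assms x by simp
  qed
  also have "\<dots> = B +> (r \<otimes> t)"
  proof -
    have "t \<in> B +> t" using coset_mem_iff[OF B assms(2)] assms(2) ideal_zero[OF B] by (simp add: a_minus_def r_neg)
    then show ?thesis by blast
  qed
  finally show ?thesis .
qed

lemma submodule_quot_image:
  assumes C: "ideal C R" "B \<subseteq> C" "C \<subseteq> T"
  shows "submodule ((+>) B ` C) R Q"
proof (intro submodule.intro subgroup.intro submodule_axioms.intro)
  have Cc: "c \<in> carrier R" if "c \<in> C" for c by (rule ideal.Icarr[OF C(1) that])
  have B0: "B +> \<zero> = B" using coset_eq_base_iff[OF B] ideal_zero[OF B] by simp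
  show "(+>) B ` C \<subseteq> carrier (add_monoid Q)" using C(3) by (auto simp: quot_carrier)
  show "x \<otimes>\<^bsub>add_monoid Q\<^esub> y \<in> (+>) B ` C" if "x \<in> (+>) B ` C" "y \<in> (+>) B ` C" for x y
    using that quot_add Cc ideal_add[OF C(1)] by auto
  show "\<one>\<^bsub>add_monoid Q\<^esub> \<in> (+>) B ` C"
    using B0 ideal_zero[OF C(1)] by (auto simp: quot_zero intro!: image_eqI[of _ _ \<zero>])
  show "inv\<^bsub>add_monoid Q\<^esub> x \<in> (+>) B ` C" if x: "x \<in> (+>) B ` C" for x
  proof -
    obtain c where c: "c \<in> C" "x = B +> c" using x by blast
    have cc: "c \<in> carrier R" "\<ominus> c \<in> C" using Cc[OF c(1)] ideal_neg[OF C(1) c(1)] by auto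
    \<comment> \<open>The inverse is identified from its definition as a unique element, because no
      group structure on \<open>Q\<close> has been established at this point.\<close>
    have "inv\<^bsub>add_monoid Q\<^esub> x = B +> (\<ominus> c)" unfolding m_inv_def
    proof (rule the_equality)
      show "B +> (\<ominus> c) \<in> carrier (add_monoid Q) \<and> x \<otimes>\<^bsub>add_monoid Q\<^esub> (B +> (\<ominus> c)) = \<one>\<^bsub>add_monoid Q\<^esub> \<and>
          (B +> (\<ominus> c)) \<otimes>\<^bsub>add_monoid Q\<^esub> x = \<one>\<^bsub>add_monoid Q\<^esub>"
        using cc C(3) B0 by (auto simp: quot_carrier c(2) quot_add quot_zero r_neg l_neg)
    next
      fix y assume y: "y \<in> carrier (add_monoid Q) \<and> x \<otimes>\<^bsub>add_monoid Q\<^esub> y = \<one>\<^bsub>add_monoid Q\<^esub> \<and>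
          y \<otimes>\<^bsub>add_monoid Q\<^esub> x = \<one>\<^bsub>add_monoid Q\<^esub>"
      then obtain t where t: "t \<in> T" "y = B +> t" by (auto simp: quot_carrier)
      have tc: "t \<in> carrier R" by (rule Tc[OF t(1)])
      have "B +> (t \<oplus> c) = B" using y t(2) c(2) cc(1) tc by (simp add: quot_add quot_zero)
      then have "t \<oplus> c \<in> B" using coset_eq_base_iff[OF B] cc(1) tc by simp
      moreover have "t \<ominus> \<ominus> c = t \<oplus> c" using cc(1) tc by algebra
      ultimately show "y = B +> (\<ominus> c)" using coset_eq_iff[OF B tc] cc(1) t(2) by simp
    qed
    then show ?thesis using cc(2) by blast
  qed
  show "r \<odot>\<^bsub>Q\<^esub> x \<in> (+>) B ` C" if "r \<in> carrier R" "x \<in> (+>) B ` C" for r x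
    using that quot_smult Cc ideal.I_l_closed[OF C(1)] by auto
qed

lemma submodule_quotE:
  assumes S: "submodule S R Q"
  obtains C where "ideal C R" "B \<subseteq> C" "C \<subseteq> T" "S = (+>) B ` C"
proof -
  interpret S: submodule S R Q by (rule S)
  define C where "C = {t \<in> T. B +> t \<in> S}"
  have SQ: "S \<subseteq> (+>) B ` T" using S.subset by (simp add: quot_carrier)
  have B0: "B \<in> S" using S.one_closed by (simp add: quot_zero)
  have add: "s \<oplus> t \<in> C" if "s \<in> C" "t \<in> C" for s t
    using that S.m_closed[of "B +> s" "B +> t"] ideal_add[OF T] by (simp add: C_def quot_add Tc)
  have mult: "r \<otimes> t \<in> C" if "t \<in> C" "r \<in> carrier R" for r t
    using that S.smult_closed[of r "B +> t"] ideal.I_l_closed[OF T] by (simp add: C_def quot_smult Tc)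
  have Cc: "C \<subseteq> carrier R" using Tc by (auto simp: C_def)
  have BC: "B \<subseteq> C"
  proof
    fix b assume b: "b \<in> B"
    then have "B +> b = B" using coset_eq_base_iff[OF B ideal.Icarr[OF B b]] by simp
    then show "b \<in> C" using B0 b BT by (auto simp: C_def)
  qed
  have neg: "\<ominus> t \<in> C" if t: "t \<in> C" for t
  proof -
    have "(\<ominus> \<one>) \<otimes> t = \<ominus> t" using t Cc by (auto simp: l_minus)
    then show ?thesis using mult[OF t, of "\<ominus> \<one>"] by simp
  qed
  have "subgroup C (add_monoid R)"
    using add neg Cc BC ideal_zero[OF B] by (intro add.subgroupI) auto
  then have "ideal C R"
  proof (rule idealI[OF ring_axioms])
    fix c r assume c: "c \<in> C" "r \<in> carrier R"
    show "r \<otimes> c \<in> C" by (rule mult[OF c])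
    then show "c \<otimes> r \<in> C" using m_comm[OF c(2) subsetD[OF Cc c(1)]] by simp
  qed
  moreover have "S = (+>) B ` C" using SQ by (auto simp: C_def)
  moreover have "C \<subseteq> T" by (auto simp: C_def)
  ultimately show thesis using BC by (intro that[of C])
qed

lemma quot_image_strict_mono:
  assumes "ideal C R" "ideal C' R" "B \<subseteq> C" "C \<subset> C'"
  shows "(+>) B ` C \<subset> (+>) B ` C'"
proof -
  obtain c where c: "c \<in> C'" "c \<notin> C" using assms(4) by blast
  have cc: "c \<in> carrier R" by (rule ideal.Icarr[OF assms(2) c(1)])
  have "B +> c \<notin> (+>) B ` C"
  proof
    assume "B +> c \<in> (+>) B ` C"
    then obtain s where s: "s \<in> C" "B +> c = B +> s" by blast
    have sc: "s \<in> carrier R" by (rule ideal.Icarr[OF assms(1) s(1)])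
    have "c \<ominus> s \<in> C" using coset_eq_iff[OF B cc sc] s(2) assms(3) by auto
    then have "(c \<ominus> s) \<oplus> s \<in> C" by (rule ideal_add[OF assms(1) _ s(1)])
    moreover have "(c \<ominus> s) \<oplus> s = c" using cc sc by algebra
    ultimately show False using c(2) by simp
  qed
  then show ?thesis using assms(4) c(1) by blast
qed

text \<open>Submodules of T/B correspond to ideals between B and T. A proper intermediate ideal
  gives a chain with two strict steps; conversely the middle term of such a chain is an ideal
  strictly between B and T, whatever its ends are.\<close>

lemma module_length_quot_le_one_iff:
  "module_length R Q \<le> 1 \<longleftrightarrow> \<not> (\<exists>C. ideal C R \<and> B \<subset> C \<and> C \<subset> T)"
proof
  assume le: "module_length R Q \<le> 1"
  show "\<not> (\<exists>C. ideal C R \<and> B \<subset> C \<and> C \<subset> T)"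
  proof
    assume "\<exists>C. ideal C R \<and> B \<subset> C \<and> C \<subset> T"
    then obtain C where C: "ideal C R" "B \<subset> C" "C \<subset> T" by blast
    define F where "F i = (if i = 0 then (+>) B ` B else if i = 1 then (+>) B ` C else (+>) B ` T)" for i :: nat
    have sub: "submodule ((+>) B ` B) R Q" "submodule ((+>) B ` C) R Q" "submodule ((+>) B ` T) R Q"
      using C BT B T by (auto intro!: submodule_quot_image)
    have "\<forall>i\<le>2. submodule (F i) R Q" using sub by (simp add: F_def)
    moreover have "\<forall>i<2. F i \<subset> F (Suc i)"
      using quot_image_strict_mono[OF B C(1) subset_refl C(2)] quot_image_strict_mono[OF C(1) T _ C(3)] C(2)
      by (auto simp: F_def less_2_cases_iff)
    ultimately have "enat 2 \<le> module_length R Q" unfolding module_length_def by (intro Sup_upper) blast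
    then have "enat 2 \<le> 1" using le by (rule order_trans)
    then show False by (simp add: one_enat_def)
  qed
next
  assume none: "\<not> (\<exists>C. ideal C R \<and> B \<subset> C \<and> C \<subset> T)"
  show "module_length R Q \<le> 1" unfolding module_length_def
  proof (rule Sup_least)
    fix l assume "l \<in> {enat n |n. \<exists>C. (\<forall>i\<le>n. submodule (C i) R Q) \<and> (\<forall>i<n. C i \<subset> C (Suc i))}"
    then obtain n F where F: "l = enat n" "\<forall>i\<le>n. submodule (F i) R Q" "\<forall>i<n. F i \<subset> F (Suc i)" by blast
    have "n \<le> 1"
    proof (rule ccontr)
      assume n: "\<not> n \<le> 1"
      obtain C0 where C0: "ideal C0 R" "B \<subseteq> C0" "C0 \<subseteq> T" "F 0 = (+>) B ` C0" by (rule submodule_quotE[of "F 0"]) (use F(2) in auto)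
      obtain C1 where C1: "ideal C1 R" "B \<subseteq> C1" "C1 \<subseteq> T" "F 1 = (+>) B ` C1" by (rule submodule_quotE[of "F 1"]) (use F(2) n in auto)
      obtain C2 where C2: "ideal C2 R" "B \<subseteq> C2" "C2 \<subseteq> T" "F 2 = (+>) B ` C2" by (rule submodule_quotE[of "F 2"]) (use F(2) n in auto)
      have "F 0 \<subset> F 1" "F 1 \<subset> F 2" using F(3)[rule_format, of 0] F(3)[rule_format, of 1] n by (auto simp: numeral_2_eq_2)
      moreover have "B \<noteq> C1"
      proof
        assume "B = C1"
        then have "F 1 \<subseteq> F 0" unfolding C0(4) C1(4) using C0(2) by blast
        then show False using \<open>F 0 \<subset> F 1\<close> by blast
      qed
      moreover have "C1 \<noteq> T"
      proof
        assume "C1 = T"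
        then have "F 2 \<subseteq> F 1" unfolding C2(4) C1(4) using C2(3) by blast
        then show False using \<open>F 1 \<subset> F 2\<close> by blast
      qed
      ultimately show False using none C1(1-3) by blast
    qed
    then show "l \<le> 1" using F(1) by (simp add: one_enat_def)
  qed
qed

end

end

context noetherian_local_inf
begin

text \<open>By the modular law and J \<inter> I^2 = J I, the intersection of I^2 with I^3 + J is I^3
  + J I. Hence (I^2 + J)/(I^3 + J) is I^2/(J I + I^3), and length at most one means generation by
  one element that \<mm> kills.\<close>

lemma hilbert_function_2_le_one_iff:
  assumes I: "ideal I R" and J: "ideal J R" "J \<subseteq> I" and JI: "J \<inter> (I \<cdot> I) = J \<cdot> I"
  shows "hilbert_function R I J 2 \<le> 1 \<longleftrightarrow> small_quotient J I"
proof -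
  define T where "T = ext (I \<cdot> I) J"
  define B where "B = ext (I \<cdot> (I \<cdot> I)) J"
  define L where "L = ext (J \<cdot> I) (I \<cdot> (I \<cdot> I))"
  have I2: "ideal (I \<cdot> I) R" by (rule ideal_prod_is_ideal[OF I I])
  have I3: "ideal (I \<cdot> (I \<cdot> I)) R" by (rule ideal_prod_is_ideal[OF I I2])
  have JIi: "ideal (J \<cdot> I) R" by (rule ideal_prod_is_ideal[OF J(1) I])
  have Jc: "J \<subseteq> carrier R" and I3c: "I \<cdot> (I \<cdot> I) \<subseteq> carrier R"
    using ideal.Icarr[OF J(1)] ideal.Icarr[OF I3] by blast+
  have Ti: "ideal T R" and Bi: "ideal B R" and Li: "ideal L R"
    unfolding T_def B_def L_def by (intro ext_ideal I2 I3 JIi Jc I3c)+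
  have I32: "I \<cdot> (I \<cdot> I) \<subseteq> I \<cdot> I"
    using ideal.I_l_closed[OF I2] ideal.Icarr[OF I] by (intro ideal_prod_minimal[OF I2]) blast
  have BT: "B \<subseteq> T" unfolding B_def T_def by (rule ext_mono[OF I2 Jc I32 subset_refl])
  have JB: "J \<subseteq> B" and I3B: "I \<cdot> (I \<cdot> I) \<subseteq> B" unfolding B_def by (rule ext_gens[OF I3 Jc], rule ext_base[OF I3 Jc])
  have I2T: "I \<cdot> I \<subseteq> T" unfolding T_def by (rule ext_base[OF I2 Jc])
  have LB: "L \<subseteq> B" unfolding L_def using JI JB I3B by (intro ext_minimal[OF Bi]) auto
  have key: "y \<in> L" if y: "y \<in> I \<cdot> I" "y \<in> B" for y
  proof -
    have "y \<in> I \<cdot> (I \<cdot> I) <+> J" using y(2) set_add_eq_ext[OF I3 J(1)] by (simp add: B_def)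
    then obtain u j where uj: "u \<in> I \<cdot> (I \<cdot> I)" "j \<in> J" "y = u \<oplus> j" unfolding set_add_def' by blast
    have "j \<in> I \<cdot> I"
      by (rule ideal_add_cancel_left[OF I2 subsetD[OF I32 uj(1)] ideal.Icarr[OF J(1) uj(2)]]) (use y(1) uj(3) in simp)
    then have "j \<in> J \<cdot> I" using JI uj(2) by blast
    then have "j \<in> L" unfolding L_def by (rule subsetD[OF ext_base[OF JIi I3c]])
    moreover have "u \<in> L" unfolding L_def by (rule subsetD[OF ext_gens[OF JIi I3c] uj(1)])
    ultimately show ?thesis unfolding uj(3) by (intro ideal_add[OF Li])
  qed
  have "hilbert_function R I J 2 = module_length R (quot_module R (ideal_as_module R T) B)"
    using set_add_eq_ext[OF I2 J(1)] set_add_eq_ext[OF I3 J(1)] ideal_pow_1[OF I]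
    by (simp add: hilbert_function_def numeral_2_eq_2 T_def B_def del: One_nat_def)
  then have "hilbert_function R I J 2 \<le> 1 \<longleftrightarrow> \<not> (\<exists>C. ideal C R \<and> B \<subset> C \<and> C \<subset> T)"
    using module_length_quot_le_one_iff[OF Bi Ti BT] by simp
  also have "\<dots> \<longleftrightarrow> small_quotient J I"
  proof
    assume none: "\<not> (\<exists>C. ideal C R \<and> B \<subset> C \<and> C \<subset> T)"
    show "small_quotient J I"
    proof (cases "I \<cdot> I \<subseteq> B")
      case True
      have "I \<cdot> I \<subseteq> ext L {\<zero>}" using key True ext_base[OF Li, of "{\<zero>}"] by auto
      moreover have "e \<otimes> \<zero> \<in> L" if "e \<in> \<mm>" for e using that m_carrier ideal_zero[OF Li] by auto
      ultimately show ?thesis unfolding small_quotient_def L_def[symmetric]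
        using ideal_zero[OF I2] by (intro bexI[of _ \<zero>]) auto
    next
      case False
      then obtain w where w: "w \<in> I \<cdot> I" "w \<notin> B" by blast
      have wc: "w \<in> carrier R" by (rule ideal.Icarr[OF I2 w(1)])
      have full: "ext B {s} = T" if s: "s \<in> T" "s \<notin> B" for s
      proof -
        have sc: "{s} \<subseteq> carrier R" using ideal.Icarr[OF Ti s(1)] by simp
        have "B \<subset> ext B {s}" using ext_base[OF Bi sc] ext_gens[OF Bi sc] s(2) by auto
        moreover have "ext B {s} \<subseteq> T" using s(1) by (intro ext_minimal[OF Ti BT]) auto
        ultimately show ?thesis using none ext_ideal[OF Bi sc] by blast
      qed
      have wT: "w \<in> T" using w(1) I2T by auto
      have "y \<in> ext L {w}" if y: "y \<in> I \<cdot> I" for y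
      proof -
        have "y \<in> ext B {w}" using full[OF wT w(2)] y I2T by auto
        then obtain b r where br: "b \<in> B" "r \<in> carrier R" "y = b \<oplus> r \<otimes> w" by (rule ext_singletonE[OF Bi wc])
        have rw: "r \<otimes> w \<in> I \<cdot> I" by (rule ideal.I_l_closed[OF I2 w(1) br(2)])
        have bc: "b \<in> carrier R" by (rule ideal.Icarr[OF Bi br(1)])
        have "r \<otimes> w \<oplus> b = y" using br(2) wc bc by (simp add: br(3) a_comm)
        then have "b \<in> I \<cdot> I" using ideal_add_cancel_left[OF I2 rw bc] y by simp
        then have "b \<in> L" using key br(1) by blast
        then show ?thesis unfolding br(3) by (rule ext_singletonI[OF Li wc _ br(2)])
      qed
      moreover have "e \<otimes> w \<in> L" if e: "e \<in> \<mm>" for e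
      proof -
        have ec: "e \<in> carrier R" using e m_carrier by auto
        have ew: "e \<otimes> w \<in> I \<cdot> I" by (rule ideal.I_l_closed[OF I2 w(1) ec])
        have ewc: "e \<otimes> w \<in> carrier R" using ec wc by simp
        \<comment> \<open>Otherwise e w would generate T over B as well, so w would be congruent to
          r e w modulo B, and the unit 1 - r e would put w into B.\<close>
        have "e \<otimes> w \<in> B"
        proof (rule ccontr)
          assume "e \<otimes> w \<notin> B"
          then have "w \<in> ext B {e \<otimes> w}" using full[of "e \<otimes> w"] ew I2T wT by auto
          then obtain b r where br: "b \<in> B" "r \<in> carrier R" "w = b \<oplus> r \<otimes> (e \<otimes> w)"
            by (rule ext_singletonE[OF Bi ewc])
          have bc: "b \<in> carrier R" by (rule ideal.Icarr[OF Bi br(1)])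
          have "(\<one> \<ominus> r \<otimes> e) \<otimes> w = w \<ominus> r \<otimes> (e \<otimes> w)" using br(2) ec wc by algebra
          also have "\<dots> = b" by (rule minus_eqI[OF wc m_closed[OF br(2) ewc] br(3) bc])
          finally have "(\<one> \<ominus> r \<otimes> e) \<otimes> w \<in> B" using br(1) by simp
          moreover have "\<one> \<ominus> r \<otimes> e \<notin> \<mm>"
            by (rule one_minus_notin_m[OF ideal.I_l_closed[OF m_ideal e br(2)]])
          ultimately have "w \<in> B"
            by (intro unit_cancel[OF Bi minus_closed[OF one_closed m_closed[OF br(2) ec]] _ wc])
          then show False using w(2) by contradiction
        qed
        then show ?thesis by (rule key[OF ew])
      qed
      ultimately show ?thesis unfolding small_quotient_def L_def[symmetric] using w(1) by blast
    qed
  next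
    assume "small_quotient J I"
    then obtain w where w: "w \<in> I \<cdot> I" "I \<cdot> I \<subseteq> ext L {w}" "\<And>e. e \<in> \<mm> \<Longrightarrow> e \<otimes> w \<in> L"
      unfolding small_quotient_def L_def[symmetric] by blast
    have wc: "w \<in> carrier R" by (rule ideal.Icarr[OF I2 w(1)])
    show "\<not> (\<exists>C. ideal C R \<and> B \<subset> C \<and> C \<subset> T)"
    proof
      assume "\<exists>C. ideal C R \<and> B \<subset> C \<and> C \<subset> T"
      then obtain C where C: "ideal C R" "B \<subset> C" "C \<subset> T" by blast
      obtain c where c: "c \<in> C" "c \<notin> B" using C(2) by blast
      have "c \<in> I \<cdot> I <+> J" using c(1) C(3) set_add_eq_ext[OF I2 J(1)] by (auto simp: T_def)
      then obtain y j where yj: "y \<in> I \<cdot> I" "j \<in> J" "c = y \<oplus> j" unfolding set_add_def' by blast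
      have "y \<in> ext L {w}" using w(2) yj(1) by auto
      then obtain l r where lr: "l \<in> L" "r \<in> carrier R" "y = l \<oplus> r \<otimes> w" by (rule ext_singletonE[OF Li wc])
      have lB: "l \<in> B" "j \<in> B" using lr(1) LB yj(2) JB by auto
      have car: "l \<in> carrier R" "j \<in> carrier R" using lB ideal.Icarr[OF Bi] by auto
      have c': "c = (l \<oplus> j) \<oplus> r \<otimes> w" using yj(3) lr(2,3) car wc by (simp add: a_ac)
      have lj: "l \<oplus> j \<in> B" by (rule ideal_add[OF Bi lB])
      have "r \<notin> \<mm>"
      proof
        assume "r \<in> \<mm>"
        then have "r \<otimes> w \<in> B" using w(3) LB by auto
        then show False using c(2) ideal_add[OF Bi lj] unfolding c' by blast
      qed
      moreover have "r \<otimes> w \<in> C"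
        by (rule ideal_add_cancel_left[OF C(1), of "l \<oplus> j"]) (use lj C(2) lr(2) wc c(1) c' in auto)
      ultimately have "w \<in> C" by (rule unit_cancel[OF C(1) lr(2) _ wc])
      then have "ext L {w} \<subseteq> C" using LB C(2) by (intro ext_minimal[OF C(1)]) auto
      then have "T \<subseteq> C" unfolding T_def using w(2) JB C(2) by (intro ext_minimal[OF C(1)]) auto
      then show False using C(3) by blast
    qed
  qed
  finally show ?thesis .
qed

end

section \<open>Minimal reductions\<close>

context noetherian_local
begin

text \<open>Steinitz exchange modulo B. If v becomes dependent after adjoining x, the dependence has
  a unit coefficient at some p0 and another at x; then v without p0 is independent over B + (x), and
  x lies in the span of v. For equal sizes this case must occur at every stage, so v spans.\<close>

lemma kindep_exchange:
  assumes "finite P" "ideal B R" "set xs \<subseteq> carrier R" "\<And>e x. e \<in> \<mm> \<Longrightarrow> x \<in> set xs \<Longrightarrow> e \<otimes> x \<in> B"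
    and "v ` P \<subseteq> ext B (set xs)" "kindep B P v"
  shows "card P \<le> length xs \<and> (card P = length xs \<longrightarrow> set xs \<subseteq> ext B (v ` P))"
  using assms
proof (induction xs arbitrary: P B)
  case Nil
  have "P = {}"
  proof (rule ccontr)
    assume "P \<noteq> {}"
    then obtain p where p: "p \<in> P" by blast
    have vB: "v q \<in> B" if "q \<in> P" for q using Nil.prems(2,5) ext_empty that by auto
    define t where "t q = (if q = p then \<one> else \<zero>)" for q
    have "(\<Oplus>q\<in>P. t q \<otimes> v q) \<in> B"
      using vB by (intro ideal_finsum[OF Nil.prems(2)] ideal.I_l_closed[OF Nil.prems(2)]) (auto simp: t_def)
    then have "t p \<in> \<mm>" by (intro kindepD[where t = t, OF Nil.prems(6) _ _ p]) (auto simp: t_def)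
    then show False using one_notin_m by (simp add: t_def)
  qed
  then show ?case by simp
next
  case (Cons x xs)
  note fin = Cons.prems(1) and B = Cons.prems(2)
  have x: "x \<in> carrier R" "{x} \<subseteq> carrier R" and xs: "set xs \<subseteq> carrier R" using Cons.prems(3) by auto
  let ?B1 = "ext B {x}"
  have B1: "ideal ?B1 R" "B \<subseteq> ?B1" using ext_ideal[OF B x(2)] ext_base[OF B x(2)] by auto
  have eq: "ext B (set (x # xs)) = ext ?B1 (set xs)" using ext_insert[OF B x(1) xs] by simp
  have vx: "v ` P \<subseteq> ext ?B1 (set xs)" using Cons.prems(5) eq by simp
  have mx: "e \<otimes> y \<in> ?B1" if "e \<in> \<mm>" "y \<in> set xs" for e y using Cons.prems(4)[of e y] that B1(2) by auto
  have vP: "v ` P \<subseteq> carrier R" using vx ideal.Icarr[OF ext_ideal[OF B1(1) xs]] by blast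
  then have vc: "v p \<in> carrier R" if "p \<in> P" for p using that by auto
  show ?case
  proof (cases "kindep ?B1 P v")
    case True
    have "card P \<le> length xs" using Cons.IH[OF fin B1(1) xs mx vx True] by simp
    then show ?thesis by simp
  next
    case False
    then obtain t p0 where t: "t \<in> P \<rightarrow> carrier R" "(\<Oplus>p\<in>P. t p \<otimes> v p) \<in> ?B1" "p0 \<in> P" "t p0 \<notin> \<mm>"
      unfolding kindep_def by blast
    have tc: "t p \<in> carrier R" if "p \<in> P" for p using t(1) that by auto
    obtain b r where br: "b \<in> B" "r \<in> carrier R" "(\<Oplus>p\<in>P. t p \<otimes> v p) = b \<oplus> r \<otimes> x"
      by (rule ext_singletonE[OF B x(1) t(2)])
    have bc: "b \<in> carrier R" by (rule ideal.Icarr[OF B br(1)])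
    have r: "r \<notin> \<mm>"
    proof
      assume "r \<in> \<mm>"
      then have "r \<otimes> x \<in> B" using Cons.prems(4)[of r x] by simp
      then have "(\<Oplus>p\<in>P. t p \<otimes> v p) \<in> B" unfolding br(3) by (rule ideal_add[OF B br(1)])
      then have "t p0 \<in> \<mm>" using t(3) by (intro kindepD[where t = t, OF Cons.prems(6) tc])
      then show False using t(4) by simp
    qed
    let ?P = "P - {p0}"
    have fin': "finite ?P" using fin by simp
    have "kindep ?B1 ?P v" unfolding kindep_def
    proof (intro ballI impI)
      fix s q assume s: "s \<in> ?P \<rightarrow> carrier R" and rel: "(\<Oplus>p\<in>?P. s p \<otimes> v p) \<in> ?B1" and q: "q \<in> ?P"
      obtain b' r' where br': "b' \<in> B" "r' \<in> carrier R" "(\<Oplus>p\<in>?P. s p \<otimes> v p) = b' \<oplus> r' \<otimes> x"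
        by (rule ext_singletonE[OF B x(1) rel])
      have bc': "b' \<in> carrier R" by (rule ideal.Icarr[OF B br'(1)])
      define s' where "s' p = (if p = p0 then \<zero> else s p)" for p
      have sc: "s' p \<in> carrier R" if "p \<in> P" for p using s that by (auto simp: s'_def)
      have S: "(\<Oplus>p\<in>P. s' p \<otimes> v p) = b' \<oplus> r' \<otimes> x"
      proof -
        have "(\<Oplus>p\<in>P. s' p \<otimes> v p) = (\<Oplus>p\<in>insert p0 ?P. s' p \<otimes> v p)" using t(3) by (simp add: insert_absorb)
        also have "\<dots> = s' p0 \<otimes> v p0 \<oplus> (\<Oplus>p\<in>?P. s' p \<otimes> v p)"
          using fin sc vc t(3) by (intro finsum_insert) auto
        also have "(\<Oplus>p\<in>?P. s' p \<otimes> v p) = (\<Oplus>p\<in>?P. s p \<otimes> v p)"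
          using s vc by (intro finsum_cong') (auto simp: s'_def)
        finally show ?thesis using br' bc' vc[OF t(3)] x by (simp add: s'_def)
      qed
      have qP: "q \<in> P" using q by simp
      \<comment> \<open>The combination r s' - r' t cancels x, so it is a relation over B and all
        its coefficients lie in \<mm>. At p0, where s' is zero, this forces r' into \<mm>, and then
        r s' and s' as well.\<close>
      let ?c = "\<lambda>p. r \<otimes> s' p \<oplus> (\<ominus> r') \<otimes> t p"
      have cc: "?c p \<in> carrier R" if "p \<in> P" for p using br(2) br'(2) sc[OF that] tc[OF that] by simp
      have "(\<Oplus>p\<in>P. ?c p \<otimes> v p) = (\<Oplus>p\<in>P. r \<otimes> (s' p \<otimes> v p) \<oplus> (\<ominus> r') \<otimes> (t p \<otimes> v p))"
      proof (rule finsum_cong'[OF refl])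
        have dist: "(r \<otimes> u \<oplus> (\<ominus> r') \<otimes> w) \<otimes> z = r \<otimes> (u \<otimes> z) \<oplus> (\<ominus> r') \<otimes> (w \<otimes> z)"
          if "u \<in> carrier R" "w \<in> carrier R" "z \<in> carrier R" for u w z
          using that br(2) br'(2) by algebra
        show "?c p \<otimes> v p = r \<otimes> (s' p \<otimes> v p) \<oplus> (\<ominus> r') \<otimes> (t p \<otimes> v p)" if "p \<in> P" for p
          by (rule dist[OF sc[OF that] tc[OF that] vc[OF that]])
      qed (use sc tc vc br(2) br'(2) in auto)
      also have "\<dots> = (\<Oplus>p\<in>P. r \<otimes> (s' p \<otimes> v p)) \<oplus> (\<Oplus>p\<in>P. (\<ominus> r') \<otimes> (t p \<otimes> v p))"
        using sc tc vc br(2) br'(2) by (intro finsum_addf) auto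
      also have "(\<Oplus>p\<in>P. r \<otimes> (s' p \<otimes> v p)) = r \<otimes> (\<Oplus>p\<in>P. s' p \<otimes> v p)"
        using sc vc br(2) fin by (intro finsum_rdistr[symmetric]) auto
      also have "(\<Oplus>p\<in>P. (\<ominus> r') \<otimes> (t p \<otimes> v p)) = (\<ominus> r') \<otimes> (\<Oplus>p\<in>P. t p \<otimes> v p)"
        using tc vc br'(2) fin by (intro finsum_rdistr[symmetric]) auto
      also have "r \<otimes> (\<Oplus>p\<in>P. s' p \<otimes> v p) \<oplus> (\<ominus> r') \<otimes> (\<Oplus>p\<in>P. t p \<otimes> v p) = r \<otimes> b' \<oplus> (\<ominus> r') \<otimes> b"
        unfolding S br(3) using br(2) br'(2) bc bc' x(1) by algebra
      also have "r \<otimes> b' \<oplus> (\<ominus> r') \<otimes> b \<in> B"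
        using br br' by (intro ideal_add[OF B] ideal.I_l_closed[OF B]) auto
      finally have rel': "(\<Oplus>p\<in>P. ?c p \<otimes> v p) \<in> B" .
      have cm: "?c p \<in> \<mm>" if "p \<in> P" for p by (rule kindepD[where t = ?c, OF Cons.prems(6) cc rel' that])
      have "t p0 \<otimes> (\<ominus> r') \<in> \<mm>"
        using cm[OF t(3)] br(2) br'(2) tc[OF t(3)] by (simp add: s'_def m_comm)
      then have "\<ominus> r' \<in> \<mm>" by (rule unit_cancel[OF m_ideal tc[OF t(3)] t(4) a_inv_closed[OF br'(2)]])
      then have "(\<ominus> r') \<otimes> t q \<in> \<mm>" by (rule ideal.I_r_closed[OF m_ideal]) (use tc q in auto)
      moreover have "(\<ominus> r') \<otimes> t q \<oplus> r \<otimes> s' q \<in> \<mm>"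
        using cm[of q] q br(2) br'(2) tc[of q] sc[of q] by (simp add: a_comm)
      ultimately have "r \<otimes> s' q \<in> \<mm>"
        by (rule ideal_add_cancel_left[OF m_ideal _ m_closed[OF br(2) sc[OF qP]]])
      then have "s' q \<in> \<mm>" by (intro unit_cancel[OF m_ideal br(2) r sc]) (use q in auto)
      then show "s q \<in> \<mm>" using q by (simp add: s'_def)
    qed
    moreover have "v ` ?P \<subseteq> ext ?B1 (set xs)" using vx by auto
    ultimately have IH: "card ?P \<le> length xs" "card ?P = length xs \<Longrightarrow> set xs \<subseteq> ext ?B1 (v ` ?P)"
      using Cons.IH[OF fin' B1(1) xs mx] by auto
    have card: "card P = Suc (card ?P)" using card_Suc_Diff1[OF fin t(3)] by simp
    have "set (x # xs) \<subseteq> ext B (v ` P)" if "card P = length (x # xs)"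
    proof -
      have E: "ideal (ext B (v ` P)) R" by (rule ext_ideal[OF B vP])
      have "v p \<in> ext B (v ` P)" if "p \<in> P" for p using ext_gens[OF B vP] that by auto
      then have "(\<Oplus>p\<in>P. t p \<otimes> v p) \<in> ext B (v ` P)"
        using tc by (intro ideal_finsum[OF E] ideal.I_l_closed[OF E]) auto
      then have "b \<oplus> r \<otimes> x \<in> ext B (v ` P)" unfolding br(3) .
      then have "r \<otimes> x \<in> ext B (v ` P)"
        by (rule ideal_add_cancel_left[OF E subsetD[OF ext_base[OF B vP] br(1)] m_closed[OF br(2) x(1)]])
      then have xE: "x \<in> ext B (v ` P)" by (rule unit_cancel[OF E br(2) r x(1)])
      have "?B1 \<subseteq> ext B (v ` P)" using xE ext_base[OF B vP] by (intro ext_minimal[OF E]) auto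
      then have "ext ?B1 (v ` ?P) \<subseteq> ext B (v ` P)" by (rule ext_minimal[OF E]) (use ext_gens[OF B vP] in auto)
      then show ?thesis using IH(2) that card xE by auto
    qed
    then show ?thesis using IH(1) card by simp
  qed
qed

text \<open>A reduction K strictly inside contains one generated by a set A that, by the two bounds,
  has exactly as many elements as \<open>xs\<close>. These are independent modulo \<mm> J, since
  otherwise one of them could be dropped; by exchange they span J modulo \<mm> J, and Nakayama gives
  J \<subseteq> K.\<close>

lemma minimal_reductionI:
  assumes I: "ideal I R" "I \<subseteq> \<mm>" and xs: "set xs \<subseteq> carrier R" and red: "reduction R (Idl (set xs)) I"
    and lb: "\<And>A. finite A \<Longrightarrow> A \<subseteq> carrier R \<Longrightarrow> reduction R (Idl A) I \<Longrightarrow> length xs \<le> card A"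
    and ub: "\<And>K. reduction R K I \<Longrightarrow> \<exists>A. finite A \<and> A \<subseteq> carrier R \<and> card A \<le> length xs \<and> Idl A \<subseteq> K \<and> reduction R (Idl A) I"
  shows "minimal_reduction R (Idl (set xs)) I"
  unfolding minimal_reduction_def
proof (intro conjI red notI)
  let ?J = "Idl (set xs)"
  assume "\<exists>K. reduction R K I \<and> K \<subset> ?J"
  then obtain K where K: "reduction R K I" "K \<subset> ?J" by blast
  obtain A where A: "finite A" "A \<subseteq> carrier R" "card A \<le> length xs" "Idl A \<subseteq> K" "reduction R (Idl A) I"
    using ub[OF K(1)] by blast
  have cardA: "card A = length xs" using A(3) lb[OF A(1,2,5)] by simp
  have J: "ideal ?J R" by (rule genideal_ideal[OF xs])
  have JI: "?J \<subseteq> I" using red by (simp add: reduction_def)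
  let ?B = "\<mm> \<cdot> ?J"
  have B: "ideal ?B R" by (rule ideal_prod_is_ideal[OF m_ideal J])
  have Bc: "?B \<subseteq> carrier R" using ideal.Icarr[OF B] by blast
  have xJ: "set xs \<subseteq> ?J" by (rule genideal_self[OF xs])
  have AA: "A \<subseteq> Idl A" by (rule genideal_self[OF A(2)])
  have JE: "?J \<subseteq> ext ?B (set xs)" by (rule genideal_minimal[OF ext_ideal[OF B xs] ext_gens[OF B xs]])
  have AE: "id ` A \<subseteq> ext ?B (set xs)" using AA A(4) K(2) JE by auto
  have mB: "e \<otimes> x \<in> ?B" if "e \<in> \<mm>" "x \<in> set xs" for e x using ideal_prod.prod[of e \<mm> x ?J R] that xJ by auto
  have "kindep ?B A id" unfolding kindep_def
  proof (intro ballI impI, rule ccontr)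
    fix t p assume t: "t \<in> A \<rightarrow> carrier R" and rel: "(\<Oplus>p\<in>A. t p \<otimes> id p) \<in> ?B" and p: "p \<in> A" and tp: "t p \<notin> \<mm>"
    let ?A = "A - {p}"
    have A': "?A \<subseteq> carrier R" "finite ?A" using A by auto
    have tc: "t q \<in> carrier R" if "q \<in> A" for q using t that by auto
    have ac: "q \<in> carrier R" if "q \<in> A" for q using A(2) that by auto
    let ?E = "ext ?B ?A"
    have E: "ideal ?E R" by (rule ext_ideal[OF B A'(1)])
    have S: "(\<Oplus>q\<in>?A. t q \<otimes> q) \<in> ?E"
      using ext_gens[OF B A'(1)] tc by (intro ideal_finsum[OF E] ideal.I_l_closed[OF E]) auto
    have "(\<Oplus>q\<in>A. t q \<otimes> q) = (\<Oplus>q\<in>insert p ?A. t q \<otimes> q)" using p by (simp add: insert_absorb)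
    also have "\<dots> = t p \<otimes> p \<oplus> (\<Oplus>q\<in>?A. t q \<otimes> q)" using A(1) tc ac p by (intro finsum_insert) auto
    also have "\<dots> = (\<Oplus>q\<in>?A. t q \<otimes> q) \<oplus> t p \<otimes> p" using ideal.Icarr[OF E S] tc[OF p] ac[OF p] by (simp add: a_comm)
    finally have "(\<Oplus>q\<in>?A. t q \<otimes> q) \<oplus> t p \<otimes> p \<in> ?E" using rel ext_base[OF B A'(1)] by auto
    then have "t p \<otimes> p \<in> ?E" by (rule ideal_add_cancel_left[OF E S m_closed[OF tc[OF p] ac[OF p]]])
    then have pE: "p \<in> ?E" by (rule unit_cancel[OF E tc[OF p] tp ac[OF p]])
    \<comment> \<open>A dependent generator p lies in \<mm> J plus the ideal of the others. After
      multiplication with I^r the first part falls into \<mm> I^(r+1), so Nakayama makes the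
      remaining generators a reduction, against the lower bound.\<close>
    obtain r where r: "ideal_pow R I (Suc r) = (Idl A) \<cdot> ideal_pow R I r" using A(5) by (auto simp: reduction_def)
    let ?T = "ideal_pow R I r" and ?N = "ideal_pow R I (Suc r)"
    have T: "ideal ?T R" and N: "ideal ?N R" by (rule ideal_pow_ideal[OF I(1)])+
    have Tc: "?T \<subseteq> carrier R" using ideal.Icarr[OF T] by blast
    have G: "ideal (Idl ?A) R" by (rule genideal_ideal[OF A'(1)])
    have AT: "ideal ((Idl ?A) \<cdot> ?T) R" by (rule ideal_prod_is_ideal[OF G T])
    have mN: "\<mm> \<cdot> ?N \<subseteq> carrier R" using ideal.Icarr[OF ideal_prod_is_ideal[OF m_ideal N]] by blast
    let ?F = "ext ((Idl ?A) \<cdot> ?T) (\<mm> \<cdot> ?N)"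
    have F: "ideal ?F R" by (rule ext_ideal[OF AT mN])
    have gen: "q \<otimes> j \<in> ?F" if q: "q \<in> Idl ?A" and j: "j \<in> ?T" for q j
      using ext_base[OF AT mN] ideal_prod.prod[OF q j, of R] by auto
    have "A \<subseteq> {y \<in> carrier R. \<forall>j\<in>?T. y \<otimes> j \<in> ?F}"
    proof -
      have C: "ideal {y \<in> carrier R. \<forall>j\<in>?T. y \<otimes> j \<in> ?F} R" by (rule ideal_colon[OF F Tc])
      have "?B \<subseteq> {y \<in> carrier R. \<forall>j\<in>?T. y \<otimes> j \<in> ?F}"
      proof (rule ideal_prod_minimal[OF C])
        fix e y assume e: "e \<in> \<mm>" and y: "y \<in> ?J"
        have c: "e \<in> carrier R" "y \<in> carrier R" using e m_carrier ideal.Icarr[OF J y] by auto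
        have "(e \<otimes> y) \<otimes> j \<in> ?F" if j: "j \<in> ?T" for j
        proof -
          have "y \<otimes> j \<in> ?N" using ideal_prod.prod[of y I j ?T R] y JI j by auto
          then have "e \<otimes> (y \<otimes> j) \<in> \<mm> \<cdot> ?N" by (rule ideal_prod.prod[OF e])
          then have "e \<otimes> (y \<otimes> j) \<in> ?F" using ext_gens[OF AT mN] by auto
          then show ?thesis using c Tc j by (auto simp: m_assoc)
        qed
        then show "e \<otimes> y \<in> {y \<in> carrier R. \<forall>j\<in>?T. y \<otimes> j \<in> ?F}" using c by simp
      qed
      moreover have "?A \<subseteq> {y \<in> carrier R. \<forall>j\<in>?T. y \<otimes> j \<in> ?F}" using gen genideal_self[OF A'(1)] A'(1) by blast
      ultimately have "?E \<subseteq> {y \<in> carrier R. \<forall>j\<in>?T. y \<otimes> j \<in> ?F}" by (intro ext_minimal[OF C])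
      then show ?thesis using pE gen genideal_self[OF A'(1)] A(2) by blast
    qed
    then have "q \<otimes> j \<in> ?F" if "q \<in> A" "j \<in> ?T" for q j using that by auto
    then have "(Idl A) \<cdot> ?T \<subseteq> ?F" by (rule ideal_prod_Idl_left[OF F A(2) Tc])
    then have "?N \<subseteq> ?F" using r by (simp only: )
    then have "?N \<subseteq> (Idl ?A) \<cdot> ?T" by (rule nakayama[OF N AT])
    moreover have AI: "Idl ?A \<subseteq> I"
      using A'(1) AA A(5) by (intro genideal_minimal[OF I(1)]) (auto simp: reduction_def)
    then have "(Idl ?A) \<cdot> ?T \<subseteq> ?N" using ideal_prod_mono[OF AI subset_refl] by simp
    ultimately have "reduction R (Idl ?A) I" unfolding reduction_def using G AI by blast
    then have "length xs \<le> card ?A" by (rule lb[OF A'(2,1)])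
    then show False using cardA card_Diff1_less[OF A(1) p] by simp
  qed
  then have "set xs \<subseteq> ext ?B A" using kindep_exchange[OF A(1) B xs mB AE] cardA by simp
  moreover have "ext ?B A \<subseteq> ext (Idl A) ?B"
    using ext_gens[OF genideal_ideal[OF A(2)] Bc] ext_base[OF genideal_ideal[OF A(2)] Bc] AA
    by (intro ext_minimal[OF ext_ideal[OF genideal_ideal[OF A(2)] Bc]]) auto
  ultimately have "?J \<subseteq> ext (Idl A) ?B"
    by (intro genideal_minimal[OF ext_ideal[OF genideal_ideal[OF A(2)] Bc]]) auto
  then have "?J \<subseteq> Idl A" by (rule nakayama[OF J genideal_ideal[OF A(2)]])
  then show False using A(4) K(2) by blast
qed

text \<open>The reduction equation puts I^(r+1) into K, so elements with a power in I also have a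
  power in K.\<close>

lemma reduction_primary:
  assumes I: "ideal I R" and prim: "\<And>e. e \<in> \<mm> \<Longrightarrow> \<exists>n::nat. e [^] n \<in> I" and red: "reduction R K I" and e: "e \<in> \<mm>"
  shows "\<exists>n::nat. e [^] n \<in> K"
proof -
  obtain r where K: "ideal K R" and r: "ideal_pow R I (Suc r) = K \<cdot> ideal_pow R I r" using red by (auto simp: reduction_def)
  obtain n :: nat where n: "e [^] n \<in> I" using prim[OF e] by blast
  have "(e [^] n) [^] Suc r \<in> ideal_pow R I (Suc r)" by (rule ideal_pow_nat_pow[OF I n])
  also have "\<dots> \<subseteq> K" unfolding r
    using ideal.Icarr[OF ideal_pow_ideal[OF I]] ideal.I_r_closed[OF K] by (intro ideal_prod_minimal[OF K]) blast
  finally have "(e [^] n) [^] Suc r \<in> K" .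
  moreover have "e \<in> carrier R" using e m_carrier by auto
  ultimately have "e [^] (n * Suc r) \<in> K" by (simp only: nat_pow_pow)
  then show ?thesis by blast
qed

lemma ideal_prod_lin_combE:
  assumes Z: "finite Q" "g ` Q \<subseteq> carrier R" and I: "ideal I R" and y: "y \<in> (Idl (g ` Q)) \<cdot> I"
  shows "\<exists>s\<in>Q \<rightarrow> I. y = (\<Oplus>q\<in>Q. s q \<otimes> g q)"
  using y
proof induction
  case (prod h t)
  have gc: "g q \<in> carrier R" if "q \<in> Q" for q using Z(2) that by auto
  have tc: "t \<in> carrier R" by (rule ideal.Icarr[OF I prod(2)])
  have "h \<in> ext {\<zero>} (g ` Q)" using prod(1) Idl_eq_ext[OF Z(2)] by simp
  then obtain k r where kr: "k \<in> {\<zero>}" "r \<in> Q \<rightarrow> carrier R" "h = k \<oplus> (\<Oplus>q\<in>Q. r q \<otimes> g q)"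
    by (rule ext_imageE[OF Z(1) zeroideal Z(2)])
  have rc: "r q \<in> carrier R" if "q \<in> Q" for q using kr(2) that by auto
  have "h = (\<Oplus>q\<in>Q. r q \<otimes> g q)" using kr(1,3) rc gc by (auto intro!: l_zero finsum_closed)
  then have "h \<otimes> t = (\<Oplus>q\<in>Q. r q \<otimes> g q \<otimes> t)" using rc gc tc Z(1) by (simp add: finsum_ldistr)
  also have "\<dots> = (\<Oplus>q\<in>Q. (r q \<otimes> t) \<otimes> g q)" using rc gc tc by (intro finsum_cong') (auto simp: m_assoc m_comm m_lcomm)
  finally show ?case using rc ideal.I_l_closed[OF I prod(2)] by (intro bexI[of _ "\<lambda>q. r q \<otimes> t"]) auto
next
  case (sum h1 h2)
  have gc: "g q \<in> carrier R" if "q \<in> Q" for q using Z(2) that by auto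
  obtain s1 s2 where s: "s1 \<in> Q \<rightarrow> I" "h1 = (\<Oplus>q\<in>Q. s1 q \<otimes> g q)" "s2 \<in> Q \<rightarrow> I" "h2 = (\<Oplus>q\<in>Q. s2 q \<otimes> g q)"
    using sum.IH by blast
  have c: "s1 q \<in> carrier R" "s2 q \<in> carrier R" if "q \<in> Q" for q
    using ideal.Icarr[OF I] funcset_mem[OF s(1) that] funcset_mem[OF s(3) that] by auto
  have "h1 \<oplus> h2 = (\<Oplus>q\<in>Q. s1 q \<otimes> g q \<oplus> s2 q \<otimes> g q)" unfolding s(2,4)
    using c gc by (intro finsum_addf[symmetric]) auto
  also have "\<dots> = (\<Oplus>q\<in>Q. (s1 q \<oplus> s2 q) \<otimes> g q)" using c gc by (intro finsum_cong') (auto simp: l_distr)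
  finally show ?case using ideal_add[OF I] funcset_mem[OF s(1)] funcset_mem[OF s(3)]
    by (intro bexI[of _ "\<lambda>q. s1 q \<oplus> s2 q"]) auto
qed

end

section \<open>Stretched ideals\<close>

context noetherian_local_inf
begin

lemma stretched_open:
  fixes n :: nat
  defines "d \<equiv> the_enat (krull_dim R)"
  defines "N \<equiv> {..<d} \<times> {..<n}"
  assumes CM: "depth R \<mm> = krull_dim R"
    and I\<mm>: "I \<subseteq> \<mm>" and prim: "\<And>e. e \<in> \<mm> \<Longrightarrow> \<exists>n::nat. e [^] n \<in> I"
    and a: "\<And>j. j < n \<Longrightarrow> a j \<in> carrier R" and Ia: "I = Idl (a ` {..<n})" and st: "stretched R I H"
  obtains f x1 where "f \<in> polyfun N" "x1 \<in> points N" "f x1 \<notin> \<mm>"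
    "\<And>x. x \<in> points N \<Longrightarrow> f x \<notin> \<mm> \<Longrightarrow> stretched R I (comb_ideal d n a x)"
proof -
  have ac: "a ` {..<n} \<subseteq> carrier R" using a by auto
  have I: "ideal I R" unfolding Ia by (rule genideal_ideal[OF ac])
  have z: "{\<zero>} \<subseteq> \<mm>" using ideal_zero[OF m_ideal] by auto
  have pow2: "ideal_pow R I 2 = I \<cdot> I" using ideal_pow_1[OF I] by (simp add: numeral_2_eq_2)
  have minH: "minimal_reduction R H I" and HI2: "H \<inter> (I \<cdot> I) = H \<cdot> I" and hfH: "hilbert_function R I H 2 \<le> 1"
    using st pow2 by (auto simp: stretched_def)
  have redH: "reduction R H I" using minH by (simp add: minimal_reduction_def)
  have H: "ideal H R" "H \<subseteq> I" using redH by (auto simp: reduction_def)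
  \<comment> \<open>The generators of I bound the lengths of regular sequences here. The resulting
    \<open>ys\<close> is used twice: as a regular sequence it bounds the number of generators of a
    reduction from below, and through its colength it yields reductions with at most d
    generators.\<close>
  obtain ys where ys: "krull_dim R = enat (length ys)" "set ys \<subseteq> \<mm>" "regseq {\<zero>} ys"
    "\<And>e. e \<in> \<mm> \<Longrightarrow> \<exists>n::nat. e [^] n \<in> Idl (set ys)"
  proof (rule CM_regular_system[OF CM])
    have "set (map a [0..<n]) = a ` {..<n}" by (auto simp: atLeast0LessThan)
    then show "set (map a [0..<n]) \<subseteq> \<mm>" "\<And>e. e \<in> \<mm> \<Longrightarrow> \<exists>k::nat. e [^] k \<in> Idl (set (map a [0..<n]))"
      using genideal_self[OF ac] I\<mm> prim Ia by auto
  qed (rule that)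
  have d: "d = length ys" by (simp add: d_def ys(1))
  have exch: "length ys \<le> length xs \<and> (length ys = length xs \<longrightarrow>
      (\<exists>zs. length zs = length xs \<and> set zs \<subseteq> \<mm> \<and> regseq {\<zero>} zs \<and> Idl (set zs) = Idl (set xs)))"
    if xs: "set xs \<subseteq> carrier R" "reduction R (Idl (set xs)) I" for xs
  proof -
    have xm: "set xs \<subseteq> \<mm>" using genideal_self[OF xs(1)] xs(2) I\<mm> by (auto simp: reduction_def)
    have pw: "\<exists>k::nat. e [^] k \<in> ext {\<zero>} (set xs)" if e: "e \<in> \<mm>" for e
      using reduction_primary[OF I prim xs(2) e] Idl_eq_ext[OF xs(1)] by simp
    have "Idl (set zs) = ext {\<zero>} (set zs)" if "set zs \<subseteq> \<mm>" for zs
      by (rule Idl_eq_ext) (use that m_carrier in auto)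
    then show ?thesis using regseq_exchange[OF zeroideal z ys(2) xm ys(3) pw] xm by metis
  qed
  have lb: "d \<le> card A" if A: "finite A" "A \<subseteq> carrier R" "reduction R (Idl A) I" for A
  proof -
    obtain xs where "set xs = A" "distinct xs" using finite_distinct_list[OF A(1)] by blast
    then show ?thesis using exch[of xs] A(2,3) distinct_card[of xs] d by auto
  qed
  have ub: "\<exists>A. finite A \<and> A \<subseteq> carrier R \<and> card A \<le> d \<and> Idl A \<subseteq> K \<and> reduction R (Idl A) I" if K: "reduction R K I" for K
  proof -
    obtain A where "finite A" "A \<subseteq> carrier R" "card A \<le> length ys" "Idl A \<subseteq> K" "reduction R (Idl A) I"
      by (rule reduction_dim_generators[OF I I\<mm> prim K ys(2,4)])
    then show ?thesis using d by blast
  qed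
  \<comment> \<open>Minimality makes H equal to the reduction with at most d generators inside it,
    and the equality case of the exchange theorem replaces those generators by a regular
    sequence.\<close>
  obtain zs where zs: "length zs = d" "set zs \<subseteq> \<mm>" "regseq {\<zero>} zs" "H = Idl (set zs)"
  proof -
    obtain A where A: "finite A" "A \<subseteq> carrier R" "card A \<le> d" "Idl A \<subseteq> H" "reduction R (Idl A) I" using ub[OF redH] by blast
    have HA: "H = Idl A" using minH A(4,5) unfolding minimal_reduction_def by blast
    have cA: "card A = d" using lb[OF A(1,2,5)] A(3) by simp
    obtain xs where xs: "set xs = A" "distinct xs" using finite_distinct_list[OF A(1)] by blast
    have "length xs = d" using distinct_card[OF xs(2)] xs(1) cA by simp
    then show thesis using exch[of xs] xs(1) A(2,5) HA d that by auto
  qed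
  have zc: "zs ! i \<in> carrier R" if "i < d" for i using zs(1,2) that m_carrier nth_mem by blast
  have zsc: "set zs \<subseteq> carrier R" using zs(2) m_carrier by auto
  \<comment> \<open>The coefficients of \<open>zs\<close> over the generators of I; this is the
    point with J_x = H.\<close>
  define x0 where "x0 p = (SOME r. r \<in> {..<n} \<rightarrow> carrier R \<and> zs ! fst p = (\<Oplus>j\<in>{..<n}. r j \<otimes> a j)) (snd p)" for p :: "nat \<times> nat"
  have x0: "(\<lambda>j. x0 (i, j)) \<in> {..<n} \<rightarrow> carrier R \<and> zs ! i = (\<Oplus>j\<in>{..<n}. x0 (i, j) \<otimes> a j)" if i: "i < d" for i
  proof -
    have "zs ! i \<in> I" using genideal_self[OF zsc] zs(1,4) i H(2) nth_mem by blast
    then have "zs ! i \<in> ext {\<zero>} (a ` {..<n})" using Ia Idl_eq_ext[OF ac] by simp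
    then obtain k r where kr: "k \<in> {\<zero>}" "r \<in> {..<n} \<rightarrow> carrier R" "zs ! i = k \<oplus> (\<Oplus>j\<in>{..<n}. r j \<otimes> a j)"
      by (rule ext_imageE[OF finite_lessThan zeroideal ac])
    have "(\<Oplus>j\<in>{..<n}. r j \<otimes> a j) \<in> carrier R" using kr(2) a by (auto intro!: finsum_closed)
    then have "r \<in> {..<n} \<rightarrow> carrier R \<and> zs ! i = (\<Oplus>j\<in>{..<n}. r j \<otimes> a j)" using kr by simp
    then have "\<exists>r. r \<in> {..<n} \<rightarrow> carrier R \<and> zs ! i = (\<Oplus>j\<in>{..<n}. r j \<otimes> a j)" by blast
    from someI_ex[OF this] show ?thesis unfolding x0_def fst_conv snd_conv by simp
  qed
  have x0N: "x0 \<in> points N" using x0 by (auto simp: points_def N_def)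
  have lc: "lin_comb n a x0 i = zs ! i" if "i < d" for i using x0[OF that] by (simp add: lin_comb_def)
  have "lin_comb n a x0 ` {..<d} = set zs" using lc zs(1) by (auto simp: set_conv_nth)
  then have H0: "comb_ideal d n a x0 = H" by (simp add: comb_ideal_def zs(4))
  have img: "(\<lambda>i. zs ! i) ` {..<d} = set zs" using zs(1) by (auto simp: set_conv_nth)
  \<comment> \<open>A combination in I^2 lies in H \<inter> I^2 = H I, so it equals a combination
    with coefficients in I. The difference is a relation on the regular sequence, whose coefficients
    lie in H \<subseteq> I.\<close>
  have inj: "r i \<in> I" if r: "\<And>i. i < d \<Longrightarrow> r i \<in> carrier R"
    and rel: "(\<Oplus>i\<in>{..<d}. r i \<otimes> lin_comb n a x0 i) \<in> I \<cdot> I" and i: "i < d" for r i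
  proof -
    have eq: "(\<Oplus>i\<in>{..<d}. r i \<otimes> lin_comb n a x0 i) = (\<Oplus>i\<in>{..<d}. r i \<otimes> zs ! i)"
      using r zc lc by (intro finsum_cong') auto
    have "zs ! i \<in> H" if "i < d" for i using genideal_self[OF zsc] zs(1,4) that nth_mem by blast
    then have "(\<Oplus>i\<in>{..<d}. r i \<otimes> zs ! i) \<in> H"
      using r by (intro ideal_finsum[OF H(1)] ideal.I_l_closed[OF H(1)]) auto
    then have "(\<Oplus>i\<in>{..<d}. r i \<otimes> zs ! i) \<in> (Idl ((\<lambda>i. zs ! i) ` {..<d})) \<cdot> I"
      using rel HI2 unfolding eq img zs(4) by blast
    then obtain s where s: "s \<in> {..<d} \<rightarrow> I" "(\<Oplus>i\<in>{..<d}. r i \<otimes> zs ! i) = (\<Oplus>i\<in>{..<d}. s i \<otimes> zs ! i)"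
      using ideal_prod_lin_combE[OF finite_lessThan _ I] img zsc by blast
    have sI: "s i \<in> I" "s i \<in> carrier R" if "i < d" for i using s(1) that ideal.Icarr[OF I] by auto
    have Sc: "(\<Oplus>i\<in>{..<d}. s i \<otimes> zs ! i) \<in> carrier R" using sI zc by (auto intro!: finsum_closed)
    have "(\<Oplus>i\<in>{..<d}. (r i \<ominus> s i) \<otimes> zs ! i) = (\<Oplus>i\<in>{..<d}. r i \<otimes> zs ! i \<oplus> (\<ominus> \<one>) \<otimes> (s i \<otimes> zs ! i))"
    proof (rule finsum_cong'[OF refl])
      have dist: "(u \<ominus> v) \<otimes> w = u \<otimes> w \<oplus> (\<ominus> \<one>) \<otimes> (v \<otimes> w)" if "u \<in> carrier R" "v \<in> carrier R" "w \<in> carrier R" for u v w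
        using that by algebra
      show "(r i \<ominus> s i) \<otimes> zs ! i = r i \<otimes> zs ! i \<oplus> (\<ominus> \<one>) \<otimes> (s i \<otimes> zs ! i)" if "i \<in> {..<d}" for i
        using that by (intro dist r sI zc) auto
    qed (use r sI zc in auto)
    also have "\<dots> = (\<Oplus>i\<in>{..<d}. r i \<otimes> zs ! i) \<oplus> (\<Oplus>i\<in>{..<d}. (\<ominus> \<one>) \<otimes> (s i \<otimes> zs ! i))"
      using r sI zc by (intro finsum_addf) auto
    also have "(\<Oplus>i\<in>{..<d}. (\<ominus> \<one>) \<otimes> (s i \<otimes> zs ! i)) = (\<ominus> \<one>) \<otimes> (\<Oplus>i\<in>{..<d}. s i \<otimes> zs ! i)"
      using sI zc by (intro finsum_rdistr[symmetric]) auto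
    also have "(\<Oplus>i\<in>{..<d}. r i \<otimes> zs ! i) \<oplus> (\<ominus> \<one>) \<otimes> (\<Oplus>i\<in>{..<d}. s i \<otimes> zs ! i) = \<zero>"
      unfolding s(2) using Sc by (simp add: l_minus r_neg)
    finally have "(\<Oplus>i\<in>{..<length zs}. (r i \<ominus> s i) \<otimes> zs ! i) \<in> {\<zero>}" using zs(1) by simp
    then have "r i \<ominus> s i \<in> ext {\<zero>} (set zs)"
      using r sI i zs(1) by (intro regseq_relations[where t = "\<lambda>i. r i \<ominus> s i", OF zeroideal zsc zs(3)]) auto
    then have "r i \<ominus> s i \<in> I" using Idl_eq_ext[OF zsc] zs(4) H(2) by auto
    then have "s i \<oplus> (r i \<ominus> s i) \<in> I" by (rule ideal_add[OF I sI(1)[OF i]])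
    moreover have "s i \<oplus> (r i \<ominus> s i) = r i"
    proof -
      have "v \<oplus> (u \<ominus> v) = u" if "u \<in> carrier R" "v \<in> carrier R" for u v using that by algebra
      then show ?thesis using r[OF i] sI(2)[OF i] by blast
    qed
    ultimately show ?thesis by simp
  qed
  have sqH: "small_quotient H I" using hilbert_function_2_le_one_iff[OF I H HI2] hfH by simp
  \<comment> \<open>The reduction exponent of H is kept fixed, so that the reduction equation at x
    becomes the single inclusion I T \<subseteq> J_x T with T = I^r.\<close>
  obtain r where r: "ideal_pow R I (Suc r) = H \<cdot> ideal_pow R I r" using redH by (auto simp: reduction_def)
  let ?T = "ideal_pow R I r"
  have T: "ideal ?T R" by (rule ideal_pow_ideal[OF I])
  have sub: "I \<cdot> ?T \<subseteq> comb_ideal d n a x0 \<cdot> ?T" using r unfolding H0 by simp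
  obtain f1 where f1: "f1 \<in> polyfun N" "f1 x0 = \<one>"
    "\<And>x. x \<in> points N \<Longrightarrow> f1 x \<notin> \<mm> \<Longrightarrow> I \<cdot> ?T \<subseteq> comb_ideal d n a x \<cdot> ?T"
    unfolding N_def by (rule comb_ideal_prod_open[where n = n and a = a and d = d, OF a Ia T x0N[unfolded N_def] sub]) blast+
  obtain f2 where f2: "f2 \<in> polyfun N" "f2 x0 = \<one>"
    "\<And>x. x \<in> points N \<Longrightarrow> f2 x \<notin> \<mm> \<Longrightarrow> comb_ideal d n a x \<inter> (I \<cdot> I) \<subseteq> comb_ideal d n a x \<cdot> I"
  proof (rule inter_square_open[where n = n and a = a and d = d and I = I])
    show "r i \<in> I" if "\<And>i. i < d \<Longrightarrow> r i \<in> carrier R"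
      "(\<Oplus>i\<in>{..<d}. r i \<otimes> lin_comb n a x0 i) \<in> I \<cdot> I" "i < d" for r i
      by (rule inj[OF that])
  next
    fix f assume "f \<in> polyfun ({..<d} \<times> {..<n})" "f x0 = \<one>"
      "\<And>x. x \<in> points ({..<d} \<times> {..<n}) \<Longrightarrow> f x \<notin> \<mm> \<Longrightarrow> comb_ideal d n a x \<inter> (I \<cdot> I) \<subseteq> comb_ideal d n a x \<cdot> I"
    then show thesis unfolding N_def[symmetric] by (rule that)
  qed (use a Ia prim x0N in \<open>simp_all add: N_def\<close>)
  obtain f3 x3 where f3: "f3 \<in> polyfun N" "x3 \<in> points N" "f3 x3 \<notin> \<mm>"
    "\<And>x. x \<in> points N \<Longrightarrow> f3 x \<notin> \<mm> \<Longrightarrow> small_quotient (comb_ideal d n a x) I"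
    unfolding N_def by (rule small_quotient_open[where n = n and a = a and d = d, OF a Ia I\<mm> x0N[unfolded N_def] sqH[folded H0]]) blast+
  have f12: "(\<lambda>x. f1 x \<otimes> f2 x) \<in> polyfun N" by (rule polyfun_mult[OF f1(1) f2(1)])
  have f12x: "f1 x0 \<otimes> f2 x0 \<notin> \<mm>" using one_notin_m by (simp add: f1(2) f2(2))
  \<comment> \<open>The first two functions are units at x0, while the third is known to be one only
    at x3; a common point has to be produced.\<close>
  obtain x1 where x1: "x1 \<in> points N" "f1 x1 \<otimes> f2 x1 \<notin> \<mm>" "f3 x1 \<notin> \<mm>"
    by (rule polyfun_common_nonzero[OF f12 x0N f12x f3(1-3)])
  show thesis
  proof (rule that)
    show F: "(\<lambda>x. f1 x \<otimes> f2 x \<otimes> f3 x) \<in> polyfun N" by (rule polyfun_mult[OF f12 f3(1)])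
    show "x1 \<in> points N" by (rule x1)
    show "f1 x1 \<otimes> f2 x1 \<otimes> f3 x1 \<notin> \<mm>"
      by (rule notin_m_mult[OF polyfun_closed[OF f12 x1(1)] polyfun_closed[OF f3(1) x1(1)] x1(2,3)])
    fix x assume x: "x \<in> points N" and nz: "f1 x \<otimes> f2 x \<otimes> f3 x \<notin> \<mm>"
    let ?J = "comb_ideal d n a x"
    have fc: "f1 x \<in> carrier R" "f2 x \<in> carrier R" "f3 x \<in> carrier R"
      using polyfun_closed[OF f1(1) x] polyfun_closed[OF f2(1) x] polyfun_closed[OF f3(1) x] by auto
    have n3: "f3 x \<notin> \<mm>" using nz ideal.I_l_closed[OF m_ideal _ m_closed[OF fc(1,2)]] by blast
    have n12: "f1 x \<otimes> f2 x \<notin> \<mm>" using nz ideal.I_r_closed[OF m_ideal _ fc(3)] by blast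
    have n1: "f1 x \<notin> \<mm>" using n12 ideal.I_r_closed[OF m_ideal _ fc(2)] by blast
    have n2: "f2 x \<notin> \<mm>" using n12 ideal.I_l_closed[OF m_ideal _ fc(1)] by blast
    have J: "ideal ?J R" by (rule comb_ideal_ideal(1)[OF a x[unfolded N_def]])
    have JI: "?J \<subseteq> I" unfolding Ia by (rule comb_ideal_ideal(3)[OF a x[unfolded N_def]])
    have red: "reduction R ?J I" unfolding reduction_def
    proof (intro conjI J JI exI[of _ r])
      have "?J \<cdot> ?T \<subseteq> I \<cdot> ?T" by (rule ideal_prod_mono[OF JI subset_refl])
      then show "ideal_pow R I (Suc r) = ?J \<cdot> ?T" using f1(3)[OF x n1] by simp
    qed
    let ?xs = "map (lin_comb n a x) [0..<d]"
    have sxs: "set ?xs = lin_comb n a x ` {..<d}" by (simp add: atLeast0LessThan)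
    have xsc: "set ?xs \<subseteq> carrier R"
    proof -
      have "lin_comb n a x i \<in> carrier R" if "i < d" for i by (rule lin_comb_closed[OF a x[unfolded N_def] that])
      then show ?thesis unfolding sxs by auto
    qed
    have Jxs: "?J = Idl (set ?xs)" unfolding sxs comb_ideal_def ..
    have "minimal_reduction R (Idl (set ?xs)) I"
    proof (rule minimal_reductionI[OF I I\<mm> xsc red[unfolded Jxs]])
      show "length ?xs \<le> card A" if "finite A" "A \<subseteq> carrier R" "reduction R (Idl A) I" for A using lb[OF that] by simp
      show "\<exists>A. finite A \<and> A \<subseteq> carrier R \<and> card A \<le> length ?xs \<and> Idl A \<subseteq> K \<and> reduction R (Idl A) I"
        if "reduction R K I" for K using ub[OF that] by simp
    qed
    then have min: "minimal_reduction R ?J I" unfolding Jxs .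
    have "?J \<cdot> I \<subseteq> ?J" using ideal.I_r_closed[OF J] ideal.Icarr[OF I] by (intro ideal_prod_minimal[OF J]) blast
    moreover have "?J \<cdot> I \<subseteq> I \<cdot> I" by (rule ideal_prod_mono[OF JI subset_refl])
    ultimately have inter: "?J \<inter> (I \<cdot> I) = ?J \<cdot> I" using f2(3)[OF x n2] by blast
    show "stretched R I ?J" unfolding stretched_def pow2
      using min inter hilbert_function_2_le_one_iff[OF I J JI inter] f3(4)[OF x n3] by simp
  qed
qed

end

theorem corollary2p14:
  fixes R :: "('a, 'b) ring_scheme" (structure)
    and \<mm> I H :: "'a set" and n :: nat and a :: "nat \<Rightarrow> 'a"
  assumes "cohen_macaulay_local_ring R \<mm>"
    and "equicharacteristic R \<mm>"
    and "infinite (carrier (R Quot \<mm>))"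
    and "m_primary R \<mm> I"
    and "stretched R I H"
    and "\<forall>j<n. a j \<in> carrier R" and "I = Idl (a ` {..<n})"
  shows "holds_for_general_minimal_reduction R \<mm> n a (\<lambda>J. stretched R I J)"
proof -
  have "noetherian_local_inf R \<mm>"
    using assms(1,3) by (simp add: cohen_macaulay_local_ring_def local_ring_def noetherian_local_inf_def
      noetherian_local_def noetherian_local_axioms_def noetherian_local_inf_axioms_def)
  then interpret noetherian_local_inf R \<mm> .
  let ?d = "the_enat (krull_dim R)"
  let ?N = "{..<?d} \<times> {..<n}"
  have CM: "depth R \<mm> = krull_dim R" using assms(1) by (simp add: cohen_macaulay_local_ring_def)
  have I: "ideal I R" and rad: "radical R I = \<mm>" using assms(4) by (auto simp: m_primary_def primary_ideal_def)
  have "x \<in> radical R I" if "x \<in> I" for x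
    using that ideal.Icarr[OF I that] unfolding radical_def by (auto intro!: exI[of _ "1::nat"])
  then have Im: "I \<subseteq> \<mm>" using rad by blast
  have prim: "\<exists>k::nat. e [^] k \<in> I" if "e \<in> \<mm>" for e using that rad by (auto simp: radical_def)
  have a: "a j \<in> carrier R" if "j < n" for j using assms(6) that by blast
  obtain f x1 where f: "f \<in> polyfun ?N" "x1 \<in> points ?N" "f x1 \<notin> \<mm>"
    "\<And>x. x \<in> points ?N \<Longrightarrow> f x \<notin> \<mm> \<Longrightarrow> stretched R I (comb_ideal ?d n a x)"
    by (rule stretched_open[where n = n and a = a, OF CM Im prim a assms(7,5)]) blast+
  have "stretched R I (combination_ideal R ?d n a l)"
    if l: "\<forall>i<?d. \<forall>j<n. l i j \<in> carrier R" "residue_matrix R \<mm> ?d n l \<in> distinguished ?N f" for l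
  proof -
    let ?x = "\<lambda>(i, j). l i j"
    have x: "?x \<in> points ?N" using l(1) by (auto simp: points_def)
    have "residue_matrix R \<mm> ?d n l = residue_point ?N ?x"
      by (auto simp: residue_matrix_def residue_point_def restrict_def fun_eq_iff)
    then have "f ?x \<notin> \<mm>" using l(2) distinguished_iff[OF f(1) x] by simp
    then have "stretched R I (comb_ideal ?d n a ?x)" by (rule f(4)[OF x])
    moreover have "comb_ideal ?d n a ?x = combination_ideal R ?d n a l"
      by (simp add: comb_ideal_def combination_ideal_def lin_comb_def[abs_def])
    ultimately show ?thesis by simp
  qed
  then show ?thesis unfolding holds_for_general_minimal_reduction_def Let_def
    using dense_open_distinguished[OF f(1-3)] by blast
qed

end
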